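(* Let $p\in(1,+\infty)$, $f\in L^p_{\mathrm{loc}}(\mathbb{R})$, $\alpha>-1/p$ and $x_0\in\mathbb{R}$. Let $r$ be an integer with $r\geq\max(\alpha,1)$ and let $\psi\in C^r(\mathbb{R})$ be a non-zero even function with support contained in $[-1,1]$ such that $\int_{\mathbb{R}}x^k\psi(x)\,dx=0$ for $k=0,1,\dots,r$. Let $W_f$ and $L^{(p)}_f$ denote the continuous wavelet transform and continuous $p$-leaders of $f$ with respect to $\psi$. Then: 1. If $f\in T^p_\alpha(x_0)$, then there exist $C_f>0$ and $a_0>0$ such that for all $a\in(0,a_0)$, $$|L^{(p)}_f(a,x_0)|\leq C_f\,a^{\alpha}.$$ 2. Conversely, if $\alpha\notin\mathbb{N}$ and there exist $C_f>0$ and $a_0>0$ such that $|L^{(p)}_f(a,x_0)|\leq C_f a^\alpha$ for all $a\in(0,a_0)$, then $f\in T^p_\alpha(x_0)$.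
   Context: For $f\in L^p_{\mathrm{loc}}(\mathbb{R})$ ($p\geq1$), $x_0\in\mathbb{R}$ and $\alpha\in\mathbb{R}$, $f\in T^p_\alpha(x_0)$ means: there exist a polynomial $P_{f,x_0}$ of degree less than $\alpha$ (the zero polynomial if $\alpha\le 0$) and constants $C,R>0$ such that for all $r\in(0,R)$, $$\Big(\frac1r\int_{x_0-r}^{x_0+r}|f(x)-P_{f,x_0}(x-x_0)|^p\,dx\Big)^{1/p}\leq C r^{\alpha}.$$ The continuous wavelet transform of $f$ with respect to $\psi$ is $W_f(a,b)=\frac1a\int_{\mathbb{R}}f(x)\psi\big(\frac{x-b}{a}\big)dx$ for $(a,b)\in(0,\infty)\times\mathbb{R}$. The continuous $p$-leaders are $$L^{(p)}_f(a,b)=\Big(\frac1a\int_{b-a}^{b+a}\Big(\int_0^a|W_f(s,t)|^2\frac{ds}{s}\Big)^{p/2}dt\Big)^{1/p},\quad (a,b)\in(0,\infty)\times\mathbb{R}.$$ *)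

theory Defs
  imports "HOL-Analysis.Analysis" "HOL-Computational_Algebra.Polynomial"
begin

definition Lp_loc :: "real \<Rightarrow> (real \<Rightarrow> real) \<Rightarrow> bool" where
  "Lp_loc p f \<longleftrightarrow> f \<in> borel_measurable lborel \<and>
     (\<forall>a b. set_integrable lborel {a..b} (\<lambda>x. \<bar>f x\<bar> powr p))"

definition Tp :: "real \<Rightarrow> real \<Rightarrow> real \<Rightarrow> (real \<Rightarrow> real) \<Rightarrow> bool" where
  "Tp p \<alpha> x0 f \<longleftrightarrow>
     (\<exists>P :: real poly. (if \<alpha> \<le> 0 then P = 0 else real (degree P) < \<alpha>) \<and>
       (\<exists>C>0. \<exists>R>0. \<forall>r. 0 < r \<and> r < R \<longrightarrow>
          ((1 / r) * (LINT x:{x0 - r..x0 + r}|lborel. \<bar>f x - poly P (x - x0)\<bar> powr p)) powr (1 / p)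
            \<le> C * r powr \<alpha>))"

definition Cr :: "nat \<Rightarrow> (real \<Rightarrow> real) \<Rightarrow> bool" where
  "Cr r \<psi> \<longleftrightarrow> (\<forall>k\<le>r. continuous_on UNIV ((deriv ^^ k) \<psi>)) \<and>
     (\<forall>k<r. \<forall>x. ((deriv ^^ k) \<psi> has_real_derivative (deriv ^^ Suc k) \<psi> x) (at x))"

definition cwt :: "(real \<Rightarrow> real) \<Rightarrow> (real \<Rightarrow> real) \<Rightarrow> real \<Rightarrow> real \<Rightarrow> real" where
  "cwt \<psi> f a b = (1 / a) * (LINT x|lborel. f x * \<psi> ((x - b) / a))"

text \<open>Continuous p-leaders, valued in [0,\<infinity>] (the integrals may diverge).\<close>
definition ennpow :: "ennreal \<Rightarrow> real \<Rightarrow> ennreal" where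
  "ennpow x e = (if x = \<infinity> then \<infinity> else ennreal (enn2real x powr e))"

definition pleader :: "real \<Rightarrow> (real \<Rightarrow> real) \<Rightarrow> (real \<Rightarrow> real) \<Rightarrow> real \<Rightarrow> real \<Rightarrow> ennreal" where
  "pleader p \<psi> f a b =
     ennpow ((1 / ennreal a) *
       (\<integral>\<^sup>+ t\<in>{b - a..b + a}.
          ennpow (\<integral>\<^sup>+ s\<in>{0<..<a}. ennreal ((cwt \<psi> f s t)\<^sup>2 / s) \<partial>lborel) (p / 2) \<partial>lborel))
       (1 / p)"

end

theory Submission
  imports Defs
begin

text \<open>
  Both directions rest on the bound of the vertical square function of a compactly supported
  wavelet on \<open>L\<^sup>p\<close>, for every \<open>1 < p < \<infinity>\<close>.
  For \<open>p = 2\<close> the energy of the transform over the scales \<open>(\<epsilon>, R)\<close> is a quadratic form with kernel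
  \<open>\<phi>\<^sub>\<epsilon> - \<phi>\<^sub>R\<close>, where \<open>\<phi> u = (1 / u) * \<integral>\<^sub>0\<^sup>u A\<close> and \<open>A\<close> is the autocorrelation of the wavelet;
  \<open>\<phi>\<close> is bounded with support in \<open>[-2, 2]\<close> because \<open>A\<close> is even with integral zero.
  For \<open>p > 2\<close> one has the weighted inequality \<open>\<integral> S(f)\<^sup>2 w \<le> C \<integral> f\<^sup>2 Mw\<close> with the maximal function
  \<open>M\<close>, used with \<open>w = S(f)\<^sup>p\<^sup>-\<^sup>2\<close> and absorbed; for \<open>p < 2\<close> a Calderon--Zygmund decomposition at
  every level is integrated over the levels.

  In the direct part, vanishing moments allow to replace \<open>f\<close> near \<open>x0\<close> by \<open>f - P\<close> cut off to a ball.
  For the converse, letting \<open>\<epsilon> \<rightarrow> 0\<close>, \<open>R \<rightarrow> \<infinity>\<close> in the same quadratic form gives the reproducing formula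
  \<open>c \<integral> f g = \<integral>\<integral> W\<^sub>f W\<^sub>g dt ds/s\<close> with \<open>c = \<integral> \<phi> \<noteq> 0\<close>. For \<open>g\<close> supported in a ball of radius \<open>h\<close> about \<open>x0\<close>,
  the scales \<open>s < h\<close> are controlled by the leaders of \<open>f\<close> and the square function bound of \<open>g\<close> with the
  conjugate exponent. At the scales \<open>s \<ge> h\<close>, \<open>W\<^sub>g\<close> is replaced by its Taylor expansion at \<open>x0\<close>, whose
  coefficients integrate over all scales to those of \<open>P\<close>; this is where a noninteger \<open>\<alpha>\<close> is needed.
  Duality then yields the \<open>L\<^sup>p\<close> estimate of \<open>f - P\<close>.
\<close>


text \<open>The direct part uses the square function bound at p, the converse at the conjugate
  exponent q. Unless p = 2 these lie on opposite sides of 2, so both regimes are needed. Absorbing a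
  term is legitimate only if it is finite. The bounds are therefore proved for compact ranges of
  scales and bounded, compactly supported functions, with constants free of both truncations, and
  extended by monotone limits and Fatou. Hoelder inequalities are mostly replaced by pointwise Young
  inequalities with normalising factors, which make sense for values in [0, infinity]. In the
  converse, absolute convergence of the integral of W_f W_g over all scales is not known beforehand.
  Subtracting the Taylor terms, which do converge, leaves an integrable remainder, and convergence
  of the original follows from that. With n the ceiling of \<alpha>, sums over dyadic scales become
  integrals of a^(\<alpha> - k - 1) da: near 0 they converge for k < \<alpha>, at infinity for k = n
  > \<alpha>. An integer \<alpha> would leave the exponent -1 and a logarithm.\<close>

abbreviation lborel2 :: "(real \<times> real) measure" where
  "lborel2 \<equiv> lborel \<Otimes>\<^sub>M lborel"

section \<open>Compactly supported kernels and their transform\<close>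

lemma abs_integral_le:
  fixes f g :: "'a \<Rightarrow> real"
  assumes "integrable M g" "f \<in> borel_measurable M" "\<And>x. \<bar>f x\<bar> \<le> g x"
  shows "\<bar>integral\<^sup>L M f\<bar> \<le> integral\<^sup>L M g"
proof -
  have "integrable M f"
    using assms(2,3) by (intro Bochner_Integration.integrable_bound[OF assms(1)]) (auto intro: order_trans[OF _ abs_ge_self])
  then have "(LINT x|M. \<bar>f x\<bar>) \<le> integral\<^sup>L M g"
    using assms by (intro integral_mono) auto
  with integral_abs_bound[of M f] show ?thesis by linarith
qed

lemma integrable_const_indicator_Icc [intro, simp]:
  "integrable lborel (\<lambda>x::real. c * indicator {a..b} x :: real)"
  by (intro integrable_mult_right integrable_real_indicator) (auto simp: emeasure_lborel_Icc_eq)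

text \<open>Continuity and support only, because the locale is instantiated not just for the wavelet
  but for each of its derivatives up to the Taylor order, the highest of which may be merely
  continuous.\<close>

locale bump =
  fixes \<eta> :: "real \<Rightarrow> real"
  assumes cont: "continuous_on UNIV \<eta>"
    and supp: "\<And>x. 1 < \<bar>x\<bar> \<Longrightarrow> \<eta> x = 0"
begin

lemma meas[measurable]: "\<eta> \<in> borel_measurable borel"
  using cont by (rule borel_measurable_continuous_onI)

lemma bounded_ex: "\<exists>B>0. \<forall>x. \<bar>\<eta> x\<bar> \<le> B"
proof -
  have "bounded (\<eta> ` {-1..1})"
    by (intro compact_imp_bounded compact_continuous_image continuous_on_subset[OF cont]) auto
  then obtain B where B: "B > 0" "\<And>x. x \<in> {-1..1} \<Longrightarrow> \<bar>\<eta> x\<bar> \<le> B"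
    unfolding bounded_pos by auto
  have "\<bar>\<eta> x\<bar> \<le> B" for x
    using B supp[of x] by (cases "\<bar>x\<bar> \<le> 1") (auto simp: abs_le_iff)
  with B show ?thesis by blast
qed

definition bd :: real where "bd = (SOME B. B > 0 \<and> (\<forall>x. \<bar>\<eta> x\<bar> \<le> B))"

lemma bd_pos: "bd > 0" and bd: "\<bar>\<eta> x\<bar> \<le> bd"
  using someI_ex[OF bounded_ex] unfolding bd_def by auto

lemma bd_ind: "\<bar>\<eta> x\<bar> \<le> bd * indicator {-1..1} x"
  using bd[of x] supp[of x] by (cases "x \<in> {-1..1}") auto

lemma integrable_kernel: "integrable lborel \<eta>"
  by (rule Bochner_Integration.integrable_bound[OF integrable_const_indicator_Icc[of bd "-1" 1]])
     (use bd_ind bd_pos in \<open>auto simp: abs_mult\<close>)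

subsection \<open>Elementary properties of the wavelet transform\<close>

lemma cwt_measurable [measurable]:
  assumes [measurable]: "f \<in> borel_measurable borel"
  shows "(\<lambda>w. cwt \<eta> f (fst w) (snd w)) \<in> borel_measurable (borel \<Otimes>\<^sub>M borel)"
  unfolding cwt_def by measurable

lemma cwt_measurable_comp [measurable]:
  assumes [measurable]: "f \<in> borel_measurable borel" "S \<in> M \<rightarrow>\<^sub>M borel" "T \<in> M \<rightarrow>\<^sub>M borel"
  shows "(\<lambda>w. cwt \<eta> f (S w) (T w)) \<in> borel_measurable M"
  using measurable_compose[OF _ cwt_measurable[OF assms(1)], of "\<lambda>w. (S w, T w)" M] by simp

text \<open>Locality: the kernel at (s, t) vanishes outside the closed ball of radius s about t.
  Every cut-off argument below rests on this.\<close>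

lemma cwt_cong:
  assumes "s > 0" "\<And>x. x \<in> {t - s..t + s} \<Longrightarrow> f x = g x"
  shows "cwt \<eta> f s t = cwt \<eta> g s t"
proof -
  have "(\<lambda>x. f x * \<eta> ((x - t) / s)) = (\<lambda>x. g x * \<eta> ((x - t) / s))"
  proof
    fix x
    show "f x * \<eta> ((x - t) / s) = g x * \<eta> ((x - t) / s)"
    proof (cases "x \<in> {t - s..t + s}")
      case False
      then have "\<bar>(x - t) / s\<bar> > 1" using assms(1) by (auto simp: field_simps abs_if)
      then show ?thesis by (simp add: supp)
    qed (use assms in auto)
  qed
  then show ?thesis unfolding cwt_def by metis
qed

lemma cwt_bound:
  assumes f: "integrable lborel f" and "s > 0"
  shows "\<bar>cwt \<eta> f s t\<bar> \<le> bd / s * (LINT x|lborel. \<bar>f x\<bar>)"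
proof -
  note [measurable] = borel_measurable_integrable[OF f]
  have b: "\<bar>f x * \<eta> ((x - t) / s)\<bar> \<le> bd * \<bar>f x\<bar>" for x
    using mult_left_mono[OF bd[of "(x-t)/s"], of "\<bar>f x\<bar>"] by (simp add: abs_mult mult.commute)
  have i: "integrable lborel (\<lambda>x. bd * \<bar>f x\<bar>)" using f by simp
  have "\<bar>LINT x|lborel. f x * \<eta> ((x - t) / s)\<bar> \<le> (LINT x|lborel. bd * \<bar>f x\<bar>)"
    by (rule abs_integral_le[OF i]) (use b in auto)
  then show ?thesis using \<open>s > 0\<close> unfolding cwt_def
    by (simp add: abs_mult divide_simps)
qed

lemma cwt_eq_0:
  assumes "s > 0" "\<And>x. x \<in> {t - s..t + s} \<Longrightarrow> f x = 0"
  shows "cwt \<eta> f s t = 0"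
  using cwt_cong[of s t f "\<lambda>_. 0"] assms by (simp add: cwt_def)

subsection \<open>The autocorrelation and its primitive\<close>

definition acorr :: "real \<Rightarrow> real" where
  "acorr u = (LINT v|lborel. \<eta> (v + u) * \<eta> v)"

lemma prod_bd: "\<bar>\<eta> x * \<eta> v\<bar> \<le> bd\<^sup>2 * indicator {-1..1} v"
proof -
  have "\<bar>\<eta> x * \<eta> v\<bar> \<le> bd * (bd * indicator {-1..1} v)"
    unfolding abs_mult by (intro mult_mono bd bd_ind) (use bd_pos in auto)
  then show ?thesis by (simp add: power2_eq_square mult.assoc)
qed

lemma acorr_integrable: "integrable lborel (\<lambda>v. \<eta> (v + u) * \<eta> v)"
  by (rule Bochner_Integration.integrable_bound[OF integrable_const_indicator_Icc[of "bd\<^sup>2" "-1" 1]])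
     (use prod_bd in \<open>auto simp: abs_mult\<close>)

lemma acorr_bound: "\<bar>acorr u\<bar> \<le> 2 * bd\<^sup>2"
proof -
  have "\<bar>acorr u\<bar> \<le> (LINT v|lborel. bd\<^sup>2 * indicator {-1..1::real} v)"
    unfolding acorr_def
    by (rule abs_integral_le[OF integrable_const_indicator_Icc _ prod_bd]) measurable
  then show ?thesis by simp
qed

lemma acorr_supp: "2 < \<bar>u\<bar> \<Longrightarrow> acorr u = 0"
proof -
  assume u: "2 < \<bar>u\<bar>"
  have "(\<lambda>v. \<eta> (v + u) * \<eta> v) = (\<lambda>_. 0)"
  proof
    fix v show "\<eta> (v + u) * \<eta> v = 0"
      using supp[of v] supp[of "v+u"] u by (cases "\<bar>v\<bar> > 1") auto
  qed
  then show ?thesis unfolding acorr_def by simp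
qed

text \<open>Translating the variable by u exchanges the two factors.\<close>

lemma acorr_even: "acorr (- u) = acorr u"
  unfolding acorr_def
  by (subst lborel_integral_real_affine[where c=1 and t=u]) (auto simp: mult.commute add.commute)

lemma acorr_cont: "continuous_on UNIV acorr"
  unfolding continuous_on_eq_continuous_at[OF open_UNIV]
proof (intro ballI, unfold continuous_at_sequentially comp_def, intro allI impI)
  fix u and x :: "nat \<Rightarrow> real" assume x: "x \<longlonglongrightarrow> u"
  show "(\<lambda>n. acorr (x n)) \<longlonglongrightarrow> acorr u"
    unfolding acorr_def
  proof (rule integral_dominated_convergence[where w="\<lambda>v. bd\<^sup>2 * indicator {-1..1} v"])
    show "AE v in lborel. (\<lambda>i. \<eta> (v + x i) * \<eta> v) \<longlonglongrightarrow> \<eta> (v + u) * \<eta> v"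
      by (intro AE_I2 tendsto_intros continuous_on_tendsto_compose[OF cont] x) auto
  qed (use prod_bd in auto)
qed

lemma acorr_meas[measurable]: "acorr \<in> borel_measurable borel"
  using acorr_cont by (rule borel_measurable_continuous_onI)

end

lemma continuous_antiderivative_ex:
  fixes f :: "real \<Rightarrow> real"
  assumes "continuous_on UNIV f"
  shows "\<exists>F. \<forall>x. (F has_real_derivative f x) (at x)"
proof -
  have "\<exists>F. \<forall>x::real. - \<infinity> < ereal x \<longrightarrow> ereal x < \<infinity> \<longrightarrow> (F has_vector_derivative f x) (at x)"
    by (rule einterval_antiderivative) (use assms in \<open>auto simp: continuous_on_eq_continuous_at\<close>)
  then show ?thesis by (auto simp: has_real_derivative_iff_has_vector_derivative)
qed

context bump begin

text \<open>An arbitrary antiderivative, determined up to a constant; this is why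
  \<open>prim 0\<close> is always subtracted.\<close>

definition prim :: "real \<Rightarrow> real" where
  "prim = (SOME F. \<forall>x. (F has_real_derivative acorr x) (at x))"

lemma prim: "(prim has_real_derivative acorr x) (at x)"
  using someI_ex[OF continuous_antiderivative_ex[OF acorr_cont]] unfolding prim_def by auto

lemma prim_cont: "continuous_on UNIV prim"
  using prim DERIV_isCont continuous_at_imp_continuous_on by blast

lemma prim_odd: "prim (- u) - prim 0 = - (prim u - prim 0)"
proof -
  have "((\<lambda>u. prim u + prim (- u)) has_real_derivative 0) (at u)" for u
    by (rule DERIV_cong[OF DERIV_add[OF prim DERIV_chain'[OF _ prim]]])
       (auto intro!: derivative_eq_intros simp: acorr_even)
  then have "prim u + prim (- u) = prim 0 + prim (- 0)"
    by (intro DERIV_isconst_all[of "\<lambda>u. prim u + prim (- u)"]) auto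
  then show ?thesis by simp
qed

text \<open>The mean value theorem with the sup bound of \<open>acorr\<close>; it keeps the quotient
  defining \<open>phi\<close> bounded near 0.\<close>

lemma prim_lip: "\<bar>prim u - prim 0\<bar> \<le> 2 * bd\<^sup>2 * \<bar>u\<bar>"
proof -
  have "norm (prim u - prim 0) \<le> 2 * bd\<^sup>2 * norm (u - 0)"
    by (rule field_differentiable_bound[of UNIV prim acorr]) (auto simp: prim acorr_bound)
  then show ?thesis by simp
qed

text \<open>The mean of \<open>acorr\<close> over [0, u]. The value at 0 is the continuous
  extension, chosen so that \<open>kern_eq\<close> also holds on the diagonal x = y.\<close>

definition phi :: "real \<Rightarrow> real" where
  "phi u = (if u = 0 then acorr 0 else (prim u - prim 0) / u)"

lemma phi_meas[measurable]: "phi \<in> borel_measurable borel"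
proof -
  have [measurable]: "prim \<in> borel_measurable borel"
    using prim_cont by (rule borel_measurable_continuous_onI)
  show ?thesis unfolding phi_def by measurable
qed

lemma phi_bd: "\<bar>phi u\<bar> \<le> 2 * bd\<^sup>2"
  using acorr_bound[of 0] prim_lip[of u] unfolding phi_def by (auto simp: divide_simps)

text \<open>The kernel of the form that integrates W_f W_g against dt ds/s over scales in [e, R].
  The third power of s collects a factor 1/s from each transform and one from ds/s.\<close>

definition kern :: "real \<Rightarrow> real \<Rightarrow> real \<Rightarrow> real \<Rightarrow> real" where
  "kern e R x y = (LINT w|lborel2. indicator {e..R} (fst w) *
      (\<eta> ((x - snd w) / fst w) * \<eta> ((y - snd w) / fst w)) / fst w ^ 3)"

lemma kern_inner:
  assumes "s > 0"
  shows "(LINT t|lborel. \<eta> ((x - t) / s) * \<eta> ((y - t) / s)) = s * acorr ((x - y) / s)"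
proof -
  have "(LINT t|lborel. \<eta> ((x - t) / s) * \<eta> ((y - t) / s))
     = \<bar>- s\<bar> *\<^sub>R (LINT v|lborel. \<eta> ((x - (y + (- s) * v)) / s) * \<eta> ((y - (y + (- s) * v)) / s))"
    by (rule lborel_integral_real_affine) (use assms in auto)
  also have "(\<lambda>v. \<eta> ((x - (y + (- s) * v)) / s) * \<eta> ((y - (y + (- s) * v)) / s)) =
     (\<lambda>v. \<eta> (v + (x - y) / s) * \<eta> v)"
  proof
    fix v
    have "(x - (y + (- s) * v)) / s = v + (x - y) / s" "(y - (y + (- s) * v)) / s = v"
      using assms by (auto simp: field_simps)
    then show "\<eta> ((x - (y + (- s) * v)) / s) * \<eta> ((y - (y + (- s) * v)) / s) =
     \<eta> (v + (x - y) / s) * \<eta> v" by metis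
  qed
  finally show ?thesis using assms unfolding acorr_def by simp
qed

text \<open>For fixed x the integrand lives on the box [e, R] x [x - R, x + R], whose area does not
  depend on x. This yields the uniform bound that Fubini needs in \<open>bilinear\<close>.\<close>

lemma kern_pt_bound:
  assumes "0 < e" "e \<le> R"
  shows "\<bar>indicator {e..R} (fst w) *
      (\<eta> ((x - snd w) / fst w) * \<eta> ((y - snd w) / fst w)) / fst w ^ 3\<bar>
     \<le> bd\<^sup>2 / e ^ 3 * indicator ({e..R} \<times> {x - R..x + R}) w"
proof -
  obtain s t where w: "w = (s, t)" by (cases w)
  consider "s \<notin> {e..R}" | "s \<in> {e..R}" "\<eta> ((x - t) / s) = 0" | "s \<in> {e..R}" "\<bar>(x - t) / s\<bar> \<le> 1"
    using supp by (meson not_le)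
  then show ?thesis
  proof cases
    case 3
    then have s: "s > 0" using assms by auto
    have "\<bar>x - t\<bar> \<le> s" using 3 s by (simp add: abs_divide)
    then have q: "w \<in> {e..R} \<times> {x - R..x + R}" using 3 w by (auto simp: abs_le_iff)
    have "\<bar>\<eta> ((x - t) / s) * \<eta> ((y - t) / s)\<bar> / s ^ 3 \<le> bd\<^sup>2 / e ^ 3"
    proof (rule frac_le)
      show "\<bar>\<eta> ((x - t) / s) * \<eta> ((y - t) / s)\<bar> \<le> bd\<^sup>2"
        unfolding abs_mult power2_eq_square by (intro mult_mono bd) (use bd_pos in auto)
      show "e ^ 3 \<le> s ^ 3" using 3 assms by (intro power_mono) auto
    qed (use assms in auto)
    then show ?thesis using q w 3 s assms by (simp add: abs_mult)
  qed (use assms in \<open>auto simp: w\<close>)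
qed

lemma kern_integrable:
  assumes "0 < e" "e \<le> R"
  shows "integrable lborel2 (\<lambda>w. indicator {e..R} (fst w) *
      (\<eta> ((x - snd w) / fst w) * \<eta> ((y - snd w) / fst w)) / fst w ^ 3)"
proof (rule Bochner_Integration.integrable_bound)
  let ?Q = "{e..R} \<times> {x - R..x + R}"
  have "emeasure (lborel \<Otimes>\<^sub>M lborel) ?Q = emeasure lborel {e..R} * emeasure lborel {x - R..x + R}"
    by (rule lborel.emeasure_pair_measure_Times) auto
  also have "\<dots> < \<infinity>" using assms by (simp add: ennreal_mult[symmetric])
  finally show "integrable lborel2 (\<lambda>w. bd\<^sup>2 / e ^ 3 * indicator ?Q w :: real)"
    by (intro integrable_mult_right integrable_real_indicator) auto
  show "AE w in lborel2. norm (indicator {e..R} (fst w) *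
      (\<eta> ((x - snd w) / fst w) * \<eta> ((y - snd w) / fst w)) / fst w ^ 3) \<le> norm (bd\<^sup>2 / e ^ 3 * indicator ?Q w :: real)"
    unfolding real_norm_def by (intro AE_I2 order_trans[OF kern_pt_bound[OF assms] abs_ge_self])
qed measurable

end

section \<open>Cancellation: the truncated kernel as a difference of two dilates\<close>

locale wavelet = bump +
  assumes mean0: "(LINT x|lborel. \<eta> x) = 0"
begin

text \<open>By Fubini the integral of the autocorrelation is the square of the integral of \<eta>,
  which is zero.\<close>

lemma acorr_mean0: "(LINT u|lborel. acorr u) = 0"
proof -
  have int: "integrable lborel2 (\<lambda>(v, u). \<eta> (v + u) * \<eta> v)"
  proof (rule Bochner_Integration.integrable_bound)
    let ?Q = "{-1..1::real} \<times> {-2..2::real}"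
    have "emeasure (lborel \<Otimes>\<^sub>M lborel) ?Q = emeasure lborel {-1..1::real} * emeasure lborel {-2..2::real}"
      by (rule lborel.emeasure_pair_measure_Times) auto
    also have "\<dots> < \<infinity>" by (simp add: ennreal_mult[symmetric])
    finally show "integrable lborel2 (\<lambda>w. bd\<^sup>2 * indicator ?Q w :: real)"
      by (intro integrable_mult_right integrable_real_indicator) auto
    show "AE w in lborel2. norm (case w of (v, u) \<Rightarrow> \<eta> (v + u) * \<eta> v) \<le> norm (bd\<^sup>2 * indicator ?Q w :: real)"
    proof (intro AE_I2)
      fix w :: "real \<times> real"
      obtain v u where w: "w = (v, u)" by (cases w)
      show "norm (case w of (v, u) \<Rightarrow> \<eta> (v + u) * \<eta> v) \<le> norm (bd\<^sup>2 * indicator ?Q w :: real)"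
      proof (cases "\<bar>v\<bar> \<le> 1 \<and> \<bar>v + u\<bar> \<le> 1")
        case True
        then have "w \<in> ?Q" using w by (auto simp: abs_le_iff)
        then show ?thesis using prod_bd[of "v+u" v] True bd_pos w by (auto simp: abs_le_iff)
      next
        case False
        then show ?thesis using supp[of v] supp[of "v + u"] w by (auto simp: not_le)
      qed
    qed
  qed measurable
  have "(LINT u|lborel. acorr u) = (LINT v|lborel. LINT u|lborel. \<eta> (v + u) * \<eta> v)"
    unfolding acorr_def by (rule lborel_pair.Fubini_integral[OF int])
  also have "\<dots> = (LINT v|lborel. \<eta> v * (LINT u|lborel. \<eta> (v + 1 * u)))"
    by (simp add: mult.commute)
  also have "(\<lambda>v. LINT u|lborel. \<eta> (v + 1 * u)) = (\<lambda>v. 0)"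
    using lborel_integral_real_affine[of 1 \<eta>] mean0 by auto
  finally show ?thesis by (simp add: fun_eq_iff)
qed

text \<open>The integral of \<open>acorr\<close> over its support gives
  \<open>prim 2 = prim (-2)\<close>, while \<open>prim - prim 0\<close> is odd; together both values
  equal \<open>prim 0\<close>. Beyond 2 the primitive is constant, so \<open>phi\<close> has compact
  support.\<close>

lemma prim_2: "prim 2 = prim 0"
proof -
  have "(LINT x|lborel. indicator {-2..2} x *\<^sub>R acorr x) = prim 2 - prim (-2)"
    by (rule integral_FTC_atLeastAtMost)
       (auto simp: has_real_derivative_iff_has_vector_derivative[symmetric]
             intro: has_field_derivative_at_within prim continuous_on_subset[OF acorr_cont])
  also have "(\<lambda>x. indicator {-2..2} x *\<^sub>R acorr x) = acorr"
  proof
    fix x show "indicator {-2..2} x *\<^sub>R acorr x = acorr x"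
      using acorr_supp[of x] by (cases "\<bar>x\<bar> \<le> 2") (auto simp: indicator_def abs_le_iff not_le)
  qed
  finally have "prim 2 = prim (-2)" by (simp add: acorr_mean0)
  with prim_odd[of 2] show ?thesis by simp
qed

lemma prim_ge2: "u \<ge> 2 \<Longrightarrow> prim u = prim 0"
proof (cases "u = 2")
  case False
  assume "u \<ge> 2"
  with False have "2 < u" by simp
  then have "prim u = prim 2"
  proof (rule DERIV_isconst_end)
    fix x :: real assume "2 < x"
    then show "DERIV prim x :> 0" using prim[of x] acorr_supp[of x] by simp
  qed (use prim_cont in \<open>auto intro: continuous_on_subset\<close>)
  then show ?thesis by (simp add: prim_2)
qed (simp add: prim_2)

lemma phi_ind: "\<bar>phi u\<bar> \<le> 2 * bd\<^sup>2 * indicator {-2..2} u"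
proof (cases "u \<in> {-2..2}")
  case False
  then have "prim u = prim 0"
    using prim_ge2[of u] prim_ge2[of "-u"] prim_odd[of u] by (auto simp: not_le)
  then show ?thesis using False by (auto simp: phi_def)
qed (use phi_bd in auto)

text \<open>The inner integral in t leaves A(u/s)/s^2 with u = x - y. This is the s-derivative of
  -\<open>prim\<close>(u/s)/u, so the integral over scales reduces to its two end points; for u = 0
  the antiderivative is -A(0)/s.\<close>

lemma kern_eq:
  assumes "0 < e" "e \<le> R"
  shows "kern e R x y = phi ((x - y) / e) / e - phi ((x - y) / R) / R"
proof -
  define u where "u = x - y"
  have "kern e R x y = (LINT s|lborel. LINT t|lborel. indicator {e..R} s *
      (\<eta> ((x - t) / s) * \<eta> ((y - t) / s)) / s ^ 3)"
    unfolding kern_def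
    using lborel_pair.integral_fst'[OF kern_integrable[OF assms, of x y]] by simp
  also have "\<dots> = (LINT s|lborel. indicator {e..R} s *\<^sub>R (acorr (u / s) / s ^ 2))"
  proof (rule Bochner_Integration.integral_cong[OF refl])
    fix s
    show "(LINT t|lborel. indicator {e..R} s * (\<eta> ((x - t) / s) * \<eta> ((y - t) / s)) / s ^ 3)
       = indicator {e..R} s *\<^sub>R (acorr (u / s) / s ^ 2)"
      using kern_inner[of s x y] assms
      by (cases "s \<in> {e..R}") (auto simp: u_def power2_eq_square power3_eq_cube)
  qed
  also have "\<dots> = phi (u / e) / e - phi (u / R) / R"
  proof (cases "u = 0")
    case True
    have "(LINT s|lborel. indicator {e..R} s *\<^sub>R (acorr (u / s) / s ^ 2)) = (- acorr 0 / R) - (- acorr 0 / e)"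
      using True assms
      by (intro integral_FTC_atLeastAtMost)
         (auto simp: has_real_derivative_iff_has_vector_derivative[symmetric] power2_eq_square
             intro!: derivative_eq_intros continuous_intros)
    then show ?thesis using True by (simp add: phi_def)
  next
    case False
    have "(LINT s|lborel. indicator {e..R} s *\<^sub>R (acorr (u / s) / s ^ 2)) = (- prim (u / R) / u) - (- prim (u / e) / u)"
    proof (intro integral_FTC_atLeastAtMost)
      fix s assume s: "e \<le> s" "s \<le> R"
      have "((\<lambda>s. - prim (u / s) / u) has_real_derivative (acorr (u / s) / s ^ 2)) (at s within {e..R})"
        by (rule DERIV_cong[OF DERIV_cdivide[OF DERIV_minus[OF DERIV_chain'[OF _ prim]]]])
           (use s assms False in \<open>auto intro!: derivative_eq_intros simp: power2_eq_square field_simps\<close>)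
      then show "((\<lambda>s. - prim (u / s) / u) has_vector_derivative (acorr (u / s) / s ^ 2)) (at s within {e..R})"
        by (simp add: has_real_derivative_iff_has_vector_derivative)
    next
      show "continuous_on {e..R} (\<lambda>s. acorr (u / s) / s ^ 2)"
        using assms by (intro continuous_intros continuous_on_compose2[OF acorr_cont]) auto
    qed (use assms in auto)
    then show ?thesis using False assms by (simp add: phi_def diff_divide_distrib)
  qed
  finally show ?thesis by (simp add: u_def)
qed

end


section \<open>The energy as a quadratic form and the bound for p = 2\<close>

lemma ennreal_le_add:
  assumes "a \<le> b + c" "0 \<le> b" "0 \<le> c"
  shows "ennreal a \<le> ennreal b + ennreal c"
  using assms by (simp add: ennreal_plus[symmetric] ennreal_leI del: ennreal_plus)

lemma
  fixes f g :: "real \<Rightarrow> real"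
  assumes f: "integrable lborel f" and g: "integrable lborel g"
  shows integrable_lborel2_prod: "integrable lborel2 (\<lambda>z. f (fst z) * g (snd z))"
    and integral_lborel2_prod: "(LINT z|lborel2. f (fst z) * g (snd z)) = (LINT x|lborel. f x) * (LINT y|lborel. g y)"
proof -
  note [measurable] = borel_measurable_integrable[OF f] borel_measurable_integrable[OF g]
  show i: "integrable lborel2 (\<lambda>z. f (fst z) * g (snd z))"
    by (rule lborel_pair.Fubini_integrable) (use f g in \<open>auto simp: abs_mult\<close>)
  show "(LINT z|lborel2. f (fst z) * g (snd z)) = (LINT x|lborel. f x) * (LINT y|lborel. g y)"
    using lborel_pair.integral_fst'[OF i] by simp
qed

interpretation lborel2_pair: pair_sigma_finite lborel2 lborel2 ..

text \<open>The square of the vertical square function; no root is taken, so powers p/2 appear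
  below. The set of scales is a parameter: (0, a) for the leaders, (0, infinity) for the bounds,
  compact sets for the truncations.\<close>

definition sqf :: "(real \<Rightarrow> real) \<Rightarrow> (real \<Rightarrow> real) \<Rightarrow> real set \<Rightarrow> real \<Rightarrow> ennreal" where
  "sqf \<eta> g S t = (\<integral>\<^sup>+ s\<in>S. ennreal ((cwt \<eta> g s t)\<^sup>2 / s) \<partial>lborel)"

lemma sqf_mono: "S \<subseteq> T \<Longrightarrow> sqf \<eta> g S t \<le> sqf \<eta> g T t"
  unfolding sqf_def by (intro nn_integral_mono) (auto split: split_indicator)

context bump begin

lemma cwt_integrand_integrable:
  assumes f: "integrable lborel f"
  shows "integrable lborel (\<lambda>x. f x * \<eta> ((x - t) / s))"
proof (rule Bochner_Integration.integrable_bound)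
  note [measurable] = borel_measurable_integrable[OF f]
  show "integrable lborel (\<lambda>x. bd * f x)" using f by simp
  show "(\<lambda>x. f x * \<eta> ((x - t) / s)) \<in> borel_measurable lborel" by measurable
  show "AE x in lborel. norm (f x * \<eta> ((x - t) / s)) \<le> norm (bd * f x)"
    using bd bd_pos by (intro AE_I2) (auto simp: abs_mult mult.commute[of bd] intro!: mult_left_mono)
qed

lemma kern_abs_integral:
  assumes "0 < e" "e \<le> R"
  shows "(LINT w|lborel2. \<bar>indicator {e..R} (fst w) *
      (\<eta> ((x - snd w) / fst w) * \<eta> ((y - snd w) / fst w)) / fst w ^ 3\<bar>) \<le> bd\<^sup>2 / e ^ 3 * ((R - e) * (2 * R))"
proof -
  let ?F = "\<lambda>w. indicator {e..R} (fst w) *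
      (\<eta> ((x - snd w) / fst w) * \<eta> ((y - snd w) / fst w)) / fst w ^ 3"
  let ?Q = "{e..R} \<times> {x - R..x + R}"
  have "emeasure lborel2 ?Q = emeasure lborel {e..R} * emeasure lborel {x - R..x + R}"
    by (rule lborel.emeasure_pair_measure_Times) auto
  also have "\<dots> = ennreal ((R - e) * (2 * R))" using assms by (simp add: ennreal_mult[symmetric])
  finally have Q: "emeasure lborel2 ?Q = ennreal ((R - e) * (2 * R))" .
  have "(LINT w|lborel2. \<bar>?F w\<bar>) \<le> (LINT w|lborel2. bd\<^sup>2 / e ^ 3 * indicator ?Q w)"
  proof (rule integral_mono)
    show "integrable lborel2 (\<lambda>w. bd\<^sup>2 / e ^ 3 * indicator ?Q w)"
      using Q by (intro integrable_mult_right integrable_real_indicator) auto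
    show "integrable lborel2 (\<lambda>w. \<bar>?F w\<bar>)"
      by (rule integrable_abs[OF kern_integrable[OF assms]])
  qed (rule kern_pt_bound[OF assms])
  also have "\<dots> = bd\<^sup>2 / e ^ 3 * ((R - e) * (2 * R))"
    using Q assms by (simp add: measure_def)
  finally show ?thesis .
qed

text \<open>Fubini in (x, y) and (s, t). By \<open>kern_abs_integral\<close> the inner integral is
  bounded uniformly in x and y, so integrability of f and g suffices. The bilinear form serves both
  for the energy, with f = g, and for the reproducing formula.\<close>

lemma bilinear:
  assumes f: "integrable lborel f" and g: "integrable lborel g" and e: "0 < e" "e \<le> R"
  shows bilinear_integrable: "integrable lborel2 (\<lambda>w. indicator {e..R} (fst w) * (cwt \<eta> f (fst w) (snd w) * cwt \<eta> g (fst w) (snd w)) / fst w)" (is ?A)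
    and bilinear_eq: "(LINT w|lborel2. indicator {e..R} (fst w) * (cwt \<eta> f (fst w) (snd w) * cwt \<eta> g (fst w) (snd w)) / fst w)
      = (LINT z|lborel2. f (fst z) * g (snd z) * kern e R (fst z) (snd z))" (is ?B)
    and kern_fg_integrable: "integrable lborel2 (\<lambda>z. f (fst z) * g (snd z) * kern e R (fst z) (snd z))" (is ?C)
proof -
  note [measurable] = borel_measurable_integrable[OF f] borel_measurable_integrable[OF g]
  define k where "k = (\<lambda>w x y. indicator {e..R} (fst w) *
      (\<eta> ((x - snd w) / fst w) * \<eta> ((y - snd w) / fst w)) / fst w ^ 3)"
  have [measurable]: "(\<lambda>v. k (snd v) (fst (fst v)) (snd (fst v))) \<in> borel_measurable (lborel2 \<Otimes>\<^sub>M lborel2)"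
    unfolding k_def by measurable
  define F where "F = (\<lambda>(z, w). f (fst z) * g (snd z) * k w (fst z) (snd z))"
  have [measurable]: "F \<in> borel_measurable (lborel2 \<Otimes>\<^sub>M lborel2)"
    unfolding F_def split_beta by measurable
  have fg: "integrable lborel2 (\<lambda>z. f (fst z) * g (snd z))" by (rule integrable_lborel2_prod[OF f g])
  define D where "D = bd\<^sup>2 / e ^ 3 * ((R - e) * (2 * R))"
  have F: "integrable (lborel2 \<Otimes>\<^sub>M lborel2) F"
  proof (rule lborel2_pair.Fubini_integrable)
    show "integrable lborel2 (\<lambda>z. LINT w|lborel2. norm (F (z, w)))"
    proof (rule Bochner_Integration.integrable_bound)
      show "integrable lborel2 (\<lambda>z. D * (f (fst z) * g (snd z)))" using fg by simp
      show "AE z in lborel2. norm (LINT w|lborel2. norm (F (z, w))) \<le> norm (D * (f (fst z) * g (snd z)))"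
      proof (intro AE_I2)
        fix z
        have "(LINT w|lborel2. norm (F (z, w))) = \<bar>f (fst z) * g (snd z)\<bar> * (LINT w|lborel2. \<bar>k w (fst z) (snd z)\<bar>)"
          by (simp add: F_def abs_mult)
        also have "\<dots> \<le> \<bar>f (fst z) * g (snd z)\<bar> * D"
          using kern_abs_integral[OF e] unfolding k_def D_def by (intro mult_left_mono) auto
        finally show "norm (LINT w|lborel2. norm (F (z, w))) \<le> norm (D * (f (fst z) * g (snd z)))"
          using e by (simp add: abs_mult mult.commute D_def)
      qed
    qed measurable
    show "AE z in lborel2. integrable lborel2 (\<lambda>w. F (z, w))"
    proof (intro AE_I2)
      fix z
      have "integrable lborel2 (\<lambda>w. k w (fst z) (snd z))"
        using kern_integrable[OF e] unfolding k_def .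
      then have "integrable lborel2 (\<lambda>w. (f (fst z) * g (snd z)) * k w (fst z) (snd z))"
        by (rule integrable_mult_right)
      then show "integrable lborel2 (\<lambda>w. F (z, w))"
        unfolding F_def by simp
    qed
  qed measurable
  then have F': "integrable (lborel2 \<Otimes>\<^sub>M lborel2) (case_prod (\<lambda>z w. F (z, w)))" by simp
  have in1: "(LINT w|lborel2. F (z, w)) = f (fst z) * g (snd z) * kern e R (fst z) (snd z)" for z
  proof -
    have "(LINT w|lborel2. F (z, w)) = (LINT w|lborel2. (f (fst z) * g (snd z)) * k w (fst z) (snd z))"
      by (simp add: F_def)
    also have "\<dots> = f (fst z) * g (snd z) * kern e R (fst z) (snd z)"
      unfolding kern_def k_def by (rule integral_mult_right_zero)
    finally show ?thesis .
  qed
  have in2: "(LINT z|lborel2. F (z, w)) = indicator {e..R} (fst w) * (cwt \<eta> f (fst w) (snd w) * cwt \<eta> g (fst w) (snd w)) / fst w" for w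
  proof -
    obtain s t where w: "w = (s, t)" by (cases w)
    have fi: "integrable lborel (\<lambda>x. f x * \<eta> ((x - t) / s))" "integrable lborel (\<lambda>x. g x * \<eta> ((x - t) / s))"
      by (intro cwt_integrand_integrable f g)+
    have "(LINT z|lborel2. F (z, w)) = (LINT z|lborel2. (indicator {e..R} s / s ^ 3) *
       ((f (fst z) * \<eta> ((fst z - t) / s)) * (g (snd z) * \<eta> ((snd z - t) / s))))"
      unfolding F_def k_def w by (intro Bochner_Integration.integral_cong) auto
    also have "\<dots> = (indicator {e..R} s / s ^ 3) * ((s * cwt \<eta> f s t) * (s * cwt \<eta> g s t))"
      using integral_lborel2_prod[OF fi] e by (auto simp: cwt_def split: split_indicator)
    also have "\<dots> = indicator {e..R} s * (cwt \<eta> f s t * cwt \<eta> g s t) / s"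
      using e by (auto simp: power3_eq_cube split: split_indicator)
    finally show ?thesis by (simp add: w)
  qed
  show ?A using lborel2_pair.integrable_snd[OF F'] by (simp add: in2)
  show ?C using lborel2_pair.integrable_fst[OF F'] by (simp add: in1)
  show ?B using lborel2_pair.Fubini_integral[OF F'] by (simp add: in1 in2)
qed

lemma sqf_nn_lborel2:
  assumes [measurable]: "g \<in> borel_measurable borel" "S \<in> sets borel"
  shows "(\<integral>\<^sup>+t. sqf \<eta> g S t \<partial>lborel) = (\<integral>\<^sup>+w. ennreal ((cwt \<eta> g (fst w) (snd w))\<^sup>2 / fst w) * indicator S (fst w) \<partial>lborel2)"
  unfolding sqf_def
  using lborel_pair.nn_integral_snd[of "\<lambda>w. ennreal ((cwt \<eta> g (fst w) (snd w))\<^sup>2 / fst w) * indicator S (fst w)"]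
  by simp

lemma sqf_measurable[measurable]:
  assumes [measurable]: "g \<in> borel_measurable borel" "S \<in> sets borel"
  shows "sqf \<eta> g S \<in> borel_measurable borel"
  unfolding sqf_def by measurable

end

definition scales :: "nat \<Rightarrow> real set" where "scales n = {1 / real (Suc n)..real (Suc n)}"

lemma scales_le: "1 / real (Suc n) \<le> real (Suc n)"
  by (rule order_trans[of _ 1]) auto

lemma scales_sets[measurable]: "scales n \<in> sets borel" by (simp add: scales_def)

lemma scales_incseq: "incseq scales"
  by (intro incseq_SucI) (auto simp: scales_def divide_simps intro: order_trans)

lemma scales_Union: "(\<Union>n. scales n) = {0<..}"
proof (intro equalityI subsetI)
  fix x :: real assume "x \<in> {0<..}"
  then have x: "x > 0" by simp
  obtain n where n: "real n \<ge> max x (1 / x)" using real_arch_simple by blast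
  then have "1 / x \<le> real (Suc n)" "x \<le> real (Suc n)" by auto
  with x have "x \<in> scales n" by (auto simp: scales_def field_simps)
  then show "x \<in> (\<Union>n. scales n)" by blast
next
  fix x assume "x \<in> (\<Union>n. scales n)"
  then obtain n where "1 / real (Suc n) \<le> x" by (auto simp: scales_def)
  moreover have "0 < 1 / real (Suc n)" by simp
  ultimately have "0 < x" by (rule less_le_trans[rotated])
  then show "x \<in> {0<..}" by simp
qed

lemma indicator_incseq_SUP:
  assumes "incseq A"
  shows "(indicator (\<Union>n. A n) x :: ennreal) = (SUP n. indicator (A n) x)"
proof (cases "x \<in> (\<Union>n. A n)")
  case True
  then obtain n where n: "x \<in> A n" by blast
  show ?thesis
  proof (rule antisym)
    show "indicator (\<Union>n. A n) x \<le> (SUP n. indicator (A n) x :: ennreal)"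
      using True n by (intro SUP_upper2[of n]) auto
    show "(SUP n. indicator (A n) x :: ennreal) \<le> indicator (\<Union>n. A n) x"
      using True by (intro SUP_least) (auto split: split_indicator)
  qed
qed auto

lemma nn_integral_incseq_sets:
  assumes A: "incseq A" "\<And>n::nat. A n \<in> sets M" and [measurable]: "f \<in> borel_measurable M"
  shows "(\<integral>\<^sup>+x\<in>(\<Union>n. A n). f x \<partial>M) = (SUP n. \<integral>\<^sup>+x\<in>A n. f x \<partial>M)"
proof -
  have [measurable]: "A n \<in> sets M" for n by (rule A)
  have "(\<integral>\<^sup>+x\<in>(\<Union>n. A n). f x \<partial>M) = (\<integral>\<^sup>+x. (SUP n. f x * indicator (A n) x) \<partial>M)"
    by (simp add: indicator_incseq_SUP[OF A(1)] SUP_mult_left_ennreal)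
  also have "\<dots> = (SUP n. \<integral>\<^sup>+x\<in>A n. f x \<partial>M)"
    by (rule nn_integral_monotone_convergence_SUP)
       (use A(1) in \<open>auto simp: incseq_def le_fun_def split: split_indicator\<close>)
  finally show ?thesis .
qed

context wavelet begin

text \<open>The L^1 norm of a dilate does not depend on e: height 2 bd^2 / e on an interval of
  length 4e gives 8 bd^2.\<close>

lemma phi_scaled_nn:
  assumes "e > 0"
  shows "(\<integral>\<^sup>+y. ennreal \<bar>phi ((x - y) / e) / e\<bar> \<partial>lborel) \<le> ennreal (8 * bd\<^sup>2)"
    "(\<integral>\<^sup>+y. ennreal \<bar>phi ((y - x) / e) / e\<bar> \<partial>lborel) \<le> ennreal (8 * bd\<^sup>2)"
proof -
  have *: "\<bar>phi u / e\<bar> \<le> 2 * bd\<^sup>2 / e * indicator {-2..2} u" for u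
    using phi_ind[of u] assms by (auto simp: divide_simps abs_divide)
  have I: "(\<integral>\<^sup>+y. ennreal (2 * bd\<^sup>2 / e) * indicator {x - 2 * e..x + 2 * e} y \<partial>lborel) = ennreal (8 * bd\<^sup>2)"
    using assms by (subst nn_integral_cmult_indicator) (auto simp: ennreal_mult[symmetric])
  have "ennreal \<bar>phi ((x - y) / e) / e\<bar> \<le> ennreal (2 * bd\<^sup>2 / e) * indicator {x - 2 * e..x + 2 * e} y" for y
    using *[of "(x - y) / e"] assms by (auto simp: divide_simps split: split_indicator_asm split_indicator intro!: ennreal_leI)
  then show "(\<integral>\<^sup>+y. ennreal \<bar>phi ((x - y) / e) / e\<bar> \<partial>lborel) \<le> ennreal (8 * bd\<^sup>2)"
    unfolding I[symmetric] by (intro nn_integral_mono)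
  have "ennreal \<bar>phi ((y - x) / e) / e\<bar> \<le> ennreal (2 * bd\<^sup>2 / e) * indicator {x - 2 * e..x + 2 * e} y" for y
    using *[of "(y - x) / e"] assms by (auto simp: divide_simps split: split_indicator_asm split_indicator intro!: ennreal_leI)
  then show "(\<integral>\<^sup>+y. ennreal \<bar>phi ((y - x) / e) / e\<bar> \<partial>lborel) \<le> ennreal (8 * bd\<^sup>2)"
    unfolding I[symmetric] by (intro nn_integral_mono)
qed

text \<open>The energy is a quadratic form in \<open>f\<close> whose kernel is a difference of two rescaled copies of \<open>phi\<close>,
  so no Fourier transform is needed for the \<open>L\<^sup>2\<close> bound: Schur's test suffices.\<close>

lemma phi_schur:
  assumes [measurable]: "f \<in> borel_measurable borel" and "e > 0"
  shows "(\<integral>\<^sup>+z. ennreal (\<bar>f (fst z) * f (snd z)\<bar> * \<bar>phi ((fst z - snd z) / e) / e\<bar>) \<partial>lborel2)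
    \<le> ennreal (8 * bd\<^sup>2) * (\<integral>\<^sup>+x. ennreal ((f x)\<^sup>2) \<partial>lborel)"
proof -
  let ?p = "\<lambda>x y. \<bar>phi ((x - y) / e) / e\<bar>"
  let ?I = "\<integral>\<^sup>+x. ennreal ((f x)\<^sup>2) \<partial>lborel"
  \<comment> \<open>Splitting the product by the arithmetic mean lets each half be integrated first
    in the variable that occurs only in the kernel.\<close>
  have *: "\<bar>a * b\<bar> * c \<le> a\<^sup>2 / 2 * c + b\<^sup>2 / 2 * c" if "c \<ge> 0" for a b c :: real
  proof -
    have "\<bar>a * b\<bar> \<le> a\<^sup>2 / 2 + b\<^sup>2 / 2"
      using sum_squares_bound[of "\<bar>a\<bar>" "\<bar>b\<bar>"] by (simp add: abs_mult)
    from mult_right_mono[OF this that] show ?thesis by (simp add: algebra_simps)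
  qed
  have "(\<integral>\<^sup>+z. ennreal (\<bar>f (fst z) * f (snd z)\<bar> * ?p (fst z) (snd z)) \<partial>lborel2)
    \<le> (\<integral>\<^sup>+z. ennreal ((f (fst z))\<^sup>2 / 2) * ennreal (?p (fst z) (snd z)) + ennreal ((f (snd z))\<^sup>2 / 2) * ennreal (?p (fst z) (snd z)) \<partial>lborel2)"
  proof (rule nn_integral_mono)
    fix z
    have "\<bar>f (fst z) * f (snd z)\<bar> * ?p (fst z) (snd z) \<le> (f (fst z))\<^sup>2 / 2 * ?p (fst z) (snd z) + (f (snd z))\<^sup>2 / 2 * ?p (fst z) (snd z)"
      by (rule *) simp
    then have "ennreal (\<bar>f (fst z) * f (snd z)\<bar> * ?p (fst z) (snd z))
      \<le> ennreal ((f (fst z))\<^sup>2 / 2 * ?p (fst z) (snd z)) + ennreal ((f (snd z))\<^sup>2 / 2 * ?p (fst z) (snd z))"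
      by (rule ennreal_le_add) auto
    then show "ennreal (\<bar>f (fst z) * f (snd z)\<bar> * ?p (fst z) (snd z))
      \<le> ennreal ((f (fst z))\<^sup>2 / 2) * ennreal (?p (fst z) (snd z)) + ennreal ((f (snd z))\<^sup>2 / 2) * ennreal (?p (fst z) (snd z))"
      by (simp only: ennreal_mult[OF _ abs_ge_zero] zero_le_divide_iff zero_le_power2 zero_le_numeral simp_thms)
  qed
  also have "\<dots> = (\<integral>\<^sup>+z. ennreal ((f (fst z))\<^sup>2 / 2) * ennreal (?p (fst z) (snd z)) \<partial>lborel2)
     + (\<integral>\<^sup>+z. ennreal ((f (snd z))\<^sup>2 / 2) * ennreal (?p (fst z) (snd z)) \<partial>lborel2)"
    by (rule nn_integral_add) measurable
  also have "(\<integral>\<^sup>+z. ennreal ((f (fst z))\<^sup>2 / 2) * ennreal (?p (fst z) (snd z)) \<partial>lborel2)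
     = (\<integral>\<^sup>+x. ennreal ((f x)\<^sup>2 / 2) * (\<integral>\<^sup>+y. ennreal (?p x y) \<partial>lborel) \<partial>lborel)"
    by (subst lborel.nn_integral_fst[symmetric]) (auto intro!: nn_integral_cong nn_integral_cmult)
  also have "\<dots> \<le> (\<integral>\<^sup>+x. ennreal ((f x)\<^sup>2) * ennreal (4 * bd\<^sup>2) \<partial>lborel)"
  proof (rule nn_integral_mono)
    fix x
    have "ennreal ((f x)\<^sup>2 / 2) * (\<integral>\<^sup>+y. ennreal (?p x y) \<partial>lborel) \<le> ennreal ((f x)\<^sup>2 / 2) * ennreal (8 * bd\<^sup>2)"
      by (intro mult_left_mono phi_scaled_nn assms) auto
    then show "ennreal ((f x)\<^sup>2 / 2) * (\<integral>\<^sup>+y. ennreal (?p x y) \<partial>lborel) \<le> ennreal ((f x)\<^sup>2) * ennreal (4 * bd\<^sup>2)"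
      by (simp add: ennreal_mult[symmetric] ac_simps)
  qed
  also have "\<dots> = ?I * ennreal (4 * bd\<^sup>2)" by (rule nn_integral_multc) measurable
  also have "(\<integral>\<^sup>+z. ennreal ((f (snd z))\<^sup>2 / 2) * ennreal (?p (fst z) (snd z)) \<partial>lborel2)
     = (\<integral>\<^sup>+y. ennreal ((f y)\<^sup>2 / 2) * (\<integral>\<^sup>+x. ennreal (?p x y) \<partial>lborel) \<partial>lborel)"
    by (subst lborel_pair.nn_integral_snd[symmetric]) (auto intro!: nn_integral_cong nn_integral_cmult)
  also have "\<dots> \<le> (\<integral>\<^sup>+x. ennreal ((f x)\<^sup>2) * ennreal (4 * bd\<^sup>2) \<partial>lborel)"
  proof (rule nn_integral_mono)
    fix x
    have "ennreal ((f x)\<^sup>2 / 2) * (\<integral>\<^sup>+y. ennreal (?p y x) \<partial>lborel) \<le> ennreal ((f x)\<^sup>2 / 2) * ennreal (8 * bd\<^sup>2)"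
      by (intro mult_left_mono phi_scaled_nn assms) auto
    then show "ennreal ((f x)\<^sup>2 / 2) * (\<integral>\<^sup>+y. ennreal (?p y x) \<partial>lborel) \<le> ennreal ((f x)\<^sup>2) * ennreal (4 * bd\<^sup>2)"
      by (simp add: ennreal_mult[symmetric] ac_simps)
  qed
  also have "\<dots> = ?I * ennreal (4 * bd\<^sup>2)" by (rule nn_integral_multc) measurable
  also have "?I * ennreal (4 * bd\<^sup>2) + ?I * ennreal (4 * bd\<^sup>2) = ennreal (8 * bd\<^sup>2) * ?I"
    by (simp add: distrib_left[symmetric] ennreal_plus[symmetric] mult.commute del: ennreal_plus)
  finally show ?thesis by (simp add: add_mono)
qed

text \<open>The constant 16 bd^2 is 8 bd^2 for each of the two dilates of \<open>phi\<close>. It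
  does not depend on e and R, which permits the limit in \<open>sqf_L2\<close>.\<close>

lemma sqf_L2_truncated:
  assumes f: "integrable lborel f" and e: "0 < e" "e \<le> R"
  shows "(\<integral>\<^sup>+t. sqf \<eta> f {e..R} t \<partial>lborel) \<le> ennreal (16 * bd\<^sup>2) * (\<integral>\<^sup>+x. ennreal ((f x)\<^sup>2) \<partial>lborel)"
proof -
  have [measurable]: "f \<in> borel_measurable borel" using borel_measurable_integrable[OF f] by simp
  let ?F = "\<lambda>w. indicator {e..R} (fst w) * (cwt \<eta> f (fst w) (snd w) * cwt \<eta> f (fst w) (snd w)) / fst w"
  let ?p = "\<lambda>e z. \<bar>phi ((fst z - snd z) / e) / e\<bar>"
  have "(\<integral>\<^sup>+t. sqf \<eta> f {e..R} t \<partial>lborel) = (\<integral>\<^sup>+w. ennreal (?F w) \<partial>lborel2)"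
    unfolding sqf_nn_lborel2[OF \<open>f \<in> borel_measurable borel\<close> borel_closed[OF closed_atLeastAtMost]]
    by (intro nn_integral_cong) (auto simp: power2_eq_square split: split_indicator)
  also have "\<dots> = ennreal (LINT w|lborel2. ?F w)"
    by (rule nn_integral_eq_integral[OF bilinear_integrable[OF f f e]])
       (use e in \<open>auto split: split_indicator\<close>)
  also have "\<dots> \<le> ennreal \<bar>LINT z|lborel2. f (fst z) * f (snd z) * kern e R (fst z) (snd z)\<bar>"
    by (intro ennreal_leI) (simp add: bilinear_eq[OF f f e])
  also have "\<dots> \<le> (\<integral>\<^sup>+z. ennreal (norm (f (fst z) * f (snd z) * kern e R (fst z) (snd z))) \<partial>lborel2)"
    using integral_norm_bound_ennreal[OF kern_fg_integrable[OF f f e]] by simp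
  also have "\<dots> \<le> (\<integral>\<^sup>+z. ennreal (\<bar>f (fst z) * f (snd z)\<bar> * ?p e z) + ennreal (\<bar>f (fst z) * f (snd z)\<bar> * ?p R z) \<partial>lborel2)"
  proof (rule nn_integral_mono)
    fix z
    have "\<bar>kern e R (fst z) (snd z)\<bar> \<le> ?p e z + ?p R z"
      unfolding kern_eq[OF e] by (rule abs_triangle_ineq4)
    then have "\<bar>f (fst z) * f (snd z)\<bar> * \<bar>kern e R (fst z) (snd z)\<bar> \<le> \<bar>f (fst z) * f (snd z)\<bar> * (?p e z + ?p R z)"
      by (rule mult_left_mono) simp
    then show "ennreal (norm (f (fst z) * f (snd z) * kern e R (fst z) (snd z)))
      \<le> ennreal (\<bar>f (fst z) * f (snd z)\<bar> * ?p e z) + ennreal (\<bar>f (fst z) * f (snd z)\<bar> * ?p R z)"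
      unfolding real_norm_def by (intro ennreal_le_add) (auto simp only: abs_mult distrib_left mult_nonneg_nonneg abs_ge_zero)
  qed
  also have "\<dots> = (\<integral>\<^sup>+z. ennreal (\<bar>f (fst z) * f (snd z)\<bar> * ?p e z) \<partial>lborel2) + (\<integral>\<^sup>+z. ennreal (\<bar>f (fst z) * f (snd z)\<bar> * ?p R z) \<partial>lborel2)"
    by (rule nn_integral_add) measurable
  also have "\<dots> \<le> ennreal (8 * bd\<^sup>2) * (\<integral>\<^sup>+x. ennreal ((f x)\<^sup>2) \<partial>lborel) + ennreal (8 * bd\<^sup>2) * (\<integral>\<^sup>+x. ennreal ((f x)\<^sup>2) \<partial>lborel)"
    by (intro add_mono phi_schur) (use e in auto)
  also have "\<dots> = ennreal (16 * bd\<^sup>2) * (\<integral>\<^sup>+x. ennreal ((f x)\<^sup>2) \<partial>lborel)"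
    by (simp add: distrib_right[symmetric] ennreal_plus[symmetric] del: ennreal_plus)
  finally show ?thesis .
qed

end

context bump begin

lemma sqf_SUP:
  assumes [measurable]: "f \<in> borel_measurable borel"
  shows "sqf \<eta> f {0<..} t = (SUP n. sqf \<eta> f (scales n) t)"
  unfolding sqf_def scales_Union[symmetric]
  by (rule nn_integral_incseq_sets[OF scales_incseq]) auto

lemma sqf_nn_SUP:
  assumes [measurable]: "f \<in> borel_measurable borel"
  shows "(\<integral>\<^sup>+t. sqf \<eta> f {0<..} t \<partial>lborel) = (SUP n. \<integral>\<^sup>+t. sqf \<eta> f (scales n) t \<partial>lborel)"
  unfolding sqf_SUP[OF assms]
  by (rule nn_integral_monotone_convergence_SUP)
     (use scales_incseq in \<open>auto simp: incseq_def le_fun_def intro!: sqf_mono\<close>)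

end

lemma (in wavelet) sqf_L2:
  assumes f: "integrable lborel f"
  shows "(\<integral>\<^sup>+t. sqf \<eta> f {0<..} t \<partial>lborel) \<le> ennreal (16 * bd\<^sup>2) * (\<integral>\<^sup>+x. ennreal ((f x)\<^sup>2) \<partial>lborel)"
proof -
  have [measurable]: "f \<in> borel_measurable borel" using borel_measurable_integrable[OF f] by simp
  show ?thesis
    unfolding sqf_nn_SUP[OF \<open>f \<in> borel_measurable borel\<close>]
    unfolding scales_def by (intro SUP_least sqf_L2_truncated[OF f] scales_le) simp
qed


subsection \<open>Layer cake formulas\<close>

lemma nn_integral_powr_near_0:
  fixes a c :: real
  assumes "a > -1" "c \<ge> 0"
  shows "(\<integral>\<^sup>+l\<in>{0<..<c}. ennreal (l powr a) \<partial>lborel) = ennreal (c powr (a + 1) / (a + 1))"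
proof -
  have "((\<lambda>x. if x \<in> {0..c} then x powr a else 0) has_integral (c powr (a+1) / (a+1))) UNIV"
    using has_integral_powr_from_0[OF assms] by (simp only: has_integral_restrict_UNIV)
  then have "(\<integral>\<^sup>+l. ennreal (if l \<in> {0..c} then l powr a else 0) \<partial>lborel) = ennreal (c powr (a + 1) / (a + 1))"
    by (intro nn_integral_has_integral_lborel) auto
  moreover have "(\<integral>\<^sup>+l\<in>{0<..<c}. ennreal (l powr a) \<partial>lborel) = (\<integral>\<^sup>+l. ennreal (if l \<in> {0..c} then l powr a else 0) \<partial>lborel)"
    using AE_lborel_singleton[of 0] AE_lborel_singleton[of c]
    by (intro nn_integral_cong_AE, eventually_elim) (auto split: split_indicator)
  ultimately show ?thesis by simp
qed

lemma nn_integral_powr_near_inf: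
  fixes a c :: real
  assumes "a < -1" "c > 0"
  shows "(\<integral>\<^sup>+l\<in>{c..}. ennreal (l powr a) \<partial>lborel) = ennreal (- (c powr (a + 1) / (a + 1)))"
proof -
  have "((\<lambda>x. if x \<in> {c..} then x powr a else 0) has_integral (- (c powr (a+1)) / (a+1))) UNIV"
    using has_integral_powr_to_inf[OF assms] by (simp only: has_integral_restrict_UNIV)
  then have "(\<integral>\<^sup>+l. ennreal (if l \<in> {c..} then l powr a else 0) \<partial>lborel) = ennreal (- (c powr (a + 1)) / (a + 1))"
    by (intro nn_integral_has_integral_lborel) auto
  moreover have "(\<integral>\<^sup>+l\<in>{c..}. ennreal (l powr a) \<partial>lborel) = (\<integral>\<^sup>+l. ennreal (if l \<in> {c..} then l powr a else 0) \<partial>lborel)"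
    by (intro nn_integral_cong) (auto split: split_indicator)
  ultimately show ?thesis by simp
qed

lemma layer_cake:
  fixes u :: "real \<Rightarrow> real"
  assumes q: "q > 0" and [measurable]: "u \<in> borel_measurable borel" and u: "\<And>x. u x \<ge> 0"
  shows "(\<integral>\<^sup>+x. ennreal (u x powr q) \<partial>lborel)
    = (\<integral>\<^sup>+l\<in>{0<..}. ennreal (q * l powr (q - 1)) * emeasure lborel {x. l < u x} \<partial>lborel)"
proof -
  have "(\<integral>\<^sup>+x. ennreal (u x powr q) \<partial>lborel)
     = (\<integral>\<^sup>+x. (\<integral>\<^sup>+l. ennreal (q * l powr (q - 1)) * (indicator {0<..} l * indicator {x. l < u x} x) \<partial>lborel) \<partial>lborel)"
  proof (rule nn_integral_cong)
    fix x
    have "ennreal (u x powr q) = ennreal q * (\<integral>\<^sup>+l\<in>{0<..<u x}. ennreal (l powr (q - 1)) \<partial>lborel)"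
      using q u nn_integral_powr_near_0[of "q - 1" "u x"] by (simp add: ennreal_mult[symmetric])
    also have "\<dots> = (\<integral>\<^sup>+l. ennreal q * (ennreal (l powr (q - 1)) * indicator {0<..<u x} l) \<partial>lborel)"
      by (rule nn_integral_cmult[symmetric]) measurable
    also have "\<dots> = (\<integral>\<^sup>+l. ennreal (q * l powr (q - 1)) * (indicator {0<..} l * indicator {x. l < u x} x) \<partial>lborel)"
      using q by (intro nn_integral_cong) (auto simp: ennreal_mult split: split_indicator)
    finally show "ennreal (u x powr q) = \<dots>" .
  qed
  also have "\<dots> = (\<integral>\<^sup>+l. (\<integral>\<^sup>+x. ennreal (q * l powr (q - 1)) * (indicator {0<..} l * indicator {x. l < u x} x) \<partial>lborel) \<partial>lborel)"
    by (rule lborel_pair.Fubini'[symmetric]) measurable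
  also have "\<dots> = (\<integral>\<^sup>+l\<in>{0<..}. ennreal (q * l powr (q - 1)) * emeasure lborel {x. l < u x} \<partial>lborel)"
  proof (rule nn_integral_cong)
    fix l :: real
    have [measurable]: "{x. l < u x} \<in> sets lborel" by measurable
    have "(\<integral>\<^sup>+x. ennreal (q * l powr (q - 1)) * (indicator {0<..} l * indicator {x. l < u x} x) \<partial>lborel)
      = (\<integral>\<^sup>+x. (ennreal (q * l powr (q - 1)) * indicator {0<..} l) * indicator {x. l < u x} x \<partial>lborel)"
      by (simp add: mult.assoc)
    also have "\<dots> = (ennreal (q * l powr (q - 1)) * indicator {0<..} l) * emeasure lborel {x. l < u x}"
      by (rule nn_integral_cmult_indicator) measurable
    finally show "(\<integral>\<^sup>+x. ennreal (q * l powr (q - 1)) * (indicator {0<..} l * indicator {x. l < u x} x) \<partial>lborel)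
      = ennreal (q * l powr (q - 1)) * emeasure lborel {x. l < u x} * indicator {0<..} l"
      by (simp add: ac_simps)
  qed
  finally show ?thesis .
qed

text \<open>This is what a weak type (1,1) bound leaves after integration over all levels, when only
  the part of w above half the level is charged. Swapping the integrals gives the integral of
  l^(q-2) over (0, 2 w x), finite since q > 1.\<close>

lemma level_integral_above:
  fixes w :: "real \<Rightarrow> real"
  assumes q: "q > 1" and [measurable]: "w \<in> borel_measurable borel" and w: "\<And>x. w x \<ge> 0"
  shows "(\<integral>\<^sup>+l\<in>{0<..}. ennreal (l powr (q - 2)) * (\<integral>\<^sup>+x\<in>{x. l / 2 < w x}. ennreal (w x) \<partial>lborel) \<partial>lborel)
    = ennreal (2 powr (q - 1) / (q - 1)) * (\<integral>\<^sup>+x. ennreal (w x powr q) \<partial>lborel)"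
proof -
  let ?F = "\<lambda>l x. ennreal (l powr (q - 2)) * (ennreal (w x) * (indicator {0<..} l * indicator {x. l / 2 < w x} x))"
  have "(\<integral>\<^sup>+l\<in>{0<..}. ennreal (l powr (q - 2)) * (\<integral>\<^sup>+x\<in>{x. l / 2 < w x}. ennreal (w x) \<partial>lborel) \<partial>lborel)
    = (\<integral>\<^sup>+l. (\<integral>\<^sup>+x. ?F l x \<partial>lborel) \<partial>lborel)"
  proof (rule nn_integral_cong)
    fix l :: real
    have "(\<integral>\<^sup>+x. ?F l x \<partial>lborel) = (\<integral>\<^sup>+x. (ennreal (l powr (q - 2)) * indicator {0<..} l) * (ennreal (w x) * indicator {x. l / 2 < w x} x) \<partial>lborel)"
      by (intro nn_integral_cong) (simp add: ac_simps)
    also have "\<dots> = (ennreal (l powr (q - 2)) * indicator {0<..} l) * (\<integral>\<^sup>+x\<in>{x. l / 2 < w x}. ennreal (w x) \<partial>lborel)"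
      by (rule nn_integral_cmult) measurable
    finally show "ennreal (l powr (q - 2)) * (\<integral>\<^sup>+x\<in>{x. l / 2 < w x}. ennreal (w x) \<partial>lborel) * indicator {0<..} l = (\<integral>\<^sup>+x. ?F l x \<partial>lborel)"
      by (simp add: ac_simps)
  qed
  also have "\<dots> = (\<integral>\<^sup>+x. (\<integral>\<^sup>+l. ?F l x \<partial>lborel) \<partial>lborel)"
    by (rule lborel_pair.Fubini'[symmetric]) measurable
  also have "\<dots> = (\<integral>\<^sup>+x. ennreal (2 powr (q - 1) / (q - 1)) * ennreal (w x powr q) \<partial>lborel)"
  proof (rule nn_integral_cong)
    fix x
    have "(\<integral>\<^sup>+l. ?F l x \<partial>lborel) = (\<integral>\<^sup>+l. ennreal (w x) * (ennreal (l powr (q - 2)) * indicator {0<..<2 * w x} l) \<partial>lborel)"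
      by (intro nn_integral_cong) (auto simp: mult.commute split: split_indicator)
    also have "\<dots> = ennreal (w x) * ennreal ((2 * w x) powr (q - 1) / (q - 1))"
      using nn_integral_powr_near_0[of "q - 2" "2 * w x"] q w by (subst nn_integral_cmult) auto
    also have "\<dots> = ennreal (2 powr (q - 1) / (q - 1)) * ennreal (w x powr q)"
    proof -
      have "w x * (w x powr (q - 1)) = w x powr q"
        using w[of x] by (simp add: powr_mult_base)
      then have "w x * ((2 * w x) powr (q - 1) / (q - 1)) = 2 powr (q - 1) / (q - 1) * (w x powr q)"
        using w[of x] by (simp add: powr_mult)
      then show ?thesis using w[of x] q by (simp add: ennreal_mult[symmetric])
    qed
    finally show "(\<integral>\<^sup>+l. ?F l x \<partial>lborel) = \<dots>" .
  qed
  also have "\<dots> = ennreal (2 powr (q - 1) / (q - 1)) * (\<integral>\<^sup>+x. ennreal (w x powr q) \<partial>lborel)"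
    by (rule nn_integral_cmult) measurable
  finally show ?thesis .
qed

text \<open>The companion for the L^2 part below twice the level: here l^(q-3) is integrated over [w
  x / 2, infinity), which converges since q < 2. Points with w x = 0 contribute nothing.\<close>

lemma level_integral_below:
  fixes w :: "real \<Rightarrow> real"
  assumes q: "q < 2" and [measurable]: "w \<in> borel_measurable borel" and w: "\<And>x. w x \<ge> 0"
  shows "(\<integral>\<^sup>+l\<in>{0<..}. ennreal (l powr (q - 3)) * (\<integral>\<^sup>+x\<in>{x. w x \<le> 2 * l}. ennreal ((w x)\<^sup>2) \<partial>lborel) \<partial>lborel)
    = ennreal (2 powr (2 - q) / (2 - q)) * (\<integral>\<^sup>+x. ennreal (w x powr q) \<partial>lborel)"
proof -
  let ?F = "\<lambda>l x. ennreal (l powr (q - 3)) * (ennreal ((w x)\<^sup>2) * (indicator {0<..} l * indicator {x. w x \<le> 2 * l} x))"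
  have "(\<integral>\<^sup>+l\<in>{0<..}. ennreal (l powr (q - 3)) * (\<integral>\<^sup>+x\<in>{x. w x \<le> 2 * l}. ennreal ((w x)\<^sup>2) \<partial>lborel) \<partial>lborel)
    = (\<integral>\<^sup>+l. (\<integral>\<^sup>+x. ?F l x \<partial>lborel) \<partial>lborel)"
  proof (rule nn_integral_cong)
    fix l :: real
    have "(\<integral>\<^sup>+x. ?F l x \<partial>lborel) = (\<integral>\<^sup>+x. (ennreal (l powr (q - 3)) * indicator {0<..} l) * (ennreal ((w x)\<^sup>2) * indicator {x. w x \<le> 2 * l} x) \<partial>lborel)"
      by (intro nn_integral_cong) (simp add: ac_simps)
    also have "\<dots> = (ennreal (l powr (q - 3)) * indicator {0<..} l) * (\<integral>\<^sup>+x\<in>{x. w x \<le> 2 * l}. ennreal ((w x)\<^sup>2) \<partial>lborel)"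
      by (rule nn_integral_cmult) measurable
    finally show "ennreal (l powr (q - 3)) * (\<integral>\<^sup>+x\<in>{x. w x \<le> 2 * l}. ennreal ((w x)\<^sup>2) \<partial>lborel) * indicator {0<..} l = (\<integral>\<^sup>+x. ?F l x \<partial>lborel)"
      by (simp add: ac_simps)
  qed
  also have "\<dots> = (\<integral>\<^sup>+x. (\<integral>\<^sup>+l. ?F l x \<partial>lborel) \<partial>lborel)"
    by (rule lborel_pair.Fubini'[symmetric]) measurable
  also have "\<dots> = (\<integral>\<^sup>+x. ennreal (2 powr (2 - q) / (2 - q)) * ennreal (w x powr q) \<partial>lborel)"
  proof (rule nn_integral_cong)
    fix x
    show "(\<integral>\<^sup>+l. ?F l x \<partial>lborel) = ennreal (2 powr (2 - q) / (2 - q)) * ennreal (w x powr q)"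
    proof (cases "w x = 0")
      case False
      then have wx: "w x > 0" using w[of x] by simp
      have "(\<integral>\<^sup>+l. ?F l x \<partial>lborel) = (\<integral>\<^sup>+l. ennreal ((w x)\<^sup>2) * (ennreal (l powr (q - 3)) * indicator {w x / 2..} l) \<partial>lborel)"
        using wx by (intro nn_integral_cong) (auto simp: mult.commute split: split_indicator)
      also have "\<dots> = ennreal ((w x)\<^sup>2) * ennreal ((w x / 2) powr (q - 2) / (2 - q))"
        using nn_integral_powr_near_inf[of "q - 3" "w x / 2"] q wx
        by (subst nn_integral_cmult) (auto simp: minus_divide_right)
      also have "\<dots> = ennreal (2 powr (2 - q) / (2 - q)) * ennreal (w x powr q)"
      proof -
        have "(w x)\<^sup>2 * (w x powr (q - 2)) = w x powr q"
          using wx by (simp add: powr_numeral[symmetric] powr_add[symmetric] del: powr_numeral)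
        moreover have "(w x / 2) powr (q - 2) = 2 powr (2 - q) * w x powr (q - 2)"
          using wx powr_minus_divide[of 2 "q - 2"] by (simp add: powr_divide)
        ultimately have "(w x)\<^sup>2 * ((w x / 2) powr (q - 2) / (2 - q)) = 2 powr (2 - q) / (2 - q) * (w x powr q)"
          by (simp add: mult.left_commute)
        then show ?thesis using wx q by (simp add: ennreal_mult[symmetric])
      qed
      finally show ?thesis .
    qed simp
  qed
  also have "\<dots> = ennreal (2 powr (2 - q) / (2 - q)) * (\<integral>\<^sup>+x. ennreal (w x powr q) \<partial>lborel)"
    by (rule nn_integral_cmult) measurable
  finally show ?thesis .
qed

subsection \<open>The Hardy--Littlewood maximal function\<close>

text \<open>Rational end points make the supremum in \<open>hlmax\<close> countable, hence
  measurable.\<close>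

definition ivs :: "(real \<times> real) set" where "ivs = {(a, b). a \<in> \<rat> \<and> b \<in> \<rat> \<and> a < b}"

definition hlmax :: "(real \<Rightarrow> ennreal) \<Rightarrow> real \<Rightarrow> ennreal" where
  "hlmax w x = (SUP i\<in>ivs. indicator {fst i<..<snd i} x * ((\<integral>\<^sup>+y\<in>{fst i<..<snd i}. w y \<partial>lborel) / ennreal (snd i - fst i)))"

lemma countable_ivs: "countable ivs"
proof -
  have "ivs \<subseteq> \<rat> \<times> \<rat>" by (auto simp: ivs_def)
  then show ?thesis by (rule countable_subset) (intro countable_SIGMA countable_rat)
qed

lemma hlmax_measurable[measurable]: "hlmax w \<in> borel_measurable borel"
  unfolding hlmax_def by (intro borel_measurable_SUP countable_ivs) auto

text \<open>The closed interval of length 2s is enlarged to an open one with rational end points, of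
  length less than 4s; hence the divisor 4s.\<close>

lemma hlmax_ge:
  assumes s: "s > 0" and x: "x \<in> {t - s..t + s}"
  shows "(\<integral>\<^sup>+y\<in>{t - s..t + s}. w y \<partial>lborel) / ennreal (4 * s) \<le> hlmax w x"
proof -
  obtain a where a: "a \<in> \<rat>" "t - 2 * s < a" "a < t - s" using Rats_dense_in_real[of "t - 2 * s" "t - s"] s by auto
  obtain b where b: "b \<in> \<rat>" "t + s < b" "b < t + 2 * s" using Rats_dense_in_real[of "t + s" "t + 2 * s"] s by auto
  have ab: "(a, b) \<in> ivs" using a b s by (auto simp: ivs_def)
  have "(\<integral>\<^sup>+y\<in>{t - s..t + s}. w y \<partial>lborel) / ennreal (4 * s) \<le> (\<integral>\<^sup>+y\<in>{a<..<b}. w y \<partial>lborel) / ennreal (b - a)"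
  proof -
    have "b - a > 0" "b - a \<le> 4 * s" using a b s by auto
    then have "inverse (ennreal (4 * s)) \<le> inverse (ennreal (b - a))"
      using s le_imp_inverse_le[of "b - a" "4 * s"] by (simp add: inverse_ennreal ennreal_leI)
    then show ?thesis
      using a b s unfolding divide_ennreal_def
      by (intro mult_mono nn_integral_mono) (auto split: split_indicator)
  qed
  also have "\<dots> = indicator {fst (a, b)<..<snd (a, b)} x * ((\<integral>\<^sup>+y\<in>{fst (a, b)<..<snd (a, b)}. w y \<partial>lborel) / ennreal (snd (a, b) - fst (a, b)))"
    using x a b by simp
  also have "\<dots> \<le> hlmax w x"
    unfolding hlmax_def by (rule SUP_upper[OF ab])
  finally show ?thesis .
qed

text \<open>Vitali covering: the level set is covered by intervals of large mean, and the fivefold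
  enlargements of a disjoint subfamily still cover it.\<close>

lemma hlmax_weak_type:
  assumes [measurable]: "w \<in> borel_measurable borel" and fin: "(\<integral>\<^sup>+y. w y \<partial>lborel) < \<infinity>" and l: "l > 0"
  shows "emeasure lborel {x. ennreal l < hlmax w x} \<le> ennreal (5 / l) * (\<integral>\<^sup>+y. w y \<partial>lborel)"
proof -
  define J where "J i = {fst i<..<snd i}" for i :: "real \<times> real"
  \<comment> \<open>As a measure, the mass of w over a disjoint countable family is additive at
    once.\<close>
  define \<nu> where "\<nu> = density lborel w"
  have \<nu>: "emeasure \<nu> A = (\<integral>\<^sup>+y\<in>A. w y \<partial>lborel)" if "A \<in> sets borel" for A
    unfolding \<nu>_def using that by (intro emeasure_density) auto
  define K where "K = {i \<in> ivs. ennreal (l * (snd i - fst i)) < emeasure \<nu> (J i)}"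
  define c where "c i = (fst i + snd i) / 2" for i :: "real \<times> real"
  define r where "r i = (snd i - fst i) / 2" for i :: "real \<times> real"
  have Jball: "J i = ball (c i) (r i)" for i
    by (auto simp: J_def c_def r_def dist_real_def field_simps abs_if split: if_splits)
  have J[measurable]: "J i \<in> sets borel" for i by (simp add: J_def)
  obtain I where I: "(\<integral>\<^sup>+y. w y \<partial>lborel) = ennreal I" "I \<ge> 0"
    using fin by (cases "\<integral>\<^sup>+y. w y \<partial>lborel" rule: ennreal_cases) auto
  \<comment> \<open>A selected interval satisfies l * length < total mass, so the radii are bounded,
    as the covering lemma requires. This is where finiteness of the mass enters.\<close>
  have rb: "0 < r i \<and> r i \<le> I / l" if "i \<in> K" for i
  proof -
    have i: "fst i < snd i" using that by (auto simp: K_def ivs_def)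
    have "ennreal (l * (snd i - fst i)) < emeasure \<nu> (J i)" using that by (simp add: K_def)
    also have "\<dots> \<le> ennreal I" unfolding \<nu>[OF J] I(1)[symmetric] by (intro nn_integral_mono) (auto split: split_indicator)
    finally have "l * (snd i - fst i) < I" using i l by (simp add: ennreal_less_iff)
    then have "snd i - fst i \<le> I / l" using l by (simp add: field_simps)
    moreover have "r i \<le> snd i - fst i" "0 < r i" using i by (simp_all add: r_def)
    ultimately show ?thesis by linarith
  qed
  obtain C where C: "countable C" "C \<subseteq> K"
     and dis: "pairwise (\<lambda>i j. disjnt (ball (c i) (r i)) (ball (c j) (r j))) C"
     and cov: "(\<Union>i\<in>K. J i) \<subseteq> (\<Union>i\<in>C. ball (c i) (5 * r i))"
    by (rule Vitali_covering_lemma_balls[where S="\<Union>i\<in>K. J i" and K=K and a=c and r=r and B="I / l"]) (use rb in \<open>auto simp: Jball\<close>)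
  have "{x. ennreal l < hlmax w x} \<subseteq> (\<Union>i\<in>K. J i)"
  proof
    fix x assume "x \<in> {x. ennreal l < hlmax w x}"
    then obtain i where i: "i \<in> ivs" and lt: "ennreal l < indicator (J i) x * (emeasure \<nu> (J i) / ennreal (snd i - fst i))"
      by (auto simp: hlmax_def less_SUP_iff J_def \<nu>)
    have x: "x \<in> J i" using lt by (auto split: split_indicator_asm)
    have pos: "snd i - fst i > 0" using i by (auto simp: ivs_def)
    have "ennreal (l * (snd i - fst i)) = ennreal l * ennreal (snd i - fst i)" using pos l by (simp add: ennreal_mult)
    also have "\<dots> < (emeasure \<nu> (J i) / ennreal (snd i - fst i)) * ennreal (snd i - fst i)"
      using lt x pos by (intro ennreal_mult_strict_right_mono) auto
    also have "\<dots> = emeasure \<nu> (J i)" using pos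
      by (simp add: ennreal_divide_times ennreal_divide_self mult_divide_eq_ennreal)
    finally show "x \<in> (\<Union>i\<in>K. J i)" using x i by (intro UN_I[of i]) (auto simp: K_def)
  qed
  also note cov
  finally have sub: "{x. ennreal l < hlmax w x} \<subseteq> (\<Union>i\<in>C. ball (c i) (5 * r i))" .
  \<comment> \<open>The countable family is listed as a sequence of sets, with the empty set at
    every index that codes no member.\<close>
  define X where "X n = (if n \<in> to_nat_on C ` C then ball (c (from_nat_into C n)) (5 * r (from_nat_into C n)) else {})" for n
  define Y where "Y n = (if n \<in> to_nat_on C ` C then J (from_nat_into C n) else {})" for n
  have X: "X n \<in> sets borel" and Y: "Y n \<in> sets borel" for n
    by (auto simp: X_def Y_def)
  have fni: "from_nat_into C (to_nat_on C i) = i" if "i \<in> C" for i using C(1) that by (rule from_nat_into_to_nat_on)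
  have "(\<Union>i\<in>C. ball (c i) (5 * r i)) \<subseteq> (\<Union>n. X n)"
  proof
    fix x assume "x \<in> (\<Union>i\<in>C. ball (c i) (5 * r i))"
    then obtain i where i: "i \<in> C" "x \<in> ball (c i) (5 * r i)" by blast
    then have "x \<in> X (to_nat_on C i)" by (simp add: X_def fni)
    then show "x \<in> (\<Union>n. X n)" by blast
  qed
  with sub have "{x. ennreal l < hlmax w x} \<subseteq> (\<Union>n. X n)" by simp
  then have "emeasure lborel {x. ennreal l < hlmax w x} \<le> emeasure lborel (\<Union>n. X n)"
    by (rule emeasure_mono) (use X in auto)
  also have "\<dots> \<le> (\<Sum>n. emeasure lborel (X n))"
    by (rule emeasure_subadditive_countably) (use X in auto)
  also have "\<dots> \<le> (\<Sum>n. ennreal (5 / l) * emeasure \<nu> (Y n))"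
  proof (rule suminf_le)
    fix n
    show "emeasure lborel (X n) \<le> ennreal (5 / l) * emeasure \<nu> (Y n)"
    proof (cases "n \<in> to_nat_on C ` C")
      case True
      then obtain i where i: "i \<in> C" "n = to_nat_on C i" by blast
      then have iK: "i \<in> K" using C by blast
      have XY: "X n = ball (c i) (5 * r i)" "Y n = J i" using i by (auto simp: X_def Y_def fni)
      have "ball (c i) (5 * r i) = {c i - 5 * r i<..<c i + 5 * r i}"
        by (auto simp: dist_real_def)
      then have "emeasure lborel (X n) = ennreal (5 / l * (l * (snd i - fst i)))"
        using rb[OF iK] l by (simp add: XY r_def field_simps)
      also have "\<dots> = ennreal (5 / l) * ennreal (l * (snd i - fst i))"
        by (rule ennreal_mult) (use l rb[OF iK] in \<open>auto simp: r_def\<close>)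
      also have "\<dots> \<le> ennreal (5 / l) * emeasure \<nu> (Y n)"
        using iK by (intro mult_left_mono) (auto simp: K_def XY)
      finally show ?thesis .
    qed (simp add: X_def)
  qed auto
  also have "\<dots> = ennreal (5 / l) * (\<Sum>n. emeasure \<nu> (Y n))" by (rule ennreal_suminf_cmult)
  also have "(\<Sum>n. emeasure \<nu> (Y n)) = emeasure \<nu> (\<Union>n. Y n)"
  proof (rule suminf_emeasure)
    show "range Y \<subseteq> sets \<nu>" using Y by (auto simp: \<nu>_def)
    show "disjoint_family Y"
      unfolding disjoint_family_on_def
    proof (intro ballI impI)
      fix m n :: nat assume "m \<noteq> n"
      show "Y m \<inter> Y n = {}"
      proof (cases "m \<in> to_nat_on C ` C \<and> n \<in> to_nat_on C ` C")
        case True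
        then obtain i j where ij: "i \<in> C" "j \<in> C" "m = to_nat_on C i" "n = to_nat_on C j" by blast
        then have "i \<noteq> j" using \<open>m \<noteq> n\<close> by auto
        then have "disjnt (J i) (J j)" using dis ij unfolding pairwise_def Jball by blast
        then show ?thesis using ij by (simp add: Y_def fni disjnt_def)
      qed (auto simp: Y_def)
    qed
  qed
  also have "emeasure \<nu> (\<Union>n. Y n) \<le> (\<integral>\<^sup>+y. w y \<partial>lborel)"
    by (subst \<nu>) (use Y in \<open>auto intro!: nn_integral_mono split: split_indicator\<close>)
  finally show ?thesis by (simp add: mult_left_mono)
qed

lemma hlmax_bounded:
  assumes "\<And>x. w x \<le> ennreal B" "B \<ge> 0"
  shows "hlmax w x \<le> ennreal B"
  unfolding hlmax_def
proof (rule SUP_least)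
  fix i assume "i \<in> ivs"
  then have pos: "snd i - fst i > 0" by (auto simp: ivs_def)
  have "(\<integral>\<^sup>+y\<in>{fst i<..<snd i}. w y \<partial>lborel) \<le> (\<integral>\<^sup>+y. ennreal B * indicator {fst i<..<snd i} y \<partial>lborel)"
    by (intro nn_integral_mono mult_right_mono assms) auto
  also have "\<dots> = ennreal B * ennreal (snd i - fst i)"
    using pos by (subst nn_integral_cmult_indicator) auto
  finally have "(\<integral>\<^sup>+y\<in>{fst i<..<snd i}. w y \<partial>lborel) / ennreal (snd i - fst i) \<le> ennreal B * ennreal (snd i - fst i) / ennreal (snd i - fst i)"
    by (rule divide_right_mono_ennreal)
  also have "\<dots> = ennreal B" using pos by (simp add: mult_divide_eq_ennreal)
  finally show "indicator {fst i<..<snd i} x * ((\<integral>\<^sup>+y\<in>{fst i<..<snd i}. w y \<partial>lborel) / ennreal (snd i - fst i)) \<le> ennreal B"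
    by (auto split: split_indicator)
qed

text \<open>The part of w not exceeding c contributes at most c to any mean. With c half the level,
  only the large part of w is charged at each level.\<close>

lemma hlmax_split:
  assumes [measurable]: "w \<in> borel_measurable borel" and c: "c \<ge> 0"
  shows "hlmax w x \<le> hlmax (\<lambda>y. w y * indicator {y. ennreal c < w y} y) x + ennreal c"
  unfolding hlmax_def[of w]
proof (rule SUP_least)
  fix i assume i: "i \<in> ivs"
  let ?w = "\<lambda>y. w y * indicator {y. ennreal c < w y} y"
  let ?J = "{fst i<..<snd i}"
  have pos: "snd i - fst i > 0" using i by (auto simp: ivs_def)
  have "(\<integral>\<^sup>+y\<in>?J. w y \<partial>lborel) \<le> (\<integral>\<^sup>+y. ?w y * indicator ?J y + ennreal c * indicator ?J y \<partial>lborel)"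
    by (intro nn_integral_mono) (auto split: split_indicator)
  also have "\<dots> = (\<integral>\<^sup>+y. ?w y * indicator ?J y \<partial>lborel) + ennreal c * ennreal (snd i - fst i)"
    using pos by (subst nn_integral_add) (auto simp: nn_integral_cmult_indicator)
  finally have "(\<integral>\<^sup>+y\<in>?J. w y \<partial>lborel) / ennreal (snd i - fst i) \<le> ((\<integral>\<^sup>+y. ?w y * indicator ?J y \<partial>lborel) + ennreal c * ennreal (snd i - fst i)) / ennreal (snd i - fst i)"
    by (rule divide_right_mono_ennreal)
  also have "\<dots> = (\<integral>\<^sup>+y. ?w y * indicator ?J y \<partial>lborel) / ennreal (snd i - fst i) + ennreal c"
    using pos by (simp add: add_divide_distrib_ennreal mult_divide_eq_ennreal)
  finally have *: "(\<integral>\<^sup>+y\<in>?J. w y \<partial>lborel) / ennreal (snd i - fst i) \<le> (\<integral>\<^sup>+y. ?w y * indicator ?J y \<partial>lborel) / ennreal (snd i - fst i) + ennreal c" .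
  show "indicator ?J x * ((\<integral>\<^sup>+y\<in>?J. w y \<partial>lborel) / ennreal (snd i - fst i)) \<le> hlmax ?w x + ennreal c"
  proof (cases "x \<in> ?J")
    case True
    have "(\<integral>\<^sup>+y. ?w y * indicator ?J y \<partial>lborel) / ennreal (snd i - fst i) \<le> hlmax ?w x"
      unfolding hlmax_def[of ?w] by (rule SUP_upper2[OF i]) (use True in simp)
    then show ?thesis using True * by (auto intro: order_trans add_right_mono)
  qed simp
qed

text \<open>Marcinkiewicz interpolation: layer cake, \<open>hlmax_split\<close> at half the level,
  the weak type bound with 5/(l/2) = 10/l, and \<open>level_integral_above\<close>. Boundedness of w
  makes the maximal function finite, so \<open>enn2real\<close> loses nothing.\<close>

lemma hlmax_strong_type:
  fixes w :: "real \<Rightarrow> real"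
  assumes q: "q > 1" and [measurable]: "w \<in> borel_measurable borel" and w: "\<And>x. w x \<ge> 0" "\<And>x. w x \<le> B"
    and fin: "(\<integral>\<^sup>+y. ennreal (w y) \<partial>lborel) < \<infinity>"
  shows "(\<integral>\<^sup>+x. ennreal (enn2real (hlmax (\<lambda>y. ennreal (w y)) x) powr q) \<partial>lborel)
     \<le> ennreal (10 * q * 2 powr (q - 1) / (q - 1)) * (\<integral>\<^sup>+x. ennreal (w x powr q) \<partial>lborel)"
proof -
  let ?M = "hlmax (\<lambda>y. ennreal (w y))"
  define u where "u x = enn2real (?M x)" for x
  have [measurable]: "u \<in> borel_measurable borel" unfolding u_def by measurable
  have "B \<ge> 0" using w[of 0] by linarith
  then have "?M x \<le> ennreal B" for x by (intro hlmax_bounded ennreal_leI w)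
  then have Mu: "?M x = ennreal (u x)" for x
    unfolding u_def by (metis ennreal_enn2real_if ennreal_neq_top top.extremum_uniqueI)
  have "(\<integral>\<^sup>+x. ennreal (u x powr q) \<partial>lborel)
    = (\<integral>\<^sup>+l\<in>{0<..}. ennreal (q * l powr (q - 1)) * emeasure lborel {x. l < u x} \<partial>lborel)"
    by (rule layer_cake) (use q in \<open>auto simp: u_def\<close>)
  also have "\<dots> \<le> (\<integral>\<^sup>+l. ennreal (10 * q) * (ennreal (l powr (q - 2)) * (\<integral>\<^sup>+x\<in>{x. l / 2 < w x}. ennreal (w x) \<partial>lborel) * indicator {0<..} l) \<partial>lborel)"
  proof (rule nn_integral_mono)
    fix l :: real
    show "ennreal (q * l powr (q - 1)) * emeasure lborel {x. l < u x} * indicator {0<..} l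
      \<le> ennreal (10 * q) * (ennreal (l powr (q - 2)) * (\<integral>\<^sup>+x\<in>{x. l / 2 < w x}. ennreal (w x) \<partial>lborel) * indicator {0<..} l)"
    proof (cases "l > 0")
      case True
      let ?w = "\<lambda>y. ennreal (w y) * indicator {y. ennreal (l / 2) < ennreal (w y)} y"
      have eq: "(\<integral>\<^sup>+x\<in>{x. l / 2 < w x}. ennreal (w x) \<partial>lborel) = (\<integral>\<^sup>+y. ?w y \<partial>lborel)"
        using True by (intro nn_integral_cong) (auto simp: ennreal_less_iff split: split_indicator)
      have "{x. l < u x} \<subseteq> {x. ennreal (l / 2) < hlmax ?w x}"
      proof
        fix x assume "x \<in> {x. l < u x}"
        then have "ennreal l < ?M x" using True by (simp add: Mu ennreal_less_iff)
        also have "\<dots> \<le> hlmax ?w x + ennreal (l / 2)"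
          by (rule hlmax_split) (use True in auto)
        finally have "ennreal (l / 2) + ennreal (l / 2) < hlmax ?w x + ennreal (l / 2)"
          using True by (simp add: ennreal_plus[symmetric] del: ennreal_plus)
        then show "x \<in> {x. ennreal (l / 2) < hlmax ?w x}" by (metis (mono_tags) add_right_mono linorder_not_less mem_Collect_eq)
      qed
      then have "emeasure lborel {x. l < u x} \<le> emeasure lborel {x. ennreal (l / 2) < hlmax ?w x}"
        by (rule emeasure_mono) measurable
      also have "\<dots> \<le> ennreal (5 / (l / 2)) * (\<integral>\<^sup>+y. ?w y \<partial>lborel)"
      proof (rule hlmax_weak_type)
        have "(\<integral>\<^sup>+y. ?w y \<partial>lborel) \<le> (\<integral>\<^sup>+y. ennreal (w y) \<partial>lborel)"
          by (intro nn_integral_mono) (auto split: split_indicator)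
        with fin show "(\<integral>\<^sup>+y. ?w y \<partial>lborel) < \<infinity>" by (rule order_le_less_trans[rotated])
      qed (use True in auto)
      finally have "ennreal (q * l powr (q - 1)) * emeasure lborel {x. l < u x}
         \<le> ennreal (q * l powr (q - 1)) * (ennreal (5 / (l / 2)) * (\<integral>\<^sup>+y. ?w y \<partial>lborel))"
        by (rule mult_left_mono) simp
      also have "\<dots> = ennreal (q * l powr (q - 1) * (10 / l)) * (\<integral>\<^sup>+y. ?w y \<partial>lborel)"
        using True q by (simp add: mult.assoc[symmetric] ennreal_mult[symmetric])
      also have "q * l powr (q - 1) * (10 / l) = 10 * q * l powr (q - 2)"
        using True powr_diff[of l "q - 1" 1] by simp
      also have "ennreal (10 * q * l powr (q - 2)) = ennreal (10 * q) * ennreal (l powr (q - 2))"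
        using q by (intro ennreal_mult) auto
      finally show ?thesis using True unfolding eq by (simp add: mult.assoc)
    qed simp
  qed
  also have "\<dots> = ennreal (10 * q) * (\<integral>\<^sup>+l\<in>{0<..}. ennreal (l powr (q - 2)) * (\<integral>\<^sup>+x\<in>{x. l / 2 < w x}. ennreal (w x) \<partial>lborel) \<partial>lborel)"
    by (rule nn_integral_cmult) measurable
  also have "\<dots> = ennreal (10 * q) * (ennreal (2 powr (q - 1) / (q - 1)) * (\<integral>\<^sup>+x. ennreal (w x powr q) \<partial>lborel))"
    by (subst level_integral_above) (use q w in auto)
  also have "\<dots> = ennreal (10 * q * 2 powr (q - 1) / (q - 1)) * (\<integral>\<^sup>+x. ennreal (w x powr q) \<partial>lborel)"
    using q by (simp add: mult.assoc[symmetric] ennreal_mult[symmetric])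
  finally show ?thesis by (simp add: u_def)
qed


subsection \<open>The weighted inequality and the case p > 2\<close>

lemma ennreal_layer:
  "(x::ennreal) = (\<integral>\<^sup>+l. indicator {0<..} l * indicator {l. ennreal l < x} l \<partial>lborel)"
proof (cases x rule: ennreal_cases)
  case (real r)
  have "(\<integral>\<^sup>+l. indicator {0<..} l * indicator {l. ennreal l < x} l \<partial>lborel) = (\<integral>\<^sup>+l. indicator {0<..<r} l \<partial>lborel)"
    using real by (intro nn_integral_cong) (auto simp: ennreal_less_iff split: split_indicator)
  also have "\<dots> = ennreal r" using real by (simp add: nn_integral_indicator)
  finally show ?thesis using real by simp
next
  case top
  have "(\<integral>\<^sup>+l. indicator {0<..} l * indicator {l. ennreal l < x} l \<partial>lborel) = (\<integral>\<^sup>+l. indicator {0<..} (l::real) \<partial>lborel)"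
    using top by (intro nn_integral_cong) (auto split: split_indicator)
  also have "\<dots> = emeasure lborel {0::real<..}" by (simp add: nn_integral_indicator)
  also have "\<dots> = top"
  proof (rule ccontr)
    assume "emeasure lborel {0::real<..} \<noteq> top"
    then obtain r where r: "emeasure lborel {0::real<..} = ennreal r" "r \<ge> 0"
      by (cases "emeasure lborel {0::real<..}" rule: ennreal_cases) auto
    have "emeasure lborel {0<..<r + 1} \<le> emeasure lborel {0::real<..}"
      by (rule emeasure_mono) auto
    then show False using r by (simp add: ennreal_le_iff)
  qed
  finally show ?thesis using top by simp
qed

text \<open>Where \<open>m s t\<close> exceeds a level \<open>l\<close>, the transform at \<open>(s, t)\<close> only sees points with \<open>l < M x\<close>,
  so at each level the \<open>L\<^sup>2\<close> bound applies to \<open>f\<close> cut off to that set.\<close>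

lemma (in wavelet) sqf_layered:
  assumes f: "integrable lborel f"
    and m[measurable]: "(\<lambda>w. m (fst w) (snd w)) \<in> borel_measurable lborel2"
    and M[measurable]: "M \<in> borel_measurable borel"
    and mM: "\<And>s t x. s > 0 \<Longrightarrow> x \<in> {t - s..t + s} \<Longrightarrow> m s t \<le> M x"
  shows "(\<integral>\<^sup>+t. (\<integral>\<^sup>+s\<in>{0<..}. (m s t * ennreal ((cwt \<eta> f s t)\<^sup>2 / s)) \<partial>lborel) \<partial>lborel)
    \<le> ennreal (16 * bd\<^sup>2) * (\<integral>\<^sup>+x. ennreal ((f x)\<^sup>2) * M x \<partial>lborel)"
proof -
  have [measurable]: "f \<in> borel_measurable borel" using borel_measurable_integrable[OF f] by simp
  have [measurable]: "(\<lambda>w. m (S w) (T w)) \<in> borel_measurable N" if [measurable]: "S \<in> borel_measurable N" "T \<in> borel_measurable N"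
    for S T :: "'c \<Rightarrow> real" and N
    using measurable_compose[OF _ m, of "\<lambda>w. (S w, T w)" N] by simp
  define e where "e l s t = indicator {0<..} l * (indicator {w. ennreal l < m (fst w) (snd w)} (s, t) * (ennreal ((cwt \<eta> f s t)\<^sup>2 / s) * indicator {0<..} s))" for l s t :: real
  have [measurable]: "(\<lambda>w. e (L w) (S w) (T w)) \<in> borel_measurable N"
    if [measurable]: "L \<in> borel_measurable N" "S \<in> borel_measurable N" "T \<in> borel_measurable N"
    for L S T :: "'c \<Rightarrow> real" and N
    unfolding e_def indicator_def of_bool_def mem_Collect_eq fst_conv snd_conv by measurable
  have "(\<integral>\<^sup>+t. (\<integral>\<^sup>+s\<in>{0<..}. (m s t * ennreal ((cwt \<eta> f s t)\<^sup>2 / s)) \<partial>lborel) \<partial>lborel)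
    = (\<integral>\<^sup>+t. \<integral>\<^sup>+s. \<integral>\<^sup>+l. e l s t \<partial>lborel \<partial>lborel \<partial>lborel)"
  proof (intro nn_integral_cong)
    fix t s :: real
    have "(\<integral>\<^sup>+l. e l s t \<partial>lborel) = (\<integral>\<^sup>+l. (indicator {0<..} l * indicator {l. ennreal l < m s t} l) * (ennreal ((cwt \<eta> f s t)\<^sup>2 / s) * indicator {0<..} s) \<partial>lborel)"
      by (intro nn_integral_cong) (auto simp: e_def split: split_indicator)
    also have "\<dots> = (\<integral>\<^sup>+l. (indicator {0<..} l * indicator {l. ennreal l < m s t} l) \<partial>lborel) * (ennreal ((cwt \<eta> f s t)\<^sup>2 / s) * indicator {0<..} s)"
      by (rule nn_integral_multc) measurable
    finally show "m s t * ennreal ((cwt \<eta> f s t)\<^sup>2 / s) * indicator {0<..} s = (\<integral>\<^sup>+l. e l s t \<partial>lborel)"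
      by (simp add: ennreal_layer[symmetric] mult.assoc)
  qed
  also have "\<dots> = (\<integral>\<^sup>+t. \<integral>\<^sup>+l. \<integral>\<^sup>+s. e l s t \<partial>lborel \<partial>lborel \<partial>lborel)"
    by (intro nn_integral_cong lborel_pair.Fubini') measurable
  also have "\<dots> = (\<integral>\<^sup>+l. \<integral>\<^sup>+t. \<integral>\<^sup>+s. e l s t \<partial>lborel \<partial>lborel \<partial>lborel)"
    by (rule lborel_pair.Fubini') measurable
  also have "\<dots> \<le> (\<integral>\<^sup>+l. ennreal (16 * bd\<^sup>2) * (indicator {0<..} l * (\<integral>\<^sup>+x. ennreal ((f x)\<^sup>2) * indicator {x. ennreal l < M x} x \<partial>lborel)) \<partial>lborel)"
  proof (rule nn_integral_mono)
    fix l :: real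
    define h where "h x = f x * indicator {x. ennreal l < M x} x" for x
    have h: "integrable lborel h"
      unfolding h_def by (rule Bochner_Integration.integrable_bound[OF f]) (auto split: split_indicator)
    show "(\<integral>\<^sup>+t. \<integral>\<^sup>+s. e l s t \<partial>lborel \<partial>lborel)
      \<le> ennreal (16 * bd\<^sup>2) * (indicator {0<..} l * (\<integral>\<^sup>+x. ennreal ((f x)\<^sup>2) * indicator {x. ennreal l < M x} x \<partial>lborel))"
    proof (cases "l > 0")
      case True
      have "(\<integral>\<^sup>+t. \<integral>\<^sup>+s. e l s t \<partial>lborel \<partial>lborel) \<le> (\<integral>\<^sup>+t. sqf \<eta> h {0<..} t \<partial>lborel)"
        unfolding sqf_def
      proof (intro nn_integral_mono)
        fix t s :: real
        show "e l s t \<le> ennreal ((cwt \<eta> h s t)\<^sup>2 / s) * indicator {0<..} s"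
        proof (cases "s > 0 \<and> ennreal l < m s t")
          case True
          have "cwt \<eta> f s t = cwt \<eta> h s t"
          proof (rule cwt_cong)
            fix x assume "x \<in> {t - s..t + s}"
            with mM[of s x t] True have "ennreal l < M x" by auto
            then show "f x = h x" by (simp add: h_def)
          qed (use True in simp)
          then show ?thesis by (simp add: e_def split: split_indicator)
        qed (auto simp: e_def split: split_indicator)
      qed
      also have "\<dots> \<le> ennreal (16 * bd\<^sup>2) * (\<integral>\<^sup>+x. ennreal ((h x)\<^sup>2) \<partial>lborel)"
        by (rule sqf_L2[OF h])
      also have "(\<integral>\<^sup>+x. ennreal ((h x)\<^sup>2) \<partial>lborel) = (\<integral>\<^sup>+x. ennreal ((f x)\<^sup>2) * indicator {x. ennreal l < M x} x \<partial>lborel)"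
        by (intro nn_integral_cong) (auto simp: h_def split: split_indicator)
      finally show ?thesis using True by simp
    qed (simp add: e_def)
  qed
  also have "\<dots> = ennreal (16 * bd\<^sup>2) * (\<integral>\<^sup>+l. indicator {0<..} l * (\<integral>\<^sup>+x. ennreal ((f x)\<^sup>2) * indicator {x. ennreal l < M x} x \<partial>lborel) \<partial>lborel)"
    by (rule nn_integral_cmult) measurable
  also have "(\<integral>\<^sup>+l. indicator {0<..} l * (\<integral>\<^sup>+x. ennreal ((f x)\<^sup>2) * indicator {x. ennreal l < M x} x \<partial>lborel) \<partial>lborel)
    = (\<integral>\<^sup>+l. (\<integral>\<^sup>+x. indicator {0<..} l * (ennreal ((f x)\<^sup>2) * indicator {x. ennreal l < M x} x) \<partial>lborel) \<partial>lborel)"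
    by (intro nn_integral_cong nn_integral_cmult[symmetric]) measurable
  also have "\<dots> = (\<integral>\<^sup>+x. (\<integral>\<^sup>+l. indicator {0<..} l * (ennreal ((f x)\<^sup>2) * indicator {x. ennreal l < M x} x) \<partial>lborel) \<partial>lborel)"
    by (rule lborel_pair.Fubini'[symmetric]) measurable
  also have "\<dots> = (\<integral>\<^sup>+x. ennreal ((f x)\<^sup>2) * M x \<partial>lborel)"
  proof (rule nn_integral_cong)
    fix x
    have "(\<integral>\<^sup>+l. indicator {0<..} l * (ennreal ((f x)\<^sup>2) * indicator {x. ennreal l < M x} x) \<partial>lborel)
      = (\<integral>\<^sup>+l. ennreal ((f x)\<^sup>2) * (indicator {0<..} l * indicator {l. ennreal l < M x} l) \<partial>lborel)"
      by (intro nn_integral_cong) (auto split: split_indicator)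
    also have "\<dots> = ennreal ((f x)\<^sup>2) * (\<integral>\<^sup>+l. indicator {0<..} l * indicator {l. ennreal l < M x} l \<partial>lborel)"
      by (rule nn_integral_cmult) measurable
    finally show "(\<integral>\<^sup>+l. indicator {0<..} l * (ennreal ((f x)\<^sup>2) * indicator {x. ennreal l < M x} x) \<partial>lborel) = ennreal ((f x)\<^sup>2) * M x"
      by (simp add: ennreal_layer[symmetric])
  qed
  finally show ?thesis .
qed

text \<open>The derivative is required to be a wavelet too, since point values of the transform are
  compared with local means that involve the transform by \<eta>', and both then need the L^2
  bound.\<close>

locale smooth_wavelet = wavelet \<eta> + D: wavelet \<eta>' for \<eta> \<eta>' +
  assumes deriv: "\<And>x. (\<eta> has_real_derivative \<eta>' x) (at x)"
begin

text \<open>The t-derivative of the transform by \<eta> is -1/s times the transform by \<eta>'. The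
  fundamental theorem is applied to the kernel and the integrals are exchanged, so that f need only
  be integrable.\<close>

lemma cwt_diff:
  assumes f: "integrable lborel f" and s: "s > 0" and tt: "t \<le> t'"
  shows "cwt \<eta> f s t - cwt \<eta> f s t' = (1 / s) * (LINT \<tau>|lborel. indicator {t..t'} \<tau> * cwt \<eta>' f s \<tau>)"
proof -
  note [measurable] = borel_measurable_integrable[OF f]
  have ftc: "\<eta> ((x - t) / s) - \<eta> ((x - t') / s) = (LINT \<tau>|lborel. indicator {t..t'} \<tau> *\<^sub>R (\<eta>' ((x - \<tau>) / s) / s))" for x
  proof -
    have "(LINT \<tau>|lborel. indicator {t..t'} \<tau> *\<^sub>R (\<eta>' ((x - \<tau>) / s) / s)) = (- \<eta> ((x - t') / s)) - (- \<eta> ((x - t) / s))"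
    proof (rule integral_FTC_atLeastAtMost[OF tt])
      fix \<tau>
      have "((\<lambda>\<tau>. - \<eta> ((x - \<tau>) / s)) has_real_derivative (\<eta>' ((x - \<tau>) / s) / s)) (at \<tau> within {t..t'})"
        by (rule DERIV_cong[OF DERIV_minus[OF DERIV_chain'[OF _ deriv]]])
           (use s in \<open>auto intro!: derivative_eq_intros simp: field_simps\<close>)
      then show "((\<lambda>\<tau>. - \<eta> ((x - \<tau>) / s)) has_vector_derivative (\<eta>' ((x - \<tau>) / s) / s)) (at \<tau> within {t..t'})"
        by (simp add: has_real_derivative_iff_has_vector_derivative)
    next
      show "continuous_on {t..t'} (\<lambda>\<tau>. \<eta>' ((x - \<tau>) / s) / s)"
        using s by (intro continuous_intros continuous_on_compose2[OF D.cont]) auto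
    qed
    then show ?thesis by simp
  qed
  have int: "integrable lborel2 (\<lambda>(x, \<tau>). f x * (indicator {t..t'} \<tau> * \<eta>' ((x - \<tau>) / s)))"
  proof (rule Bochner_Integration.integrable_bound)
    show "integrable lborel2 (\<lambda>z. f (fst z) * (D.bd * indicator {t..t'} (snd z)))"
      by (rule integrable_lborel2_prod[OF f integrable_const_indicator_Icc])
    show "AE z in lborel2. norm (case z of (x, \<tau>) \<Rightarrow> f x * (indicator {t..t'} \<tau> * \<eta>' ((x - \<tau>) / s)))
      \<le> norm (f (fst z) * (D.bd * indicator {t..t'} (snd z)))"
      using D.bd D.bd_pos by (intro AE_I2) (auto simp: abs_mult split: split_indicator intro!: mult_left_mono)
  qed measurable
  have "s * (cwt \<eta> f s t - cwt \<eta> f s t') = (LINT x|lborel. f x * \<eta> ((x - t) / s)) - (LINT x|lborel. f x * \<eta> ((x - t') / s))"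
    using s by (simp add: cwt_def field_simps)
  also have "\<dots> = (LINT x|lborel. f x * (\<eta> ((x - t) / s) - \<eta> ((x - t') / s)))"
    using cwt_integrand_integrable[OF f] by (simp add: right_diff_distrib)
  also have "\<dots> = (LINT x|lborel. (1 / s) * (LINT \<tau>|lborel. f x * (indicator {t..t'} \<tau> * \<eta>' ((x - \<tau>) / s))))"
    unfolding ftc by (simp add: mult.commute)
  also have "\<dots> = (1 / s) * (LINT x|lborel. (LINT \<tau>|lborel. f x * (indicator {t..t'} \<tau> * \<eta>' ((x - \<tau>) / s))))"
    by (rule integral_mult_right_zero)
  also have "(LINT x|lborel. (LINT \<tau>|lborel. f x * (indicator {t..t'} \<tau> * \<eta>' ((x - \<tau>) / s))))
    = (LINT \<tau>|lborel. (LINT x|lborel. f x * (indicator {t..t'} \<tau> * \<eta>' ((x - \<tau>) / s))))"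
    by (rule lborel_pair.Fubini_integral[OF int, symmetric])
  also have "\<dots> = (LINT \<tau>|lborel. s * (indicator {t..t'} \<tau> * cwt \<eta>' f s \<tau>))"
    using s by (intro Bochner_Integration.integral_cong) (auto simp: cwt_def split: split_indicator)
  finally show ?thesis using s by (simp add: field_simps)
qed

text \<open>A Sobolev inequality at scale s: the value at t differs from the value at t' by at most
  1/s times the integral of the transform by \<eta>' over the ball, and t' is averaged over it. It
  spreads a point evaluation over the ball, so that a weight at t can later be replaced by its
  mean.\<close>

lemma cwt_local_energy:
  assumes f: "integrable lborel f" and s: "s > 0"
  shows "ennreal ((cwt \<eta> f s t)\<^sup>2) \<le> ennreal (4 / s) *
    (\<integral>\<^sup>+t'\<in>{t - s..t + s}. (ennreal ((cwt \<eta> f s t')\<^sup>2) + ennreal ((cwt \<eta>' f s t')\<^sup>2)) \<partial>lborel)"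
proof -
  have [measurable]: "f \<in> borel_measurable borel" using borel_measurable_integrable[OF f] by simp
  let ?J = "{t - s..t + s}"
  define Y where "Y = (\<integral>\<^sup>+\<tau>\<in>?J. ennreal \<bar>cwt \<eta>' f s \<tau>\<bar> \<partial>lborel)"
  define E where "E = (\<integral>\<^sup>+\<tau>\<in>?J. ennreal ((cwt \<eta>' f s \<tau>)\<^sup>2) \<partial>lborel)"
  define V where "V = (\<integral>\<^sup>+\<tau>\<in>?J. ennreal ((cwt \<eta> f s \<tau>)\<^sup>2) \<partial>lborel)"
  have J: "emeasure lborel ?J = ennreal (2 * s)" using s by simp
  have "Y\<^sup>2 = (\<integral>\<^sup>+\<tau>. (ennreal \<bar>cwt \<eta>' f s \<tau>\<bar> * indicator ?J \<tau>) * indicator ?J \<tau> \<partial>lborel)\<^sup>2"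
    unfolding Y_def by (intro arg_cong[where f="\<lambda>x. x\<^sup>2"] nn_integral_cong) (auto split: split_indicator)
  also have "\<dots> \<le> (\<integral>\<^sup>+\<tau>. (ennreal \<bar>cwt \<eta>' f s \<tau>\<bar> * indicator ?J \<tau>)\<^sup>2 \<partial>lborel) * (\<integral>\<^sup>+\<tau>. (indicator ?J \<tau>)\<^sup>2 \<partial>lborel)"
    by (rule Cauchy_Schwarz_nn_integral) measurable
  also have "(\<integral>\<^sup>+\<tau>. (ennreal \<bar>cwt \<eta>' f s \<tau>\<bar> * indicator ?J \<tau>)\<^sup>2 \<partial>lborel) = E"
    unfolding E_def by (intro nn_integral_cong) (auto simp: ennreal_power split: split_indicator)
  also have "(\<integral>\<^sup>+\<tau>. (indicator ?J \<tau> :: ennreal)\<^sup>2 \<partial>lborel) = (\<integral>\<^sup>+\<tau>. indicator ?J \<tau> \<partial>lborel)"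
    by (intro nn_integral_cong) (auto split: split_indicator)
  also have "\<dots> = ennreal (2 * s)" using J by (subst nn_integral_indicator) auto
  finally have Y2: "Y\<^sup>2 \<le> E * ennreal (2 * s)" .
  have osc: "ennreal \<bar>cwt \<eta> f s t - cwt \<eta> f s t'\<bar> \<le> ennreal (1 / s) * Y" if "t' \<in> ?J" for t'
  proof -
    have *: "ennreal \<bar>cwt \<eta> f s a - cwt \<eta> f s b\<bar> \<le> ennreal (1 / s) * Y" if ab: "a \<le> b" "a \<in> ?J" "b \<in> ?J" for a b
    proof -
      have i: "integrable lborel (\<lambda>\<tau>. indicator {a..b} \<tau> * cwt \<eta>' f s \<tau>)"
      proof -
        define K where "K = D.bd / s * (LINT x|lborel. \<bar>f x\<bar>)"
        have "\<bar>cwt \<eta>' f s \<tau>\<bar> \<le> \<bar>K\<bar>" for \<tau>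
          using D.cwt_bound[OF f s, of \<tau>] unfolding K_def by linarith
        then show ?thesis
          by (intro Bochner_Integration.integrable_bound[OF integrable_const_indicator_Icc[of K a b]])
             (auto split: split_indicator)
      qed
      have "ennreal \<bar>cwt \<eta> f s a - cwt \<eta> f s b\<bar> = ennreal (1 / s) * ennreal \<bar>LINT \<tau>|lborel. indicator {a..b} \<tau> * cwt \<eta>' f s \<tau>\<bar>"
        using s by (simp add: cwt_diff[OF f s ab(1)] abs_mult ennreal_mult[symmetric])
      also have "\<dots> \<le> ennreal (1 / s) * (\<integral>\<^sup>+\<tau>. ennreal (norm (indicator {a..b} \<tau> * cwt \<eta>' f s \<tau>)) \<partial>lborel)"
        using integral_norm_bound_ennreal[OF i] by (intro mult_left_mono) auto
      also have "\<dots> \<le> ennreal (1 / s) * Y"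
        unfolding Y_def using ab by (intro mult_left_mono nn_integral_mono) (auto split: split_indicator)
      finally show ?thesis .
    qed
    show ?thesis
      using *[of t t'] *[of t' t] that s by (cases "t \<le> t'") (auto simp: abs_minus_commute)
  qed
  have pt: "ennreal ((cwt \<eta> f s t)\<^sup>2) \<le> 2 * ennreal ((cwt \<eta> f s t')\<^sup>2) + ennreal (2 / s\<^sup>2) * Y\<^sup>2" if "t' \<in> ?J" for t'
  proof -
    have "(cwt \<eta> f s t)\<^sup>2 \<le> 2 * (cwt \<eta> f s t')\<^sup>2 + 2 * \<bar>cwt \<eta> f s t - cwt \<eta> f s t'\<bar>\<^sup>2"
      using sum_squares_bound[of "cwt \<eta> f s t'" "cwt \<eta> f s t - cwt \<eta> f s t'"] zero_le_power2[of "cwt \<eta> f s t - 2 * cwt \<eta> f s t'"]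
      by (simp add: power2_eq_square algebra_simps)
    then have "ennreal ((cwt \<eta> f s t)\<^sup>2) \<le> ennreal (2 * (cwt \<eta> f s t')\<^sup>2) + ennreal (2 * \<bar>cwt \<eta> f s t - cwt \<eta> f s t'\<bar>\<^sup>2)"
      by (rule ennreal_le_add) auto
    also have "ennreal (2 * \<bar>cwt \<eta> f s t - cwt \<eta> f s t'\<bar>\<^sup>2) = 2 * (ennreal \<bar>cwt \<eta> f s t - cwt \<eta> f s t'\<bar>)\<^sup>2"
      by (simp add: ennreal_mult ennreal_power)
    also have "\<dots> \<le> 2 * (ennreal (1 / s) * Y)\<^sup>2"
      by (intro mult_left_mono power_mono osc that) auto
    also have "\<dots> = ennreal (2 / s\<^sup>2) * Y\<^sup>2"
      using s ennreal_mult[of 2 "1 / s\<^sup>2"] by (simp add: power_mult_distrib ennreal_power power_divide mult.assoc)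
    finally show ?thesis by (simp add: ennreal_mult add_left_mono)
  qed
  have "ennreal (2 * s) * ennreal ((cwt \<eta> f s t)\<^sup>2) = (\<integral>\<^sup>+t'. ennreal ((cwt \<eta> f s t)\<^sup>2) * indicator ?J t' \<partial>lborel)"
    using J by (subst nn_integral_cmult_indicator) (auto simp: mult.commute)
  also have "\<dots> \<le> (\<integral>\<^sup>+t'. 2 * (ennreal ((cwt \<eta> f s t')\<^sup>2) * indicator ?J t') + (ennreal (2 / s\<^sup>2) * Y\<^sup>2) * indicator ?J t' \<partial>lborel)"
    using pt by (intro nn_integral_mono) (auto split: split_indicator)
  also have "\<dots> = 2 * V + (ennreal (2 / s\<^sup>2) * Y\<^sup>2) * ennreal (2 * s)"
    unfolding V_def using J by (subst nn_integral_add) (auto simp: nn_integral_cmult nn_integral_cmult_indicator)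
  also have "\<dots> \<le> 2 * V + (ennreal (2 / s\<^sup>2) * (E * ennreal (2 * s))) * ennreal (2 * s)"
    by (intro add_mono mult_right_mono mult_left_mono Y2) auto
  also have "\<dots> = 2 * V + 8 * E"
  proof -
    have "(ennreal (2 / s\<^sup>2) * (E * ennreal (2 * s))) * ennreal (2 * s) = E * (ennreal (2 / s\<^sup>2) * ennreal (2 * s) * ennreal (2 * s))"
      by (simp add: ac_simps)
    also have "ennreal (2 / s\<^sup>2) * ennreal (2 * s) * ennreal (2 * s) = ennreal (2 / s\<^sup>2 * (2 * s) * (2 * s))"
      using s by (simp add: ennreal_mult[symmetric])
    also have "2 / s\<^sup>2 * (2 * s) * (2 * s) = 8" using s by (simp add: power2_eq_square)
    finally show ?thesis by (simp add: mult.commute)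
  qed
  \<comment> \<open>Dividing by 2s below turns this into the factor 4/s.\<close>
  also have "\<dots> \<le> 8 * (V + E)"
    by (auto simp: distrib_left intro!: add_right_mono mult_right_mono)
  finally have "ennreal (2 * s) * ennreal ((cwt \<eta> f s t)\<^sup>2) \<le> 8 * (V + E)" .
  then have "ennreal (1 / (2 * s)) * (ennreal (2 * s) * ennreal ((cwt \<eta> f s t)\<^sup>2)) \<le> ennreal (1 / (2 * s)) * (8 * (V + E))"
    by (rule mult_left_mono) simp
  also have "ennreal (1 / (2 * s)) * (8 * (V + E)) = ennreal (4 / s) * (V + E)"
  proof -
    have "ennreal (1 / (2 * s)) * 8 = ennreal (4 / s)"
      using s ennreal_mult[of "1 / (2 * s)" 8] by simp
    then show ?thesis by (metis mult.assoc)
  qed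
  also have "ennreal (1 / (2 * s)) * (ennreal (2 * s) * ennreal ((cwt \<eta> f s t)\<^sup>2)) = ennreal ((cwt \<eta> f s t)\<^sup>2)"
    using s by (simp add: ennreal_mult[symmetric])
  also have "V + E = (\<integral>\<^sup>+t'\<in>?J. (ennreal ((cwt \<eta> f s t')\<^sup>2) + ennreal ((cwt \<eta>' f s t')\<^sup>2)) \<partial>lborel)"
    unfolding V_def E_def distrib_right by (rule nn_integral_add[symmetric]) measurable
  finally show ?thesis .
qed

text \<open>After \<open>cwt_local_energy\<close>, the integral over t hits only w and produces its
  mean over a ball, which is dominated by \<open>hlmax w\<close> on that ball;
  \<open>sqf_layered\<close> then applies to \<eta> and to \<eta>'. The constant is 16 * 16: 4/s^2
  times 4s gives 16/s, and the L^2 bound gives the other 16.\<close>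

lemma sqf_weighted:
  assumes f: "integrable lborel f" and w[measurable]: "w \<in> borel_measurable borel"
  shows "(\<integral>\<^sup>+t. w t * sqf \<eta> f {0<..} t \<partial>lborel)
    \<le> ennreal (256 * (bd\<^sup>2 + D.bd\<^sup>2)) * (\<integral>\<^sup>+x. ennreal ((f x)\<^sup>2) * hlmax w x \<partial>lborel)"
proof -
  have [measurable]: "f \<in> borel_measurable borel" using borel_measurable_integrable[OF f] by simp
  \<comment> \<open>Normalised by 4s instead of the length 2s, to fit
    \<open>hlmax_ge\<close>.\<close>
  define m where "m s t = (\<integral>\<^sup>+y\<in>{t - s..t + s}. w y \<partial>lborel) / ennreal (4 * s)" for s t
  have m_eq: "m s t = (\<integral>\<^sup>+y. w y * (if t - s \<le> y \<and> y \<le> t + s then 1 else 0) \<partial>lborel) / ennreal (4 * s)" for s t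
    unfolding m_def by (intro arg_cong2[where f="(/)"] nn_integral_cong) (auto split: split_indicator)
  have mm[measurable]: "(\<lambda>w. m (fst w) (snd w)) \<in> borel_measurable lborel2"
    unfolding m_eq by measurable
  have mm2[measurable]: "(\<lambda>w. m (S w) (T w)) \<in> borel_measurable N" if [measurable]: "S \<in> borel_measurable N" "T \<in> borel_measurable N"
    for S T :: "'c \<Rightarrow> real" and N
    using measurable_compose[OF _ mm, of "\<lambda>w. (S w, T w)" N] by simp
  let ?V = "\<lambda>s t. ennreal ((cwt \<eta> f s t)\<^sup>2)" and ?V' = "\<lambda>s t. ennreal ((cwt \<eta>' f s t)\<^sup>2)"
  let ?I = "\<lambda>s t t'. if t - s \<le> t' \<and> t' \<le> t + s then 1 else 0 :: ennreal"
  have "(\<integral>\<^sup>+t. w t * sqf \<eta> f {0<..} t \<partial>lborel) = (\<integral>\<^sup>+t. \<integral>\<^sup>+s. w t * (ennreal ((cwt \<eta> f s t)\<^sup>2 / s) * indicator {0<..} s) \<partial>lborel \<partial>lborel)"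
    unfolding sqf_def by (intro nn_integral_cong nn_integral_cmult[symmetric]) measurable
  also have "\<dots> \<le> (\<integral>\<^sup>+t. \<integral>\<^sup>+s. \<integral>\<^sup>+t'. (w t * ?I s t t') * ((ennreal (4 / s\<^sup>2) * indicator {0<..} s) * (?V s t' + ?V' s t')) \<partial>lborel \<partial>lborel \<partial>lborel)"
  proof (intro nn_integral_mono)
    fix t s :: real
    show "w t * (ennreal ((cwt \<eta> f s t)\<^sup>2 / s) * indicator {0<..} s)
      \<le> (\<integral>\<^sup>+t'. (w t * ?I s t t') * ((ennreal (4 / s\<^sup>2) * indicator {0<..} s) * (?V s t' + ?V' s t')) \<partial>lborel)"
    proof (cases "s > 0")
      case True
      have "ennreal ((cwt \<eta> f s t)\<^sup>2 / s) = ennreal (1 / s) * ?V s t"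
        using True by (simp add: ennreal_mult[symmetric])
      also have "\<dots> \<le> ennreal (1 / s) * (ennreal (4 / s) * (\<integral>\<^sup>+t'\<in>{t - s..t + s}. (?V s t' + ?V' s t') \<partial>lborel))"
        by (intro mult_left_mono cwt_local_energy[OF f True]) auto
      also have "\<dots> = ennreal (4 / s\<^sup>2) * (\<integral>\<^sup>+t'\<in>{t - s..t + s}. (?V s t' + ?V' s t') \<partial>lborel)"
        using True by (simp add: ennreal_mult[symmetric] mult.assoc[symmetric] power2_eq_square)
      finally have "w t * ennreal ((cwt \<eta> f s t)\<^sup>2 / s) \<le> w t * (ennreal (4 / s\<^sup>2) * (\<integral>\<^sup>+t'\<in>{t - s..t + s}. (?V s t' + ?V' s t') \<partial>lborel))"
        by (rule mult_left_mono) simp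
      also have "\<dots> = (w t * ennreal (4 / s\<^sup>2)) * (\<integral>\<^sup>+t'\<in>{t - s..t + s}. (?V s t' + ?V' s t') \<partial>lborel)"
        by (simp add: mult.assoc)
      also have "\<dots> = (\<integral>\<^sup>+t'. (w t * ennreal (4 / s\<^sup>2)) * ((?V s t' + ?V' s t') * indicator {t - s..t + s} t') \<partial>lborel)"
        by (rule nn_integral_cmult[symmetric]) measurable
      also have "\<dots> = (\<integral>\<^sup>+t'. (w t * ?I s t t') * ((ennreal (4 / s\<^sup>2) * indicator {0<..} s) * (?V s t' + ?V' s t')) \<partial>lborel)"
        using True by (intro nn_integral_cong) (auto simp: ac_simps split: split_indicator)
      finally show ?thesis using True by simp
    qed simp
  qed
  \<comment> \<open>Three exchanges move t innermost, where only the weight and the condition on the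
    distance of t and t' depend on it.\<close>
  also have "\<dots> = (\<integral>\<^sup>+t. \<integral>\<^sup>+t'. \<integral>\<^sup>+s. (w t * ?I s t t') * ((ennreal (4 / s\<^sup>2) * indicator {0<..} s) * (?V s t' + ?V' s t')) \<partial>lborel \<partial>lborel \<partial>lborel)"
    by (intro nn_integral_cong lborel_pair.Fubini') measurable
  also have "\<dots> = (\<integral>\<^sup>+t'. \<integral>\<^sup>+t. \<integral>\<^sup>+s. (w t * ?I s t t') * ((ennreal (4 / s\<^sup>2) * indicator {0<..} s) * (?V s t' + ?V' s t')) \<partial>lborel \<partial>lborel \<partial>lborel)"
    by (rule lborel_pair.Fubini') measurable
  also have "\<dots> = (\<integral>\<^sup>+t'. \<integral>\<^sup>+s. \<integral>\<^sup>+t. (w t * ?I s t t') * ((ennreal (4 / s\<^sup>2) * indicator {0<..} s) * (?V s t' + ?V' s t')) \<partial>lborel \<partial>lborel \<partial>lborel)"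
    by (intro nn_integral_cong lborel_pair.Fubini') measurable
  also have "\<dots> = (\<integral>\<^sup>+t'. \<integral>\<^sup>+s. 16 * (m s t' * ennreal ((cwt \<eta> f s t')\<^sup>2 / s) * indicator {0<..} s) + 16 * (m s t' * ennreal ((cwt \<eta>' f s t')\<^sup>2 / s) * indicator {0<..} s) \<partial>lborel \<partial>lborel)"
  proof (intro nn_integral_cong)
    fix t' s :: real
    show "(\<integral>\<^sup>+t. (w t * ?I s t t') * ((ennreal (4 / s\<^sup>2) * indicator {0<..} s) * (?V s t' + ?V' s t')) \<partial>lborel)
      = 16 * (m s t' * ennreal ((cwt \<eta> f s t')\<^sup>2 / s) * indicator {0<..} s) + 16 * (m s t' * ennreal ((cwt \<eta>' f s t')\<^sup>2 / s) * indicator {0<..} s)"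
    proof (cases "s > 0")
      case True
      have "(\<integral>\<^sup>+t. (w t * ?I s t t') * ((ennreal (4 / s\<^sup>2) * indicator {0<..} s) * (?V s t' + ?V' s t')) \<partial>lborel)
        = (\<integral>\<^sup>+t. w t * ?I s t t' \<partial>lborel) * ((ennreal (4 / s\<^sup>2) * indicator {0<..} s) * (?V s t' + ?V' s t'))"
        by (rule nn_integral_multc) measurable
      also have "(\<integral>\<^sup>+t. w t * ?I s t t' \<partial>lborel) = (\<integral>\<^sup>+y\<in>{t' - s..t' + s}. w y \<partial>lborel)"
        by (intro nn_integral_cong) (auto split: split_indicator)
      also have "\<dots> = m s t' * ennreal (4 * s)"
        unfolding m_def using True by (simp add: ennreal_divide_times mult_divide_eq_ennreal)
      also have "m s t' * ennreal (4 * s) * ((ennreal (4 / s\<^sup>2) * indicator {0<..} s) * (?V s t' + ?V' s t'))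
        = m s t' * ((ennreal (4 * s) * ennreal (4 / s\<^sup>2)) * (?V s t' + ?V' s t'))"
        using True by (simp add: ac_simps)
      also have "ennreal (4 * s) * ennreal (4 / s\<^sup>2) = ennreal (16 * (1 / s))"
        using True by (simp add: ennreal_mult[symmetric] power2_eq_square)
      also have "\<dots> = 16 * ennreal (1 / s)"
        using True ennreal_mult[of 16 "1 / s"] by simp
      finally have *: "(\<integral>\<^sup>+t. (w t * ?I s t t') * ((ennreal (4 / s\<^sup>2) * indicator {0<..} s) * (?V s t' + ?V' s t')) \<partial>lborel)
        = m s t' * (16 * ennreal (1 / s) * (?V s t' + ?V' s t'))" .
      have d: "ennreal (x / s) = ennreal (1 / s) * ennreal x" if "x \<ge> 0" for x
        using True that by (simp add: ennreal_mult[symmetric])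
      show ?thesis unfolding * d[OF zero_le_power2] using True
        by (simp only: distrib_left indicator_simps greaterThan_iff mult_1_right) (simp add: ac_simps del: ennreal_eq_0_iff)
    qed simp
  qed
  also have "\<dots> = (\<integral>\<^sup>+t'. 16 * (\<integral>\<^sup>+s. m s t' * ennreal ((cwt \<eta> f s t')\<^sup>2 / s) * indicator {0<..} s \<partial>lborel) + 16 * (\<integral>\<^sup>+s. m s t' * ennreal ((cwt \<eta>' f s t')\<^sup>2 / s) * indicator {0<..} s \<partial>lborel) \<partial>lborel)"
    by (simp add: nn_integral_add nn_integral_cmult)
  also have "\<dots> = 16 * (\<integral>\<^sup>+t'. \<integral>\<^sup>+s. m s t' * ennreal ((cwt \<eta> f s t')\<^sup>2 / s) * indicator {0<..} s \<partial>lborel \<partial>lborel) + 16 * (\<integral>\<^sup>+t'. \<integral>\<^sup>+s. m s t' * ennreal ((cwt \<eta>' f s t')\<^sup>2 / s) * indicator {0<..} s \<partial>lborel \<partial>lborel)"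
    by (simp add: nn_integral_add nn_integral_cmult)
  also have "\<dots> \<le> 16 * (ennreal (16 * bd\<^sup>2) * (\<integral>\<^sup>+x. ennreal ((f x)\<^sup>2) * hlmax w x \<partial>lborel)) + 16 * (ennreal (16 * D.bd\<^sup>2) * (\<integral>\<^sup>+x. ennreal ((f x)\<^sup>2) * hlmax w x \<partial>lborel))"
    by (intro add_mono mult_left_mono sqf_layered D.sqf_layered f mm) (auto simp: m_def intro!: hlmax_ge)
  also have "\<dots> = (16 * ennreal (16 * bd\<^sup>2) + 16 * ennreal (16 * D.bd\<^sup>2)) * (\<integral>\<^sup>+x. ennreal ((f x)\<^sup>2) * hlmax w x \<partial>lborel)"
    by (simp add: distrib_right mult.assoc)
  also have "16 * ennreal (16 * bd\<^sup>2) + 16 * ennreal (16 * D.bd\<^sup>2) = ennreal (256 * (bd\<^sup>2 + D.bd\<^sup>2))"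
  proof -
    have "16 * ennreal a = ennreal (16 * a)" if "a \<ge> 0" for a using ennreal_mult[of 16 a] that by simp
    then show ?thesis by (simp add: ennreal_plus[symmetric] distrib_left del: ennreal_plus)
  qed
  finally show ?thesis .
qed

end


section \<open>Powers in [0, infinity], test functions and a priori finiteness\<close>

lemma ennpow_ennreal [simp]: "x \<ge> 0 \<Longrightarrow> ennpow (ennreal x) e = ennreal (x powr e)"
  by (simp add: ennpow_def)

lemma ennpow_measurable [measurable]:
  assumes [measurable]: "f \<in> borel_measurable M"
  shows "(\<lambda>x. ennpow (f x) e) \<in> borel_measurable M"
  unfolding ennpow_def by measurable

text \<open>A Galois connection between the powers e and 1/e, covering the value infinity.
  Monotonicity and compatibility with suprema both follow from it.\<close>

lemma ennpow_le_iff: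
  assumes e: "e > 0" and s: "s \<ge> 0"
  shows "ennpow x e \<le> ennreal s \<longleftrightarrow> x \<le> ennreal (s powr (1 / e))"
proof (cases x rule: ennreal_cases)
  case (real r)
  have "r powr e \<le> s \<longleftrightarrow> r \<le> s powr (1 / e)"
  proof
    assume "r powr e \<le> s"
    then have "(r powr e) powr (1 / e) \<le> s powr (1 / e)" using e by (intro powr_mono2) auto
    then show "r \<le> s powr (1 / e)" using real e by (simp add: powr_powr)
  next
    assume "r \<le> s powr (1 / e)"
    then have "r powr e \<le> (s powr (1 / e)) powr e" using e real by (intro powr_mono2) auto
    then show "r powr e \<le> s" using s e by (simp add: powr_powr)
  qed
  then show ?thesis using real s by simp
qed (simp add: ennpow_def top_unique)

lemma ennpow_mono:
  assumes "e > 0" "x \<le> y"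
  shows "ennpow x e \<le> ennpow y e"
proof (cases "ennpow y e" rule: ennreal_cases)
  case (real s)
  then have "y \<le> ennreal (s powr (1 / e))" using ennpow_le_iff[OF assms(1), of s y] by simp
  then have "ennpow x e \<le> ennreal s" using ennpow_le_iff[OF assms(1), of s x] real assms(2) by simp
  then show ?thesis using real by simp
qed simp

lemma ennpow_SUP:
  assumes e: "e > 0"
  shows "ennpow (SUP n. x n) e = (SUP n::nat. ennpow (x n) e)"
proof (rule antisym)
  show "ennpow (SUP n. x n) e \<le> (SUP n. ennpow (x n) e)"
  proof (cases "SUP n. ennpow (x n) e" rule: ennreal_cases)
    case (real s)
    have "x n \<le> ennreal (s powr (1 / e))" for n
      using ennpow_le_iff[OF e real(1), of "x n"] SUP_upper[of n UNIV "\<lambda>n. ennpow (x n) e"] real by simp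
    then have "(SUP n. x n) \<le> ennreal (s powr (1 / e))" by (intro SUP_least)
    then show ?thesis using ennpow_le_iff[OF e real(1)] real by simp
  next
    case top
    then show ?thesis by (simp only: top_greatest)
  qed
  show "(SUP n. ennpow (x n) e) \<le> ennpow (SUP n. x n) e"
    by (intro SUP_least ennpow_mono e SUP_upper) auto
qed

text \<open>For such functions and compact ranges of scales, all quantities that are to be absorbed
  are finite; continuity is demanded separately where it is needed.\<close>

definition test_fun :: "(real \<Rightarrow> real) \<Rightarrow> bool" where
  "test_fun f \<longleftrightarrow> f \<in> borel_measurable borel \<and> (\<exists>B. \<forall>x. \<bar>f x\<bar> \<le> B) \<and> (\<exists>A. \<forall>x. A < \<bar>x\<bar> \<longrightarrow> f x = 0)"

lemma test_fun_bound:
  assumes "test_fun f"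
  obtains A B where "A > 0" "B > 0" "\<And>x. \<bar>f x\<bar> \<le> B * indicator {-A..A} x"
proof -
  obtain A0 B0 where AB: "\<And>x. \<bar>f x\<bar> \<le> B0" "\<And>x. A0 < \<bar>x\<bar> \<Longrightarrow> f x = 0"
    using assms by (auto simp: test_fun_def)
  have "\<bar>f x\<bar> \<le> max 1 B0 * indicator {- max 1 A0..max 1 A0} x" for x
    using AB[of x] by (cases "A0 < \<bar>x\<bar>") (auto simp: max_def abs_le_iff split: split_indicator)
  then show ?thesis using that[of "max 1 A0" "max 1 B0"] by auto
qed

lemma test_fun_integrable:
  assumes "test_fun f" shows "integrable lborel f"
proof -
  obtain A B where "A > 0" "B > 0" and b: "\<And>x. \<bar>f x\<bar> \<le> B * indicator {-A..A} x"
    using test_fun_bound[OF assms] by blast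
  have [measurable]: "f \<in> borel_measurable borel" using assms by (simp add: test_fun_def)
  show ?thesis
    by (rule Bochner_Integration.integrable_bound[OF integrable_const_indicator_Icc[of B "-A" A]])
       (use b in \<open>auto intro: order_trans[OF _ abs_ge_self]\<close>)
qed

lemma test_fun_nn_powr_finite:
  assumes "test_fun f" "q > 0"
  shows "(\<integral>\<^sup>+x. ennreal (\<bar>f x\<bar> powr q) \<partial>lborel) < \<infinity>"
proof -
  obtain A B where AB: "A > 0" "B > 0" and b: "\<And>x. \<bar>f x\<bar> \<le> B * indicator {-A..A} x"
    using test_fun_bound[OF assms(1)] by blast
  have "(\<integral>\<^sup>+x. ennreal (\<bar>f x\<bar> powr q) \<partial>lborel) \<le> (\<integral>\<^sup>+x. ennreal (B powr q) * indicator {-A..A} x \<partial>lborel)"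
  proof (rule nn_integral_mono)
    fix x
    show "ennreal (\<bar>f x\<bar> powr q) \<le> ennreal (B powr q) * indicator {-A..A} x"
      using b[of x] AB assms(2) by (auto split: split_indicator_asm split_indicator intro!: ennreal_leI powr_mono2)
  qed
  also have "\<dots> = ennreal (B powr q) * ennreal (2 * A)"
    using AB by (subst nn_integral_cmult_indicator) auto
  also have "\<dots> < \<infinity>" by (simp add: ennreal_mult_less_top)
  finally show ?thesis .
qed

context bump begin

lemma sqf_scales_bound:
  assumes f: "integrable lborel f"
  obtains D where "D \<ge> 0" "\<And>t. sqf \<eta> f (scales n) t \<le> ennreal D"
proof
  define N where "N = real (Suc n)"
  have N: "N \<ge> 1" by (simp add: N_def)
  define I where "I = (LINT x|lborel. \<bar>f x\<bar>)"
  have I: "I \<ge> 0" unfolding I_def by simp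
  let ?D = "(bd * N * I)\<^sup>2 * N * (N - 1 / N)"
  have N1: "1 / N \<le> N" using scales_le[of n] by (simp add: N_def)
  then show "?D \<ge> 0" using N by (intro mult_nonneg_nonneg) auto
  fix t
  have "sqf \<eta> f (scales n) t \<le> (\<integral>\<^sup>+s. ennreal ((bd * N * I)\<^sup>2 * N) * indicator {1 / N..N} s \<partial>lborel)"
    unfolding sqf_def
  proof (rule nn_integral_mono)
    fix s
    show "ennreal ((cwt \<eta> f s t)\<^sup>2 / s) * indicator (scales n) s \<le> ennreal ((bd * N * I)\<^sup>2 * N) * indicator {1 / N..N} s"
    proof (cases "s \<in> scales n")
      case True
      then have s: "1 / N \<le> s" "s \<le> N" by (auto simp: scales_def N_def)
      have "0 < 1 / N" using N by simp
      then have s0: "s > 0" using s by linarith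
      have sN: "1 / s \<le> N" using s s0 N by (simp add: field_simps)
      have "\<bar>cwt \<eta> f s t\<bar> \<le> bd / s * I" unfolding I_def by (rule cwt_bound[OF f s0])
      also have "\<dots> = bd * (1 / s) * I" by simp
      also have "\<dots> \<le> bd * N * I" using sN bd_pos I by (intro mult_right_mono mult_left_mono) auto
      finally have "\<bar>cwt \<eta> f s t\<bar> \<le> \<bar>bd * N * I\<bar>" by simp
      then have "(cwt \<eta> f s t)\<^sup>2 \<le> (bd * N * I)\<^sup>2" by (simp only: abs_le_square_iff)
      then have "(cwt \<eta> f s t)\<^sup>2 * (1 / s) \<le> (bd * N * I)\<^sup>2 * N"
        using sN s0 by (intro mult_mono) auto
      then have "ennreal ((cwt \<eta> f s t)\<^sup>2 / s) \<le> ennreal ((bd * N * I)\<^sup>2 * N)" by (intro ennreal_leI) simp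
      then show ?thesis using True s by simp
    qed simp
  qed
  also have "\<dots> = ennreal ?D"
    using N N1 by (subst nn_integral_cmult_indicator) (auto simp: ennreal_mult)
  finally show "sqf \<eta> f (scales n) t \<le> ennreal ?D" .
qed

lemma sqf_scales_supp:
  assumes "\<And>x. A < \<bar>x\<bar> \<Longrightarrow> f x = 0" "\<bar>t\<bar> > A + real (Suc n)"
  shows "sqf \<eta> f (scales n) t = 0"
proof -
  have "ennreal ((cwt \<eta> f s t)\<^sup>2 / s) * indicator (scales n) s = 0" for s
  proof (cases "s \<in> scales n")
    case True
    have "0 < 1 / real (Suc n)" by simp
    moreover have "1 / real (Suc n) \<le> s" "s \<le> real (Suc n)" using True unfolding scales_def by auto
    ultimately have s: "s > 0" "s \<le> real (Suc n)" by linarith+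
    have "cwt \<eta> f s t = 0"
      by (rule cwt_eq_0[OF s(1)], rule assms(1)) (use s assms(2) in auto)
    then show ?thesis by simp
  qed simp
  then have "(\<lambda>s. ennreal ((cwt \<eta> f s t)\<^sup>2 / s) * indicator (scales n) s) = (\<lambda>_. 0)" by (rule ext)
  then show ?thesis unfolding sqf_def by simp
qed

text \<open>The truncated square function is again bounded with bounded support, so its powers are
  admissible weights and have finite integrals.\<close>

lemma sqf_scales_test_fun:
  assumes f: "test_fun f" and q: "q \<ge> 0"
  shows "test_fun (\<lambda>t. enn2real (sqf \<eta> f (scales n) t) powr q)"
    and "sqf \<eta> f (scales n) t = ennreal (enn2real (sqf \<eta> f (scales n) t))"
proof -
  have [measurable]: "f \<in> borel_measurable borel" using f by (simp add: test_fun_def)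
  obtain D where D: "D \<ge> 0" "\<And>t. sqf \<eta> f (scales n) t \<le> ennreal D"
    using sqf_scales_bound[OF test_fun_integrable[OF f]] by blast
  obtain A where A: "\<And>x. A < \<bar>x\<bar> \<Longrightarrow> f x = 0" using f by (auto simp: test_fun_def)
  have U: "enn2real (sqf \<eta> f (scales n) t) \<le> D" for t using enn2real_mono[OF D(2)[of t]] D(1) by simp
  show "test_fun (\<lambda>t. enn2real (sqf \<eta> f (scales n) t) powr q)"
    unfolding test_fun_def
  proof (intro conjI exI allI impI)
    show "(\<lambda>t. enn2real (sqf \<eta> f (scales n) t) powr q) \<in> borel_measurable borel" by measurable
    show "\<bar>enn2real (sqf \<eta> f (scales n) t) powr q\<bar> \<le> D powr q" for t
      using U q by (auto intro!: powr_mono2)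
    fix t assume "A + real (Suc n) < \<bar>t\<bar>"
    then show "enn2real (sqf \<eta> f (scales n) t) powr q = 0"
      using sqf_scales_supp[of A f n t] A by simp
  qed
  show "sqf \<eta> f (scales n) t = ennreal (enn2real (sqf \<eta> f (scales n) t))"
    using D(2)[of t] by (cases "sqf \<eta> f (scales n) t" rule: ennreal_cases) (auto simp: top_unique)
qed

text \<open>A bound that is uniform in the truncation survives the supremum over n by monotone
  convergence.\<close>

lemma sqf_Lp_from_scales:
  assumes [measurable]: "f \<in> borel_measurable borel" and p: "p > 0"
    and b: "\<And>n. (\<integral>\<^sup>+t. ennpow (sqf \<eta> f (scales n) t) p \<partial>lborel) \<le> K"
  shows "(\<integral>\<^sup>+t. ennpow (sqf \<eta> f {0<..} t) p \<partial>lborel) \<le> K"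
proof -
  have "(\<integral>\<^sup>+t. ennpow (sqf \<eta> f {0<..} t) p \<partial>lborel) = (\<integral>\<^sup>+t. (SUP n. ennpow (sqf \<eta> f (scales n) t) p) \<partial>lborel)"
    by (simp only: sqf_SUP[OF assms(1)] ennpow_SUP[OF p])
  also have "\<dots> = (SUP n. \<integral>\<^sup>+t. ennpow (sqf \<eta> f (scales n) t) p \<partial>lborel)"
    by (rule nn_integral_monotone_convergence_SUP)
       (use scales_incseq p in \<open>auto simp: incseq_def le_fun_def intro!: ennpow_mono sqf_mono\<close>)
  also have "\<dots> \<le> K" by (intro SUP_least b)
  finally show ?thesis .
qed

end

text \<open>Finiteness of X permits subtracting b X. If F is infinite and a = 0, the product
  \<open>ennreal a * F\<close> is 0, so that X = 0 has to be shown separately.\<close>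

lemma absorb_half:
  assumes "X \<le> ennreal a * F + ennreal b * X" "X < \<infinity>" "0 \<le> a" "0 \<le> b" "b \<le> 1 / 2"
  shows "X \<le> ennreal (2 * a) * F"
proof -
  obtain x where x: "X = ennreal x" "x \<ge> 0" using assms(2) by (cases X rule: ennreal_cases) auto
  show ?thesis
  proof (cases F rule: ennreal_cases)
    case (real \<phi>)
    have "ennreal x \<le> ennreal (a * \<phi> + b * x)"
      using assms x real by (simp add: ennreal_mult ennreal_plus)
    then have "x \<le> a * \<phi> + b * x" using assms x real by (subst (asm) ennreal_le_iff) auto
    moreover have "b * x \<le> x / 2" using mult_right_mono[OF assms(5) x(2)] by simp
    ultimately have "x \<le> 2 * a * \<phi>" by simp
    then show ?thesis using x real assms by (simp add: ennreal_mult[symmetric] ennreal_leI)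
  next
    case top
    show ?thesis
    proof (cases "a = 0")
      case True
      have "ennreal x \<le> ennreal (b * x)" using assms x True by (simp add: ennreal_mult)
      then have "x \<le> b * x" using assms x by (subst (asm) ennreal_le_iff) auto
      moreover have "b * x \<le> x / 2" using mult_right_mono[OF assms(5) x(2)] by simp
      ultimately have "x = 0" using x by linarith
      then show ?thesis using x by simp
    next
      case False
      then show ?thesis using top assms by (simp add: ennreal_mult_top)
    qed
  qed
qed

text \<open>With U = S^2 and w = U^((p-2)/2) the integral X of U^(p/2) equals that of U w. The
  weighted inequality and Young with the dual exponents P = p/2 and Q = p/(p-2) bound it by the
  p-norm of f plus a multiple of the integral of (Mw)^Q, hence of w^Q = U^(p/2), that is, of X
  itself.\<close>

lemma (in smooth_wavelet) sqf_Lp_gt2: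
  assumes p: "p > 2"
  shows "\<exists>C\<ge>0. \<forall>f. test_fun f \<longrightarrow> (\<integral>\<^sup>+t. ennpow (sqf \<eta> f {0<..} t) (p / 2) \<partial>lborel) \<le> ennreal C * (\<integral>\<^sup>+x. ennreal (\<bar>f x\<bar> powr p) \<partial>lborel)"
proof -
  define Q where "Q = p / (p - 2)"
  define P where "P = p / 2"
  have Q: "Q > 1" and P: "P > 1" and PQ: "1 / P + 1 / Q = 1" using p by (auto simp: Q_def P_def field_simps)
  define C1 where "C1 = 256 * (bd\<^sup>2 + D.bd\<^sup>2)"
  have C1: "C1 \<ge> 0" by (simp add: C1_def)
  define C2 where "C2 = 10 * Q * 2 powr (Q - 1) / (Q - 1)"
  have C2: "C2 \<ge> 0" using Q by (simp add: C2_def)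
  \<comment> \<open>The weight in Young's inequality, chosen so that the coefficient b of X is at
    most 1/2; the summand 1 keeps K positive.\<close>
  define K where "K = (2 * C1 * C2 / Q + 1) powr (1 / Q)"
  have "2 * C1 * C2 / Q + 1 > 0" using C1 C2 Q by (intro add_nonneg_pos) auto
  then have K0: "K > 0" by (simp add: K_def)
  have KQ: "K powr Q = 2 * C1 * C2 / Q + 1" using C1 C2 Q by (simp add: K_def powr_powr)
  define a where "a = C1 * (K powr P / P)"
  define b where "b = C1 * (C2 / (K powr Q * Q))"
  have b: "b \<ge> 0" "b \<le> 1 / 2"
  proof -
    show "b \<ge> 0" using C1 C2 Q by (simp add: b_def)
    have "2 * (C1 * C2 / Q) \<le> K powr Q" by (simp add: KQ)
    moreover have "K powr Q > 0" using K0 by simp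
    ultimately show "b \<le> 1 / 2" using Q by (simp add: b_def field_simps)
  qed
  have a: "a \<ge> 0" using C1 P by (simp add: a_def)
  have main: "(\<integral>\<^sup>+t. ennpow (sqf \<eta> f (scales n) t) (p / 2) \<partial>lborel) \<le> ennreal (2 * a) * (\<integral>\<^sup>+x. ennreal (\<bar>f x\<bar> powr p) \<partial>lborel)"
    if f: "test_fun f" for f n
  proof -
    have [measurable]: "f \<in> borel_measurable borel" using f by (simp add: test_fun_def)
    note fi = test_fun_integrable[OF f]
    define U where "U t = enn2real (sqf \<eta> f (scales n) t)" for t
    have U0: "U t \<ge> 0" for t by (simp add: U_def)
    have sU: "sqf \<eta> f (scales n) t = ennreal (U t)" for t
      unfolding U_def by (rule sqf_scales_test_fun(2)[OF f order_refl])
    have [measurable]: "U \<in> borel_measurable borel" unfolding U_def by measurable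
    define w where "w t = U t powr ((p - 2) / 2)" for t
    have w: "test_fun w" unfolding w_def U_def using p by (intro sqf_scales_test_fun(1) f) auto
    then have [measurable]: "w \<in> borel_measurable borel" by (simp add: test_fun_def)
    obtain B where B: "\<And>t. w t \<le> B" using w unfolding test_fun_def by (meson abs_le_D1)
    have w0: "w t \<ge> 0" for t by (simp add: w_def)
    have wfin: "(\<integral>\<^sup>+t. ennreal (w t) \<partial>lborel) < \<infinity>"
      using test_fun_nn_powr_finite[OF w, of 1] w0 by simp
    define X where "X = (\<integral>\<^sup>+t. ennreal (U t powr (p / 2)) \<partial>lborel)"
    have Xfin: "X < \<infinity>"
      using test_fun_nn_powr_finite[OF sqf_scales_test_fun(1)[OF f, of "p/2" n], of 1] p
      by (simp add: X_def U_def)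
    have wQ: "w t powr Q = U t powr (p / 2)" for t
    proof -
      have "(p - 2) * Q = p" using p by (simp add: Q_def)
      then have "(p - 2) / 2 * Q = p / 2" by simp
      then show ?thesis by (simp only: w_def powr_powr)
    qed
    define u where "u x = enn2real (hlmax (\<lambda>y. ennreal (w y)) x)" for x
    have [measurable]: "u \<in> borel_measurable borel" unfolding u_def by measurable
    have "B \<ge> 0" using B[of 0] w0[of 0] by linarith
    then have "hlmax (\<lambda>y. ennreal (w y)) x \<le> ennreal B" for x by (intro hlmax_bounded ennreal_leI B)
    then have Mu: "hlmax (\<lambda>y. ennreal (w y)) x = ennreal (u x)" for x
      unfolding u_def by (metis ennreal_enn2real_if ennreal_neq_top top.extremum_uniqueI)
    have u0: "u x \<ge> 0" for x by (simp add: u_def)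
    have "X = (\<integral>\<^sup>+t. ennreal (w t) * sqf \<eta> f (scales n) t \<partial>lborel)"
      unfolding X_def
    proof (rule nn_integral_cong)
      fix t
      have "U t powr (p / 2) = U t powr ((p - 2) / 2) * U t powr 1"
        unfolding powr_add[symmetric] by (simp add: field_simps)
      also have "\<dots> = w t * U t" using U0[of t] by (simp add: w_def)
      finally show "ennreal (U t powr (p / 2)) = ennreal (w t) * sqf \<eta> f (scales n) t"
        using U0 w0 by (simp add: sU ennreal_mult[symmetric])
    qed
    also have "\<dots> \<le> (\<integral>\<^sup>+t. ennreal (w t) * sqf \<eta> f {0<..} t \<partial>lborel)"
      by (intro nn_integral_mono mult_left_mono sqf_mono) (use scales_Union in auto)
    also have "\<dots> \<le> ennreal C1 * (\<integral>\<^sup>+x. ennreal ((f x)\<^sup>2) * hlmax (\<lambda>y. ennreal (w y)) x \<partial>lborel)"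
      unfolding C1_def by (rule sqf_weighted[OF fi]) measurable
    also have "\<dots> \<le> ennreal C1 * (\<integral>\<^sup>+x. ennreal (K powr P / P) * ennreal (\<bar>f x\<bar> powr p) + ennreal (1 / (K powr Q * Q)) * ennreal (u x powr Q) \<partial>lborel)"
    proof (intro mult_left_mono nn_integral_mono)
      fix x
      have "(f x)\<^sup>2 * u x = (K * (f x)\<^sup>2) * (u x / K)" using K0 by simp
      also have "\<dots> \<le> (K * (f x)\<^sup>2) powr P / P + (u x / K) powr Q / Q"
        by (rule Youngs_inequality[OF P Q PQ]) (use K0 u0 in auto)
      also have "(K * (f x)\<^sup>2) powr P = K powr P * (\<bar>f x\<bar> powr p)"
      proof -
        have "(f x)\<^sup>2 powr P = \<bar>f x\<bar> powr p"
        proof (cases "f x = 0")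
          case False
          have "(f x)\<^sup>2 = \<bar>f x\<bar> powr 2" using False by (simp add: powr_numeral)
          then have "(f x)\<^sup>2 powr P = (\<bar>f x\<bar> powr 2) powr P" by (simp only:)
          also have "\<dots> = \<bar>f x\<bar> powr p" by (simp only: powr_powr) (simp add: P_def)
          finally show ?thesis .
        qed (use p P in auto)
        then show ?thesis using K0 by (simp add: powr_mult)
      qed
      also have "(u x / K) powr Q = u x powr Q / K powr Q" using K0 u0 by (simp add: powr_divide)
      finally have "(f x)\<^sup>2 * u x \<le> K powr P / P * (\<bar>f x\<bar> powr p) + 1 / (K powr Q * Q) * (u x powr Q)"
        by simp
      then have "ennreal ((f x)\<^sup>2 * u x) \<le> ennreal (K powr P / P * (\<bar>f x\<bar> powr p)) + ennreal (1 / (K powr Q * Q) * (u x powr Q))"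
        using P Q by (intro ennreal_le_add) auto
      then show "ennreal ((f x)\<^sup>2) * hlmax (\<lambda>y. ennreal (w y)) x \<le> ennreal (K powr P / P) * ennreal (\<bar>f x\<bar> powr p) + ennreal (1 / (K powr Q * Q)) * ennreal (u x powr Q)"
      proof -
        have e: "ennreal (K powr P / P * (\<bar>f x\<bar> powr p)) = ennreal (K powr P / P) * ennreal (\<bar>f x\<bar> powr p)"
          "ennreal (1 / (K powr Q * Q) * (u x powr Q)) = ennreal (1 / (K powr Q * Q)) * ennreal (u x powr Q)"
          "ennreal ((f x)\<^sup>2 * u x) = ennreal ((f x)\<^sup>2) * ennreal (u x)"
          using P Q u0 by (intro ennreal_mult; simp)+
        assume "ennreal ((f x)\<^sup>2 * u x) \<le> ennreal (K powr P / P * (\<bar>f x\<bar> powr p)) + ennreal (1 / (K powr Q * Q) * (u x powr Q))"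
        then show ?thesis by (simp only: Mu e)
      qed
    qed simp
    also have "\<dots> = ennreal C1 * (ennreal (K powr P / P) * (\<integral>\<^sup>+x. ennreal (\<bar>f x\<bar> powr p) \<partial>lborel) + ennreal (1 / (K powr Q * Q)) * (\<integral>\<^sup>+x. ennreal (u x powr Q) \<partial>lborel))"
      by (subst nn_integral_add) (auto simp: nn_integral_cmult)
    also have "\<dots> \<le> ennreal C1 * (ennreal (K powr P / P) * (\<integral>\<^sup>+x. ennreal (\<bar>f x\<bar> powr p) \<partial>lborel) + ennreal (1 / (K powr Q * Q)) * (ennreal C2 * X))"
    proof -
      have "(\<integral>\<^sup>+x. ennreal (u x powr Q) \<partial>lborel) \<le> ennreal C2 * (\<integral>\<^sup>+x. ennreal (w x powr Q) \<partial>lborel)"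
        unfolding u_def C2_def by (rule hlmax_strong_type[OF Q _ w0 B wfin]) measurable
      also have "(\<integral>\<^sup>+x. ennreal (w x powr Q) \<partial>lborel) = X" by (simp add: X_def wQ)
      finally show ?thesis by (intro mult_left_mono add_left_mono) auto
    qed
    also have "\<dots> = ennreal a * (\<integral>\<^sup>+x. ennreal (\<bar>f x\<bar> powr p) \<partial>lborel) + ennreal b * X"
      using C1 C2 P Q by (simp add: a_def b_def distrib_left mult.assoc[symmetric] ennreal_mult[symmetric])
    finally have "X \<le> ennreal a * (\<integral>\<^sup>+x. ennreal (\<bar>f x\<bar> powr p) \<partial>lborel) + ennreal b * X" .
    from absorb_half[OF this Xfin a b] show ?thesis
      using U0 by (simp add: X_def sU)
  qed
  show ?thesis
    by (rule exI[of _ "2 * a"]) (use a p main in \<open>auto intro!: sqf_Lp_from_scales simp: test_fun_def\<close>)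
qed

lemma (in wavelet) sqf_Lp_eq2:
  "\<exists>C\<ge>0. \<forall>f. test_fun f \<longrightarrow> (\<integral>\<^sup>+t. ennpow (sqf \<eta> f {0<..} t) (2 / 2) \<partial>lborel) \<le> ennreal C * (\<integral>\<^sup>+x. ennreal (\<bar>f x\<bar> powr 2) \<partial>lborel)"
proof -
  have "ennpow x 1 = x" for x by (cases x rule: ennreal_cases) (auto simp: ennpow_def)
  then show ?thesis
    by (intro exI[of _ "16 * bd\<^sup>2"]) (auto intro!: sqf_L2 test_fun_integrable)
qed


subsection \<open>Calderon--Zygmund decomposition and the case p < 2\<close>

text \<open>A pair stores left end point and length; half-open intervals are split by bisection
  without overlap.\<close>

abbreviation ivl :: "real \<times> real \<Rightarrow> real set" where
  "ivl i \<equiv> {fst i..<fst i + snd i}"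

text \<open>The Calderon--Zygmund selection for a nonnegative g at level l, with a finite family.
  Because bisection stops at a positive length, the bound off the family holds everywhere and not
  almost everywhere, at the price of 2l in place of l.\<close>

definition cz :: "(real \<Rightarrow> real) \<Rightarrow> real \<Rightarrow> real set \<Rightarrow> (real \<times> real) set \<Rightarrow> bool" where
  "cz g l J B \<longleftrightarrow> finite B \<and>
    (\<forall>i\<in>B. 0 < snd i \<and> ivl i \<subseteq> J \<and> l * snd i < (LINT x:ivl i|lborel. g x) \<and> (LINT x:ivl i|lborel. g x) \<le> 2 * l * snd i) \<and>
    disjoint_family_on ivl B \<and> (\<forall>x\<in>J. x \<notin> (\<Union>i\<in>B. ivl i) \<longrightarrow> g x \<le> 2 * l)"

lemma cz_Un:
  assumes "cz g l J1 B1" "cz g l J2 B2" "J1 \<inter> J2 = {}"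
  shows "cz g l (J1 \<union> J2) (B1 \<union> B2)"
proof -
  have "disjoint_family_on ivl (B1 \<union> B2)"
    unfolding disjoint_family_on_def
  proof (intro ballI impI)
    fix i j assume ij: "i \<in> B1 \<union> B2" "j \<in> B1 \<union> B2" "i \<noteq> j"
    have s: "\<And>i. i \<in> B1 \<Longrightarrow> ivl i \<subseteq> J1" "\<And>i. i \<in> B2 \<Longrightarrow> ivl i \<subseteq> J2"
      using assms unfolding cz_def by blast+
    have d: "disjoint_family_on ivl B1" "disjoint_family_on ivl B2" using assms unfolding cz_def by blast+
    from ij consider "i \<in> B1" "j \<in> B1" | "i \<in> B2" "j \<in> B2" | "i \<in> B1" "j \<in> B2" | "i \<in> B2" "j \<in> B1" by blast
    then show "ivl i \<inter> ivl j = {}"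
    proof cases
      case 1 then show ?thesis using d(1) ij(3) unfolding disjoint_family_on_def by blast
    next
      case 2 then show ?thesis using d(2) ij(3) unfolding disjoint_family_on_def by blast
    next
      case 3 then show ?thesis using s(1)[of i] s(2)[of j] assms(3) by blast
    next
      case 4 then show ?thesis using s(1)[of j] s(2)[of i] assms(3) by blast
    qed
  qed
  then show ?thesis using assms(1,2) unfolding cz_def by blast
qed

text \<open>Bisection: a half on which the average exceeds the level is selected, the other halves are
  bisected further. Below the scale of uniform continuity the average controls the function.\<close>

lemma cz_interval:
  fixes g :: "real \<Rightarrow> real"
  assumes g: "integrable lborel g" and g0: "\<And>x. g x \<ge> 0" and l: "l > 0" and h: "h > 0"
    and osc: "\<And>x y. \<bar>x - y\<bar> \<le> h \<Longrightarrow> \<bar>g x - g y\<bar> \<le> l"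
  shows "(LINT x:{a..<a + h * 2 ^ n}|lborel. g x) \<le> l * (h * 2 ^ n) \<Longrightarrow> \<exists>B. cz g l {a..<a + h * 2 ^ n} B"
proof (induction n arbitrary: a)
  case 0
  \<comment> \<open>Bottom of the recursion: the mean is at most l and the oscillation over length h
    is at most l, so no value exceeds 2l.\<close>
  have "g x \<le> 2 * l" if x: "x \<in> {a..<a + h}" for x
  proof (rule ccontr)
    assume "\<not> g x \<le> 2 * l"
    then have gx: "g x - l > l" by simp
    have "(g x - l) * h = (LINT y:{a..<a + h}|lborel. g x - l)"
      using h by (simp add: set_lebesgue_integral_def measure_def)
    also have "\<dots> \<le> (LINT y:{a..<a + h}|lborel. g y)"
      unfolding set_lebesgue_integral_def
    proof (rule integral_mono)
      show "integrable lborel (\<lambda>y. indicator {a..<a + h} y *\<^sub>R (g x - l))"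
        using h by (intro integrable_scaleR_left integrable_real_indicator) auto
      show "integrable lborel (\<lambda>y. indicator {a..<a + h} y *\<^sub>R g y)"
        by (rule Bochner_Integration.integrable_bound[OF g]) (use g in \<open>auto split: split_indicator\<close>)
      fix y
      have "g x - l \<le> g y" if "y \<in> {a..<a + h}" for y
      proof -
        have "\<bar>x - y\<bar> \<le> h" using that x by (auto simp: abs_le_iff)
        from osc[OF this] show ?thesis by linarith
      qed
      from this[of y] show "indicator {a..<a + h} y *\<^sub>R (g x - l) \<le> indicator {a..<a + h} y *\<^sub>R g y"
        by (auto split: split_indicator)
    qed
    also have "\<dots> \<le> l * h" using 0 by simp
    finally show False using gx h by simp
  qed
  then have "cz g l {a..<a + h} {}" by (auto simp: cz_def disjoint_family_on_def)
  then show ?case by auto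
next
  case (Suc n)
  define L where "L = h * 2 ^ n"
  have L: "L > 0" using h by (simp add: L_def)
  have dbl: "h * 2 ^ Suc n = 2 * L" by (simp add: L_def)
  have half: "\<exists>B. cz g l {c..<c + L} B" if c: "{c..<c + L} \<subseteq> {a..<a + 2 * L}" for c
  proof (cases "(LINT x:{c..<c + L}|lborel. g x) \<le> l * L")
    case True
    then show ?thesis using Suc.IH[of c] by (simp add: L_def)
  next
    case False
    \<comment> \<open>A selected half inherits its upper bound 2l from the parent, whose mean is at
      most l and whose length is twice as large.\<close>
    have "(LINT x:{c..<c + L}|lborel. g x) \<le> (LINT x:{a..<a + 2 * L}|lborel. g x)"
      unfolding set_lebesgue_integral_def
      by (intro integral_mono integrable_mult_indicator[where 'b=real]) (use c g g0 in \<open>auto split: split_indicator\<close>)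
    also have "\<dots> \<le> l * (2 * L)" using Suc.prems by (simp only: dbl)
    finally have "cz g l {c..<c + L} {(c, L)}"
      using False L by (auto simp: cz_def disjoint_family_on_def)
    then show ?thesis by blast
  qed
  obtain B1 where B1: "cz g l {a..<a + L} B1" using half[of a] L by auto
  obtain B2 where B2: "cz g l {a + L..<a + L + L} B2" using half[of "a + L"] L by auto
  have "cz g l ({a..<a + L} \<union> {a + L..<a + L + L}) (B1 \<union> B2)"
    by (rule cz_Un[OF B1 B2]) auto
  also have "{a..<a + L} \<union> {a + L..<a + L + L} = {a..<a + h * 2 ^ Suc n}"
    unfolding dbl using L by auto
  finally show ?case by blast
qed

lemma cz_exists:
  fixes g :: "real \<Rightarrow> real"
  assumes g: "test_fun g" and cg: "continuous_on UNIV g" and g0: "\<And>x. g x \<ge> 0" and l: "l > 0"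
  shows "\<exists>B. cz g l UNIV B"
proof -
  obtain A where A0: "\<And>x. A < \<bar>x\<bar> \<Longrightarrow> g x = 0" using g by (auto simp: test_fun_def)
  have gi: "integrable lborel g" by (rule test_fun_integrable[OF g])
  define A' where "A' = \<bar>A\<bar> + 1"
  have A: "g x = 0" if "A' \<le> \<bar>x\<bar>" for x using A0[of x] that by (simp add: A'_def)
  have A1: "A' \<ge> 1" by (simp add: A'_def)
  have "uniformly_continuous_on {-A'-1..A'+1} g"
    by (intro compact_uniformly_continuous continuous_on_subset[OF cg]) auto
  then obtain d where d: "d > 0" "\<And>x y. x \<in> {-A'-1..A'+1} \<Longrightarrow> y \<in> {-A'-1..A'+1} \<Longrightarrow> dist y x < d \<Longrightarrow> dist (g y) (g x) < l"
    unfolding uniformly_continuous_on_def using l by metis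
  define h where "h = min (d / 2) 1"
  have h: "h > 0" "h \<le> 1" "h < d" using d(1) by (auto simp: h_def)
  have osc: "\<bar>g x - g y\<bar> \<le> l" if xy: "\<bar>x - y\<bar> \<le> h" for x y
  proof (cases "\<bar>x\<bar> \<le> A' \<or> \<bar>y\<bar> \<le> A'")
    case True
    then have "x \<in> {-A'-1..A'+1}" "y \<in> {-A'-1..A'+1}" using xy h by (auto simp: abs_le_iff)
    then have "dist (g x) (g y) < l" using xy h by (intro d) (auto simp: dist_real_def)
    then show ?thesis by (simp add: dist_real_def)
  next
    case False
    then show ?thesis using A[of x] A[of y] l by auto
  qed
  \<comment> \<open>The starting interval must contain the support of g and be so long that its own
    mean is at most l; the two terms of the maximum express this.\<close>
  obtain n :: nat where n: "max (2 * A' / h) ((LINT x|lborel. g x) / (l * h)) \<le> 2 ^ n"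
    using real_arch_pow[of 2 "max (2 * A' / h) ((LINT x|lborel. g x) / (l * h))"] by (auto intro: less_imp_le)
  have n1: "2 * A' \<le> h * 2 ^ n" using n h by (simp add: field_simps)
  have n2: "(LINT x|lborel. g x) \<le> l * (h * 2 ^ n)" using n h l by (simp add: field_simps)
  let ?J = "{-A'..<-A' + h * 2 ^ n}"
  have "(LINT x:?J|lborel. g x) \<le> (LINT x|lborel. g x)"
    unfolding set_lebesgue_integral_def
    by (intro integral_mono integrable_mult_indicator[where 'b=real] gi) (use g0 in \<open>auto split: split_indicator\<close>)
  also note n2
  finally obtain B where B: "cz g l ?J B" using cz_interval[OF gi g0 l h(1) osc] by blast
  have "g x \<le> 2 * l" if "x \<notin> ?J" for x
    using A[of x] that n1 l by (auto simp: not_le not_less)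
  then have "cz g l UNIV B" using B unfolding cz_def by blast
  then show ?thesis by blast
qed

context smooth_wavelet begin

lemma lipschitz: "\<bar>\<eta> u - \<eta> v\<bar> \<le> D.bd * \<bar>u - v\<bar>"
proof -
  have "norm (\<eta> u - \<eta> v) \<le> D.bd * norm (u - v)"
    by (rule field_differentiable_bound[of UNIV \<eta> \<eta>']) (auto simp: deriv D.bd)
  then show ?thesis by simp
qed

text \<open>Since b has mean zero, a constant may be subtracted from the kernel, and the Lipschitz
  bound gains the factor l/s. If t lies outside the tripled interval and its ball still meets the
  support of b, then s > l and t is within 2s of c; this is the cone condition.\<close>

lemma cwt_atom:
  fixes b :: "real \<Rightarrow> real"
  assumes b: "integrable lborel b" and supp_b: "\<And>x. x \<notin> {c..<c + l} \<Longrightarrow> b x = 0" and m: "(LINT x|lborel. b x) = 0"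
    and K: "(LINT x|lborel. \<bar>b x\<bar>) \<le> K" and s: "s > 0" and l: "l > 0" and t: "t \<notin> {c - l..c + 2 * l}"
  shows "\<bar>cwt \<eta> b s t\<bar> \<le> D.bd * K * l / s\<^sup>2 * (if l < s \<and> \<bar>t - c\<bar> \<le> 2 * s then 1 else 0)"
proof (cases "l < s \<and> \<bar>t - c\<bar> \<le> 2 * s")
  case False
  have "cwt \<eta> b s t = 0"
  proof (rule cwt_eq_0[OF s], rule supp_b, rule notI)
    fix x assume "x \<in> {t - s..t + s}" "x \<in> {c..<c + l}"
    then show False using False t by auto
  qed
  then show ?thesis using False by (simp only: if_False abs_zero mult_zero_right order_refl)
next
  case True
  have [measurable]: "b \<in> borel_measurable borel" using borel_measurable_integrable[OF b] by simp
  have "cwt \<eta> b s t = (1 / s) * ((LINT x|lborel. b x * \<eta> ((x - t) / s)) - \<eta> ((c - t) / s) * (LINT x|lborel. b x))"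
    by (simp add: cwt_def m)
  also have "\<dots> = (1 / s) * (LINT x|lborel. b x * (\<eta> ((x - t) / s) - \<eta> ((c - t) / s)))"
    using cwt_integrand_integrable[OF b] b by (simp add: right_diff_distrib mult.commute)
  finally have eq: "cwt \<eta> b s t = (1 / s) * (LINT x|lborel. b x * (\<eta> ((x - t) / s) - \<eta> ((c - t) / s)))" .
  have "\<bar>LINT x|lborel. b x * (\<eta> ((x - t) / s) - \<eta> ((c - t) / s))\<bar> \<le> (LINT x|lborel. D.bd * l / s * \<bar>b x\<bar>)"
  proof (rule abs_integral_le)
    fix x
    show "\<bar>b x * (\<eta> ((x - t) / s) - \<eta> ((c - t) / s))\<bar> \<le> D.bd * l / s * \<bar>b x\<bar>"
    proof (cases "x \<in> {c..<c + l}")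
      case True
      have "\<bar>\<eta> ((x - t) / s) - \<eta> ((c - t) / s)\<bar> \<le> D.bd * \<bar>(x - t) / s - (c - t) / s\<bar>" by (rule lipschitz)
      also have "(x - t) / s - (c - t) / s = (x - c) / s" by (simp add: diff_divide_distrib)
      also have "D.bd * \<bar>(x - c) / s\<bar> \<le> D.bd * (l / s)"
        using True s D.bd_pos by (intro mult_left_mono) (auto simp: divide_right_mono)
      finally have "\<bar>b x\<bar> * \<bar>\<eta> ((x - t) / s) - \<eta> ((c - t) / s)\<bar> \<le> \<bar>b x\<bar> * (D.bd * (l / s))"
        by (rule mult_left_mono) simp
      then show ?thesis by (simp add: abs_mult ac_simps)
    qed (simp add: supp_b)
  qed (use b in auto)
  also have "\<dots> \<le> D.bd * l / s * K" using K s l D.bd_pos by (simp add: mult_left_mono divide_right_mono)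
  finally have "\<bar>cwt \<eta> b s t\<bar> \<le> (1 / s) * (D.bd * l / s * K)" 
    unfolding eq abs_mult using s by (simp only: abs_of_pos zero_less_divide_1_iff) (rule mult_left_mono, auto)
  then show ?thesis using True s by (simp add: power2_eq_square ac_simps)
qed

end

lemma disjoint_ivl_sum:
  assumes B: "finite B" "disjoint_family_on ivl B" "\<And>i. i \<in> B \<Longrightarrow> 0 < snd i" "\<And>i. i \<in> B \<Longrightarrow> ivl i \<subseteq> {a..b}" and ab: "a \<le> b"
  shows "(\<Sum>i\<in>B. snd i) \<le> b - a"
proof -
  have "ennreal (\<Sum>i\<in>B. snd i) = (\<Sum>i\<in>B. ennreal (snd i))" using B(3) by (intro sum_ennreal[symmetric]) (auto intro: less_imp_le)
  also have "\<dots> = (\<Sum>i\<in>B. emeasure lborel (ivl i))" 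
  proof (intro sum.cong refl)
    fix i assume "i \<in> B"
    then show "ennreal (snd i) = emeasure lborel (ivl i)" using B(3)[of i] by simp
  qed
  also have "\<dots> = emeasure lborel (\<Union>i\<in>B. ivl i)" by (rule sum_emeasure) (use B in auto)
  also have "\<dots> \<le> emeasure lborel {a..b}" using B(4) by (intro emeasure_mono UN_least) auto
  also have "\<dots> = ennreal (b - a)" using ab by simp
  finally show ?thesis using ab by (simp add: ennreal_le_iff)
qed

text \<open>At scale s > l the section of the cone has length 4s, leaving the integral of 4 l^2 /
  s^2 over s > l, which equals 4l. A single atom thus costs a multiple of the length of its
  interval.\<close>

lemma nn_cone_integral:
  assumes l: "l > 0"
  shows "(\<integral>\<^sup>+t. \<integral>\<^sup>+s. ennreal (l\<^sup>2 / s\<^sup>2 * (if l < s \<and> \<bar>t - c\<bar> \<le> 2 * s then 1 else 0) / s) * indicator {0<..} s \<partial>lborel \<partial>lborel) \<le> ennreal (4 * l)"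
proof -
  have "(\<integral>\<^sup>+t. \<integral>\<^sup>+s. ennreal (l\<^sup>2 / s\<^sup>2 * (if l < s \<and> \<bar>t - c\<bar> \<le> 2 * s then 1 else 0) / s) * indicator {0<..} s \<partial>lborel \<partial>lborel)
    = (\<integral>\<^sup>+s. \<integral>\<^sup>+t. ennreal (l\<^sup>2 / s\<^sup>2 * (if l < s \<and> \<bar>t - c\<bar> \<le> 2 * s then 1 else 0) / s) * indicator {0<..} s \<partial>lborel \<partial>lborel)"
    by (rule lborel_pair.Fubini') measurable
  also have "\<dots> \<le> (\<integral>\<^sup>+s. ennreal (4 * l\<^sup>2) * (ennreal (s powr (-2)) * indicator {l..} s) \<partial>lborel)"
  proof (rule nn_integral_mono)
    fix s
    show "(\<integral>\<^sup>+t. ennreal (l\<^sup>2 / s\<^sup>2 * (if l < s \<and> \<bar>t - c\<bar> \<le> 2 * s then 1 else 0) / s) * indicator {0<..} s \<partial>lborel)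
      \<le> ennreal (4 * l\<^sup>2) * (ennreal (s powr (-2)) * indicator {l..} s)"
    proof (cases "l < s")
      case True
      then have s: "s > 0" using l by simp
      have "(\<integral>\<^sup>+t. ennreal (l\<^sup>2 / s\<^sup>2 * (if l < s \<and> \<bar>t - c\<bar> \<le> 2 * s then 1 else 0) / s) * indicator {0<..} s \<partial>lborel)
        = (\<integral>\<^sup>+t. ennreal (l\<^sup>2 / s\<^sup>2 / s) * indicator {c - 2 * s..c + 2 * s} t \<partial>lborel)"
        using True s by (intro nn_integral_cong) (auto simp: abs_le_iff split: split_indicator)
      also have "\<dots> = ennreal (l\<^sup>2 / s\<^sup>2 / s) * ennreal (4 * s)"
        using s by (subst nn_integral_cmult_indicator) auto
      also have "\<dots> = ennreal (4 * l\<^sup>2 * s powr (-2))"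
        using s by (simp add: ennreal_mult[symmetric] powr_minus_divide powr_numeral)
      also have "\<dots> = ennreal (4 * l\<^sup>2) * ennreal (s powr (-2))" by (rule ennreal_mult) auto
      finally show ?thesis using True by simp
    qed simp
  qed
  also have "\<dots> = ennreal (4 * l\<^sup>2) * ennreal (1 / l)"
    using nn_integral_powr_near_inf[of "-2" l] l by (subst nn_integral_cmult) (auto simp: powr_minus_divide)
  also have "\<dots> = ennreal (4 * l)" using l by (simp add: ennreal_mult[symmetric] power2_eq_square)
  finally show ?thesis .
qed

context smooth_wavelet begin

text \<open>The atoms satisfy |W| <= 4 D.bd l a_i with a_i supported in a cone. The sum of the a_i
  is bounded at each (s, t), so one factor of the square is replaced by that bound and the other is
  integrated atom by atom: 96 = 16 * 6 and 384 = 96 * 4.\<close>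

lemma sqf_bad:
  fixes b :: "real \<times> real \<Rightarrow> real \<Rightarrow> real"
  assumes B: "finite B" "disjoint_family_on ivl B" "\<And>i. i \<in> B \<Longrightarrow> 0 < snd i"
    and b: "\<And>i. i \<in> B \<Longrightarrow> integrable lborel (b i)" "\<And>i x. i \<in> B \<Longrightarrow> x \<notin> ivl i \<Longrightarrow> b i x = 0"
      "\<And>i. i \<in> B \<Longrightarrow> (LINT x|lborel. b i x) = 0"
      "\<And>i. i \<in> B \<Longrightarrow> (LINT x|lborel. \<bar>b i x\<bar>) \<le> 4 * l * snd i" and l: "l > 0"
  shows "(\<integral>\<^sup>+t\<in>- (\<Union>i\<in>B. {fst i - snd i..fst i + 2 * snd i}). sqf \<eta> (\<lambda>x. \<Sum>i\<in>B. b i x) {0<..} t \<partial>lborel)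
    \<le> ennreal (384 * D.bd\<^sup>2 * l\<^sup>2 * (\<Sum>i\<in>B. snd i))"
proof -
  define \<Omega> where "\<Omega> = (\<Union>i\<in>B. {fst i - snd i..fst i + 2 * snd i})"
  define a where "a i s t = (snd i)\<^sup>2 / s\<^sup>2 * (if snd i < s \<and> \<bar>t - fst i\<bar> \<le> 2 * s then 1 else 0 :: real)" for i s t
  have a0: "a i s t \<ge> 0" for i s t by (simp add: a_def)
  have lin: "cwt \<eta> (\<lambda>x. \<Sum>i\<in>B. b i x) s t = (\<Sum>i\<in>B. cwt \<eta> (b i) s t)" for s t
    unfolding cwt_def sum_distrib_right sum_distrib_left[symmetric]
    by (subst Bochner_Integration.integral_sum) (auto intro: cwt_integrand_integrable b)
  have pt: "(cwt \<eta> (\<lambda>x. \<Sum>i\<in>B. b i x) s t)\<^sup>2 \<le> 96 * D.bd\<^sup>2 * l\<^sup>2 * (\<Sum>i\<in>B. a i s t)"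
    if t: "t \<notin> \<Omega>" and s: "s > 0" for s t
  proof -
    have "\<bar>cwt \<eta> (b i) s t\<bar> \<le> 4 * D.bd * l * a i s t" if i: "i \<in> B" for i
    proof -
      have "\<bar>cwt \<eta> (b i) s t\<bar> \<le> D.bd * (4 * l * snd i) * snd i / s\<^sup>2 * (if snd i < s \<and> \<bar>t - fst i\<bar> \<le> 2 * s then 1 else 0)"
        using t i by (intro cwt_atom b s B) (auto simp: \<Omega>_def)
      then show ?thesis by (simp add: a_def power2_eq_square ac_simps)
    qed
    then have 1: "\<bar>\<Sum>i\<in>B. cwt \<eta> (b i) s t\<bar> \<le> 4 * D.bd * l * (\<Sum>i\<in>B. a i s t)"
      by (auto simp: sum_distrib_left intro!: order_trans[OF sum_abs] sum_mono)
    \<comment> \<open>Active intervals are disjoint, shorter than s and contained in the ball of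
      radius 3s about t, so their total length is at most 6s; and (length/s)^2 <= length/s.\<close>
    have 2: "(\<Sum>i\<in>B. a i s t) \<le> 6"
    proof -
      let ?C = "{i\<in>B. snd i < s \<and> \<bar>t - fst i\<bar> \<le> 2 * s}"
      have "(\<Sum>i\<in>B. a i s t) = (\<Sum>i\<in>?C. (snd i)\<^sup>2 / s\<^sup>2)"
        by (rule sum.mono_neutral_cong_right) (use B in \<open>auto simp: a_def\<close>)
      also have "\<dots> \<le> (\<Sum>i\<in>?C. snd i / s)"
      proof (rule sum_mono)
        fix i assume "i \<in> ?C"
        then have "snd i / s \<le> 1" "snd i / s \<ge> 0" using s B(3)[of i] by (auto simp: less_imp_le)
        then have "(snd i / s) * (snd i / s) \<le> snd i / s" by (rule mult_left_le)
        then show "(snd i)\<^sup>2 / s\<^sup>2 \<le> snd i / s" by (simp add: power2_eq_square)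
      qed
      also have "\<dots> = (\<Sum>i\<in>?C. snd i) / s" by (simp add: sum_divide_distrib)
      also have "\<dots> \<le> ((t + 3 * s) - (t - 3 * s)) / s"
      proof (intro divide_right_mono disjoint_ivl_sum)
        show "disjoint_family_on ivl ?C" by (rule disjoint_family_on_mono[OF _ B(2)]) auto
        show "ivl i \<subseteq> {t - 3 * s..t + 3 * s}" if "i \<in> ?C" for i using that B(3)[of i] by auto
      qed (use B s in auto)
      also have "\<dots> = 6" using s by simp
      finally show ?thesis .
    qed
    have "(cwt \<eta> (\<lambda>x. \<Sum>i\<in>B. b i x) s t)\<^sup>2 \<le> (4 * D.bd * l * (\<Sum>i\<in>B. a i s t))\<^sup>2"
      unfolding lin using 1 by (meson abs_ge_self abs_le_square_iff order_trans)
    also have "\<dots> = 16 * D.bd\<^sup>2 * l\<^sup>2 * (\<Sum>i\<in>B. a i s t) * (\<Sum>i\<in>B. a i s t)" by (simp add: power2_eq_square)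
    also have "\<dots> \<le> 16 * D.bd\<^sup>2 * l\<^sup>2 * (\<Sum>i\<in>B. a i s t) * 6"
      by (rule mult_left_mono[OF 2]) (simp add: sum_nonneg a0)
    finally show ?thesis by simp
  qed
  let ?E = "\<lambda>i t s. ennreal (a i s t / s) * indicator {0<..} s"
  have [measurable]: "(\<lambda>t. a i s t) \<in> borel_measurable borel" "(\<lambda>s. a i s t) \<in> borel_measurable borel" for i s t
    unfolding a_def by measurable
  have [measurable]: "(\<lambda>(s, t). a i s t) \<in> borel_measurable (borel \<Otimes>\<^sub>M borel)" "(\<lambda>(t, s). a i s t) \<in> borel_measurable (borel \<Otimes>\<^sub>M borel)" for i
    unfolding a_def by measurable
  have "(\<integral>\<^sup>+t\<in>- \<Omega>. sqf \<eta> (\<lambda>x. \<Sum>i\<in>B. b i x) {0<..} t \<partial>lborel)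
    \<le> (\<integral>\<^sup>+t. ennreal (96 * D.bd\<^sup>2 * l\<^sup>2) * (\<Sum>i\<in>B. \<integral>\<^sup>+s. ?E i t s \<partial>lborel) \<partial>lborel)"
  proof (rule nn_integral_mono)
    fix t
    show "sqf \<eta> (\<lambda>x. \<Sum>i\<in>B. b i x) {0<..} t * indicator (- \<Omega>) t \<le> ennreal (96 * D.bd\<^sup>2 * l\<^sup>2) * (\<Sum>i\<in>B. \<integral>\<^sup>+s. ?E i t s \<partial>lborel)"
    proof (cases "t \<in> \<Omega>")
      case False
      have "sqf \<eta> (\<lambda>x. \<Sum>i\<in>B. b i x) {0<..} t \<le> (\<integral>\<^sup>+s. ennreal (96 * D.bd\<^sup>2 * l\<^sup>2) * (\<Sum>i\<in>B. ?E i t s) \<partial>lborel)"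
        unfolding sqf_def
      proof (rule nn_integral_mono)
        fix s
        show "ennreal ((cwt \<eta> (\<lambda>x. \<Sum>i\<in>B. b i x) s t)\<^sup>2 / s) * indicator {0<..} s \<le> ennreal (96 * D.bd\<^sup>2 * l\<^sup>2) * (\<Sum>i\<in>B. ?E i t s)"
        proof (cases "s > 0")
          case True
          have "(cwt \<eta> (\<lambda>x. \<Sum>i\<in>B. b i x) s t)\<^sup>2 / s \<le> 96 * D.bd\<^sup>2 * l\<^sup>2 * (\<Sum>i\<in>B. a i s t) / s"
            by (rule divide_right_mono[OF pt[OF False True]]) (use True in simp)
          also have "\<dots> = 96 * D.bd\<^sup>2 * l\<^sup>2 * (\<Sum>i\<in>B. a i s t / s)" by (simp only: sum_divide_distrib[symmetric] times_divide_eq_right)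
          finally have "ennreal ((cwt \<eta> (\<lambda>x. \<Sum>i\<in>B. b i x) s t)\<^sup>2 / s) \<le> ennreal (96 * D.bd\<^sup>2 * l\<^sup>2 * (\<Sum>i\<in>B. a i s t / s))"
            by (rule ennreal_leI)
          also have "\<dots> = ennreal (96 * D.bd\<^sup>2 * l\<^sup>2) * (\<Sum>i\<in>B. ennreal (a i s t / s))"
            using True a0 by (subst sum_ennreal) (auto intro!: ennreal_mult sum_nonneg)
          finally show ?thesis using True by simp
        qed simp
      qed
      also have "\<dots> = ennreal (96 * D.bd\<^sup>2 * l\<^sup>2) * (\<integral>\<^sup>+s. (\<Sum>i\<in>B. ?E i t s) \<partial>lborel)"
        by (rule nn_integral_cmult) measurable
      also have "(\<integral>\<^sup>+s. (\<Sum>i\<in>B. ?E i t s) \<partial>lborel) = (\<Sum>i\<in>B. \<integral>\<^sup>+s. ?E i t s \<partial>lborel)"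
        by (rule nn_integral_sum) measurable
      finally show ?thesis using False by simp
    qed simp
  qed
  also have "\<dots> = ennreal (96 * D.bd\<^sup>2 * l\<^sup>2) * (\<integral>\<^sup>+t. (\<Sum>i\<in>B. \<integral>\<^sup>+s. ?E i t s \<partial>lborel) \<partial>lborel)"
    by (rule nn_integral_cmult) measurable
  also have "(\<integral>\<^sup>+t. (\<Sum>i\<in>B. \<integral>\<^sup>+s. ?E i t s \<partial>lborel) \<partial>lborel) = (\<Sum>i\<in>B. \<integral>\<^sup>+t. \<integral>\<^sup>+s. ?E i t s \<partial>lborel \<partial>lborel)"
    by (rule nn_integral_sum) measurable
  also have "ennreal (96 * D.bd\<^sup>2 * l\<^sup>2) * \<dots> \<le> ennreal (96 * D.bd\<^sup>2 * l\<^sup>2) * (\<Sum>i\<in>B. ennreal (4 * snd i))"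
    by (intro mult_left_mono sum_mono) (use nn_cone_integral B(3) in \<open>auto simp: a_def\<close>)
  also have "\<dots> = ennreal (96 * D.bd\<^sup>2 * l\<^sup>2) * ennreal (4 * (\<Sum>i\<in>B. snd i))"
    using B(3) by (subst sum_ennreal) (auto simp: sum_distrib_left intro: less_imp_le)
  also have "\<dots> = ennreal (384 * D.bd\<^sup>2 * l\<^sup>2 * (\<Sum>i\<in>B. snd i))"
  proof -
    have "0 \<le> (\<Sum>i\<in>B. snd i)" by (intro sum_nonneg less_imp_le B(3))
    then show ?thesis by (subst ennreal_mult[symmetric]) (auto simp: mult.assoc)
  qed
  finally show ?thesis by (simp add: \<Omega>_def)
qed

lemma sqf_add_le:
  assumes f: "integrable lborel f" and g: "integrable lborel g"
  shows "sqf \<eta> (\<lambda>x. f x + g x) {0<..} t \<le> 2 * sqf \<eta> f {0<..} t + 2 * sqf \<eta> g {0<..} t"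
proof -
  have [measurable]: "f \<in> borel_measurable borel" "g \<in> borel_measurable borel"
    using borel_measurable_integrable[OF f] borel_measurable_integrable[OF g] by auto
  have "sqf \<eta> (\<lambda>x. f x + g x) {0<..} t \<le> (\<integral>\<^sup>+s. 2 * (ennreal ((cwt \<eta> f s t)\<^sup>2 / s) * indicator {0<..} s) + 2 * (ennreal ((cwt \<eta> g s t)\<^sup>2 / s) * indicator {0<..} s) \<partial>lborel)"
    unfolding sqf_def
  proof (rule nn_integral_mono)
    fix s
    show "ennreal ((cwt \<eta> (\<lambda>x. f x + g x) s t)\<^sup>2 / s) * indicator {0<..} s
      \<le> 2 * (ennreal ((cwt \<eta> f s t)\<^sup>2 / s) * indicator {0<..} s) + 2 * (ennreal ((cwt \<eta> g s t)\<^sup>2 / s) * indicator {0<..} s)"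
    proof (cases "s > 0")
      case True
      have "cwt \<eta> (\<lambda>x. f x + g x) s t = cwt \<eta> f s t + cwt \<eta> g s t"
        using cwt_integrand_integrable[OF f] cwt_integrand_integrable[OF g]
        by (simp add: cwt_def distrib_right add_divide_distrib)
      then have "(cwt \<eta> (\<lambda>x. f x + g x) s t)\<^sup>2 \<le> 2 * (cwt \<eta> f s t)\<^sup>2 + 2 * (cwt \<eta> g s t)\<^sup>2"
        using sum_squares_bound[of "cwt \<eta> f s t" "cwt \<eta> g s t"] by (simp add: power2_sum)
      then have "(cwt \<eta> (\<lambda>x. f x + g x) s t)\<^sup>2 / s \<le> 2 * ((cwt \<eta> f s t)\<^sup>2 / s) + 2 * ((cwt \<eta> g s t)\<^sup>2 / s)"
        using True by (simp add: field_simps)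
      then have "ennreal ((cwt \<eta> (\<lambda>x. f x + g x) s t)\<^sup>2 / s) \<le> ennreal (2 * ((cwt \<eta> f s t)\<^sup>2 / s)) + ennreal (2 * ((cwt \<eta> g s t)\<^sup>2 / s))"
        using True by (intro ennreal_le_add) auto
      moreover have two: "ennreal (2 * a) = 2 * ennreal a" if "a \<ge> 0" for a using that ennreal_mult[of 2 a] by simp
      moreover have n: "0 \<le> (cwt \<eta> h s t)\<^sup>2 / s" for h using True by simp
      ultimately have "ennreal ((cwt \<eta> (\<lambda>x. f x + g x) s t)\<^sup>2 / s) \<le> 2 * ennreal ((cwt \<eta> f s t)\<^sup>2 / s) + 2 * ennreal ((cwt \<eta> g s t)\<^sup>2 / s)"
        by (simp only: two[OF n])
      then show ?thesis using True by simp
    qed simp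
  qed
  also have "\<dots> = 2 * sqf \<eta> f {0<..} t + 2 * sqf \<eta> g {0<..} t"
    unfolding sqf_def by (subst nn_integral_add) (auto simp: nn_integral_cmult)
  finally show ?thesis .
qed

text \<open>Calderon--Zygmund decomposition of f at level l: the tripled intervals are discarded,
  and Chebyshev is applied outside them, with the L^2 bound for the good part and
  \<open>sqf_bad\<close> for the atoms. Unlike a plain weak type estimate, the right side retains
  only the part of |f| above l/2 and the part of f^2 below 2l, and can therefore be integrated over
  all levels.\<close>

lemma sqf_level:
  assumes f: "test_fun f" and cf: "continuous_on UNIV f" and l: "l > 0"
  shows "emeasure lborel {t. ennreal (l\<^sup>2) < sqf \<eta> f {0<..} t}
    \<le> ennreal (6 + 256 * bd\<^sup>2 + 1536 * D.bd\<^sup>2) * (ennreal (1 / l) * (\<integral>\<^sup>+x\<in>{x. l / 2 < \<bar>f x\<bar>}. ennreal \<bar>f x\<bar> \<partial>lborel))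
      + ennreal (32 * bd\<^sup>2) * (ennreal (1 / l\<^sup>2) * (\<integral>\<^sup>+x\<in>{x. \<bar>f x\<bar> \<le> 2 * l}. ennreal (\<bar>f x\<bar>\<^sup>2) \<partial>lborel))"
proof -
  have [measurable]: "f \<in> borel_measurable borel" using f by (simp add: test_fun_def)
  have fi: "integrable lborel f" by (rule test_fun_integrable[OF f])
  define g where "g x = \<bar>f x\<bar>" for x
  have [measurable]: "g \<in> borel_measurable borel" unfolding g_def by measurable
  have gi: "integrable lborel g" using fi unfolding g_def by simp
  have "test_fun g" using f by (auto simp: test_fun_def g_def)
  moreover have "continuous_on UNIV g" unfolding g_def by (intro continuous_intros cf)
  ultimately obtain B where "cz g l UNIV B"
    using cz_exists[of g l] l by (auto simp: g_def)
  then have B: "finite B" "disjoint_family_on ivl B" "\<And>i. i \<in> B \<Longrightarrow> 0 < snd i"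
    and Blo: "\<And>i. i \<in> B \<Longrightarrow> l * snd i < (LINT x:ivl i|lborel. g x)"
    and Bhi: "\<And>i. i \<in> B \<Longrightarrow> (LINT x:ivl i|lborel. g x) \<le> 2 * l * snd i"
    and Bout: "\<And>x. x \<notin> (\<Union>i\<in>B. ivl i) \<Longrightarrow> g x \<le> 2 * l"
    unfolding cz_def by auto
  define L where "L = (\<Sum>i\<in>B. snd i)"
  have L0: "L \<ge> 0" unfolding L_def by (intro sum_nonneg less_imp_le B(3))
  have seti: "integrable lborel (\<lambda>x. indicator (ivl i) x * h x)" if "integrable lborel h" for i and h :: "real \<Rightarrow> real"
    using integrable_mult_indicator[of "ivl i" lborel h] that by simp
  text \<open>Only the part of the function above half the level contributes to the selected intervals.\<close>
  have Lb: "ennreal L \<le> ennreal (2 / l) * (\<integral>\<^sup>+x\<in>{x. l / 2 < \<bar>f x\<bar>}. ennreal \<bar>f x\<bar> \<partial>lborel)"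
  proof -
    have one: "ennreal (snd i) \<le> ennreal (2 / l) * (\<integral>\<^sup>+x. (ennreal \<bar>f x\<bar> * indicator {x. l / 2 < \<bar>f x\<bar>} x) * indicator (ivl i) x \<partial>lborel)" if i: "i \<in> B" for i
    proof -
      let ?h = "\<lambda>x. g x * indicator {x. l / 2 < \<bar>f x\<bar>} x"
      have hi: "integrable lborel ?h"
        by (rule Bochner_Integration.integrable_bound[OF gi]) (auto split: split_indicator)
      have "(LINT x:ivl i|lborel. g x) \<le> (LINT x|lborel. indicator (ivl i) x * ?h x + l / 2 * indicator (ivl i) x)"
        unfolding set_lebesgue_integral_def
      proof (rule integral_mono)
        show "integrable lborel (\<lambda>x. indicator (ivl i) x *\<^sub>R g x)" using seti[OF gi] by simp
        show "integrable lborel (\<lambda>x. indicator (ivl i) x * ?h x + l / 2 * indicator (ivl i) x)"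
          using B(3)[OF i] by (intro Bochner_Integration.integrable_add seti hi integrable_mult_right integrable_real_indicator) auto
        show "indicator (ivl i) x *\<^sub>R g x \<le> indicator (ivl i) x * ?h x + l / 2 * indicator (ivl i) x" for x
          using l by (auto simp: g_def split: split_indicator)
      qed
      also have "\<dots> = (LINT x|lborel. indicator (ivl i) x * ?h x) + l / 2 * snd i"
      proof -
        have i2: "integrable lborel (\<lambda>x. l / 2 * indicator (ivl i) x)"
          using B(3)[OF i] by (intro integrable_mult_right integrable_real_indicator) auto
        show ?thesis
          unfolding Bochner_Integration.integral_add[OF seti[OF hi] i2] using B(3)[OF i] by (simp add: measure_def)
      qed
      finally have "snd i \<le> 2 / l * (LINT x|lborel. indicator (ivl i) x * ?h x)"
        using Blo[OF i] l by (simp add: field_simps)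
      then have "ennreal (snd i) \<le> ennreal (2 / l * (LINT x|lborel. indicator (ivl i) x * ?h x))" by (rule ennreal_leI)
      also have "\<dots> = ennreal (2 / l) * ennreal (LINT x|lborel. indicator (ivl i) x * ?h x)"
        using l by (intro ennreal_mult integral_nonneg_AE) (auto simp: g_def split: split_indicator)
      also have "ennreal (LINT x|lborel. indicator (ivl i) x * ?h x) = (\<integral>\<^sup>+x. ennreal (indicator (ivl i) x * ?h x) \<partial>lborel)"
        by (rule nn_integral_eq_integral[symmetric, OF seti[OF hi]]) (auto simp: g_def split: split_indicator)
      also have "\<dots> = (\<integral>\<^sup>+x. (ennreal \<bar>f x\<bar> * indicator {x. l / 2 < \<bar>f x\<bar>} x) * indicator (ivl i) x \<partial>lborel)"
        by (intro nn_integral_cong) (auto simp: g_def split: split_indicator)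
      finally show ?thesis .
    qed
    have "ennreal L = (\<Sum>i\<in>B. ennreal (snd i))" unfolding L_def by (intro sum_ennreal[symmetric] less_imp_le B(3))
    also have "\<dots> \<le> (\<Sum>i\<in>B. ennreal (2 / l) * (\<integral>\<^sup>+x. (ennreal \<bar>f x\<bar> * indicator {x. l / 2 < \<bar>f x\<bar>} x) * indicator (ivl i) x \<partial>lborel))"
      by (intro sum_mono one)
    also have "\<dots> = ennreal (2 / l) * (\<integral>\<^sup>+x. (\<Sum>i\<in>B. (ennreal \<bar>f x\<bar> * indicator {x. l / 2 < \<bar>f x\<bar>} x) * indicator (ivl i) x) \<partial>lborel)"
      by (subst nn_integral_sum) (auto simp: sum_distrib_left)
    also have "\<dots> \<le> ennreal (2 / l) * (\<integral>\<^sup>+x\<in>{x. l / 2 < \<bar>f x\<bar>}. ennreal \<bar>f x\<bar> \<partial>lborel)"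
    proof (intro mult_left_mono nn_integral_mono)
      fix x
      have "(\<Sum>i\<in>B. indicator (ivl i) x :: ennreal) = indicator (\<Union>i\<in>B. ivl i) x"
        using B(1,2) by (rule indicator_UN_disjoint[symmetric])
      also have "\<dots> \<le> 1" by (simp split: split_indicator)
      finally show "(\<Sum>i\<in>B. (ennreal \<bar>f x\<bar> * indicator {x. l / 2 < \<bar>f x\<bar>} x) * indicator (ivl i) x) \<le> ennreal \<bar>f x\<bar> * indicator {x. l / 2 < \<bar>f x\<bar>} x"
        unfolding sum_distrib_left[symmetric] by (rule mult_left_le) simp
    qed simp
    finally show ?thesis .
  qed
  \<comment> \<open>On each selected interval f is replaced by its mean: the differences are the
    atoms, and what remains is bounded by 2l there.\<close>
  define av where "av i = (LINT x:ivl i|lborel. f x) / snd i" for i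
  define b where "b i x = indicator (ivl i) x * (f x - av i)" for i x
  define G where "G x = f x - (\<Sum>i\<in>B. b i x)" for x
  have intf: "\<bar>LINT x:ivl i|lborel. f x\<bar> \<le> (LINT x:ivl i|lborel. g x)" for i
    unfolding set_lebesgue_integral_def
    by (rule abs_integral_le) (use seti[OF gi] in \<open>auto simp: g_def split: split_indicator\<close>)
  have av: "\<bar>av i\<bar> \<le> 2 * l" if "i \<in> B" for i
    using intf[of i] Bhi[OF that] B(3)[OF that] by (simp add: av_def abs_divide field_simps)
  have ci: "integrable lborel (\<lambda>x. indicator (ivl i) x * c)" if "i \<in> B" for i and c :: real
    using B(3)[OF that] by (intro integrable_mult_left integrable_real_indicator) auto
  have bi: "integrable lborel (b i)" if "i \<in> B" for i
    unfolding b_def right_diff_distrib by (intro Bochner_Integration.integrable_diff seti fi ci that)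
  have b0: "(LINT x|lborel. b i x) = 0" if "i \<in> B" for i
  proof -
    have "(LINT x|lborel. b i x) = (LINT x|lborel. indicator (ivl i) x * f x) - (LINT x|lborel. indicator (ivl i) x * av i)"
      unfolding b_def right_diff_distrib by (intro Bochner_Integration.integral_diff seti fi ci that)
    also have "(LINT x|lborel. indicator (ivl i) x * av i) = snd i * av i" using B(3)[OF that] by (simp add: measure_def)
    finally show ?thesis using B(3)[OF that] by (simp add: av_def set_lebesgue_integral_def)
  qed
  have b1: "(LINT x|lborel. \<bar>b i x\<bar>) \<le> 4 * l * snd i" if "i \<in> B" for i
  proof -
    have "(LINT x|lborel. \<bar>b i x\<bar>) \<le> (LINT x|lborel. indicator (ivl i) x * g x + indicator (ivl i) x * (2 * l))"
    proof (rule integral_mono)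
      show "\<bar>b i x\<bar> \<le> indicator (ivl i) x * g x + indicator (ivl i) x * (2 * l)" for x
        using av[OF that] by (auto simp: b_def g_def split: split_indicator)
    qed (use that bi in \<open>auto intro!: Bochner_Integration.integrable_add seti gi ci[OF that]\<close>)
    also have "\<dots> = (LINT x:ivl i|lborel. g x) + snd i * (2 * l)"
      unfolding Bochner_Integration.integral_add[OF seti[OF gi] ci[OF that]]
      using B(3)[OF that] by (simp add: set_lebesgue_integral_def measure_def)
    also have "\<dots> \<le> 4 * l * snd i" using Bhi[OF that] by (simp add: algebra_simps)
    finally show ?thesis .
  qed
  have bsum: "integrable lborel (\<lambda>x. \<Sum>i\<in>B. b i x)" by (intro Bochner_Integration.integrable_sum bi)
  have Gi: "integrable lborel G" unfolding G_def by (intro Bochner_Integration.integrable_diff fi bsum)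
  \<comment> \<open>The good part equals a mean of size at most 2l on a selected interval, and f
    itself, then at most 2l, off the family.\<close>
  have G2: "(G x)\<^sup>2 \<le> \<bar>f x\<bar>\<^sup>2 * indicator {x. \<bar>f x\<bar> \<le> 2 * l} x + 4 * l\<^sup>2 * (\<Sum>i\<in>B. indicator (ivl i) x)" for x
  proof (cases "x \<in> (\<Union>i\<in>B. ivl i)")
    case True
    then obtain i where i: "i \<in> B" "x \<in> ivl i" by blast
    have ne: "x \<notin> ivl j" if "j \<in> B - {i}" for j using B(2) that i unfolding disjoint_family_on_def by blast
    have "(\<Sum>j\<in>B. b j x) = b i x + (\<Sum>j\<in>B - {i}. b j x)" by (rule sum.remove[OF B(1) i(1)])
    also have "(\<Sum>j\<in>B - {i}. b j x) = 0" using ne by (intro sum.neutral) (auto simp: b_def)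
    finally have "G x = av i" using i by (simp add: G_def b_def)
    then have "\<bar>G x\<bar> \<le> \<bar>2 * l\<bar>" using av[OF i(1)] l by simp
    then have "(G x)\<^sup>2 \<le> (2 * l)\<^sup>2" by (simp only: abs_le_square_iff)
    moreover have "(\<Sum>j\<in>B. indicator (ivl j) x :: real) \<ge> indicator (ivl i) x"
      by (rule member_le_sum[OF i(1)]) (use B(1) in auto)
    then have "4 * l\<^sup>2 * 1 \<le> 4 * l\<^sup>2 * (\<Sum>j\<in>B. indicator (ivl j) x)" using i by (intro mult_left_mono) auto
    moreover have "0 \<le> \<bar>f x\<bar>\<^sup>2 * indicator {x. \<bar>f x\<bar> \<le> 2 * l} x" by simp
    moreover have "(2 * l)\<^sup>2 = 4 * l\<^sup>2 * 1" by (simp add: power_mult_distrib)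
    ultimately show ?thesis by linarith
  next
    case False
    then have "(\<Sum>j\<in>B. b j x) = 0" by (intro sum.neutral) (auto simp: b_def)
    then have "G x = f x" by (simp add: G_def)
    moreover have "\<bar>f x\<bar> \<le> 2 * l" using Bout[OF False] by (simp add: g_def)
    ultimately show ?thesis by (simp add: sum_nonneg)
  qed
  let ?F2 = "\<integral>\<^sup>+x\<in>{x. \<bar>f x\<bar> \<le> 2 * l}. ennreal (\<bar>f x\<bar>\<^sup>2) \<partial>lborel"
  have Gnn: "(\<integral>\<^sup>+x. ennreal ((G x)\<^sup>2) \<partial>lborel) \<le> ?F2 + ennreal (4 * l\<^sup>2 * L)"
  proof -
    have "(\<integral>\<^sup>+x. ennreal ((G x)\<^sup>2) \<partial>lborel) \<le> (\<integral>\<^sup>+x. ennreal (\<bar>f x\<bar>\<^sup>2) * indicator {x. \<bar>f x\<bar> \<le> 2 * l} x + ennreal (4 * l\<^sup>2) * (\<Sum>i\<in>B. indicator (ivl i) x) \<partial>lborel)"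
    proof (rule nn_integral_mono)
      fix x
      have "ennreal ((G x)\<^sup>2) \<le> ennreal (\<bar>f x\<bar>\<^sup>2 * indicator {x. \<bar>f x\<bar> \<le> 2 * l} x) + ennreal (4 * l\<^sup>2 * (\<Sum>i\<in>B. indicator (ivl i) x))"
        by (rule ennreal_le_add[OF G2]) (auto intro!: sum_nonneg mult_nonneg_nonneg)
      also have "ennreal (4 * l\<^sup>2 * (\<Sum>i\<in>B. indicator (ivl i) x)) = ennreal (4 * l\<^sup>2) * ennreal (\<Sum>i\<in>B. indicator (ivl i) x)"
        by (rule ennreal_mult) (auto intro!: sum_nonneg)
      also have "ennreal (\<Sum>i\<in>B. indicator (ivl i) x) = (\<Sum>i\<in>B. indicator (ivl i) x)"
        by (subst sum_ennreal[symmetric]) (auto simp: ennreal_indicator)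
      also have "ennreal (\<bar>f x\<bar>\<^sup>2 * indicator {x. \<bar>f x\<bar> \<le> 2 * l} x) = ennreal (\<bar>f x\<bar>\<^sup>2) * indicator {x. \<bar>f x\<bar> \<le> 2 * l} x"
        by (auto split: split_indicator)
      finally show "ennreal ((G x)\<^sup>2) \<le> ennreal (\<bar>f x\<bar>\<^sup>2) * indicator {x. \<bar>f x\<bar> \<le> 2 * l} x + ennreal (4 * l\<^sup>2) * (\<Sum>i\<in>B. indicator (ivl i) x)" .
    qed
    also have "\<dots> = ?F2 + ennreal (4 * l\<^sup>2) * (\<Sum>i\<in>B. emeasure lborel (ivl i))"
      by (subst nn_integral_add) (auto simp: nn_integral_cmult nn_integral_sum)
    also have "(\<Sum>i\<in>B. emeasure lborel (ivl i)) = (\<Sum>i\<in>B. ennreal (snd i))"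
    proof (intro sum.cong refl)
      fix i assume "i \<in> B"
      then show "emeasure lborel (ivl i) = ennreal (snd i)" using B(3)[of i] by simp
    qed
    also have "\<dots> = ennreal L" unfolding L_def by (intro sum_ennreal less_imp_le B(3))
    finally show ?thesis using L0 by (simp add: ennreal_mult)
  qed
  define \<Omega> where "\<Omega> = (\<Union>i\<in>B. {fst i - snd i..fst i + 2 * snd i})"
  have \<Omega>_sets[measurable]: "\<Omega> \<in> sets borel" unfolding \<Omega>_def using B(1) by (intro sets.finite_UN) auto
  have \<Omega>m: "emeasure lborel \<Omega> \<le> ennreal (3 * L)"
  proof -
    have "emeasure lborel \<Omega> \<le> (\<Sum>i\<in>B. emeasure lborel {fst i - snd i..fst i + 2 * snd i})"
      unfolding \<Omega>_def by (rule emeasure_subadditive_finite[OF B(1)]) auto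
    also have "\<dots> = (\<Sum>i\<in>B. ennreal (3 * snd i))"
    proof (intro sum.cong refl)
      fix i assume "i \<in> B"
      then show "emeasure lborel {fst i - snd i..fst i + 2 * snd i} = ennreal (3 * snd i)" using B(3)[of i] by simp
    qed
    also have "\<dots> = ennreal (3 * L)" unfolding L_def sum_distrib_left using B(3) by (intro sum_ennreal) (simp add: less_imp_le)
    finally show ?thesis .
  qed
  let ?S = "\<lambda>h. sqf \<eta> h {0<..}"
  have [measurable]: "G \<in> borel_measurable borel" "(\<lambda>x. \<Sum>i\<in>B. b i x) \<in> borel_measurable borel"
    using borel_measurable_integrable[OF Gi] borel_measurable_integrable[OF bsum] by auto
  have off: "(\<integral>\<^sup>+t\<in>- \<Omega>. ?S f t \<partial>lborel) \<le> 2 * (ennreal (16 * bd\<^sup>2) * (?F2 + ennreal (4 * l\<^sup>2 * L))) + 2 * ennreal (384 * D.bd\<^sup>2 * l\<^sup>2 * L)"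
  proof -
    have "(\<integral>\<^sup>+t\<in>- \<Omega>. ?S f t \<partial>lborel) \<le> (\<integral>\<^sup>+t. 2 * ?S G t + 2 * (?S (\<lambda>x. \<Sum>i\<in>B. b i x) t * indicator (- \<Omega>) t) \<partial>lborel)"
    proof (rule nn_integral_mono)
      fix t
      have "?S f t = ?S (\<lambda>x. G x + (\<Sum>i\<in>B. b i x)) t" by (simp add: G_def)
      also have "\<dots> \<le> 2 * ?S G t + 2 * ?S (\<lambda>x. \<Sum>i\<in>B. b i x) t" by (rule sqf_add_le[OF Gi bsum])
      finally show "?S f t * indicator (- \<Omega>) t \<le> 2 * ?S G t + 2 * (?S (\<lambda>x. \<Sum>i\<in>B. b i x) t * indicator (- \<Omega>) t)"
        by (auto split: split_indicator)
    qed
    also have "\<dots> = 2 * (\<integral>\<^sup>+t. ?S G t \<partial>lborel) + 2 * (\<integral>\<^sup>+t\<in>- \<Omega>. ?S (\<lambda>x. \<Sum>i\<in>B. b i x) t \<partial>lborel)"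
      by (subst nn_integral_add) (auto simp: nn_integral_cmult)
    also have "\<dots> \<le> 2 * (ennreal (16 * bd\<^sup>2) * (?F2 + ennreal (4 * l\<^sup>2 * L))) + 2 * ennreal (384 * D.bd\<^sup>2 * l\<^sup>2 * L)"
    proof (intro add_mono mult_left_mono)
      have "(\<integral>\<^sup>+t. ?S G t \<partial>lborel) \<le> ennreal (16 * bd\<^sup>2) * (\<integral>\<^sup>+x. ennreal ((G x)\<^sup>2) \<partial>lborel)" by (rule sqf_L2[OF Gi])
      also have "\<dots> \<le> ennreal (16 * bd\<^sup>2) * (?F2 + ennreal (4 * l\<^sup>2 * L))" by (intro mult_left_mono Gnn) simp
      finally show "(\<integral>\<^sup>+t. ?S G t \<partial>lborel) \<le> ennreal (16 * bd\<^sup>2) * (?F2 + ennreal (4 * l\<^sup>2 * L))" .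
      show "(\<integral>\<^sup>+t\<in>- \<Omega>. ?S (\<lambda>x. \<Sum>i\<in>B. b i x) t \<partial>lborel) \<le> ennreal (384 * D.bd\<^sup>2 * l\<^sup>2 * L)"
        unfolding \<Omega>_def L_def 
      proof (rule sqf_bad[OF B])
        show "b i x = 0" if "x \<notin> ivl i" for i x using that by (simp add: b_def)
      qed (assumption | rule bi b0 b1 l)+
    qed auto
    finally show ?thesis .
  qed
  have "emeasure lborel {t. ennreal (l\<^sup>2) < ?S f t} = (\<integral>\<^sup>+t. indicator {t. ennreal (l\<^sup>2) < ?S f t} t \<partial>lborel)"
    by (rule nn_integral_indicator[symmetric]) measurable
  also have "\<dots> \<le> (\<integral>\<^sup>+t. indicator \<Omega> t + ennreal (1 / l\<^sup>2) * (?S f t * indicator (- \<Omega>) t) \<partial>lborel)"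
  proof (rule nn_integral_mono)
    fix t
    show "indicator {t. ennreal (l\<^sup>2) < ?S f t} t \<le> indicator \<Omega> t + ennreal (1 / l\<^sup>2) * (?S f t * indicator (- \<Omega>) t)"
    proof (cases "t \<notin> \<Omega> \<and> ennreal (l\<^sup>2) < ?S f t")
      case True
      have "1 = ennreal (1 / l\<^sup>2) * ennreal (l\<^sup>2)" using l by (simp add: ennreal_mult[symmetric])
      also have "\<dots> \<le> ennreal (1 / l\<^sup>2) * ?S f t" using True by (intro mult_left_mono) auto
      finally show ?thesis using True by simp
    qed (auto split: split_indicator)
  qed
  also have "\<dots> = emeasure lborel \<Omega> + ennreal (1 / l\<^sup>2) * (\<integral>\<^sup>+t\<in>- \<Omega>. ?S f t \<partial>lborel)"
    by (subst nn_integral_add) (auto simp: nn_integral_cmult)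
  also have "\<dots> \<le> ennreal (3 * L) + ennreal (1 / l\<^sup>2) * (2 * (ennreal (16 * bd\<^sup>2) * (?F2 + ennreal (4 * l\<^sup>2 * L))) + 2 * ennreal (384 * D.bd\<^sup>2 * l\<^sup>2 * L))"
    by (intro add_mono mult_left_mono \<Omega>m off) auto
  \<comment> \<open>The 3 comes from the tripled intervals, 128 = 2 * 16 * 4 from the good part on
    the selected intervals, and 768 = 2 * 384 from the atoms. All three double when
    \<open>Lb\<close> replaces L.\<close>
  also have "\<dots> = ennreal (3 + 128 * bd\<^sup>2 + 768 * D.bd\<^sup>2) * ennreal L + ennreal (32 * bd\<^sup>2) * (ennreal (1 / l\<^sup>2) * ?F2)"
  proof -
    have two: "2 * ennreal a = ennreal (2 * a)" if "a \<ge> 0" for a using that ennreal_mult[of 2 a] by simp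
    have e1: "ennreal (1 / l\<^sup>2) * (2 * (ennreal (16 * bd\<^sup>2) * ennreal (4 * l\<^sup>2 * L))) = ennreal (128 * bd\<^sup>2 * L)"
      using l L0 by (simp add: two ennreal_mult[symmetric])
    have e2: "ennreal (1 / l\<^sup>2) * (2 * ennreal (384 * D.bd\<^sup>2 * l\<^sup>2 * L)) = ennreal (768 * D.bd\<^sup>2 * L)"
      using l L0 by (simp add: two ennreal_mult[symmetric])
    have e3: "ennreal (1 / l\<^sup>2) * (2 * (ennreal (16 * bd\<^sup>2) * ?F2)) = ennreal (32 * bd\<^sup>2) * (ennreal (1 / l\<^sup>2) * ?F2)"
    proof -
      have "2 * ennreal (16 * bd\<^sup>2) = ennreal (32 * bd\<^sup>2)" by (simp add: two)
      then have "2 * (ennreal (16 * bd\<^sup>2) * ?F2) = ennreal (32 * bd\<^sup>2) * ?F2" by (simp only: mult.assoc[symmetric])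
      then show ?thesis by (simp only: mult.left_commute)
    qed
    have "ennreal (3 * L) + (ennreal (128 * bd\<^sup>2 * L) + ennreal (768 * D.bd\<^sup>2 * L)) = ennreal (3 + 128 * bd\<^sup>2 + 768 * D.bd\<^sup>2) * ennreal L"
      using L0 by (simp add: ennreal_plus[symmetric] ennreal_mult[symmetric] algebra_simps del: ennreal_plus)
    then show ?thesis unfolding distrib_left e1 e2 e3 by (simp add: ac_simps)
  qed
  also have "\<dots> \<le> ennreal (3 + 128 * bd\<^sup>2 + 768 * D.bd\<^sup>2) * (ennreal (2 / l) * (\<integral>\<^sup>+x\<in>{x. l / 2 < \<bar>f x\<bar>}. ennreal \<bar>f x\<bar> \<partial>lborel)) + ennreal (32 * bd\<^sup>2) * (ennreal (1 / l\<^sup>2) * ?F2)"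
    by (intro add_right_mono mult_left_mono Lb) auto
  also have "ennreal (3 + 128 * bd\<^sup>2 + 768 * D.bd\<^sup>2) * (ennreal (2 / l) * (\<integral>\<^sup>+x\<in>{x. l / 2 < \<bar>f x\<bar>}. ennreal \<bar>f x\<bar> \<partial>lborel))
    = ennreal (6 + 256 * bd\<^sup>2 + 1536 * D.bd\<^sup>2) * (ennreal (1 / l) * (\<integral>\<^sup>+x\<in>{x. l / 2 < \<bar>f x\<bar>}. ennreal \<bar>f x\<bar> \<partial>lborel))"
  proof -
    have "ennreal (3 + 128 * bd\<^sup>2 + 768 * D.bd\<^sup>2) * ennreal (2 / l) = ennreal (6 + 256 * bd\<^sup>2 + 1536 * D.bd\<^sup>2) * ennreal (1 / l)"
    proof -
      have "(3 + 128 * bd\<^sup>2 + 768 * D.bd\<^sup>2) * (2 / l) = (6 + 256 * bd\<^sup>2 + 1536 * D.bd\<^sup>2) * (1 / l)"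
        using l by (simp add: field_simps)
      moreover have "ennreal (3 + 128 * bd\<^sup>2 + 768 * D.bd\<^sup>2) * ennreal (2 / l) = ennreal ((3 + 128 * bd\<^sup>2 + 768 * D.bd\<^sup>2) * (2 / l))"
        "ennreal (6 + 256 * bd\<^sup>2 + 1536 * D.bd\<^sup>2) * ennreal (1 / l) = ennreal ((6 + 256 * bd\<^sup>2 + 1536 * D.bd\<^sup>2) * (1 / l))"
        using l by (intro ennreal_mult[symmetric]; simp)+
      ultimately show ?thesis by simp
    qed
    then show ?thesis by (simp only: mult.assoc[symmetric])
  qed
  finally show ?thesis .
qed

text \<open>Integration of \<open>sqf_level\<close> against p l^(p-1) dl. The term above the level
  converges since p > 1, the one below it since p < 2. Continuity of f is what the finite selection
  of intervals requires.\<close>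

lemma sqf_Lp_lt2:
  assumes p: "1 < p" "p < 2"
  shows "\<exists>C\<ge>0. \<forall>f. test_fun f \<longrightarrow> continuous_on UNIV f \<longrightarrow> (\<integral>\<^sup>+t. ennpow (sqf \<eta> f {0<..} t) (p / 2) \<partial>lborel) \<le> ennreal C * (\<integral>\<^sup>+x. ennreal (\<bar>f x\<bar> powr p) \<partial>lborel)"
proof -
  define K1 where "K1 = 6 + 256 * bd\<^sup>2 + 1536 * D.bd\<^sup>2"
  define K2 where "K2 = 32 * bd\<^sup>2"
  have K: "K1 \<ge> 0" "K2 \<ge> 0" by (auto simp: K1_def K2_def)
  define C where "C = p * K1 * (2 powr (p - 1) / (p - 1)) + p * K2 * (2 powr (2 - p) / (2 - p))"
  have C: "C \<ge> 0" using K p by (auto simp: C_def intro!: add_nonneg_nonneg mult_nonneg_nonneg)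
  have main: "(\<integral>\<^sup>+t. ennpow (sqf \<eta> f (scales n) t) (p / 2) \<partial>lborel) \<le> ennreal C * (\<integral>\<^sup>+x. ennreal (\<bar>f x\<bar> powr p) \<partial>lborel)"
    if f: "test_fun f" and cf: "continuous_on UNIV f" for f n
  proof -
    have [measurable]: "f \<in> borel_measurable borel" using f by (simp add: test_fun_def)
    define U where "U t = enn2real (sqf \<eta> f (scales n) t)" for t
    have U0: "U t \<ge> 0" for t by (simp add: U_def)
    have sU: "sqf \<eta> f (scales n) t = ennreal (U t)" for t
      unfolding U_def by (rule sqf_scales_test_fun(2)[OF f order_refl])
    have [measurable]: "U \<in> borel_measurable borel" unfolding U_def by measurable
    let ?H = "\<lambda>l. \<integral>\<^sup>+x\<in>{x. l / 2 < \<bar>f x\<bar>}. ennreal \<bar>f x\<bar> \<partial>lborel"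
    let ?F2 = "\<lambda>l. \<integral>\<^sup>+x\<in>{x. \<bar>f x\<bar> \<le> 2 * l}. ennreal (\<bar>f x\<bar>\<^sup>2) \<partial>lborel"
    \<comment> \<open>Levels refer to the square function itself, hence the root of U; the
      truncation makes it real-valued, as \<open>layer_cake\<close> requires.\<close>
    have "(\<integral>\<^sup>+t. ennpow (sqf \<eta> f (scales n) t) (p / 2) \<partial>lborel) = (\<integral>\<^sup>+t. ennreal ((sqrt (U t)) powr p) \<partial>lborel)"
      using U0 by (intro nn_integral_cong) (simp add: sU powr_half_sqrt[symmetric] powr_powr)
    also have "\<dots> = (\<integral>\<^sup>+l\<in>{0<..}. ennreal (p * l powr (p - 1)) * emeasure lborel {t. l < sqrt (U t)} \<partial>lborel)"
      by (rule layer_cake) (use p U0 in auto)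
    also have "\<dots> \<le> (\<integral>\<^sup>+l. ennreal (p * K1) * (ennreal (l powr (p - 2)) * ?H l * indicator {0<..} l) + ennreal (p * K2) * (ennreal (l powr (p - 3)) * ?F2 l * indicator {0<..} l) \<partial>lborel)"
    proof (rule nn_integral_mono)
      fix l :: real
      show "ennreal (p * l powr (p - 1)) * emeasure lborel {t. l < sqrt (U t)} * indicator {0<..} l
        \<le> ennreal (p * K1) * (ennreal (l powr (p - 2)) * ?H l * indicator {0<..} l) + ennreal (p * K2) * (ennreal (l powr (p - 3)) * ?F2 l * indicator {0<..} l)"
      proof (cases "l > 0")
        case True
        have "{t. l < sqrt (U t)} \<subseteq> {t. ennreal (l\<^sup>2) < sqf \<eta> f {0<..} t}"
        proof
          fix t assume "t \<in> {t. l < sqrt (U t)}"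
          then have "l\<^sup>2 < (sqrt (U t))\<^sup>2" using True by (intro power_strict_mono) auto
          then have "ennreal (l\<^sup>2) < sqf \<eta> f (scales n) t" using U0 by (simp add: sU ennreal_less_iff)
          also have "\<dots> \<le> sqf \<eta> f {0<..} t" by (rule sqf_mono) (use scales_Union in auto)
          finally show "t \<in> {t. ennreal (l\<^sup>2) < sqf \<eta> f {0<..} t}" by simp
        qed
        then have "emeasure lborel {t. l < sqrt (U t)} \<le> emeasure lborel {t. ennreal (l\<^sup>2) < sqf \<eta> f {0<..} t}"
          by (rule emeasure_mono) measurable
        also have "\<dots> \<le> ennreal K1 * (ennreal (1 / l) * ?H l) + ennreal K2 * (ennreal (1 / l\<^sup>2) * ?F2 l)"
          unfolding K1_def K2_def by (rule sqf_level[OF f cf True])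
        finally have "ennreal (p * l powr (p - 1)) * emeasure lborel {t. l < sqrt (U t)}
          \<le> ennreal (p * l powr (p - 1)) * (ennreal K1 * (ennreal (1 / l) * ?H l) + ennreal K2 * (ennreal (1 / l\<^sup>2) * ?F2 l))"
          by (rule mult_left_mono) simp
        also have "\<dots> = (ennreal (p * l powr (p - 1)) * ennreal K1 * ennreal (1 / l)) * ?H l + (ennreal (p * l powr (p - 1)) * ennreal K2 * ennreal (1 / l\<^sup>2)) * ?F2 l"
          by (simp only: distrib_left mult.assoc)
        also have "ennreal (p * l powr (p - 1)) * ennreal K1 * ennreal (1 / l) = ennreal (p * K1) * ennreal (l powr (p - 2))"
        proof -
          have "l powr (p - 1) * (1 / l) = l powr (p - 2)" using True powr_diff[of l "p - 1" 1] by simp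
          then have "p * l powr (p - 1) * K1 * (1 / l) = p * K1 * l powr (p - 2)" by (simp add: ac_simps)
          then show ?thesis using p K True by (simp add: ennreal_mult[symmetric])
        qed
        also have "ennreal (p * l powr (p - 1)) * ennreal K2 * ennreal (1 / l\<^sup>2) = ennreal (p * K2) * ennreal (l powr (p - 3))"
        proof -
          have "l powr (p - 1) * (1 / l\<^sup>2) = l powr (p - 3)" using True powr_diff[of l "p - 1" 2] by (simp add: powr_numeral)
          moreover have "p * l powr (p - 1) * K2 * (1 / l\<^sup>2) = p * K2 * (l powr (p - 1) * (1 / l\<^sup>2))" by (simp only: ac_simps)
          ultimately have "p * l powr (p - 1) * K2 * (1 / l\<^sup>2) = p * K2 * l powr (p - 3)" by (simp only:)
          then show ?thesis using p K True by (simp add: ennreal_mult[symmetric])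
        qed
        finally show ?thesis using True by (simp add: mult.assoc)
      qed simp
    qed
    also have "\<dots> = ennreal (p * K1) * (\<integral>\<^sup>+l\<in>{0<..}. ennreal (l powr (p - 2)) * ?H l \<partial>lborel) + ennreal (p * K2) * (\<integral>\<^sup>+l\<in>{0<..}. ennreal (l powr (p - 3)) * ?F2 l \<partial>lborel)"
      by (subst nn_integral_add) (auto simp: nn_integral_cmult)
    also have "\<dots> = ennreal (p * K1) * (ennreal (2 powr (p - 1) / (p - 1)) * (\<integral>\<^sup>+x. ennreal (\<bar>f x\<bar> powr p) \<partial>lborel))
      + ennreal (p * K2) * (ennreal (2 powr (2 - p) / (2 - p)) * (\<integral>\<^sup>+x. ennreal (\<bar>f x\<bar> powr p) \<partial>lborel))"
      using level_integral_above[OF p(1), of "\<lambda>x. \<bar>f x\<bar>"] level_integral_below[OF p(2), of "\<lambda>x. \<bar>f x\<bar>"] by simp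
    also have "\<dots> = ennreal C * (\<integral>\<^sup>+x. ennreal (\<bar>f x\<bar> powr p) \<partial>lborel)"
    proof -
      have "ennreal C = ennreal (p * K1) * ennreal (2 powr (p - 1) / (p - 1)) + ennreal (p * K2) * ennreal (2 powr (2 - p) / (2 - p))"
        unfolding C_def using p K by (subst ennreal_plus) (simp_all add: ennreal_mult[symmetric])
      then show ?thesis by (simp only: distrib_right mult.assoc)
    qed
    finally show ?thesis .
  qed
  show ?thesis
    by (rule exI[of _ C]) (use C p main in \<open>auto intro!: sqf_Lp_from_scales simp: test_fun_def\<close>)
qed

lemma sqf_Lp_continuous:
  assumes p: "1 < p"
  shows "\<exists>C\<ge>0. \<forall>f. test_fun f \<longrightarrow> continuous_on UNIV f \<longrightarrow> (\<integral>\<^sup>+t. ennpow (sqf \<eta> f {0<..} t) (p / 2) \<partial>lborel) \<le> ennreal C * (\<integral>\<^sup>+x. ennreal (\<bar>f x\<bar> powr p) \<partial>lborel)"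
proof -
  consider "p < 2" | "p = 2" | "p > 2" by linarith
  then show ?thesis
  proof cases
    case 1 then show ?thesis using sqf_Lp_lt2[OF p] by blast
  next
    case 2 then show ?thesis using sqf_Lp_eq2 by blast
  next
    case 3 then show ?thesis using sqf_Lp_gt2 by blast
  qed
qed

end


subsection \<open>Extension to compactly supported functions in \<open>L\<^sup>p\<close>\<close>

lemma test_funI:
  assumes "f \<in> borel_measurable borel" "\<And>x. \<bar>f x\<bar> \<le> B" "\<And>x. A < \<bar>x\<bar> \<Longrightarrow> f x = 0"
  shows "test_fun f"
  using assms unfolding test_fun_def by blast

text \<open>A measurable function is an almost everywhere limit of continuous ones. Clamping these
  to [-B, B] and multiplying by a trapezoid that is 1 on [a, b] and 0 outside [a - d, b + d]
  preserves the limit and gives a common majorant.\<close>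

lemma continuous_approximation:
  fixes g :: "real \<Rightarrow> real"
  assumes [measurable]: "g \<in> borel_measurable borel" and b: "\<And>x. \<bar>g x\<bar> \<le> B * indicator {a..b} x" and d: "d > 0" and B0: "B \<ge> 0"
  obtains G where "\<And>n::nat. continuous_on UNIV (G n)" "\<And>n x. \<bar>G n x\<bar> \<le> B * indicator {a - d..b + d} x"
    "AE x in lborel. (\<lambda>n. G n x) \<longlonglongrightarrow> g x"
proof -
  have "g measurable_on UNIV"
    by (rule lebesgue_measurable_imp_measurable_on) (auto intro: measurable_completion)
  then obtain N h where N: "negligible N" and h: "\<And>n. continuous_on UNIV (h n)" and lim: "\<And>x. x \<notin> N \<Longrightarrow> (\<lambda>n. h n x) \<longlonglongrightarrow> g x"
    unfolding measurable_on_def by auto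
  define cut where "cut x = max 0 (1 - max 0 (max (a - x) (x - b)) / d)" for x
  have cut: "0 \<le> cut x" "cut x \<le> 1" for x using d by (auto simp: cut_def max_def)
  have cut1: "cut x = 1" if "x \<in> {a..b}" for x using that by (simp add: cut_def)
  have cut0: "cut x = 0" if "x \<notin> {a - d..b + d}" for x
  proof -
    have "d \<le> max 0 (max (a - x) (x - b))" using that by auto
    then have "1 \<le> max 0 (max (a - x) (x - b)) / d" using d by simp
    then show ?thesis by (simp add: cut_def)
  qed
  define G where "G n x = cut x * max (- B) (min B (h n x))" for n x
  show ?thesis
  proof (rule that[of G])
    show "continuous_on UNIV (G n)" for n
      unfolding G_def cut_def using d by (intro continuous_intros h) auto
    show "\<bar>G n x\<bar> \<le> B * indicator {a - d..b + d} x" for n x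
    proof (cases "x \<in> {a - d..b + d}")
      case True
      have "\<bar>G n x\<bar> \<le> 1 * B" unfolding G_def abs_mult using cut[of x] B0 by (intro mult_mono) auto
      then show ?thesis using True by simp
    qed (simp add: G_def cut0)
    have "N \<in> null_sets lebesgue" using N by (simp add: negligible_iff_null_sets)
    then have "AE x in lebesgue. x \<notin> N" by (rule AE_not_in)
    then have "AE x in lborel. x \<notin> N" by (simp add: AE_completion_iff)
    then show "AE x in lborel. (\<lambda>n. G n x) \<longlonglongrightarrow> g x"
    proof eventually_elim
      case (elim x)
      have "(\<lambda>n. G n x) \<longlonglongrightarrow> cut x * max (- B) (min B (g x))"
        unfolding G_def by (intro tendsto_intros lim elim)
      also have "cut x * max (- B) (min B (g x)) = g x"
        using b[of x] cut1[of x] B0 by (auto split: split_indicator_asm simp: abs_le_iff)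
      finally show ?case .
    qed
  qed
qed

lemma ennpow_liminf_le:
  assumes "e > 0"
  shows "ennpow (liminf x) e \<le> liminf (\<lambda>n. ennpow (x n) e)"
  unfolding liminf_SUP_INF ennpow_SUP[OF assms]
  by (intro SUP_mono bexI INF_greatest ennpow_mono assms INF_lower) auto

text \<open>The transforms converge pointwise by domination. Fatou, first in s and then in t,
  handles the left side, and dominated convergence the right side.\<close>

lemma (in bump) sqf_Lp_limit:
  assumes p: "p > 0" and [measurable]: "\<And>n. F n \<in> borel_measurable borel" "f \<in> borel_measurable borel"
    and lim: "AE x in lborel. (\<lambda>n::nat. F n x) \<longlonglongrightarrow> f x"
    and w: "integrable lborel w" "(\<integral>\<^sup>+x. ennreal (\<bar>w x\<bar> powr p) \<partial>lborel) < \<infinity>" and dom: "\<And>n x. \<bar>F n x\<bar> \<le> \<bar>w x\<bar>"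
    and bound: "\<And>n. (\<integral>\<^sup>+t. ennpow (sqf \<eta> (F n) {0<..} t) (p / 2) \<partial>lborel) \<le> ennreal C * (\<integral>\<^sup>+x. ennreal (\<bar>F n x\<bar> powr p) \<partial>lborel)"
  shows "(\<integral>\<^sup>+t. ennpow (sqf \<eta> f {0<..} t) (p / 2) \<partial>lborel) \<le> ennreal C * (\<integral>\<^sup>+x. ennreal (\<bar>f x\<bar> powr p) \<partial>lborel)"
proof -
  have [measurable]: "w \<in> borel_measurable borel" using borel_measurable_integrable[OF w(1)] by simp
  have cwt_lim: "(\<lambda>n. cwt \<eta> (F n) s t) \<longlonglongrightarrow> cwt \<eta> f s t" for s t
    unfolding cwt_def
  proof (intro tendsto_mult tendsto_const integral_dominated_convergence[where w="\<lambda>x. bd * \<bar>w x\<bar>"])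
    show "integrable lborel (\<lambda>x. bd * \<bar>w x\<bar>)" using w by simp
    show "AE x in lborel. (\<lambda>n. F n x * \<eta> ((x - t) / s)) \<longlonglongrightarrow> f x * \<eta> ((x - t) / s)"
      using lim by eventually_elim (intro tendsto_intros)
    show "AE x in lborel. norm (F n x * \<eta> ((x - t) / s)) \<le> bd * \<bar>w x\<bar>" for n
    proof (intro AE_I2)
      fix x
      have "\<bar>F n x\<bar> * \<bar>\<eta> ((x - t) / s)\<bar> \<le> \<bar>w x\<bar> * bd" by (intro mult_mono dom bd) auto
      then show "norm (F n x * \<eta> ((x - t) / s)) \<le> bd * \<bar>w x\<bar>" by (simp add: abs_mult mult.commute)
    qed
  qed measurable
  have sq: "sqf \<eta> f {0<..} t \<le> liminf (\<lambda>n. sqf \<eta> (F n) {0<..} t)" for t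
  proof -
    have "sqf \<eta> f {0<..} t = (\<integral>\<^sup>+s. liminf (\<lambda>n. ennreal ((cwt \<eta> (F n) s t)\<^sup>2 / s) * indicator {0<..} s) \<partial>lborel)"
      unfolding sqf_def
    proof (rule nn_integral_cong)
      fix s
      have "(\<lambda>n. ennreal ((cwt \<eta> (F n) s t)\<^sup>2 / s) * indicator {0<..} s) \<longlonglongrightarrow> ennreal ((cwt \<eta> f s t)\<^sup>2 / s) * indicator {0<..} s"
      proof (cases "s > 0")
        case True
        have "(\<lambda>n. ennreal ((cwt \<eta> (F n) s t)\<^sup>2 / s)) \<longlonglongrightarrow> ennreal ((cwt \<eta> f s t)\<^sup>2 / s)"
          using True by (intro tendsto_ennrealI tendsto_intros cwt_lim) auto
        then show ?thesis using True by simp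
      qed simp
      then show "ennreal ((cwt \<eta> f s t)\<^sup>2 / s) * indicator {0<..} s = liminf (\<lambda>n. ennreal ((cwt \<eta> (F n) s t)\<^sup>2 / s) * indicator {0<..} s)"
        by (intro lim_imp_Liminf[symmetric]) auto
    qed
    also have "\<dots> \<le> liminf (\<lambda>n. sqf \<eta> (F n) {0<..} t)"
      unfolding sqf_def by (rule nn_integral_liminf) measurable
    finally show ?thesis .
  qed
  have conv: "(\<lambda>n. \<integral>\<^sup>+x. ennreal (\<bar>F n x\<bar> powr p) \<partial>lborel) \<longlonglongrightarrow> (\<integral>\<^sup>+x. ennreal (\<bar>f x\<bar> powr p) \<partial>lborel)"
  proof (rule nn_integral_dominated_convergence[where w="\<lambda>x. ennreal (\<bar>w x\<bar> powr p)"])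
    show "AE x in lborel. ennreal (\<bar>F n x\<bar> powr p) \<le> ennreal (\<bar>w x\<bar> powr p)" for n
      using dom p by (intro AE_I2 ennreal_leI powr_mono2) auto
    show "AE x in lborel. (\<lambda>n. ennreal (\<bar>F n x\<bar> powr p)) \<longlonglongrightarrow> ennreal (\<bar>f x\<bar> powr p)"
      using lim by eventually_elim (use p in \<open>intro tendsto_ennrealI tendsto_powr2 tendsto_rabs, auto\<close>)
  qed (use w in auto)
  have "(\<integral>\<^sup>+t. ennpow (sqf \<eta> f {0<..} t) (p / 2) \<partial>lborel) \<le> (\<integral>\<^sup>+t. liminf (\<lambda>n. ennpow (sqf \<eta> (F n) {0<..} t) (p / 2)) \<partial>lborel)"
  proof (rule nn_integral_mono)
    fix t
    have "ennpow (sqf \<eta> f {0<..} t) (p / 2) \<le> ennpow (liminf (\<lambda>n. sqf \<eta> (F n) {0<..} t)) (p / 2)"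
      using p by (intro ennpow_mono sq) auto
    also have "\<dots> \<le> liminf (\<lambda>n. ennpow (sqf \<eta> (F n) {0<..} t) (p / 2))"
      using p by (intro ennpow_liminf_le) auto
    finally show "ennpow (sqf \<eta> f {0<..} t) (p / 2) \<le> liminf (\<lambda>n. ennpow (sqf \<eta> (F n) {0<..} t) (p / 2))" .
  qed
  also have "\<dots> \<le> liminf (\<lambda>n. \<integral>\<^sup>+t. ennpow (sqf \<eta> (F n) {0<..} t) (p / 2) \<partial>lborel)"
    by (rule nn_integral_liminf) measurable
  also have "\<dots> \<le> liminf (\<lambda>n. ennreal C * (\<integral>\<^sup>+x. ennreal (\<bar>F n x\<bar> powr p) \<partial>lborel))"
    by (intro Liminf_mono always_eventually allI bound)
  also have "\<dots> = ennreal C * (\<integral>\<^sup>+x. ennreal (\<bar>f x\<bar> powr p) \<partial>lborel)"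
    by (intro lim_imp_Liminf ennreal_tendsto_cmult conv) auto
  finally show ?thesis .
qed

text \<open>Two passages to the limit: from continuous to bounded measurable functions by
  \<open>continuous_approximation\<close>, then to unbounded ones by cutting off large
  values.\<close>

lemma (in smooth_wavelet) sqf_Lp:
  assumes p: "1 < p"
  obtains C where "C \<ge> 0" "\<And>f A. integrable lborel f \<Longrightarrow> (\<And>x. A < \<bar>x\<bar> \<Longrightarrow> f x = 0) \<Longrightarrow>
    (\<integral>\<^sup>+x. ennreal (\<bar>f x\<bar> powr p) \<partial>lborel) < \<infinity> \<Longrightarrow>
    (\<integral>\<^sup>+t. ennpow (sqf \<eta> f {0<..} t) (p / 2) \<partial>lborel) \<le> ennreal C * (\<integral>\<^sup>+x. ennreal (\<bar>f x\<bar> powr p) \<partial>lborel)"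
proof -
  obtain C where C: "C \<ge> 0" and b: "\<And>f. test_fun f \<Longrightarrow> continuous_on UNIV f \<Longrightarrow> (\<integral>\<^sup>+t. ennpow (sqf \<eta> f {0<..} t) (p / 2) \<partial>lborel) \<le> ennreal C * (\<integral>\<^sup>+x. ennreal (\<bar>f x\<bar> powr p) \<partial>lborel)"
    using sqf_Lp_continuous[OF p] by blast
  have b2: "(\<integral>\<^sup>+t. ennpow (sqf \<eta> f {0<..} t) (p / 2) \<partial>lborel) \<le> ennreal C * (\<integral>\<^sup>+x. ennreal (\<bar>f x\<bar> powr p) \<partial>lborel)"
    if f: "test_fun f" for f
  proof -
    have [measurable]: "f \<in> borel_measurable borel" using f by (simp add: test_fun_def)
    obtain A B where AB: "A > 0" "B > 0" and fb: "\<And>x. \<bar>f x\<bar> \<le> B * indicator {-A..A} x"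
      using test_fun_bound[OF f] by blast
    obtain G where G: "\<And>n::nat. continuous_on UNIV (G n)" "\<And>n x. \<bar>G n x\<bar> \<le> B * indicator {-A - 1..A + 1} x"
      "AE x in lborel. (\<lambda>n. G n x) \<longlonglongrightarrow> f x"
      using continuous_approximation[OF _ fb, of 1] AB by auto
    have Gm[measurable]: "G n \<in> borel_measurable borel" for n using G(1) by (rule borel_measurable_continuous_onI)
    have tf: "test_fun (\<lambda>x. B * indicator {-A - 1..A + 1} x)"
      by (rule test_funI[of _ "\<bar>B\<bar>" "A + 1"]) (auto split: split_indicator)
    have tG: "test_fun (G n)" for n
    proof (rule test_funI[of _ "\<bar>B\<bar>" "A + 1"])
      show "\<bar>G n x\<bar> \<le> \<bar>B\<bar>" for x using G(2)[of n x] by (auto split: split_indicator_asm)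
      show "G n x = 0" if "A + 1 < \<bar>x\<bar>" for x using G(2)[of n x] that by (auto split: split_indicator_asm)
    qed (rule Gm)
    show ?thesis
    proof (rule sqf_Lp_limit[where F=G and w="\<lambda>x. B * indicator {-A - 1..A + 1} x"])
      show "(\<integral>\<^sup>+x. ennreal (\<bar>B * indicator {-A - 1..A + 1} x\<bar> powr p) \<partial>lborel) < \<infinity>"
        using test_fun_nn_powr_finite[OF tf] p by simp
      show "\<bar>G n x\<bar> \<le> \<bar>B * indicator {-A - 1..A + 1} x\<bar>" for n x
        using G(2)[of n x] by linarith
      show "integrable lborel (\<lambda>x. B * indicator {-A - 1..A + 1} x)" by (rule integrable_const_indicator_Icc)
    qed (use p G tG b in auto)
  qed
  show ?thesis
  proof (rule that[OF C])
    fix f :: "real \<Rightarrow> real" and A :: real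
    assume f: "integrable lborel f" and A: "\<And>x. A < \<bar>x\<bar> \<Longrightarrow> f x = 0" and fin: "(\<integral>\<^sup>+x. ennreal (\<bar>f x\<bar> powr p) \<partial>lborel) < \<infinity>"
    have [measurable]: "f \<in> borel_measurable borel" using borel_measurable_integrable[OF f] by simp
    define F where "F n x = (if \<bar>f x\<bar> \<le> real n then f x else 0)" for n x
    have Fm[measurable]: "F n \<in> borel_measurable borel" for n unfolding F_def by measurable
    show "(\<integral>\<^sup>+t. ennpow (sqf \<eta> f {0<..} t) (p / 2) \<partial>lborel) \<le> ennreal C * (\<integral>\<^sup>+x. ennreal (\<bar>f x\<bar> powr p) \<partial>lborel)"
    proof (rule sqf_Lp_limit[where F=F and w=f])
      show "AE x in lborel. (\<lambda>n. F n x) \<longlonglongrightarrow> f x"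
      proof (intro AE_I2 tendsto_eventually)
        fix x
        obtain n0 where n0: "\<bar>f x\<bar> \<le> real n0" using real_arch_simple by blast
        show "eventually (\<lambda>n. F n x = f x) sequentially"
          using eventually_ge_at_top[of n0] by eventually_elim (use n0 in \<open>auto simp: F_def\<close>)
      qed
      have "test_fun (F n)" for n
        by (rule test_funI[of _ "real n" A]) (auto simp: F_def A)
      then show "(\<integral>\<^sup>+t. ennpow (sqf \<eta> (F n) {0<..} t) (p / 2) \<partial>lborel) \<le> ennreal C * (\<integral>\<^sup>+x. ennreal (\<bar>F n x\<bar> powr p) \<partial>lborel)" for n
        by (rule b2)
      show "\<bar>F n x\<bar> \<le> \<bar>f x\<bar>" for n x by (simp add: F_def)
    qed (use p f fin in auto)
  qed
qed

subsection \<open>Polynomials, leaders and the direct part\<close>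

text \<open>Removes the outer root and the factor 1/a, leaving a plain integral bound in terms of
  \<open>sqf\<close>.\<close>

lemma pleader_le_iff:
  assumes "a > 0" "p > 0" "K \<ge> 0"
  shows "pleader p \<psi> f a b \<le> ennreal K \<longleftrightarrow>
    (\<integral>\<^sup>+t\<in>{b - a..b + a}. ennpow (sqf \<psi> f {0<..<a} t) (p / 2) \<partial>lborel) \<le> ennreal (a * K powr p)"
proof -
  let ?X = "\<integral>\<^sup>+t\<in>{b - a..b + a}. ennpow (sqf \<psi> f {0<..<a} t) (p / 2) \<partial>lborel"
  have "pleader p \<psi> f a b \<le> ennreal K \<longleftrightarrow> (1 / ennreal a) * ?X \<le> ennreal (K powr p)"
    unfolding pleader_def sqf_def[symmetric] using ennpow_le_iff[of "1 / p" K] assms by simp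
  also have "\<dots> \<longleftrightarrow> ?X \<le> ennreal (a * K powr p)"
  proof (cases ?X rule: ennreal_cases)
    case (real x)
    have e: "1 / ennreal a = ennreal (1 / a)" using assms divide_ennreal[of 1 a] by simp
    have "(1 / ennreal a) * ?X = ennreal (x / a)"
      unfolding e real using real assms by (simp add: ennreal_mult[symmetric])
    then show ?thesis using real assms by (simp add: field_simps)
  next
    case top
    have "(1 / ennreal a) * ?X = \<infinity>" unfolding top using assms by (simp add: ennreal_mult_top ennreal_divide_eq_0_iff)
    then show ?thesis using top by (simp add: top_unique)
  qed
  finally show ?thesis .
qed

text \<open>A substitute for Hoelder on bounded intervals: local p-integrability gives local
  integrability.\<close>

lemma abs_le_one_plus_powr:
  fixes y :: real
  assumes "1 < p"
  shows "\<bar>y\<bar> \<le> 1 + \<bar>y\<bar> powr p"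
proof (cases "\<bar>y\<bar> \<le> 1")
  case False
  then have "\<bar>y\<bar> powr 1 \<le> \<bar>y\<bar> powr p" using assms by (intro powr_mono) auto
  then show ?thesis using False by simp
qed (use powr_ge_zero[of "\<bar>y\<bar>" p] in linarith)

lemma Lp_loc_integrable:
  assumes p: "1 < p" and f: "Lp_loc p f"
  shows "integrable lborel (\<lambda>x. indicator {a..b} x * f x)" "integrable lborel (\<lambda>x. indicator {a..b} x * (\<bar>f x\<bar> powr p))"
proof -
  have [measurable]: "f \<in> borel_measurable borel" using f by (simp add: Lp_loc_def)
  show i: "integrable lborel (\<lambda>x. indicator {a..b} x * (\<bar>f x\<bar> powr p))"
    using f by (simp add: Lp_loc_def set_integrable_def)
  show "integrable lborel (\<lambda>x. indicator {a..b} x * f x)"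
  proof (rule Bochner_Integration.integrable_bound)
    show "integrable lborel (\<lambda>x. 1 * indicator {a..b} x + indicator {a..b} x * (\<bar>f x\<bar> powr p))"
      by (intro Bochner_Integration.integrable_add i integrable_const_indicator_Icc)
    show "AE x in lborel. norm (indicator {a..b} x * f x) \<le> norm (1 * indicator {a..b} x + indicator {a..b} x * (\<bar>f x\<bar> powr p))"
      using abs_le_one_plus_powr[OF p] by (intro AE_I2) (auto split: split_indicator)
  qed measurable
qed

lemma abs_add_powr_le:
  fixes x y :: real
  assumes "p > 0"
  shows "\<bar>x + y\<bar> powr p \<le> 2 powr p * (\<bar>x\<bar> powr p + \<bar>y\<bar> powr p)"
proof -
  have "\<bar>x + y\<bar> powr p \<le> (2 * max \<bar>x\<bar> \<bar>y\<bar>) powr p" using assms by (intro powr_mono2) auto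
  also have "\<dots> = 2 powr p * (max \<bar>x\<bar> \<bar>y\<bar>) powr p" by (simp add: powr_mult)
  also have "\<dots> \<le> 2 powr p * (\<bar>x\<bar> powr p + \<bar>y\<bar> powr p)"
    by (intro mult_left_mono) (auto simp: max_def)
  finally show ?thesis .
qed

lemma Lp_loc_minus_poly:
  assumes p: "1 < p" and f: "Lp_loc p f"
  shows "Lp_loc p (\<lambda>x. f x - poly P (x - x0))"
  unfolding Lp_loc_def set_integrable_def
proof (intro conjI allI)
  have [measurable]: "f \<in> borel_measurable borel" using f by (simp add: Lp_loc_def)
  have c: "continuous_on UNIV (\<lambda>x. poly P (x - x0))" by (intro continuous_intros)
  have [measurable]: "(\<lambda>x. poly P (x - x0)) \<in> borel_measurable borel"
    using c by (rule borel_measurable_continuous_onI)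
  show "(\<lambda>x. f x - poly P (x - x0)) \<in> borel_measurable lborel" by measurable
  fix a b
  have "continuous_on {a..b} (\<lambda>x. \<bar>poly P (x - x0)\<bar> powr p)"
    using p by (intro continuous_on_powr' continuous_intros) auto
  then have i2: "integrable lborel (\<lambda>x. indicator {a..b} x *\<^sub>R (\<bar>poly P (x - x0)\<bar> powr p))"
    using borel_integrable_atLeastAtMost'[of a b "\<lambda>x. \<bar>poly P (x - x0)\<bar> powr p"] by (simp add: set_integrable_def)
  show "integrable lborel (\<lambda>x. indicator {a..b} x *\<^sub>R (\<bar>f x - poly P (x - x0)\<bar> powr p))"
  proof (rule Bochner_Integration.integrable_bound)
    show "integrable lborel (\<lambda>x. 2 powr p * (indicator {a..b} x * (\<bar>f x\<bar> powr p) + indicator {a..b} x *\<^sub>R (\<bar>poly P (x - x0)\<bar> powr p)))"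
      by (intro integrable_mult_right Bochner_Integration.integrable_add Lp_loc_integrable(2)[OF p f] i2)
    show "AE x in lborel. norm (indicator {a..b} x *\<^sub>R (\<bar>f x - poly P (x - x0)\<bar> powr p))
      \<le> norm (2 powr p * (indicator {a..b} x * (\<bar>f x\<bar> powr p) + indicator {a..b} x *\<^sub>R (\<bar>poly P (x - x0)\<bar> powr p)))"
      using abs_add_powr_le[of p "f x" "- poly P (x - x0)" for x] p
      by (intro AE_I2) (auto split: split_indicator)
  qed measurable
qed

locale vanishing_moments = bump +
  fixes r :: nat
  assumes moments: "\<And>k. k \<le> r \<Longrightarrow> (LINT x|lborel. x ^ k * \<eta> x) = 0"
begin

lemma integrable_power_kernel: "integrable lborel (\<lambda>u. u ^ k * \<eta> u)"
proof (rule Bochner_Integration.integrable_bound[OF integrable_const_indicator_Icc[of bd "-1" 1]])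
  show "AE u in lborel. norm (u ^ k * \<eta> u) \<le> norm (bd * indicator {-1..1} u)"
  proof (intro AE_I2)
    fix u :: real
    show "norm (u ^ k * \<eta> u) \<le> norm (bd * indicator {-1..1} u)"
    proof (cases "\<bar>u\<bar> \<le> 1")
      case True
      then have "\<bar>u\<bar> ^ k * \<bar>\<eta> u\<bar> \<le> 1 * bd" by (intro mult_mono bd power_le_one) auto
      then show ?thesis using True bd_pos by (auto simp: abs_mult power_abs abs_le_iff)
    qed (simp add: supp)
  qed
qed measurable

lemma poly_kernel:
  shows "integrable lborel (\<lambda>u. poly Q u * \<eta> u)"
    and "degree Q \<le> r \<Longrightarrow> (LINT u|lborel. poly Q u * \<eta> u) = 0"
proof -
  have eq: "(\<lambda>u. poly Q u * \<eta> u) = (\<lambda>u. \<Sum>k\<le>degree Q. coeff Q k * (u ^ k * \<eta> u))"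
    by (simp add: poly_altdef sum_distrib_right mult.assoc)
  have i: "integrable lborel (\<lambda>u. coeff Q k * (u ^ k * \<eta> u))" for k
    by (intro integrable_mult_right integrable_power_kernel)
  show "integrable lborel (\<lambda>u. poly Q u * \<eta> u)" unfolding eq by (intro Bochner_Integration.integrable_sum i)
  assume "degree Q \<le> r"
  then show "(LINT u|lborel. poly Q u * \<eta> u) = 0"
    unfolding eq by (subst Bochner_Integration.integral_sum[OF i]) (simp add: moments)
qed

text \<open>The substitution x = t + s u turns the integral into one of a polynomial of the same
  degree against \<eta>, where the vanishing moments apply.\<close>

lemma poly_wavelet:
  assumes s: "s > 0" and deg: "degree P \<le> r"
  shows "integrable lborel (\<lambda>x. poly P (x - x0) * \<eta> ((x - t) / s))"
    and "(LINT x|lborel. poly P (x - x0) * \<eta> ((x - t) / s)) = 0"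
proof -
  define Q where "Q = pcompose P [:t - x0, s:]"
  have "degree [:t - x0, s:] = 1" using s by simp
  then have Q: "degree Q \<le> r" using deg by (simp add: Q_def degree_pcompose)
  have eq: "poly P (t + s * u - x0) * \<eta> ((t + s * u - t) / s) = poly Q u * \<eta> u" for u
    using s by (simp add: Q_def poly_pcompose algebra_simps)
  show "integrable lborel (\<lambda>x. poly P (x - x0) * \<eta> ((x - t) / s))"
    using lborel_integrable_real_affine_iff[of s "\<lambda>x. poly P (x - x0) * \<eta> ((x - t) / s)" t] s poly_kernel(1)[of Q]
    by (simp only: eq)
  have "(LINT x|lborel. poly P (x - x0) * \<eta> ((x - t) / s)) = \<bar>s\<bar> *\<^sub>R (LINT u|lborel. poly Q u * \<eta> u)"
    using lborel_integral_real_affine[of s "\<lambda>x. poly P (x - x0) * \<eta> ((x - t) / s)" t] s by (simp only: eq)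
  then show "(LINT x|lborel. poly P (x - x0) * \<eta> ((x - t) / s)) = 0" by (simp add: poly_kernel(2)[OF Q])
qed

lemma cwt_minus_poly:
  assumes s: "s > 0" and deg: "degree P \<le> r" and f: "integrable lborel (\<lambda>x. indicator {a..b} x * (f x - poly P (x - x0)))"
    and sub: "{t - s..t + s} \<subseteq> {a..b}"
  shows "cwt \<eta> f s t = cwt \<eta> (\<lambda>x. indicator {a..b} x * (f x - poly P (x - x0))) s t"
proof -
  have "f x * \<eta> ((x - t) / s) = (indicator {a..b} x * (f x - poly P (x - x0))) * \<eta> ((x - t) / s) + poly P (x - x0) * \<eta> ((x - t) / s)" for x
  proof (cases "x \<in> {t - s..t + s}")
    case True
    then show ?thesis using sub by (auto simp: left_diff_distrib)
  next
    case False
    then have "\<bar>(x - t) / s\<bar> > 1" using s by (auto simp: field_simps abs_if)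
    then show ?thesis by (simp add: supp)
  qed
  then have "(LINT x|lborel. f x * \<eta> ((x - t) / s)) = (LINT x|lborel. (indicator {a..b} x * (f x - poly P (x - x0))) * \<eta> ((x - t) / s) + poly P (x - x0) * \<eta> ((x - t) / s))"
    by (rule Bochner_Integration.integral_cong[OF refl])
  also have "\<dots> = (LINT x|lborel. (indicator {a..b} x * (f x - poly P (x - x0))) * \<eta> ((x - t) / s))"
    using poly_wavelet[OF s deg, of x0 t] by (subst Bochner_Integration.integral_add[OF cwt_integrand_integrable[OF f]]) auto
  finally show ?thesis by (simp add: cwt_def)
qed

end

lemma leaders_of_Tp:
  assumes sw: "smooth_wavelet \<psi> \<psi>'" and vm: "vanishing_moments \<psi> r" and p: "1 < p" and f: "Lp_loc p f" and r: "\<alpha> \<le> real r"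
    and T: "Tp p \<alpha> x0 f"
  shows "\<exists>C>0. \<exists>a0>0. \<forall>a. 0 < a \<and> a < a0 \<longrightarrow> pleader p \<psi> f a x0 \<le> ennreal (C * a powr \<alpha>)"
proof -
  interpret smooth_wavelet \<psi> \<psi>' by (rule sw)
  interpret V: vanishing_moments \<psi> r by (rule vm)
  obtain P C R where P: "if \<alpha> \<le> 0 then P = 0 else real (degree P) < \<alpha>" and C: "C > 0" and R: "R > 0"
    and b: "\<And>r. 0 < r \<Longrightarrow> r < R \<Longrightarrow> ((1 / r) * (LINT x:{x0 - r..x0 + r}|lborel. \<bar>f x - poly P (x - x0)\<bar> powr p)) powr (1 / p) \<le> C * r powr \<alpha>"
    using T unfolding Tp_def by blast
  have deg: "degree P \<le> r" using P r by (auto split: if_splits)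
  obtain C0 where C0: "C0 \<ge> 0" and Lp: "\<And>f A. integrable lborel f \<Longrightarrow> (\<And>x. A < \<bar>x\<bar> \<Longrightarrow> f x = 0) \<Longrightarrow>
    (\<integral>\<^sup>+x. ennreal (\<bar>f x\<bar> powr p) \<partial>lborel) < \<infinity> \<Longrightarrow>
    (\<integral>\<^sup>+t. ennpow (sqf \<psi> f {0<..} t) (p / 2) \<partial>lborel) \<le> ennreal C0 * (\<integral>\<^sup>+x. ennreal (\<bar>f x\<bar> powr p) \<partial>lborel)"
    using sqf_Lp[OF p] by blast
  \<comment> \<open>The factors 2 and 2^\<alpha> arise because the hypothesis is applied at radius
    2a; adding 1 secures positivity.\<close>
  define K0 where "K0 = 2 * C0 * (C * 2 powr \<alpha>) powr p + 1"
  have K0: "K0 > 0" using C0 by (auto simp: K0_def intro!: add_nonneg_pos)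
  define K where "K = K0 powr (1 / p)"
  have K: "K > 0" "K powr p = K0" using K0 p by (auto simp: K_def powr_powr)
  show ?thesis
  proof (rule exI[of _ K], intro conjI, rule K(1), rule exI[of _ "R / 2"], intro conjI allI impI)
    \<comment> \<open>For s < a and t within a of x0 the transform sees only the ball of radius 2a
      about x0, so 2a has to stay below R.\<close>
    fix a assume a: "0 < a \<and> a < R / 2"
    let ?I = "{x0 - 2 * a..x0 + 2 * a}"
    define g where "g x = indicator ?I x * (f x - poly P (x - x0))" for x
    have fP: "Lp_loc p (\<lambda>x. f x - poly P (x - x0))" by (rule Lp_loc_minus_poly[OF p f])
    have gi: "integrable lborel g" unfolding g_def by (rule Lp_loc_integrable(1)[OF p fP])
    have [measurable]: "g \<in> borel_measurable borel" using borel_measurable_integrable[OF gi] by simp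
    have gp: "\<bar>g x\<bar> powr p = indicator ?I x * (\<bar>f x - poly P (x - x0)\<bar> powr p)" for x
      using p by (auto simp: g_def split: split_indicator)
    define N where "N = (LINT x:?I|lborel. \<bar>f x - poly P (x - x0)\<bar> powr p)"
    have gN: "(\<integral>\<^sup>+x. ennreal (\<bar>g x\<bar> powr p) \<partial>lborel) = ennreal N"
      unfolding gp N_def set_lebesgue_integral_def real_scaleR_def
      by (rule nn_integral_eq_integral[OF Lp_loc_integrable(2)[OF p fP]]) simp
    have N0: "N \<ge> 0" unfolding N_def set_lebesgue_integral_def by simp
    have "((1 / (2 * a)) * N) powr (1 / p) \<le> C * (2 * a) powr \<alpha>" using b[of "2 * a"] a by (simp add: N_def)
    then have "(((1 / (2 * a)) * N) powr (1 / p)) powr p \<le> (C * (2 * a) powr \<alpha>) powr p" using p by (intro powr_mono2) auto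
    also have "(((1 / (2 * a)) * N) powr (1 / p)) powr p = N / (2 * a)" using p N0 a by (simp add: powr_powr)
    finally have N1: "N \<le> 2 * a * (C * (2 * a) powr \<alpha>) powr p" using a by (simp add: field_simps)
    have N2: "C0 * N \<le> a * (K * a powr \<alpha>) powr p"
    proof -
      have "(C * (2 * a) powr \<alpha>) powr p = (C * 2 powr \<alpha>) powr p * (a powr \<alpha>) powr p"
        using a C by (simp add: powr_mult)
      then have "C0 * N \<le> a * (2 * C0 * (C * 2 powr \<alpha>) powr p * (a powr \<alpha>) powr p)"
        using mult_left_mono[OF N1 C0] by (simp add: ac_simps)
      also have "\<dots> \<le> a * (K0 * (a powr \<alpha>) powr p)"
        using a by (intro mult_left_mono mult_right_mono) (auto simp: K0_def)
      also have "\<dots> = a * (K * a powr \<alpha>) powr p" using K by (simp add: powr_mult)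
      finally show ?thesis .
    qed
    have "(\<integral>\<^sup>+t\<in>{x0 - a..x0 + a}. ennpow (sqf \<psi> f {0<..<a} t) (p / 2) \<partial>lborel) \<le> (\<integral>\<^sup>+t. ennpow (sqf \<psi> g {0<..} t) (p / 2) \<partial>lborel)"
    proof (rule nn_integral_mono)
      fix t
      show "ennpow (sqf \<psi> f {0<..<a} t) (p / 2) * indicator {x0 - a..x0 + a} t \<le> ennpow (sqf \<psi> g {0<..} t) (p / 2)"
      proof (cases "t \<in> {x0 - a..x0 + a}")
        case True
        have "sqf \<psi> f {0<..<a} t = sqf \<psi> g {0<..<a} t"
          unfolding sqf_def
        proof (rule nn_integral_cong)
          fix s
          show "ennreal ((cwt \<psi> f s t)\<^sup>2 / s) * indicator {0<..<a} s = ennreal ((cwt \<psi> g s t)\<^sup>2 / s) * indicator {0<..<a} s"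
          proof (cases "s \<in> {0<..<a}")
            case s: True
            have "cwt \<psi> f s t = cwt \<psi> g s t"
              unfolding g_def
              by (rule V.cwt_minus_poly[OF _ deg]) (use s True gi[unfolded g_def] in auto)
            then show ?thesis by simp
          qed simp
        qed
        also have "\<dots> \<le> sqf \<psi> g {0<..} t" by (rule sqf_mono) auto
        finally have "ennpow (sqf \<psi> f {0<..<a} t) (p / 2) \<le> ennpow (sqf \<psi> g {0<..} t) (p / 2)"
          using p by (intro ennpow_mono) auto
        then show ?thesis using True by simp
      qed simp
    qed
    also have "\<dots> \<le> ennreal C0 * (\<integral>\<^sup>+x. ennreal (\<bar>g x\<bar> powr p) \<partial>lborel)"
      by (rule Lp[of g "\<bar>x0\<bar> + 2 * a"]) (auto simp: gi gN, auto simp: g_def split: split_indicator)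
    also have "\<dots> = ennreal (C0 * N)" unfolding gN using C0 N0 by (simp add: ennreal_mult)
    also have "\<dots> \<le> ennreal (a * (K * a powr \<alpha>) powr p)" using N2 by (rule ennreal_leI)
    finally show "pleader p \<psi> f a x0 \<le> ennreal (K * a powr \<alpha>)"
      using a K p by (subst pleader_le_iff) auto
  qed (use R in auto)
qed


subsection \<open>The reproducing formula\<close>

context wavelet begin

definition calderon :: real where "calderon = (LINT v|lborel. phi v)"

lemma phi_integrable: "integrable lborel phi"
  by (rule Bochner_Integration.integrable_bound[OF integrable_const_indicator_Icc[of "2 * bd\<^sup>2" "-2" 2]])
     (use phi_ind in \<open>auto intro: order_trans[OF _ abs_ge_self]\<close>)

text \<open>The explicit bound decays like 1/e, so the dilate with large e disappears in the limit
  of large scales.\<close>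

lemma phi_approx_integrable:
  assumes f: "integrable lborel f" and g: "integrable lborel g" and e: "e > 0"
  shows "integrable lborel2 (\<lambda>z. f (fst z) * g (snd z) * (phi ((fst z - snd z) / e) / e))"
    and "\<bar>LINT z|lborel2. f (fst z) * g (snd z) * (phi ((fst z - snd z) / e) / e)\<bar> \<le> 2 * bd\<^sup>2 / e * ((LINT x|lborel. \<bar>f x\<bar>) * (LINT x|lborel. \<bar>g x\<bar>))"
proof -
  note [measurable] = borel_measurable_integrable[OF f] borel_measurable_integrable[OF g]
  have i: "integrable lborel2 (\<lambda>z. 2 * bd\<^sup>2 / e * (\<bar>f (fst z)\<bar> * \<bar>g (snd z)\<bar>))"
    by (intro integrable_mult_right integrable_lborel2_prod integrable_abs f g)
  have b: "\<bar>f (fst z) * g (snd z) * (phi ((fst z - snd z) / e) / e)\<bar> \<le> 2 * bd\<^sup>2 / e * (\<bar>f (fst z)\<bar> * \<bar>g (snd z)\<bar>)" for z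
  proof -
    have "\<bar>phi ((fst z - snd z) / e) / e\<bar> \<le> 2 * bd\<^sup>2 / e"
      using phi_bd e by (simp add: abs_divide divide_right_mono)
    then have "\<bar>f (fst z)\<bar> * \<bar>g (snd z)\<bar> * \<bar>phi ((fst z - snd z) / e) / e\<bar> \<le> \<bar>f (fst z)\<bar> * \<bar>g (snd z)\<bar> * (2 * bd\<^sup>2 / e)"
      by (intro mult_left_mono) auto
    then show ?thesis unfolding abs_mult by (simp only: ac_simps)
  qed
  show "integrable lborel2 (\<lambda>z. f (fst z) * g (snd z) * (phi ((fst z - snd z) / e) / e))"
  proof (rule Bochner_Integration.integrable_bound[OF i])
    show "AE z in lborel2. norm (f (fst z) * g (snd z) * (phi ((fst z - snd z) / e) / e)) \<le> norm (2 * bd\<^sup>2 / e * (\<bar>f (fst z)\<bar> * \<bar>g (snd z)\<bar>))"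
      unfolding real_norm_def by (intro AE_I2 order_trans[OF b abs_ge_self])
  qed measurable
  have "\<bar>LINT z|lborel2. f (fst z) * g (snd z) * (phi ((fst z - snd z) / e) / e)\<bar> \<le> (LINT z|lborel2. 2 * bd\<^sup>2 / e * (\<bar>f (fst z)\<bar> * \<bar>g (snd z)\<bar>))"
    by (rule abs_integral_le[OF i _ b]) measurable
  also have "\<dots> = 2 * bd\<^sup>2 / e * ((LINT x|lborel. \<bar>f x\<bar>) * (LINT x|lborel. \<bar>g x\<bar>))"
    using integral_lborel2_prod[OF integrable_abs[OF f] integrable_abs[OF g]] by simp
  finally show "\<bar>LINT z|lborel2. f (fst z) * g (snd z) * (phi ((fst z - snd z) / e) / e)\<bar> \<le> 2 * bd\<^sup>2 / e * ((LINT x|lborel. \<bar>f x\<bar>) * (LINT x|lborel. \<bar>g x\<bar>))" .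
qed

text \<open>The dilates of \<open>phi\<close> act on the continuous bounded g like an approximate
  identity of total mass \<open>calderon\<close>; the limit is taken first inside and then against f
  by dominated convergence.\<close>

lemma phi_approx_limit:
  assumes f: "integrable lborel f" and g: "test_fun g" and cg: "continuous_on UNIV g"
    and e: "\<And>n. e n > 0" "e \<longlonglongrightarrow> 0"
  shows "(\<lambda>n. LINT z|lborel2. f (fst z) * g (snd z) * (phi ((fst z - snd z) / e n) / e n)) \<longlonglongrightarrow> calderon * (LINT x|lborel. f x * g x)"
proof -
  note gi = test_fun_integrable[OF g]
  have [measurable]: "f \<in> borel_measurable borel" "g \<in> borel_measurable borel"
    using borel_measurable_integrable[OF f] borel_measurable_integrable[OF gi] by auto
  obtain B where B: "\<And>x. \<bar>g x\<bar> \<le> B" using g by (auto simp: test_fun_def)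
  have B0: "B \<ge> 0" using B[of 0] by linarith
  define h where "h n x = (LINT v|lborel. g (x + (- e n) * v) * phi v)" for n x
  have hm[measurable]: "h n \<in> borel_measurable borel" for n unfolding h_def by measurable
  have pb: "\<bar>g y * phi v\<bar> \<le> B * \<bar>phi v\<bar>" for y v unfolding abs_mult by (intro mult_right_mono B) auto
  have pi: "integrable lborel (\<lambda>v. B * \<bar>phi v\<bar>)" using phi_integrable by simp
  have hb: "\<bar>h n x\<bar> \<le> (LINT v|lborel. B * \<bar>phi v\<bar>)" for n x
    unfolding h_def by (rule abs_integral_le[OF pi _ pb]) measurable
  have hlim: "(\<lambda>n. h n x) \<longlonglongrightarrow> g x * calderon" for x
  proof -
    have "(\<lambda>n. h n x) \<longlonglongrightarrow> (LINT v|lborel. g x * phi v)"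
      unfolding h_def
    proof (rule integral_dominated_convergence[where w="\<lambda>v. B * \<bar>phi v\<bar>"])
      show "AE v in lborel. (\<lambda>n. g (x + (- e n) * v) * phi v) \<longlonglongrightarrow> g x * phi v"
      proof (intro AE_I2 tendsto_mult tendsto_const)
        fix v
        have "(\<lambda>n. x + (- e n) * v) \<longlonglongrightarrow> x + (- 0) * v" by (intro tendsto_intros e(2))
        then have "(\<lambda>n. x + (- e n) * v) \<longlonglongrightarrow> x" by simp
        then show "(\<lambda>n. g (x + (- e n) * v)) \<longlonglongrightarrow> g x"
          by (rule continuous_on_tendsto_compose[OF cg]) auto
      qed
    qed (use pi pb in auto)
    then show ?thesis by (simp add: calderon_def)
  qed
  have eq: "(LINT z|lborel2. f (fst z) * g (snd z) * (phi ((fst z - snd z) / e n) / e n)) = (LINT x|lborel. f x * h n x)" for n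
  proof -
    have "(LINT z|lborel2. f (fst z) * g (snd z) * (phi ((fst z - snd z) / e n) / e n))
      = (LINT x|lborel. LINT y|lborel. f x * g y * (phi ((x - y) / e n) / e n))"
      using lborel_pair.integral_fst'[OF phi_approx_integrable(1)[OF f gi e(1)], of n, symmetric] by simp
    also have "\<dots> = (LINT x|lborel. f x * h n x)"
    proof (rule Bochner_Integration.integral_cong[OF refl])
      fix x
      have "(LINT y|lborel. f x * g y * (phi ((x - y) / e n) / e n)) = \<bar>- e n\<bar> *\<^sub>R (LINT v|lborel. f x * g (x + (- e n) * v) * (phi ((x - (x + (- e n) * v)) / e n) / e n))"
        using e(1)[of n] by (intro lborel_integral_real_affine) auto
      also have "\<dots> = (LINT v|lborel. f x * (g (x + (- e n) * v) * phi v))"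
        using e(1)[of n] unfolding real_scaleR_def integral_mult_right_zero[symmetric]
        by (intro Bochner_Integration.integral_cong) auto
      also have "\<dots> = f x * h n x" unfolding h_def by (rule integral_mult_right_zero)
      finally show "(LINT y|lborel. f x * g y * (phi ((x - y) / e n) / e n)) = f x * h n x" .
    qed
    finally show ?thesis .
  qed
  have "(\<lambda>n. LINT x|lborel. f x * h n x) \<longlonglongrightarrow> (LINT x|lborel. f x * (g x * calderon))"
  proof (rule integral_dominated_convergence[where w="\<lambda>x. \<bar>f x\<bar> * (LINT v|lborel. B * \<bar>phi v\<bar>)"])
    show "integrable lborel (\<lambda>x. \<bar>f x\<bar> * (LINT v|lborel. B * \<bar>phi v\<bar>))" using f by simp
    show "AE x in lborel. norm (f x * h n x) \<le> \<bar>f x\<bar> * (LINT v|lborel. B * \<bar>phi v\<bar>)" for n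
      unfolding real_norm_def abs_mult by (intro AE_I2 mult_left_mono hb) auto
    show "AE x in lborel. (\<lambda>n. f x * h n x) \<longlonglongrightarrow> f x * (g x * calderon)"
      by (intro AE_I2 tendsto_intros hlim)
  qed measurable
  also have "(LINT x|lborel. f x * (g x * calderon)) = calderon * (LINT x|lborel. f x * g x)"
  proof -
    have "(\<lambda>x. f x * (g x * calderon)) = (\<lambda>x. calderon * (f x * g x))" by (simp add: fun_eq_iff ac_simps)
    then show ?thesis by simp
  qed
  finally show ?thesis unfolding eq .
qed

text \<open>On \<open>scales n\<close> the kernel is the dilate of \<open>phi\<close> with e =
  1/(n+1) minus the one with e = n+1. The first tends to \<open>calderon\<close> times the pairing
  of f and g, the second is O(1/n).\<close>

lemma reproducing_limit:
  assumes f: "integrable lborel f" and g: "test_fun g" and cg: "continuous_on UNIV g"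
  shows "(\<lambda>n. LINT w|lborel2. indicator (scales n) (fst w) * (cwt \<eta> f (fst w) (snd w) * cwt \<eta> g (fst w) (snd w)) / fst w)
    \<longlonglongrightarrow> calderon * (LINT x|lborel. f x * g x)"
proof -
  note gi = test_fun_integrable[OF g]
  let ?\<Phi> = "\<lambda>e. LINT z|lborel2. f (fst z) * g (snd z) * (phi ((fst z - snd z) / e) / e)"
  have eq: "(LINT w|lborel2. indicator (scales n) (fst w) * (cwt \<eta> f (fst w) (snd w) * cwt \<eta> g (fst w) (snd w)) / fst w)
    = ?\<Phi> (1 / real (Suc n)) - ?\<Phi> (real (Suc n))" for n
  proof -
    have p: "0 < 1 / real (Suc n)" "0 < real (Suc n)" by auto
    have "(LINT w|lborel2. indicator (scales n) (fst w) * (cwt \<eta> f (fst w) (snd w) * cwt \<eta> g (fst w) (snd w)) / fst w)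
      = (LINT z|lborel2. f (fst z) * g (snd z) * kern (1 / real (Suc n)) (real (Suc n)) (fst z) (snd z))"
      unfolding scales_def by (rule bilinear_eq[OF f gi p(1) scales_le])
    also have "\<dots> = ?\<Phi> (1 / real (Suc n)) - ?\<Phi> (real (Suc n))"
      unfolding kern_eq[OF p(1) scales_le] right_diff_distrib
      by (rule Bochner_Integration.integral_diff) (intro phi_approx_integrable f gi p)+
    finally show ?thesis .
  qed
  have lim0: "(\<lambda>n. 1 / real (Suc n)) \<longlonglongrightarrow> 0" by (rule lim_1_over_n[THEN LIMSEQ_Suc])
  have 1: "(\<lambda>n. ?\<Phi> (1 / real (Suc n))) \<longlonglongrightarrow> calderon * (LINT x|lborel. f x * g x)"
    by (rule phi_approx_limit[OF f g cg _ lim0]) simp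
  let ?c = "2 * bd\<^sup>2 * ((LINT x|lborel. \<bar>f x\<bar>) * (LINT x|lborel. \<bar>g x\<bar>))"
  have 2: "(\<lambda>n. ?\<Phi> (real (Suc n))) \<longlonglongrightarrow> 0"
  proof (rule Lim_null_comparison)
    have "norm (?\<Phi> (real (Suc n))) \<le> ?c * (1 / real (Suc n))" for n
      using phi_approx_integrable(2)[OF f gi, of "real (Suc n)"] by simp
    then show "eventually (\<lambda>n. norm (?\<Phi> (real (Suc n))) \<le> ?c * (1 / real (Suc n))) sequentially" by (intro always_eventually allI)
    show "(\<lambda>n. ?c * (1 / real (Suc n))) \<longlonglongrightarrow> 0" by (intro tendsto_mult_right_zero lim0)
  qed
  show ?thesis unfolding eq using tendsto_diff[OF 1 2] by simp
qed

end

context smooth_wavelet begin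

lemma test_fun_kernel: "test_fun \<eta>"
  by (rule test_funI[of _ bd 1]) (auto simp: bd supp)

lemma kernel_square_pos:
  assumes "\<eta> x0 \<noteq> 0"
  shows "(LINT x|lborel. \<eta> x * \<eta> x) > 0"
proof -
  define d where "d = \<bar>\<eta> x0\<bar> / (2 * D.bd)"
  have d: "d > 0" using assms D.bd_pos by (simp add: d_def)
  have lower: "(\<bar>\<eta> x0\<bar> / 2)\<^sup>2 * indicator {x0..x0 + d} x \<le> \<eta> x * \<eta> x" for x
  proof (cases "x \<in> {x0..x0 + d}")
    case True
    have "\<bar>\<eta> x0 - \<eta> x\<bar> \<le> D.bd * \<bar>x0 - x\<bar>" by (rule lipschitz)
    also have "\<dots> \<le> D.bd * d" using True D.bd_pos by (intro mult_left_mono) auto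
    also have "\<dots> = \<bar>\<eta> x0\<bar> / 2" using D.bd_pos by (simp add: d_def)
    finally have "\<bar>\<bar>\<eta> x0\<bar> / 2\<bar> \<le> \<bar>\<eta> x\<bar>" by linarith
    then have "(\<bar>\<eta> x0\<bar> / 2)\<^sup>2 \<le> (\<eta> x)\<^sup>2" by (simp only: abs_le_square_iff)
    then show ?thesis using True by (simp add: power2_eq_square)
  qed simp
  have "(LINT x|lborel. (\<bar>\<eta> x0\<bar> / 2)\<^sup>2 * indicator {x0..x0 + d} x) \<le> (LINT x|lborel. \<eta> x * \<eta> x)"
    using acorr_integrable[of 0] by (intro integral_mono lower integrable_const_indicator_Icc) auto
  also have "(LINT x|lborel. (\<bar>\<eta> x0\<bar> / 2)\<^sup>2 * indicator {x0..x0 + d} x) = (\<bar>\<eta> x0\<bar> / 2)\<^sup>2 * d"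
    using d by simp
  finally show ?thesis using d assms by (smt (verit) zero_less_power mult_pos_pos zero_less_abs_iff half_gt_zero)
qed

text \<open>At (1, 0) the transform of \<eta> by itself is the integral of \<eta>^2; the Lipschitz
  bound keeps at least half of that value nearby.\<close>

lemma cwt_self_lower:
  assumes d: "0 < d" and sq: "4 * D.bd * d * (LINT x|lborel. \<bar>\<eta> x\<bar>) \<le> (LINT x|lborel. \<eta> x * \<eta> x)"
    and s: "1 \<le> s" "s \<le> 1 + d" and t: "0 \<le> t" "t \<le> d"
  shows "(LINT x|lborel. \<eta> x * \<eta> x) / 2 \<le> s * cwt \<eta> \<eta> s t"
proof -
  have i1: "integrable lborel (\<lambda>x. \<eta> x * \<eta> x)" using acorr_integrable[of 0] by simp
  have i2: "integrable lborel (\<lambda>x. \<eta> x * \<eta> ((x - t) / s))" by (rule cwt_integrand_integrable[OF integrable_kernel])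
  have "\<bar>LINT x|lborel. \<eta> x * \<eta> x - \<eta> x * \<eta> ((x - t) / s)\<bar> \<le> (LINT x|lborel. 2 * D.bd * d * \<bar>\<eta> x\<bar>)"
  proof (rule abs_integral_le)
    fix x
    show "\<bar>\<eta> x * \<eta> x - \<eta> x * \<eta> ((x - t) / s)\<bar> \<le> 2 * D.bd * d * \<bar>\<eta> x\<bar>"
    proof (cases "\<bar>x\<bar> \<le> 1")
      case True
      have "x - (x - t) / s = (x * (s - 1) + t) / s" using s by (simp add: field_simps)
      also have "\<bar>\<dots>\<bar> \<le> \<bar>x * (s - 1) + t\<bar>" using s mult_left_mono[OF s(1) abs_ge_zero[of "x * (s - 1) + t"]] by (simp add: abs_divide divide_le_eq)
      also have "\<dots> \<le> \<bar>x\<bar> * \<bar>s - 1\<bar> + \<bar>t\<bar>" by (simp add: abs_mult[symmetric])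
      also have "\<dots> \<le> 1 * d + d" using True s t by (intro add_mono mult_mono) auto
      finally have "\<bar>x - (x - t) / s\<bar> \<le> 2 * d" by simp
      then have "\<bar>\<eta> x - \<eta> ((x - t) / s)\<bar> \<le> D.bd * (2 * d)"
        using D.bd_pos by (intro order_trans[OF lipschitz] mult_left_mono) auto
      then have "\<bar>\<eta> x\<bar> * \<bar>\<eta> x - \<eta> ((x - t) / s)\<bar> \<le> \<bar>\<eta> x\<bar> * (D.bd * (2 * d))" by (rule mult_left_mono) simp
      then show ?thesis unfolding right_diff_distrib[symmetric] abs_mult by (simp add: ac_simps)
    qed (simp add: supp)
  qed (use integrable_kernel in auto)
  also have "\<dots> = 2 * D.bd * d * (LINT x|lborel. \<bar>\<eta> x\<bar>)" by simp
  finally have "\<bar>(LINT x|lborel. \<eta> x * \<eta> x) - (LINT x|lborel. \<eta> x * \<eta> ((x - t) / s))\<bar> \<le> 2 * D.bd * d * (LINT x|lborel. \<bar>\<eta> x\<bar>)"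
    using i1 i2 by simp
  moreover have "s * cwt \<eta> \<eta> s t = (LINT x|lborel. \<eta> x * \<eta> ((x - t) / s))" using s by (simp add: cwt_def)
  ultimately show ?thesis using sq by linarith
qed

text \<open>Apply the limit formula to f = g = \<eta>: the integrands are nonnegative and bounded
  below on a fixed rectangle near (1, 0), so the limit, \<open>calderon\<close> times the integral
  of \<eta>^2, is positive.\<close>

lemma calderon_nonzero:
  assumes nz: "\<eta> x0 \<noteq> 0"
  shows "calderon \<noteq> 0"
proof -
  define Z where "Z = (LINT x|lborel. \<eta> x * \<eta> x)"
  have Z: "Z > 0" unfolding Z_def by (rule kernel_square_pos[OF nz])
  define Y where "Y = (LINT x|lborel. \<bar>\<eta> x\<bar>)"
  have Y: "Y \<ge> 0" by (simp add: Y_def)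
  \<comment> \<open>The bound 1 gives s <= 2; the other term is the smallness condition of
    \<open>cwt_self_lower\<close>, with Y + 1 to avoid a zero denominator.\<close>
  define d where "d = min 1 (Z / (4 * D.bd * (Y + 1)))"
  have d: "0 < d" "d \<le> 1" using Z Y D.bd_pos by (auto simp: d_def)
  have "4 * D.bd * d * Y \<le> 4 * D.bd * (Z / (4 * D.bd * (Y + 1))) * (Y + 1)"
    using Y D.bd_pos d Z by (intro mult_mono) (auto simp: d_def)
  also have "\<dots> = Z" using Y D.bd_pos by simp
  finally have sq: "4 * D.bd * d * Y \<le> Z" .
  let ?F = "\<lambda>n w. indicator (scales n) (fst w) * (cwt \<eta> \<eta> (fst w) (snd w) * cwt \<eta> \<eta> (fst w) (snd w)) / fst w"
  let ?Q = "{1..1 + d} \<times> {0..d}"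
  have Q: "emeasure lborel2 ?Q = ennreal (d * d)"
  proof -
    have "emeasure lborel2 ?Q = emeasure lborel {1..1 + d} * emeasure lborel {0..d}"
      by (rule lborel.emeasure_pair_measure_Times) auto
    then show ?thesis using d by (simp add: ennreal_mult)
  qed
  \<comment> \<open>For n >= 1 the set \<open>scales n\<close> contains [1, 2]. On the rectangle the
    transform is at least Z/4 and s <= 2, whence Z^2/32.\<close>
  have low: "(LINT w|lborel2. Z\<^sup>2 / 32 * indicator ?Q w) \<le> (LINT w|lborel2. ?F n w)" if n: "n \<ge> 1" for n
  proof (rule integral_mono)
    show "integrable lborel2 (\<lambda>w. Z\<^sup>2 / 32 * indicator ?Q w)"
      using Q by (intro integrable_mult_right integrable_real_indicator) auto
    show "integrable lborel2 (?F n)"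
      unfolding scales_def by (intro bilinear_integrable integrable_kernel scales_le) auto
    fix w :: "real \<times> real"
    obtain s t where w: "w = (s, t)" by (cases w)
    show "Z\<^sup>2 / 32 * indicator ?Q w \<le> ?F n w"
    proof (cases "w \<in> ?Q")
      case True
      then have st: "1 \<le> s" "s \<le> 1 + d" "0 \<le> t" "t \<le> d" using w by auto
      have "Z / 2 \<le> s * cwt \<eta> \<eta> s t"
        using cwt_self_lower[OF d(1) _ st] sq by (simp add: Z_def Y_def)
      then have "Z / 2 / s \<le> cwt \<eta> \<eta> s t" using st by (simp add: field_simps)
      moreover have "Z / 2 / 2 \<le> Z / 2 / s" using Z st d by (intro divide_left_mono) auto
      ultimately have v: "Z / 4 \<le> cwt \<eta> \<eta> s t" by simp
      have "(Z / 4) * (Z / 4) \<le> cwt \<eta> \<eta> s t * cwt \<eta> \<eta> s t" using v Z by (intro mult_mono) auto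
      then have "(Z / 4) * (Z / 4) / 2 \<le> cwt \<eta> \<eta> s t * cwt \<eta> \<eta> s t / s"
        using st d Z by (intro frac_le) auto
      moreover have "s \<in> scales n"
      proof -
        have "1 / real (Suc n) \<le> 1" by simp
        moreover have "2 \<le> real (Suc n)" using n by simp
        ultimately have "1 / real (Suc n) \<le> s" "s \<le> real (Suc n)" using st d by linarith+
        then show ?thesis unfolding scales_def by simp
      qed
      ultimately show ?thesis using True w by (simp add: power2_eq_square)
    next
      case False
      have "0 < s" if "s \<in> scales n" using that scales_Union by blast
      then show ?thesis using False w by (auto split: split_indicator)
    qed
  qed
  have "(LINT w|lborel2. Z\<^sup>2 / 32 * indicator ?Q w) \<le> calderon * Z"
  proof (rule LIMSEQ_le_const)
    show "(\<lambda>n. LINT w|lborel2. ?F n w) \<longlonglongrightarrow> calderon * Z"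
      unfolding Z_def by (rule reproducing_limit[OF integrable_kernel test_fun_kernel cont])
    show "\<exists>N. \<forall>n\<ge>N. (LINT w|lborel2. Z\<^sup>2 / 32 * indicator ?Q w) \<le> (LINT w|lborel2. ?F n w)"
      using low by blast
  qed
  also have "(LINT w|lborel2. Z\<^sup>2 / 32 * indicator ?Q w) = Z\<^sup>2 / 32 * (d * d)" using Q d by (simp add: measure_def)
  finally have "Z\<^sup>2 / 32 * (d * d) \<le> calderon * Z" .
  moreover have "0 < Z\<^sup>2 / 32 * (d * d)" using Z d by simp
  ultimately show ?thesis by auto
qed

text \<open>Absolute convergence over all scales lets dominated convergence identify the limit over
  \<open>scales n\<close> with the full integral.\<close>

lemma reproducing:
  assumes f: "integrable lborel f" and g: "test_fun g" and cg: "continuous_on UNIV g"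
    and int: "integrable lborel2 (\<lambda>w. indicator {0<..} (fst w) * (cwt \<eta> f (fst w) (snd w) * cwt \<eta> g (fst w) (snd w)) / fst w)"
  shows "(LINT w|lborel2. indicator {0<..} (fst w) * (cwt \<eta> f (fst w) (snd w) * cwt \<eta> g (fst w) (snd w)) / fst w)
    = calderon * (LINT x|lborel. f x * g x)"
proof (rule LIMSEQ_unique[OF _ reproducing_limit[OF f g cg]])
  note gi = test_fun_integrable[OF g]
  have [measurable]: "f \<in> borel_measurable borel" "g \<in> borel_measurable borel"
    using borel_measurable_integrable[OF f] borel_measurable_integrable[OF gi] by auto
  let ?H = "\<lambda>w. cwt \<eta> f (fst w) (snd w) * cwt \<eta> g (fst w) (snd w)"
  show "(\<lambda>n. LINT w|lborel2. indicator (scales n) (fst w) * ?H w / fst w) \<longlonglongrightarrow> (LINT w|lborel2. indicator {0<..} (fst w) * ?H w / fst w)"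
  proof (rule integral_dominated_convergence[where w="\<lambda>w. \<bar>indicator {0<..} (fst w) * ?H w / fst w\<bar>"])
    show "integrable lborel2 (\<lambda>w. \<bar>indicator {0<..} (fst w) * ?H w / fst w\<bar>)" by (rule integrable_abs[OF int])
    show "AE w in lborel2. norm (indicator (scales n) (fst w) * ?H w / fst w) \<le> \<bar>indicator {0<..} (fst w) * ?H w / fst w\<bar>" for n
      using scales_Union by (intro AE_I2) (auto split: split_indicator)
    show "AE w in lborel2. (\<lambda>n. indicator (scales n) (fst w) * ?H w / fst w) \<longlonglongrightarrow> indicator {0<..} (fst w) * ?H w / fst w"
    proof (intro AE_I2 tendsto_eventually)
      fix w :: "real \<times> real"
      show "eventually (\<lambda>n. indicator (scales n) (fst w) * ?H w / fst w = indicator {0<..} (fst w) * ?H w / fst w) sequentially"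
      proof (cases "fst w \<in> {0<..}")
        case True
        then obtain n0 where n0: "fst w \<in> scales n0" using scales_Union by blast
        show ?thesis
          using eventually_ge_at_top[of n0]
        proof eventually_elim
          case (elim n)
          then have "fst w \<in> scales n" using n0 incseqD[OF scales_incseq] by blast
          then show ?case using True by simp
        qed
      next
        case False
        then have "fst w \<notin> scales n" for n using scales_Union by blast
        then show ?thesis using False by simp
      qed
    qed
  qed measurable
qed

end


subsection \<open>Mass of the wavelet transform in a cone\<close>

text \<open>Applied to the square root of A B at each t and then integrated, this replaces Hoelder:
  E and G are to be bounds for the two norms, so that the bracket integrates to a constant. The
  factors 1/p and 1/q are simply dropped.\<close>

lemma young_ennreal:
  fixes X A B :: ennreal
  assumes p: "p > 1" "q > 1" "1 / p + 1 / q = 1" and X: "X\<^sup>2 \<le> A * B" and E: "E > 0" and G: "G > 0"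
  shows "X \<le> ennreal (E * G) * (ennreal (1 / E powr p) * ennpow A (p / 2) + ennreal (1 / G powr q) * ennpow B (q / 2))"
proof (cases "A = \<infinity> \<or> B = \<infinity>")
  case True
  then have "ennreal (E * G) * (ennreal (1 / E powr p) * ennpow A (p / 2) + ennreal (1 / G powr q) * ennpow B (q / 2)) = \<infinity>"
    using E G by (auto simp: ennpow_def ennreal_mult_top)
  then show ?thesis by simp
next
  case False
  then obtain a b where ab: "A = ennreal a" "B = ennreal b" "a \<ge> 0" "b \<ge> 0"
    by (cases A rule: ennreal_cases; cases B rule: ennreal_cases) auto
  have "X \<noteq> \<infinity>"
  proof
    assume "X = \<infinity>"
    then show False using X ab by (simp add: ennreal_mult[symmetric] top_unique)
  qed
  then obtain x where x: "X = ennreal x" "x \<ge> 0" by (cases X rule: ennreal_cases) auto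
  have "x\<^sup>2 \<le> a * b" using X ab x by (simp add: ennreal_mult[symmetric] ennreal_power)
  then have "x \<le> sqrt a * sqrt b" using real_le_rsqrt by (simp add: real_sqrt_mult[symmetric])
  also have "\<dots> = E * G * ((sqrt a / E) * (sqrt b / G))" using E G by simp
  also have "\<dots> \<le> E * G * ((sqrt a / E) powr p / p + (sqrt b / G) powr q / q)"
    using E G ab by (intro mult_left_mono Youngs_inequality[OF p]) auto
  also have "\<dots> \<le> E * G * ((sqrt a / E) powr p + (sqrt b / G) powr q)"
    using E G p by (intro mult_left_mono add_mono) (auto simp: divide_le_eq mult_le_cancel_left1)
  also have "(sqrt a / E) powr p = 1 / E powr p * a powr (p / 2)"
    using E ab by (simp add: powr_divide powr_half_sqrt[symmetric] powr_powr)
  also have "(sqrt b / G) powr q = 1 / G powr q * b powr (q / 2)"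
    using G ab by (simp add: powr_divide powr_half_sqrt[symmetric] powr_powr)
  finally have "ennreal x \<le> ennreal (E * G * (1 / E powr p * a powr (p / 2) + 1 / G powr q * b powr (q / 2)))"
    by (rule ennreal_leI)
  also have "\<dots> = ennreal (E * G) * (ennreal (1 / E powr p) * ennreal (a powr (p / 2)) + ennreal (1 / G powr q) * ennreal (b powr (q / 2)))"
  proof -
    have "ennreal (E * G * (1 / E powr p * a powr (p / 2) + 1 / G powr q * b powr (q / 2)))
      = ennreal (E * G) * ennreal (1 / E powr p * a powr (p / 2) + 1 / G powr q * b powr (q / 2))"
      using E G by (intro ennreal_mult) auto
    also have "ennreal (1 / E powr p * a powr (p / 2) + 1 / G powr q * b powr (q / 2))
      = ennreal (1 / E powr p * a powr (p / 2)) + ennreal (1 / G powr q * b powr (q / 2))" by (intro ennreal_plus) auto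
    also have "ennreal (1 / E powr p * a powr (p / 2)) = ennreal (1 / E powr p) * ennreal (a powr (p / 2))" by (intro ennreal_mult) auto
    also have "ennreal (1 / G powr q * b powr (q / 2)) = ennreal (1 / G powr q) * ennreal (b powr (q / 2))" by (intro ennreal_mult) auto
    finally show ?thesis .
  qed
  finally show ?thesis using ab x by simp
qed

text \<open>Dominates s^(-b) by an integral over a in [2s, 4s]. Inserting it and swapping the
  integrals replaces a sum over dyadic scales. The constant comes from the value of the integrand at
  a = 4s and the length 2s.\<close>

lemma nn_powr_lower:
  fixes b s :: real
  assumes s: "s > 0" and b: "b \<ge> 0"
  shows "ennreal (s powr (- b)) \<le> ennreal (4 powr (b + 1) / 2) * (\<integral>\<^sup>+a\<in>{2 * s..4 * s}. ennreal (a powr (- b - 1)) \<partial>lborel)"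
proof -
  have "s powr (- b) = 4 powr (b + 1) / 2 * ((4 * s) powr (- b - 1) * (2 * s))"
  proof -
    have "(4 * s) powr (- b - 1) = 4 powr (- (b + 1)) * s powr (- b - 1)" using s by (simp add: powr_mult)
    moreover have "s powr (- b - 1) * s = s powr (- b)" using s powr_add[of s "- b - 1" 1] by simp
    moreover have "(4::real) powr (b + 1) * 4 powr (- (b + 1)) = 1" by (simp add: powr_add[symmetric])
    ultimately have "4 powr (b + 1) / 2 * ((4 * s) powr (- b - 1) * (2 * s)) = (4 powr (b + 1) * 4 powr (- (b + 1))) * (s powr (- b - 1) * s)"
      by (simp only: ac_simps times_divide_eq_left times_divide_eq_right)
    then show ?thesis using \<open>s powr (- b - 1) * s = s powr (- b)\<close> \<open>(4::real) powr (b + 1) * 4 powr (- (b + 1)) = 1\<close> by simp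
  qed
  then have "ennreal (s powr (- b)) = ennreal (4 powr (b + 1) / 2) * (ennreal ((4 * s) powr (- b - 1)) * ennreal (2 * s))"
    using s by (simp add: ennreal_mult[symmetric])
  moreover have "ennreal ((4 * s) powr (- b - 1)) * ennreal (2 * s) \<le> (\<integral>\<^sup>+a\<in>{2 * s..4 * s}. ennreal (a powr (- b - 1)) \<partial>lborel)"
  proof -
  have "ennreal ((4 * s) powr (- b - 1)) * ennreal (2 * s) = (\<integral>\<^sup>+a. ennreal ((4 * s) powr (- b - 1)) * indicator {2 * s..4 * s} a \<partial>lborel)"
    using s by (subst nn_integral_cmult_indicator) auto
  also have "\<dots> \<le> (\<integral>\<^sup>+a\<in>{2 * s..4 * s}. ennreal (a powr (- b - 1)) \<partial>lborel)"
  proof (rule nn_integral_mono)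
    fix a
    show "ennreal ((4 * s) powr (- b - 1)) * indicator {2 * s..4 * s} a \<le> ennreal (a powr (- b - 1)) * indicator {2 * s..4 * s} a"
      using s b powr_mono2'[of "- b - 1" a "4 * s"] by (auto split: split_indicator intro!: ennreal_leI)
  qed
  finally show ?thesis .
  qed
  ultimately show ?thesis by (simp add: mult_left_mono)
qed

context bump begin

text \<open>The factor 1/s belongs to ds/s. The aperture 2s is dictated by the test function: if g
  lives in a ball of radius h <= s about x0, its transform at scale s vanishes for |t - x0| > s + h,
  hence beyond 2s.\<close>

definition cone :: "(real \<Rightarrow> real) \<Rightarrow> real \<Rightarrow> real \<Rightarrow> ennreal" where
  "cone f x0 s = (\<integral>\<^sup>+t. ennreal (\<bar>cwt \<eta> f s t\<bar> / s) * (if \<bar>t - x0\<bar> \<le> 2 * s then 1 else 0) \<partial>lborel)"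

lemma cone_measurable[measurable]:
  assumes [measurable]: "f \<in> borel_measurable borel"
  shows "cone f x0 \<in> borel_measurable borel"
  unfolding cone_def by measurable

text \<open>For s in [a/4, a/2] the cone stays within distance a of x0, where the leader at a is
  available. Cauchy--Schwarz in s passes to the square function, and Young with normalisation
  a^\<alpha> in t to its p-th power.\<close>

lemma cone_block:
  assumes p: "p > 1" and fm[measurable]: "f \<in> borel_measurable borel" and a: "a > 0" and C: "C \<ge> 0"
    and H: "(\<integral>\<^sup>+t\<in>{x0 - a..x0 + a}. ennpow (sqf \<eta> f {0<..<a} t) (p / 2) \<partial>lborel) \<le> ennreal (a * (C * a powr \<alpha>) powr p)"
  shows "(\<integral>\<^sup>+s\<in>{a / 4..a / 2}. cone f x0 s \<partial>lborel) \<le> ennreal ((C powr p + 2) * a powr (1 + \<alpha>))"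
proof -
  define q where "q = p / (p - 1)"
  have q: "q > 1" "1 / p + 1 / q = 1" using p by (auto simp: q_def field_simps)
  define Y where "Y t = (\<integral>\<^sup>+s\<in>{a / 4..a / 2}. ennreal (\<bar>cwt \<eta> f s t\<bar> / s) \<partial>lborel)" for t
  have Y2: "(Y t)\<^sup>2 \<le> sqf \<eta> f {0<..<a} t * 1" for t
  proof -
    let ?u = "\<lambda>s. ennreal (\<bar>cwt \<eta> f s t\<bar> / sqrt s) * indicator {a / 4..a / 2} s"
    let ?v = "\<lambda>s. ennreal (1 / sqrt s) * indicator {a / 4..a / 2} s"
    have "Y t = (\<integral>\<^sup>+s. ?u s * ?v s \<partial>lborel)"
      unfolding Y_def
    proof (rule nn_integral_cong)
      fix s
      show "ennreal (\<bar>cwt \<eta> f s t\<bar> / s) * indicator {a / 4..a / 2} s = ?u s * ?v s"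
        using a by (auto simp: ennreal_mult[symmetric] split: split_indicator)
    qed
    then have "(Y t)\<^sup>2 \<le> (\<integral>\<^sup>+s. (?u s)\<^sup>2 \<partial>lborel) * (\<integral>\<^sup>+s. (?v s)\<^sup>2 \<partial>lborel)"
      by (simp only:) (rule Cauchy_Schwarz_nn_integral; measurable)
    also have "\<dots> \<le> sqf \<eta> f {0<..<a} t * 1"
    proof (rule mult_mono)
      show "(\<integral>\<^sup>+s. (?u s)\<^sup>2 \<partial>lborel) \<le> sqf \<eta> f {0<..<a} t"
        unfolding sqf_def
      proof (rule nn_integral_mono)
        fix s
        show "(?u s)\<^sup>2 \<le> ennreal ((cwt \<eta> f s t)\<^sup>2 / s) * indicator {0<..<a} s"
          using a by (auto simp: ennreal_power power_divide split: split_indicator)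
      qed
      \<comment> \<open>The factor 1/s is at most 4/a on a range of length a/4, so this side of
        Cauchy--Schwarz is at most 1.\<close>
      have "(\<integral>\<^sup>+s. (?v s)\<^sup>2 \<partial>lborel) \<le> (\<integral>\<^sup>+s. ennreal (4 / a) * indicator {a / 4..a / 2} s \<partial>lborel)"
      proof (rule nn_integral_mono)
        fix s
        show "(?v s)\<^sup>2 \<le> ennreal (4 / a) * indicator {a / 4..a / 2} s"
          using a by (auto simp: ennreal_power power_divide field_simps split: split_indicator intro!: ennreal_leI)
      qed
      also have "\<dots> = 1" using a by (subst nn_integral_cmult_indicator) (auto simp: ennreal_mult[symmetric])
      finally show "(\<integral>\<^sup>+s. (?v s)\<^sup>2 \<partial>lborel) \<le> 1" .
    qed auto
    finally show ?thesis .
  qed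
  define E where "E = a powr \<alpha>"
  have E: "E > 0" using a by (simp add: E_def)
  have Yb: "Y t \<le> ennreal E * (ennreal (1 / E powr p) * ennpow (sqf \<eta> f {0<..<a} t) (p / 2) + 1)" for t
    using young_ennreal[OF p q Y2 E, of 1 t] ennpow_ennreal[of 1 "q / 2"] by (simp add: one_ennreal_def[symmetric])
  have "(\<integral>\<^sup>+s\<in>{a / 4..a / 2}. cone f x0 s \<partial>lborel)
    = (\<integral>\<^sup>+s. \<integral>\<^sup>+t. ennreal (\<bar>cwt \<eta> f s t\<bar> / s) * (if \<bar>t - x0\<bar> \<le> 2 * s then 1 else 0) * indicator {a / 4..a / 2} s \<partial>lborel \<partial>lborel)"
    unfolding cone_def by (intro nn_integral_cong nn_integral_multc[symmetric]) measurable
  also have "\<dots> = (\<integral>\<^sup>+t. \<integral>\<^sup>+s. ennreal (\<bar>cwt \<eta> f s t\<bar> / s) * (if \<bar>t - x0\<bar> \<le> 2 * s then 1 else 0) * indicator {a / 4..a / 2} s \<partial>lborel \<partial>lborel)"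
    by (rule lborel_pair.Fubini') measurable
  also have "\<dots> \<le> (\<integral>\<^sup>+t. Y t * indicator {x0 - a..x0 + a} t \<partial>lborel)"
  proof (rule nn_integral_mono)
    fix t
    show "(\<integral>\<^sup>+s. ennreal (\<bar>cwt \<eta> f s t\<bar> / s) * (if \<bar>t - x0\<bar> \<le> 2 * s then 1 else 0) * indicator {a / 4..a / 2} s \<partial>lborel)
      \<le> Y t * indicator {x0 - a..x0 + a} t"
    proof (cases "t \<in> {x0 - a..x0 + a}")
      case True
      then show ?thesis unfolding Y_def by (auto intro!: nn_integral_mono split: split_indicator)
    next
      case False
      have "(\<integral>\<^sup>+s. ennreal (\<bar>cwt \<eta> f s t\<bar> / s) * (if \<bar>t - x0\<bar> \<le> 2 * s then 1 else 0) * indicator {a / 4..a / 2} s \<partial>lborel) = (\<integral>\<^sup>+s. 0 \<partial>(lborel :: real measure))"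
        using False by (intro nn_integral_cong) (auto split: split_indicator)
      then show ?thesis by simp
    qed
  qed
  also have "\<dots> \<le> (\<integral>\<^sup>+t. ennreal E * (ennreal (1 / E powr p) * (ennpow (sqf \<eta> f {0<..<a} t) (p / 2) * indicator {x0 - a..x0 + a} t) + indicator {x0 - a..x0 + a} t) \<partial>lborel)"
    using Yb by (intro nn_integral_mono) (auto split: split_indicator)
  also have "\<dots> = ennreal E * (ennreal (1 / E powr p) * (\<integral>\<^sup>+t\<in>{x0 - a..x0 + a}. ennpow (sqf \<eta> f {0<..<a} t) (p / 2) \<partial>lborel) + ennreal (2 * a))"
    using a by (subst nn_integral_cmult, measurable, subst nn_integral_add) (auto simp: nn_integral_cmult)
  also have "\<dots> \<le> ennreal E * (ennreal (1 / E powr p) * ennreal (a * (C * a powr \<alpha>) powr p) + ennreal (2 * a))"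
    by (intro mult_left_mono add_right_mono H) auto
  also have "\<dots> = ennreal (E * (1 / E powr p * (a * (C * a powr \<alpha>) powr p) + 2 * a))"
    using a E C by (simp add: ennreal_mult[symmetric] ennreal_plus[symmetric] del: ennreal_plus)
  also have "E * (1 / E powr p * (a * (C * a powr \<alpha>) powr p) + 2 * a) = (C powr p + 2) * a powr (1 + \<alpha>)"
  proof -
    have "(C * a powr \<alpha>) powr p = C powr p * E powr p" using a C by (simp add: powr_mult E_def)
    moreover have "E powr p > 0" using E by simp
    moreover have "a powr (1 + \<alpha>) = a * E" using a by (simp add: powr_add E_def)
    ultimately show ?thesis by (simp add: field_simps)
  qed
  finally show ?thesis .
qed

text \<open>By \<open>nn_powr_lower\<close> and Fubini, each a collects exactly the scales in
  [a/4, a/2], to which the block bound applies. For s <= A/4 all a concerned are at most 4s <=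
  A.\<close>

lemma cone_powr:
  assumes [measurable]: "f \<in> borel_measurable borel" and b: "b \<ge> 0" and K: "K \<ge> 0"
    and blk: "\<And>a. 0 < a \<Longrightarrow> a \<le> A \<Longrightarrow> (\<integral>\<^sup>+s\<in>{a / 4..a / 2}. cone f x0 s \<partial>lborel) \<le> ennreal (K * a powr (1 + \<alpha>))"
    and S[measurable]: "S \<in> sets borel" "S \<subseteq> {0<..A / 4}" and T[measurable]: "T \<in> sets borel"
    and ST: "\<And>s a. s \<in> S \<Longrightarrow> 2 * s \<le> a \<Longrightarrow> a \<le> 4 * s \<Longrightarrow> a \<in> T"
  shows "(\<integral>\<^sup>+s\<in>S. (cone f x0 s * ennreal (s powr (- b))) \<partial>lborel) \<le> ennreal (4 powr (b + 1) / 2 * K) * (\<integral>\<^sup>+a\<in>T. ennreal (a powr (\<alpha> - b)) \<partial>lborel)"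
proof -
  let ?k = "4 powr (b + 1) / 2"
  let ?e = "\<lambda>s a. (cone f x0 s * indicator S s) * (ennreal (a powr (- b - 1)) * (if 2 * s \<le> a \<and> a \<le> 4 * s then 1 else 0))"
  have "(\<integral>\<^sup>+s\<in>S. (cone f x0 s * ennreal (s powr (- b))) \<partial>lborel) \<le> (\<integral>\<^sup>+s. ennreal ?k * (\<integral>\<^sup>+a. ?e s a \<partial>lborel) \<partial>lborel)"
  proof (rule nn_integral_mono)
    fix s
    show "cone f x0 s * ennreal (s powr (- b)) * indicator S s \<le> ennreal ?k * (\<integral>\<^sup>+a. ?e s a \<partial>lborel)"
    proof (cases "s \<in> S")
      case True
      then have s: "s > 0" using S(2) by auto
      have eq: "(\<integral>\<^sup>+a\<in>{2 * s..4 * s}. ennreal (a powr (- b - 1)) \<partial>lborel) = (\<integral>\<^sup>+a. ennreal (a powr (- b - 1)) * (if 2 * s \<le> a \<and> a \<le> 4 * s then 1 else 0) \<partial>lborel)"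
        by (intro nn_integral_cong) (auto split: split_indicator)
      have "cone f x0 s * ennreal (s powr (- b)) \<le> cone f x0 s * (ennreal ?k * (\<integral>\<^sup>+a. ennreal (a powr (- b - 1)) * (if 2 * s \<le> a \<and> a \<le> 4 * s then 1 else 0) \<partial>lborel))"
        unfolding eq[symmetric] by (intro mult_left_mono nn_powr_lower s b) auto
      also have "\<dots> = ennreal ?k * (\<integral>\<^sup>+a. ?e s a \<partial>lborel)"
        using True by (subst nn_integral_cmult) (auto simp: ac_simps)
      finally show ?thesis using True by simp
    qed simp
  qed
  also have "\<dots> = ennreal ?k * (\<integral>\<^sup>+s. \<integral>\<^sup>+a. ?e s a \<partial>lborel \<partial>lborel)"
    by (rule nn_integral_cmult) measurable
  finally have 1: "(\<integral>\<^sup>+s\<in>S. (cone f x0 s * ennreal (s powr (- b))) \<partial>lborel) \<le> ennreal ?k * (\<integral>\<^sup>+s. \<integral>\<^sup>+a. ?e s a \<partial>lborel \<partial>lborel)" .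
  have "(\<integral>\<^sup>+s. \<integral>\<^sup>+a. ?e s a \<partial>lborel \<partial>lborel) = (\<integral>\<^sup>+a. \<integral>\<^sup>+s. ?e s a \<partial>lborel \<partial>lborel)"
    by (rule lborel_pair.Fubini') measurable
  also have "\<dots> \<le> (\<integral>\<^sup>+a. ennreal K * (ennreal (a powr (\<alpha> - b)) * indicator T a) \<partial>lborel)"
  proof (rule nn_integral_mono)
    fix a
    show "(\<integral>\<^sup>+s. ?e s a \<partial>lborel) \<le> ennreal K * (ennreal (a powr (\<alpha> - b)) * indicator T a)"
    proof (cases "0 < a \<and> a \<le> A \<and> a \<in> T")
      case True
      have "(\<integral>\<^sup>+s. ?e s a \<partial>lborel) \<le> (\<integral>\<^sup>+s. ennreal (a powr (- b - 1)) * (cone f x0 s * indicator {a / 4..a / 2} s) \<partial>lborel)"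
        by (intro nn_integral_mono) (auto simp: mult.commute split: split_indicator)
      also have "\<dots> = ennreal (a powr (- b - 1)) * (\<integral>\<^sup>+s\<in>{a / 4..a / 2}. cone f x0 s \<partial>lborel)"
        by (rule nn_integral_cmult) measurable
      also have "\<dots> \<le> ennreal (a powr (- b - 1)) * ennreal (K * a powr (1 + \<alpha>))"
        using True by (intro mult_left_mono blk) auto
      also have "\<dots> = ennreal (K * (a powr (- b - 1) * a powr (1 + \<alpha>)))" using K by (simp add: ennreal_mult[symmetric] ac_simps)
      also have "a powr (- b - 1) * a powr (1 + \<alpha>) = a powr (\<alpha> - b)" unfolding powr_add[symmetric] by simp
      finally show ?thesis using True K by (simp add: ennreal_mult)
    next
      case False
      have "?e s a = 0" for s
        using False S(2) ST[of s a] by (auto split: split_indicator)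
      then have "(\<integral>\<^sup>+s. ?e s a \<partial>lborel) = (\<integral>\<^sup>+s. 0 \<partial>(lborel :: real measure))" by (intro nn_integral_cong)
      then show ?thesis by (simp only: nn_integral_const mult_zero_left zero_le)
    qed
  qed
  also have "\<dots> = ennreal K * (\<integral>\<^sup>+a\<in>T. ennreal (a powr (\<alpha> - b)) \<partial>lborel)"
    by (rule nn_integral_cmult) measurable
  finally have "ennreal ?k * (\<integral>\<^sup>+s. \<integral>\<^sup>+a. ?e s a \<partial>lborel \<partial>lborel) \<le> ennreal ?k * (ennreal K * (\<integral>\<^sup>+a\<in>T. ennreal (a powr (\<alpha> - b)) \<partial>lborel))"
    by (rule mult_left_mono) simp
  also have "\<dots> = ennreal (?k * K) * (\<integral>\<^sup>+a\<in>T. ennreal (a powr (\<alpha> - b)) \<partial>lborel)"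
  proof -
    have "ennreal (?k * K) = ennreal ?k * ennreal K" using K by (intro ennreal_mult) auto
    then show ?thesis by (simp only: mult.assoc)
  qed
  finally show ?thesis by (rule order_trans[OF 1])
qed

text \<open>The integral of a^(\<alpha> - k - 1) over (0, 4h) converges because k < \<alpha>. It
  makes the Taylor coefficients of order below \<alpha> integrable at small scales.\<close>

lemma cone_near:
  assumes f: "f \<in> borel_measurable borel" and K: "K \<ge> 0" and k: "real k < \<alpha>"
    and blk: "\<And>a. 0 < a \<Longrightarrow> a \<le> A \<Longrightarrow> (\<integral>\<^sup>+s\<in>{a / 4..a / 2}. cone f x0 s \<partial>lborel) \<le> ennreal (K * a powr (1 + \<alpha>))"
  shows "\<exists>C\<ge>0. \<forall>h. 0 < h \<and> h \<le> A / 4 \<longrightarrow> (\<integral>\<^sup>+s\<in>{0<..<h}. (cone f x0 s * ennreal (s powr (- (real k + 1)))) \<partial>lborel) \<le> ennreal (C * h powr (\<alpha> - real k))"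
proof -
  let ?k = "4 powr (real k + 1 + 1) / 2 * K"
  have K': "?k \<ge> 0" using K by simp
  show ?thesis
  proof (rule exI[of _ "?k * (4 powr (\<alpha> - real k) / (\<alpha> - real k))"], intro conjI allI impI)
    show "?k * (4 powr (\<alpha> - real k) / (\<alpha> - real k)) \<ge> 0" using K k by (intro mult_nonneg_nonneg) auto
    fix h assume h: "0 < h \<and> h \<le> A / 4"
    have "(\<integral>\<^sup>+s\<in>{0<..<h}. (cone f x0 s * ennreal (s powr (- (real k + 1)))) \<partial>lborel) \<le> ennreal ?k * (\<integral>\<^sup>+a\<in>{0<..<4 * h}. ennreal (a powr (\<alpha> - (real k + 1))) \<partial>lborel)"
      using h by (intro cone_powr[OF f _ K blk]) auto
    also have "\<dots> = ennreal ?k * ennreal ((4 * h) powr (\<alpha> - real k) / (\<alpha> - real k))"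
      using nn_integral_powr_near_0[of "\<alpha> - (real k + 1)" "4 * h"] h k by (simp add: algebra_simps)
    also have "\<dots> = ennreal (?k * ((4 * h) powr (\<alpha> - real k) / (\<alpha> - real k)))"
      using K' k h by (intro ennreal_mult[symmetric]) auto
    also have "(4 * h) powr (\<alpha> - real k) = 4 powr (\<alpha> - real k) * h powr (\<alpha> - real k)" using h by (simp add: powr_mult)
    finally show "(\<integral>\<^sup>+s\<in>{0<..<h}. (cone f x0 s * ennreal (s powr (- (real k + 1)))) \<partial>lborel) \<le> ennreal (?k * (4 powr (\<alpha> - real k) / (\<alpha> - real k)) * h powr (\<alpha> - real k))"
      by (simp add: mult.assoc)
  qed
qed

text \<open>The integral of a^(\<alpha> - n - 1) over [2h, infinity) converges because \<alpha> < n.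
  It controls the Taylor remainder at scales between h and A/4.\<close>

lemma cone_middle:
  assumes f: "f \<in> borel_measurable borel" and K: "K \<ge> 0" and n: "\<alpha> < real n"
    and blk: "\<And>a. 0 < a \<Longrightarrow> a \<le> A \<Longrightarrow> (\<integral>\<^sup>+s\<in>{a / 4..a / 2}. cone f x0 s \<partial>lborel) \<le> ennreal (K * a powr (1 + \<alpha>))"
  shows "\<exists>C\<ge>0. \<forall>h. 0 < h \<and> h \<le> A / 4 \<longrightarrow> (\<integral>\<^sup>+s\<in>{h..A / 4}. (cone f x0 s * ennreal (s powr (- (real n + 1)))) \<partial>lborel) \<le> ennreal (C * h powr (\<alpha> - real n))"
proof -
  let ?k = "4 powr (real n + 1 + 1) / 2 * K"
  have K': "?k \<ge> 0" using K by simp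
  show ?thesis
  proof (rule exI[of _ "?k * (2 powr (\<alpha> - real n) / (real n - \<alpha>))"], intro conjI allI impI)
    show "?k * (2 powr (\<alpha> - real n) / (real n - \<alpha>)) \<ge> 0" using K n by (intro mult_nonneg_nonneg) auto
    fix h assume h: "0 < h \<and> h \<le> A / 4"
    have "(\<integral>\<^sup>+s\<in>{h..A / 4}. (cone f x0 s * ennreal (s powr (- (real n + 1)))) \<partial>lborel) \<le> ennreal ?k * (\<integral>\<^sup>+a\<in>{2 * h..}. ennreal (a powr (\<alpha> - (real n + 1))) \<partial>lborel)"
      using h by (intro cone_powr[OF f _ K blk]) auto
    also have "\<dots> = ennreal ?k * ennreal ((2 * h) powr (\<alpha> - real n) / (real n - \<alpha>))"
      using nn_integral_powr_near_inf[of "\<alpha> - (real n + 1)" "2 * h"] h n by (simp add: algebra_simps minus_divide_right)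
    also have "\<dots> = ennreal (?k * ((2 * h) powr (\<alpha> - real n) / (real n - \<alpha>)))"
      using K' n h by (intro ennreal_mult[symmetric]) auto
    also have "(2 * h) powr (\<alpha> - real n) = 2 powr (\<alpha> - real n) * h powr (\<alpha> - real n)" using h by (simp add: powr_mult)
    finally show "(\<integral>\<^sup>+s\<in>{h..A / 4}. (cone f x0 s * ennreal (s powr (- (real n + 1)))) \<partial>lborel) \<le> ennreal (?k * (2 powr (\<alpha> - real n) / (real n - \<alpha>)) * h powr (\<alpha> - real n))"
      by (simp add: mult.assoc)
  qed
qed

text \<open>Beyond A/4 the leaders give no information; the trivial bound of the transform by the
  L^1 norm of f over s suffices.\<close>

lemma cone_far:
  assumes f: "integrable lborel f" and h: "h > 0"
  shows "\<exists>C\<ge>0. (\<integral>\<^sup>+s\<in>{h..}. (cone f x0 s * ennreal (s powr (- (real k + 1)))) \<partial>lborel) \<le> ennreal C"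
proof -
  have [measurable]: "f \<in> borel_measurable borel" using borel_measurable_integrable[OF f] by simp
  define F where "F = (LINT x|lborel. \<bar>f x\<bar>)"
  have F: "F \<ge> 0" by (simp add: F_def)
  have c: "cone f x0 s \<le> ennreal (4 * bd * F / s)" if s: "s > 0" for s
  proof -
    have "cone f x0 s \<le> (\<integral>\<^sup>+t. ennreal (bd * F / s\<^sup>2) * indicator {x0 - 2 * s..x0 + 2 * s} t \<partial>lborel)"
      unfolding cone_def
    proof (rule nn_integral_mono)
      fix t
      have "\<bar>cwt \<eta> f s t\<bar> / s \<le> bd / s * F / s"
        unfolding F_def using s by (intro divide_right_mono cwt_bound f) auto
      then have "ennreal (\<bar>cwt \<eta> f s t\<bar> / s) \<le> ennreal (bd * F / s\<^sup>2)" by (intro ennreal_leI) (simp add: power2_eq_square)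
      then show "ennreal (\<bar>cwt \<eta> f s t\<bar> / s) * (if \<bar>t - x0\<bar> \<le> 2 * s then 1 else 0) \<le> ennreal (bd * F / s\<^sup>2) * indicator {x0 - 2 * s..x0 + 2 * s} t"
        by (auto simp: abs_le_iff split: split_indicator)
    qed
    also have "\<dots> = ennreal (bd * F / s\<^sup>2) * ennreal (4 * s)" using s by (subst nn_integral_cmult_indicator) auto
    also have "\<dots> = ennreal (4 * bd * F / s)" using s F bd_pos by (simp add: ennreal_mult[symmetric] power2_eq_square)
    finally show ?thesis .
  qed
  have "(\<integral>\<^sup>+s\<in>{h..}. (cone f x0 s * ennreal (s powr (- (real k + 1)))) \<partial>lborel) \<le> (\<integral>\<^sup>+s. ennreal (4 * bd * F) * (ennreal (s powr (- (real k + 2))) * indicator {h..} s) \<partial>lborel)"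
  proof (rule nn_integral_mono)
    fix s
    show "cone f x0 s * ennreal (s powr (- (real k + 1))) * indicator {h..} s \<le> ennreal (4 * bd * F) * (ennreal (s powr (- (real k + 2))) * indicator {h..} s)"
    proof (cases "h \<le> s")
      case True
      then have s: "s > 0" using h by simp
      have "cone f x0 s * ennreal (s powr (- (real k + 1))) \<le> ennreal (4 * bd * F / s) * ennreal (s powr (- (real k + 1)))"
        by (intro mult_right_mono c s) auto
      also have "\<dots> = ennreal (4 * bd * F * (s powr (- (real k + 1)) / s))"
        using s F bd_pos by (simp add: ennreal_mult[symmetric])
      also have "s powr (- (real k + 1)) / s = s powr (- (real k + 2))"
        using s powr_diff[of s "- (real k + 1)" 1] by (simp add: algebra_simps)
      finally show ?thesis using True F bd_pos by (simp add: ennreal_mult)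
    qed simp
  qed
  also have "\<dots> = ennreal (4 * bd * F) * ennreal (h powr (- (real k + 1)) / (real k + 1))"
    using nn_integral_powr_near_inf[of "- (real k + 2)" h] h
    by (subst nn_integral_cmult) (auto simp: algebra_simps minus_divide_right)
  also have "\<dots> = ennreal (4 * bd * F * (h powr (- (real k + 1)) / (real k + 1)))"
    using F bd_pos by (intro ennreal_mult[symmetric]) auto
  finally show ?thesis using F bd_pos by (intro exI[of _ "4 * bd * F * (h powr (- (real k + 1)) / (real k + 1))"]) auto
qed

lemma cone_lborel2:
  assumes [measurable]: "f \<in> borel_measurable borel" "S \<in> sets borel"
  shows "(\<integral>\<^sup>+w. ennreal (\<bar>cwt \<eta> f (fst w) (snd w)\<bar> / fst w * fst w powr (- b)) * (if \<bar>snd w - x0\<bar> \<le> 2 * fst w then 1 else 0) * indicator S (fst w) \<partial>lborel2)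
    = (\<integral>\<^sup>+s\<in>S. (cone f x0 s * ennreal (s powr (- b))) \<partial>lborel)"
proof -
  have "(\<integral>\<^sup>+w. ennreal (\<bar>cwt \<eta> f (fst w) (snd w)\<bar> / fst w * fst w powr (- b)) * (if \<bar>snd w - x0\<bar> \<le> 2 * fst w then 1 else 0) * indicator S (fst w) \<partial>lborel2)
    = (\<integral>\<^sup>+s. \<integral>\<^sup>+t. ennreal (\<bar>cwt \<eta> f s t\<bar> / s * s powr (- b)) * (if \<bar>t - x0\<bar> \<le> 2 * s then 1 else 0) * indicator S s \<partial>lborel \<partial>lborel)"
    by (subst lborel.nn_integral_fst[symmetric]) auto
  also have "\<dots> = (\<integral>\<^sup>+s. \<integral>\<^sup>+t. (ennreal (\<bar>cwt \<eta> f s t\<bar> / s) * (if \<bar>t - x0\<bar> \<le> 2 * s then 1 else 0)) * (ennreal (s powr (- b)) * indicator S s) \<partial>lborel \<partial>lborel)"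
  proof (intro nn_integral_cong)
    fix s t :: real
    have "ennreal (\<bar>cwt \<eta> f s t\<bar> / s * s powr (- b)) = ennreal (\<bar>cwt \<eta> f s t\<bar> / s) * ennreal (s powr (- b))"
      by (rule ennreal_mult'') simp
    then show "ennreal (\<bar>cwt \<eta> f s t\<bar> / s * s powr (- b)) * (if \<bar>t - x0\<bar> \<le> 2 * s then 1 else 0) * indicator S s
      = (ennreal (\<bar>cwt \<eta> f s t\<bar> / s) * (if \<bar>t - x0\<bar> \<le> 2 * s then 1 else 0)) * (ennreal (s powr (- b)) * indicator S s)"
      by (simp only: ac_simps)
  qed
  also have "\<dots> = (\<integral>\<^sup>+s. cone f x0 s * (ennreal (s powr (- b)) * indicator S s) \<partial>lborel)"
    unfolding cone_def by (intro nn_integral_cong nn_integral_multc) measurable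
  finally show ?thesis by (simp add: mult.assoc)
qed

end


subsection \<open>The key estimate for the converse\<close>

text \<open>Hoelder up to the factor 2, by the inequality |y| <= 1 + |y|^q for y = g / \<kappa>; the
  choice of \<kappa> gives both terms the same bound 2h.\<close>

lemma L1_le_Lq:
  fixes g :: "real \<Rightarrow> real"
  assumes p: "p > 1" "q > 1" "1 / p + 1 / q = 1" and g: "integrable lborel g" and supp: "\<And>x. x \<notin> {x0 - h..x0 + h} \<Longrightarrow> g x = 0"
    and h: "h > 0" and G: "G > 0" and Gq: "(\<integral>\<^sup>+x. ennreal (\<bar>g x\<bar> powr q) \<partial>lborel) \<le> ennreal (G powr q)"
  shows "(LINT x|lborel. \<bar>g x\<bar>) \<le> 2 * 2 powr (1 / p) * h powr (1 / p) * G"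
proof -
  have [measurable]: "g \<in> borel_measurable borel" using borel_measurable_integrable[OF g] by simp
  define \<kappa> where "\<kappa> = G / (2 * h) powr (1 / q)"
  have \<kappa>: "\<kappa> > 0" using G h by (simp add: \<kappa>_def)
  have \<kappa>q: "1 / \<kappa> powr q * G powr q = 2 * h"
    using G h p by (simp add: \<kappa>_def powr_divide powr_powr)
  have "ennreal (LINT x|lborel. \<bar>g x\<bar>) = (\<integral>\<^sup>+x. ennreal \<bar>g x\<bar> \<partial>lborel)"
    using g by (intro nn_integral_eq_integral[symmetric]) auto
  also have "\<dots> \<le> (\<integral>\<^sup>+x. ennreal \<kappa> * (indicator {x0 - h..x0 + h} x + ennreal (1 / \<kappa> powr q) * ennreal (\<bar>g x\<bar> powr q)) \<partial>lborel)"
  proof (rule nn_integral_mono)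
    fix x
    show "ennreal \<bar>g x\<bar> \<le> ennreal \<kappa> * (indicator {x0 - h..x0 + h} x + ennreal (1 / \<kappa> powr q) * ennreal (\<bar>g x\<bar> powr q))"
    proof (cases "x \<in> {x0 - h..x0 + h}")
      case True
      have "\<bar>g x\<bar> = \<kappa> * \<bar>g x / \<kappa>\<bar>" using \<kappa> by (simp add: abs_divide)
      also have "\<dots> \<le> \<kappa> * (1 + \<bar>g x / \<kappa>\<bar> powr q)" using \<kappa> p by (intro mult_left_mono abs_le_one_plus_powr) auto
      also have "\<bar>g x / \<kappa>\<bar> powr q = 1 / \<kappa> powr q * \<bar>g x\<bar> powr q" using \<kappa> by (simp add: abs_divide powr_divide)
      finally have "ennreal \<bar>g x\<bar> \<le> ennreal (\<kappa> * (1 + 1 / \<kappa> powr q * \<bar>g x\<bar> powr q))" by (rule ennreal_leI)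
      also have "\<dots> = ennreal \<kappa> * (ennreal 1 + ennreal (1 / \<kappa> powr q) * ennreal (\<bar>g x\<bar> powr q))"
      proof -
        have "ennreal (\<kappa> * (1 + 1 / \<kappa> powr q * \<bar>g x\<bar> powr q)) = ennreal \<kappa> * ennreal (1 + 1 / \<kappa> powr q * \<bar>g x\<bar> powr q)"
          using \<kappa> by (intro ennreal_mult) auto
        also have "ennreal (1 + 1 / \<kappa> powr q * \<bar>g x\<bar> powr q) = ennreal 1 + ennreal (1 / \<kappa> powr q * \<bar>g x\<bar> powr q)"
          by (intro ennreal_plus) auto
        also have "ennreal (1 / \<kappa> powr q * \<bar>g x\<bar> powr q) = ennreal (1 / \<kappa> powr q) * ennreal (\<bar>g x\<bar> powr q)"
          by (intro ennreal_mult) auto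
        finally show ?thesis .
      qed
      finally show ?thesis using True by simp
    qed (simp add: supp)
  qed
  also have "\<dots> = ennreal \<kappa> * (ennreal (2 * h) + ennreal (1 / \<kappa> powr q) * (\<integral>\<^sup>+x. ennreal (\<bar>g x\<bar> powr q) \<partial>lborel))"
    using h by (subst nn_integral_cmult, measurable, subst nn_integral_add) (auto simp: nn_integral_cmult)
  also have "\<dots> \<le> ennreal \<kappa> * (ennreal (2 * h) + ennreal (1 / \<kappa> powr q) * ennreal (G powr q))"
    by (intro mult_left_mono add_left_mono Gq) auto
  also have "\<dots> = ennreal \<kappa> * (ennreal (2 * h) + ennreal (2 * h))"
    by (simp only: \<kappa>q[symmetric] ennreal_mult''[OF powr_ge_zero])
  also have "\<dots> = ennreal (\<kappa> * (4 * h))"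
    using h \<kappa> by (simp add: ennreal_plus[symmetric] ennreal_mult[symmetric] del: ennreal_plus)
  finally have "(LINT x|lborel. \<bar>g x\<bar>) \<le> \<kappa> * (4 * h)" using \<kappa> h by (simp add: ennreal_le_iff)
  also have "\<dots> = 2 * (2 * h) powr (1 / p) * G"
  proof -
    have "1 / p = 1 - 1 / q" using p by simp
    then have "(2 * h) powr (1 / p) = 2 * h / (2 * h) powr (1 / q)" using h powr_diff[of "2 * h" 1 "1 / q"] by simp
    then show ?thesis by (simp add: \<kappa>_def)
  qed
  also have "\<dots> = 2 * 2 powr (1 / p) * h powr (1 / p) * G" using h by (simp add: powr_mult)
  finally show ?thesis .
qed

text \<open>\<open>Dk k\<close> stands for the k-th derivative of \<eta>; at the top order n only
  continuity is asked, which is enough for the Lagrange remainder.\<close>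

locale taylor_wavelet = smooth_wavelet \<eta> \<eta>' for \<eta> \<eta>' +
  fixes Dk :: "nat \<Rightarrow> real \<Rightarrow> real" and n :: nat
  assumes Dk_0: "Dk 0 = \<eta>"
    and Dk_bump: "\<And>k. k \<le> n \<Longrightarrow> bump (Dk k)"
    and Dk_deriv: "\<And>k x. k < n \<Longrightarrow> (Dk k has_real_derivative Dk (Suc k) x) (at x)"
begin

definition BD :: real where "BD = (\<Sum>k\<le>n. bump.bd (Dk k))"

lemma BD: assumes "k \<le> n" shows "\<bar>Dk k x\<bar> \<le> BD"
proof -
  have "\<bar>Dk k x\<bar> \<le> bump.bd (Dk k)" by (rule bump.bd[OF Dk_bump[OF assms]])
  also have "\<dots> \<le> BD"
    unfolding BD_def using assms bump.bd_pos[OF Dk_bump] by (intro member_le_sum) (auto intro: less_imp_le)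
  finally show ?thesis .
qed

lemma BD_nonneg: "BD \<ge> 0" using BD[of 0 0] by auto

lemma Dk_supp: "k \<le> n \<Longrightarrow> 1 < \<bar>x\<bar> \<Longrightarrow> Dk k x = 0"
  by (rule bump.supp[OF Dk_bump])

lemma Dk_measurable: "k \<le> n \<Longrightarrow> Dk k \<in> borel_measurable borel"
  by (rule bump.meas[OF Dk_bump])

text \<open>The k-th Taylor coefficient at x0 of the function y -> (1/s) \<eta>((y - t)/s), so that
  W_g is approximated by the moments of g about x0 times these.\<close>

definition \<tau> :: "nat \<Rightarrow> real \<Rightarrow> real \<Rightarrow> real \<Rightarrow> real" where
  "\<tau> k x0 s t = Dk k ((x0 - t) / s) / (fact k * s ^ Suc k)"

lemma \<tau>_measurable: "k \<le> n \<Longrightarrow> (\<lambda>w. \<tau> k x0 (fst w) (snd w)) \<in> borel_measurable lborel2"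
  using Dk_measurable[of k] unfolding \<tau>_def by measurable

lemma powr_neg_Suc: "s > 0 \<Longrightarrow> s powr (- (real k + 1)) = 1 / s ^ Suc k"
proof -
  assume "s > 0"
  then have "s powr (real k + 1) = s ^ Suc k" using powr_realpow[of s "Suc k"] by (simp only: of_nat_Suc add.commute)
  then show ?thesis by (simp only: powr_minus_divide)
qed

lemma \<tau>_bound:
  assumes k: "k \<le> n" and s: "s > 0"
  shows "\<bar>\<tau> k x0 s t\<bar> \<le> BD * (s powr (- (real k + 1)) * (if \<bar>t - x0\<bar> \<le> 2 * s then 1 else 0))"
proof (cases "\<bar>t - x0\<bar> \<le> 2 * s")
  case True
  have "\<bar>\<tau> k x0 s t\<bar> = \<bar>Dk k ((x0 - t) / s)\<bar> / fact k * (1 / s ^ Suc k)"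
    using s by (simp add: \<tau>_def abs_mult)
  also have "\<dots> \<le> BD * (1 / s ^ Suc k)"
  proof (rule mult_right_mono)
    have "\<bar>Dk k ((x0 - t) / s)\<bar> / fact k \<le> BD / 1"
      using BD[OF k] BD_nonneg by (intro frac_le) (auto simp: fact_ge_1)
    then show "\<bar>Dk k ((x0 - t) / s)\<bar> / fact k \<le> BD" by simp
  qed (use s in simp)
  finally show ?thesis unfolding powr_neg_Suc[OF s] using True by simp
next
  case False
  then have "1 < \<bar>(x0 - t) / s\<bar>" using s by (simp add: abs_divide abs_minus_commute)
  then show ?thesis using Dk_supp[OF k] False by (simp add: \<tau>_def)
qed

lemma taylor_pointwise:
  "\<bar>\<eta> (u + v) - (\<Sum>k<n. Dk k u / fact k * v ^ k)\<bar> \<le> BD * \<bar>v\<bar> ^ n"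
proof -
  have "\<exists>t. \<bar>t\<bar> \<le> \<bar>v\<bar> \<and> \<eta> (u + v) = (\<Sum>m<n. Dk m (u + 0) / fact m * v ^ m) + Dk n (u + t) / fact n * v ^ n"
  proof (rule Maclaurin_bi_le)
    show "(\<lambda>t. Dk 0 (u + t)) = (\<lambda>t. \<eta> (u + t))" by (simp add: Dk_0)
    show "\<forall>m t. m < n \<and> \<bar>t\<bar> \<le> \<bar>v\<bar> \<longrightarrow> ((\<lambda>t. Dk m (u + t)) has_real_derivative Dk (Suc m) (u + t)) (at t)"
    proof (intro allI impI)
      fix m t assume "m < n \<and> \<bar>t\<bar> \<le> \<bar>v\<bar>"
      then have "(Dk m has_real_derivative Dk (Suc m) (u + t)) (at (u + t))" by (intro Dk_deriv) simp
      then show "((\<lambda>t. Dk m (u + t)) has_real_derivative Dk (Suc m) (u + t)) (at t)"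
        by (simp add: DERIV_shift add.commute)
    qed
  qed
  then obtain t where "\<eta> (u + v) = (\<Sum>m<n. Dk m (u + 0) / fact m * v ^ m) + Dk n (u + t) / fact n * v ^ n" by blast
  then have "\<eta> (u + v) - (\<Sum>k<n. Dk k u / fact k * v ^ k) = Dk n (u + t) / fact n * v ^ n" by simp
  then have "\<bar>\<eta> (u + v) - (\<Sum>k<n. Dk k u / fact k * v ^ k)\<bar> = \<bar>Dk n (u + t)\<bar> / fact n * \<bar>v\<bar> ^ n"
    by (simp add: abs_mult power_abs)
  also have "\<dots> \<le> BD * \<bar>v\<bar> ^ n"
  proof (rule mult_right_mono)
    have "\<bar>Dk n (u + t)\<bar> / fact n \<le> BD / 1"
      using BD[of n] BD_nonneg by (intro frac_le) (auto simp: fact_ge_1)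
    then show "\<bar>Dk n (u + t)\<bar> / fact n \<le> BD" by simp
  qed simp
  finally show ?thesis .
qed

lemma moment_integrable:
  fixes g :: "real \<Rightarrow> real"
  assumes g: "integrable lborel g" and gs: "\<And>x. x \<notin> {x0 - h..x0 + h} \<Longrightarrow> g x = 0" and h: "h \<ge> 0"
  shows "integrable lborel (\<lambda>y. (y - x0) ^ k * g y)"
    and "\<bar>LINT y|lborel. (y - x0) ^ k * g y\<bar> \<le> h ^ k * (LINT y|lborel. \<bar>g y\<bar>)"
proof -
  have [measurable]: "g \<in> borel_measurable borel" using borel_measurable_integrable[OF g] by simp
  have i: "integrable lborel (\<lambda>y. h ^ k * \<bar>g y\<bar>)" using g by simp
  have b: "\<bar>(y - x0) ^ k * g y\<bar> \<le> h ^ k * \<bar>g y\<bar>" for y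
  proof (cases "y \<in> {x0 - h..x0 + h}")
    case True
    then have "\<bar>y - x0\<bar> ^ k \<le> h ^ k" by (intro power_mono) (auto simp: abs_le_iff)
    then show ?thesis by (simp add: abs_mult power_abs mult_right_mono)
  qed (simp add: gs)
  show "integrable lborel (\<lambda>y. (y - x0) ^ k * g y)"
    by (rule Bochner_Integration.integrable_bound[OF i]) (use b in \<open>auto intro: order_trans[OF _ abs_ge_self]\<close>)
  have "\<bar>LINT y|lborel. (y - x0) ^ k * g y\<bar> \<le> (LINT y|lborel. h ^ k * \<bar>g y\<bar>)"
    by (rule abs_integral_le[OF i _ b]) measurable
  then show "\<bar>LINT y|lborel. (y - x0) ^ k * g y\<bar> \<le> h ^ k * (LINT y|lborel. \<bar>g y\<bar>)" by simp
qed

text \<open>On the support of g the remainder is at most BD (h/s)^n, with another 1/s from the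
  transform. Since h <= s, the transform of g and all coefficients vanish outside the cone.\<close>

lemma cwt_taylor:
  assumes g: "integrable lborel g" and gs: "\<And>x. x \<notin> {x0 - h..x0 + h} \<Longrightarrow> g x = 0" and h: "0 < h" "h \<le> s"
  shows "\<bar>cwt \<eta> g s t - (\<Sum>k<n. (LINT y|lborel. (y - x0) ^ k * g y) * \<tau> k x0 s t)\<bar>
    \<le> BD * (h ^ n * (LINT y|lborel. \<bar>g y\<bar>)) * (s powr (- (real n + 1)) * (if \<bar>t - x0\<bar> \<le> 2 * s then 1 else 0))"
proof (cases "\<bar>t - x0\<bar> \<le> 2 * s")
  case False
  have s: "s > 0" using h by simp
  have "cwt \<eta> g s t = 0" by (rule cwt_eq_0[OF s], rule gs) (use False h in auto)
  moreover have "\<tau> k x0 s t = 0" if "k < n" for k using \<tau>_bound[of k s x0 t] that s False by simp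
  ultimately show ?thesis using False by simp
next
  case True
  have s: "s > 0" using h by simp
  note [measurable] = borel_measurable_integrable[OF g]
  define u where "u = (x0 - t) / s"
  define R where "R y = \<eta> ((y - t) / s) - (\<Sum>k<n. Dk k u / fact k * ((y - x0) / s) ^ k)" for y
  have Rm[measurable]: "R \<in> borel_measurable borel" unfolding R_def by measurable
  have Rb: "\<bar>g y * R y\<bar> \<le> BD * (h / s) ^ n * \<bar>g y\<bar>" for y
  proof (cases "y \<in> {x0 - h..x0 + h}")
    case True
    have "(y - t) / s = u + (y - x0) / s" by (simp add: u_def diff_divide_distrib)
    then have "\<bar>R y\<bar> \<le> BD * \<bar>(y - x0) / s\<bar> ^ n" unfolding R_def using taylor_pointwise[of u "(y - x0) / s"] by simp
    also have "\<dots> \<le> BD * (h / s) ^ n"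
      using True s BD_nonneg by (intro mult_left_mono power_mono) (auto simp: abs_divide abs_le_iff intro!: divide_right_mono)
    finally have "\<bar>g y\<bar> * \<bar>R y\<bar> \<le> \<bar>g y\<bar> * (BD * (h / s) ^ n)" by (rule mult_left_mono) simp
    then show ?thesis by (simp add: abs_mult ac_simps)
  qed (simp add: gs)
  have mi: "integrable lborel (\<lambda>y. (y - x0) ^ k * g y)" for k
    by (rule moment_integrable(1)[OF g gs]) (use h in auto)
  have i2: "integrable lborel (\<lambda>y. \<Sum>k<n. Dk k u / fact k / s ^ k * ((y - x0) ^ k * g y))"
    by (intro Bochner_Integration.integrable_sum integrable_mult_right mi)
  have "g y * R y = g y * \<eta> ((y - t) / s) - (\<Sum>k<n. Dk k u / fact k / s ^ k * ((y - x0) ^ k * g y))" for y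
    unfolding R_def right_diff_distrib sum_distrib_left
    by (intro arg_cong2[where f="(-)"] sum.cong refl) (simp add: power_divide)
  then have "(LINT y|lborel. g y * R y) = (LINT y|lborel. g y * \<eta> ((y - t) / s) - (\<Sum>k<n. Dk k u / fact k / s ^ k * ((y - x0) ^ k * g y)))"
    by simp
  also have "\<dots> = (LINT y|lborel. g y * \<eta> ((y - t) / s)) - (\<Sum>k<n. Dk k u / fact k / s ^ k * (LINT y|lborel. (y - x0) ^ k * g y))"
    unfolding Bochner_Integration.integral_diff[OF cwt_integrand_integrable[OF g] i2]
    by (subst Bochner_Integration.integral_sum) (auto intro!: integrable_mult_right mi)
  finally have eq: "(1 / s) * (LINT y|lborel. g y * R y) = cwt \<eta> g s t - (\<Sum>k<n. (LINT y|lborel. (y - x0) ^ k * g y) * \<tau> k x0 s t)"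
    using s by (simp add: cwt_def right_diff_distrib sum_distrib_left \<tau>_def u_def ac_simps)
  have "\<bar>LINT y|lborel. g y * R y\<bar> \<le> (LINT y|lborel. BD * (h / s) ^ n * \<bar>g y\<bar>)"
    by (rule abs_integral_le) (use g Rb in auto)
  also have "\<dots> = BD * (h / s) ^ n * (LINT y|lborel. \<bar>g y\<bar>)" by simp
  finally have "(1 / s) * \<bar>LINT y|lborel. g y * R y\<bar> \<le> (1 / s) * (BD * (h / s) ^ n * (LINT y|lborel. \<bar>g y\<bar>))"
    by (rule mult_left_mono) (use s in simp)
  also have "\<dots> = BD * (h ^ n * (LINT y|lborel. \<bar>g y\<bar>)) * s powr (- (real n + 1))"
    unfolding powr_neg_Suc[OF s] by (simp add: power_divide)
  also have "(1 / s) * \<bar>LINT y|lborel. g y * R y\<bar> = \<bar>(1 / s) * (LINT y|lborel. g y * R y)\<bar>" using s by (simp add: abs_mult)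
  finally show ?thesis using True unfolding eq by simp
qed

end

text \<open>For s < h the transform of g lives within 2h of x0, where the leader of f at a = 2h
  applies. Cauchy--Schwarz in s and Young in t pair the two square functions.\<close>

lemma (in smooth_wavelet) small_scales:
  assumes p: "p > 1" "q > 1" "1 / p + 1 / q = 1" and fm[measurable]: "f \<in> borel_measurable borel" and gm[measurable]: "g \<in> borel_measurable borel"
    and h: "h > 0" and C: "C \<ge> 0" and G: "G > 0"
    and gs: "\<And>x. x \<notin> {x0 - h..x0 + h} \<Longrightarrow> g x = 0"
    and Hf: "(\<integral>\<^sup>+t\<in>{x0 - 2 * h..x0 + 2 * h}. ennpow (sqf \<eta> f {0<..<2 * h} t) (p / 2) \<partial>lborel) \<le> ennreal (2 * h * (C * (2 * h) powr \<alpha>) powr p)"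
    and Hg: "(\<integral>\<^sup>+t. ennpow (sqf \<eta> g {0<..} t) (q / 2) \<partial>lborel) \<le> ennreal (Cq * G powr q)" and Cq: "Cq \<ge> 0"
  shows "(\<integral>\<^sup>+w. ennreal (\<bar>cwt \<eta> f (fst w) (snd w) * cwt \<eta> g (fst w) (snd w)\<bar> / fst w) * indicator {0<..<h} (fst w) \<partial>lborel2)
    \<le> ennreal ((1 + Cq) * (C + 1) * 2 powr (\<alpha> + 1 / p) * h powr (\<alpha> + 1 / p) * G)"
proof -
  define X where "X t = (\<integral>\<^sup>+s\<in>{0<..<2 * h}. ennreal (\<bar>cwt \<eta> f s t * cwt \<eta> g s t\<bar> / s) \<partial>lborel)" for t
  have X2: "(X t)\<^sup>2 \<le> sqf \<eta> f {0<..<2 * h} t * sqf \<eta> g {0<..} t" for t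
  proof -
    let ?u = "\<lambda>s. ennreal (\<bar>cwt \<eta> f s t\<bar> / sqrt s) * indicator {0<..<2 * h} s"
    let ?v = "\<lambda>s. ennreal (\<bar>cwt \<eta> g s t\<bar> / sqrt s) * indicator {0<..<2 * h} s"
    have "X t = (\<integral>\<^sup>+s. ?u s * ?v s \<partial>lborel)"
      unfolding X_def
    proof (rule nn_integral_cong)
      fix s
      show "ennreal (\<bar>cwt \<eta> f s t * cwt \<eta> g s t\<bar> / s) * indicator {0<..<2 * h} s = ?u s * ?v s"
        by (auto simp: ennreal_mult[symmetric] abs_mult split: split_indicator)
    qed
    then have "(X t)\<^sup>2 \<le> (\<integral>\<^sup>+s. (?u s)\<^sup>2 \<partial>lborel) * (\<integral>\<^sup>+s. (?v s)\<^sup>2 \<partial>lborel)"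
      by (simp only:) (rule Cauchy_Schwarz_nn_integral; measurable)
    also have "\<dots> \<le> sqf \<eta> f {0<..<2 * h} t * sqf \<eta> g {0<..} t"
      unfolding sqf_def by (intro mult_mono nn_integral_mono) (auto simp: ennreal_power power_divide split: split_indicator)
    finally show ?thesis .
  qed
  \<comment> \<open>The p-th power of E dominates the bound assumed for f; C + 1 keeps E positive
    even for C = 0.\<close>
  define E where "E = (C + 1) * (2 * h) powr (\<alpha> + 1 / p)"
  have E: "E > 0" using C h by (simp add: E_def)
  have Ep: "2 * h * (C * (2 * h) powr \<alpha>) powr p \<le> E powr p"
  proof -
    have "((2 * h) powr (\<alpha> + 1 / p)) powr p = (2 * h) powr (\<alpha> * p + 1)"
      using p unfolding powr_powr by (simp add: distrib_right)
    also have "\<dots> = 2 * h * ((2 * h) powr \<alpha>) powr p" using h by (simp add: powr_add powr_powr)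
    finally have e: "((2 * h) powr (\<alpha> + 1 / p)) powr p = 2 * h * ((2 * h) powr \<alpha>) powr p" .
    have "2 * h * (C * (2 * h) powr \<alpha>) powr p = C powr p * (2 * h * ((2 * h) powr \<alpha>) powr p)"
      using C by (simp add: powr_mult)
    also have "\<dots> \<le> (C + 1) powr p * (2 * h * ((2 * h) powr \<alpha>) powr p)"
      using C p h by (intro mult_right_mono powr_mono2) auto
    also have "\<dots> = E powr p" unfolding e[symmetric] E_def using C by (simp add: powr_mult)
    finally show ?thesis .
  qed
  have Xb: "X t \<le> ennreal (E * G) * (ennreal (1 / E powr p) * ennpow (sqf \<eta> f {0<..<2 * h} t) (p / 2) + ennreal (1 / G powr q) * ennpow (sqf \<eta> g {0<..} t) (q / 2))" for t
    by (rule young_ennreal[OF p X2 E G])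
  have "(\<integral>\<^sup>+w. ennreal (\<bar>cwt \<eta> f (fst w) (snd w) * cwt \<eta> g (fst w) (snd w)\<bar> / fst w) * indicator {0<..<h} (fst w) \<partial>lborel2)
    = (\<integral>\<^sup>+t. \<integral>\<^sup>+s. ennreal (\<bar>cwt \<eta> f s t * cwt \<eta> g s t\<bar> / s) * indicator {0<..<h} s \<partial>lborel \<partial>lborel)"
    by (subst lborel_pair.nn_integral_snd[symmetric]) auto
  also have "\<dots> \<le> (\<integral>\<^sup>+t. X t * indicator {x0 - 2 * h..x0 + 2 * h} t \<partial>lborel)"
  proof (rule nn_integral_mono)
    fix t
    show "(\<integral>\<^sup>+s. ennreal (\<bar>cwt \<eta> f s t * cwt \<eta> g s t\<bar> / s) * indicator {0<..<h} s \<partial>lborel) \<le> X t * indicator {x0 - 2 * h..x0 + 2 * h} t"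
    proof (cases "t \<in> {x0 - 2 * h..x0 + 2 * h}")
      case True
      then show ?thesis unfolding X_def using h by (auto intro!: nn_integral_mono split: split_indicator)
    next
      case False
      have "(\<integral>\<^sup>+s. ennreal (\<bar>cwt \<eta> f s t * cwt \<eta> g s t\<bar> / s) * indicator {0<..<h} s \<partial>lborel) = (\<integral>\<^sup>+s. 0 \<partial>(lborel :: real measure))"
      proof (rule nn_integral_cong)
        fix s
        show "ennreal (\<bar>cwt \<eta> f s t * cwt \<eta> g s t\<bar> / s) * indicator {0<..<h} s = 0"
        proof (cases "s \<in> {0<..<h}")
          case True
          have "cwt \<eta> g s t = 0" by (rule cwt_eq_0, use True in simp, rule gs) (use True False in auto)
          then show ?thesis by simp
        qed simp
      qed
      then show ?thesis by simp
    qed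
  qed
  also have "\<dots> \<le> (\<integral>\<^sup>+t. ennreal (E * G) * (ennreal (1 / E powr p) * (ennpow (sqf \<eta> f {0<..<2 * h} t) (p / 2) * indicator {x0 - 2 * h..x0 + 2 * h} t) + ennreal (1 / G powr q) * ennpow (sqf \<eta> g {0<..} t) (q / 2)) \<partial>lborel)"
    using Xb by (intro nn_integral_mono) (auto split: split_indicator)
  also have "\<dots> = ennreal (E * G) * (ennreal (1 / E powr p) * (\<integral>\<^sup>+t\<in>{x0 - 2 * h..x0 + 2 * h}. ennpow (sqf \<eta> f {0<..<2 * h} t) (p / 2) \<partial>lborel) + ennreal (1 / G powr q) * (\<integral>\<^sup>+t. ennpow (sqf \<eta> g {0<..} t) (q / 2) \<partial>lborel))"
    by (subst nn_integral_cmult, measurable, subst nn_integral_add) (auto simp: nn_integral_cmult)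
  also have "\<dots> \<le> ennreal (E * G) * (ennreal (1 / E powr p) * ennreal (2 * h * (C * (2 * h) powr \<alpha>) powr p) + ennreal (1 / G powr q) * ennreal (Cq * G powr q))"
    by (intro mult_left_mono add_mono Hf Hg) auto
  also have "\<dots> \<le> ennreal (E * G) * (ennreal 1 + ennreal Cq)"
  proof (intro mult_left_mono add_mono)
    have "1 / E powr p * (2 * h * (C * (2 * h) powr \<alpha>) powr p) \<le> 1 / E powr p * E powr p"
      by (intro mult_left_mono Ep) auto
    also have "\<dots> = 1" using E by simp
    finally show "ennreal (1 / E powr p) * ennreal (2 * h * (C * (2 * h) powr \<alpha>) powr p) \<le> ennreal 1"
      using h by (subst ennreal_mult[symmetric]) (auto simp del: ennreal_1 intro!: ennreal_leI)
    have "ennreal (1 / G powr q) * ennreal (Cq * G powr q) = ennreal (1 / G powr q * (Cq * G powr q))"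
      using G Cq by (intro ennreal_mult[symmetric]) auto
    also have "1 / G powr q * (Cq * G powr q) = Cq" using G by simp
    finally show "ennreal (1 / G powr q) * ennreal (Cq * G powr q) \<le> ennreal Cq" by simp
  qed auto
  also have "\<dots> = ennreal (E * G * (1 + Cq))"
    using E G Cq by (simp add: ennreal_plus[symmetric] ennreal_mult[symmetric] del: ennreal_plus ennreal_1)
  also have "E * G * (1 + Cq) = (1 + Cq) * (C + 1) * 2 powr (\<alpha> + 1 / p) * h powr (\<alpha> + 1 / p) * G"
    using h by (simp add: E_def powr_mult ac_simps)
  finally show ?thesis .
qed


lemma (in bump) cone_mass:
  assumes [measurable]: "f \<in> borel_measurable borel" "S \<in> sets borel" "v \<in> borel_measurable lborel2" and S: "S \<subseteq> {0<..}"
    and B: "B \<ge> 0" and v: "\<And>s t. s \<in> S \<Longrightarrow> \<bar>v (s, t)\<bar> \<le> B * (s powr (- b) * (if \<bar>t - x0\<bar> \<le> 2 * s then 1 else 0))"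
  shows "(\<integral>\<^sup>+w. ennreal (\<bar>cwt \<eta> f (fst w) (snd w) * v w\<bar> / fst w) * indicator S (fst w) \<partial>lborel2)
    \<le> ennreal B * (\<integral>\<^sup>+s\<in>S. (cone f x0 s * ennreal (s powr (- b))) \<partial>lborel)"
proof -
  have "(\<integral>\<^sup>+w. ennreal (\<bar>cwt \<eta> f (fst w) (snd w) * v w\<bar> / fst w) * indicator S (fst w) \<partial>lborel2)
    \<le> (\<integral>\<^sup>+w. ennreal B * (ennreal (\<bar>cwt \<eta> f (fst w) (snd w)\<bar> / fst w * fst w powr (- b)) * (if \<bar>snd w - x0\<bar> \<le> 2 * fst w then 1 else 0) * indicator S (fst w)) \<partial>lborel2)"
  proof (rule nn_integral_mono)
    fix w :: "real \<times> real"
    obtain s t where w: "w = (s, t)" by (cases w)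
    show "ennreal (\<bar>cwt \<eta> f (fst w) (snd w) * v w\<bar> / fst w) * indicator S (fst w)
      \<le> ennreal B * (ennreal (\<bar>cwt \<eta> f (fst w) (snd w)\<bar> / fst w * fst w powr (- b)) * (if \<bar>snd w - x0\<bar> \<le> 2 * fst w then 1 else 0) * indicator S (fst w))"
    proof (cases "s \<in> S")
      case True
      then have s: "s > 0" using S by auto
      let ?i = "if \<bar>t - x0\<bar> \<le> 2 * s then 1 else 0 :: real"
      have "\<bar>cwt \<eta> f s t * v (s, t)\<bar> / s \<le> \<bar>cwt \<eta> f s t\<bar> * (B * (s powr (- b) * ?i)) / s"
        unfolding abs_mult using s by (intro divide_right_mono mult_left_mono v True) auto
      also have "\<dots> = B * (\<bar>cwt \<eta> f s t\<bar> / s * s powr (- b) * ?i)" by simp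
      finally have "ennreal (\<bar>cwt \<eta> f s t * v (s, t)\<bar> / s) \<le> ennreal (B * (\<bar>cwt \<eta> f s t\<bar> / s * s powr (- b) * ?i))"
        by (rule ennreal_leI)
      also have "\<dots> = ennreal B * ennreal (\<bar>cwt \<eta> f s t\<bar> / s * s powr (- b) * ?i)"
        using B s by (intro ennreal_mult) auto
      also have "ennreal (\<bar>cwt \<eta> f s t\<bar> / s * s powr (- b) * ?i) = ennreal (\<bar>cwt \<eta> f s t\<bar> / s * s powr (- b)) * (if \<bar>t - x0\<bar> \<le> 2 * s then 1 else 0)"
        by simp
      finally show ?thesis using True w by simp
    qed (simp add: w)
  qed
  also have "\<dots> = ennreal B * (\<integral>\<^sup>+w. ennreal (\<bar>cwt \<eta> f (fst w) (snd w)\<bar> / fst w * fst w powr (- b)) * (if \<bar>snd w - x0\<bar> \<le> 2 * fst w then 1 else 0) * indicator S (fst w) \<partial>lborel2)"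
    by (rule nn_integral_cmult) measurable
  also have "\<dots> = ennreal B * (\<integral>\<^sup>+s\<in>S. (cone f x0 s * ennreal (s powr (- b))) \<partial>lborel)"
    by (subst cone_lborel2) auto
  finally show ?thesis .
qed

lemma set_nn_integral_cover:
  assumes [measurable]: "u \<in> borel_measurable M" "S \<in> sets M" "T \<in> sets M" and "R \<subseteq> S \<union> T"
  shows "(\<integral>\<^sup>+x\<in>R. u x \<partial>M) \<le> (\<integral>\<^sup>+x\<in>S. u x \<partial>M) + (\<integral>\<^sup>+x\<in>T. u x \<partial>M)"
proof -
  have "(\<integral>\<^sup>+x\<in>R. u x \<partial>M) \<le> (\<integral>\<^sup>+x. u x * indicator S x + u x * indicator T x \<partial>M)"
    using assms(4) by (intro nn_integral_mono) (auto split: split_indicator)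
  also have "\<dots> = (\<integral>\<^sup>+x\<in>S. u x \<partial>M) + (\<integral>\<^sup>+x\<in>T. u x \<partial>M)"
    by (rule nn_integral_add) measurable
  finally show ?thesis .
qed

context taylor_wavelet begin

lemma taylor_integral_bound:
  assumes f: "integrable lborel f" and g: "test_fun g"
    and gs: "\<And>x. x \<notin> {x0 - h..x0 + h} \<Longrightarrow> g x = 0" and h: "0 < h" "h \<le> A / 4" and A: "A \<le> 1"
    and a: "\<alpha> < real n"
    and C2: "C2 \<ge> 0" "(\<integral>\<^sup>+s\<in>{h..A / 4}. (cone f x0 s * ennreal (s powr (- (real n + 1)))) \<partial>lborel) \<le> ennreal (C2 * h powr (\<alpha> - real n))"
    and C3: "C3 \<ge> 0" "(\<integral>\<^sup>+s\<in>{A / 4..}. (cone f x0 s * ennreal (s powr (- (real n + 1)))) \<partial>lborel) \<le> ennreal C3"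
  shows "(\<integral>\<^sup>+w. ennreal (\<bar>cwt \<eta> f (fst w) (snd w) * (cwt \<eta> g (fst w) (snd w) - (\<Sum>k<n. (LINT y|lborel. (y - x0) ^ k * g y) * \<tau> k x0 (fst w) (snd w)))\<bar> / fst w) * indicator {h..} (fst w) \<partial>lborel2)
    \<le> ennreal (BD * (C2 + C3) * (h powr \<alpha> * (LINT y|lborel. \<bar>g y\<bar>)))"
proof -
  note gi = test_fun_integrable[OF g]
  have fm[measurable]: "f \<in> borel_measurable borel" "g \<in> borel_measurable borel"
    using borel_measurable_integrable[OF f] borel_measurable_integrable[OF gi] by auto
  define N where "N = (LINT y|lborel. \<bar>g y\<bar>)"
  have N: "N \<ge> 0" by (simp add: N_def)
  have [measurable]: "(\<lambda>w. \<tau> k x0 (fst w) (snd w)) \<in> borel_measurable lborel2" if "k < n" for k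
    using \<tau>_measurable[of k x0] that by simp
  have "(\<integral>\<^sup>+w. ennreal (\<bar>cwt \<eta> f (fst w) (snd w) * (cwt \<eta> g (fst w) (snd w) - (\<Sum>k<n. (LINT y|lborel. (y - x0) ^ k * g y) * \<tau> k x0 (fst w) (snd w)))\<bar> / fst w) * indicator {h..} (fst w) \<partial>lborel2)
    \<le> ennreal (BD * (h ^ n * N)) * (\<integral>\<^sup>+s\<in>{h..}. (cone f x0 s * ennreal (s powr (- (real n + 1)))) \<partial>lborel)"
  proof (rule cone_mass)
    fix s t assume "s \<in> {h..}"
    then show "\<bar>cwt \<eta> g (fst (s, t)) (snd (s, t)) - (\<Sum>k<n. (LINT y|lborel. (y - x0) ^ k * g y) * \<tau> k x0 (fst (s, t)) (snd (s, t)))\<bar> \<le> BD * (h ^ n * N) * (s powr (- (real n + 1)) * (if \<bar>t - x0\<bar> \<le> 2 * s then 1 else 0))"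
      unfolding N_def fst_conv snd_conv by (intro cwt_taylor gi gs h) auto
  qed (use h N BD_nonneg in \<open>auto intro!: borel_measurable_sum\<close>)
  also have "\<dots> \<le> ennreal (BD * (h ^ n * N)) * ennreal (C2 * h powr (\<alpha> - real n) + C3)"
  proof (intro mult_left_mono)
    have "(\<integral>\<^sup>+s\<in>{h..}. (cone f x0 s * ennreal (s powr (- (real n + 1)))) \<partial>lborel)
      \<le> (\<integral>\<^sup>+s\<in>{h..A / 4}. (cone f x0 s * ennreal (s powr (- (real n + 1)))) \<partial>lborel) + (\<integral>\<^sup>+s\<in>{A / 4..}. (cone f x0 s * ennreal (s powr (- (real n + 1)))) \<partial>lborel)"
      by (rule set_nn_integral_cover) auto
    also have "\<dots> \<le> ennreal (C2 * h powr (\<alpha> - real n)) + ennreal C3" by (intro add_mono C2 C3)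
    also have "\<dots> = ennreal (C2 * h powr (\<alpha> - real n) + C3)" using C2 C3 by (intro ennreal_plus[symmetric]) auto
    finally show "(\<integral>\<^sup>+s\<in>{h..}. (cone f x0 s * ennreal (s powr (- (real n + 1)))) \<partial>lborel) \<le> ennreal (C2 * h powr (\<alpha> - real n) + C3)" .
  qed simp
  also have "\<dots> = ennreal (BD * (h ^ n * N) * (C2 * h powr (\<alpha> - real n) + C3))"
    using BD_nonneg N C2 C3 h by (intro ennreal_mult[symmetric]) auto
  also have "\<dots> \<le> ennreal (BD * (C2 + C3) * (h powr \<alpha> * N))"
  proof (rule ennreal_leI)
    have hn: "h ^ n = h powr real n" using h by (simp add: powr_realpow)
    have e: "h ^ n * h powr (\<alpha> - real n) = h powr \<alpha>" unfolding hn powr_add[symmetric] by simp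
    \<comment> \<open>The far scales contribute only h^n, which is absorbed since h <= 1 and
      \<alpha> < n.\<close>
    have le: "h ^ n \<le> h powr \<alpha>" unfolding hn using h A a by (intro powr_mono') auto
    have "h ^ n * (C2 * h powr (\<alpha> - real n) + C3) = C2 * (h ^ n * h powr (\<alpha> - real n)) + h ^ n * C3"
      by (simp add: algebra_simps)
    also have "\<dots> \<le> C2 * h powr \<alpha> + h powr \<alpha> * C3" unfolding e using C3 le by (intro add_left_mono mult_right_mono)
    finally have "h ^ n * (C2 * h powr (\<alpha> - real n) + C3) \<le> (C2 + C3) * h powr \<alpha>" by (simp add: algebra_simps)
    then have "(BD * N) * (h ^ n * (C2 * h powr (\<alpha> - real n) + C3)) \<le> (BD * N) * ((C2 + C3) * h powr \<alpha>)"
      using BD_nonneg N by (intro mult_left_mono) auto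
    then show "BD * (h ^ n * N) * (C2 * h powr (\<alpha> - real n) + C3) \<le> BD * (C2 + C3) * (h powr \<alpha> * N)"
      by (simp only: ac_simps)
  qed
  finally show ?thesis by (simp only: N_def)
qed

text \<open>P depends only on f and is fixed before h and g: its coefficients are integrals over all
  scales, although for each g the Taylor expansion is used only for s >= h. The Taylor terms added
  at s < h are of the admissible size by \<open>cone_near\<close>. The exponent 1/p of h comes from
  the passage from the q-norm of g to its L^1 norm, and at small scales from the size of the
  ball.\<close>

lemma key_estimate:
  assumes p: "p > 1" "q > 1" "1 / p + 1 / q = 1" and f: "integrable lborel f" and A: "0 < A" "A \<le> 1" and C: "C \<ge> 0"
    and a: "\<alpha> < real n" and k_less: "\<And>k. k < n \<Longrightarrow> real k < \<alpha>"
    and H: "\<And>a. 0 < a \<Longrightarrow> a \<le> A \<Longrightarrow> (\<integral>\<^sup>+t\<in>{x0 - a..x0 + a}. ennpow (sqf \<eta> f {0<..<a} t) (p / 2) \<partial>lborel) \<le> ennreal (a * (C * a powr \<alpha>) powr p)"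
    and nz: "\<eta> z \<noteq> 0"
  obtains P K where "K \<ge> 0" "if n = 0 then P = 0 else degree P < n"
    "\<And>h g G. 0 < h \<Longrightarrow> h \<le> A / 4 \<Longrightarrow> test_fun g \<Longrightarrow> continuous_on UNIV g \<Longrightarrow> (\<And>x. x \<notin> {x0 - h..x0 + h} \<Longrightarrow> g x = 0) \<Longrightarrow>
      G > 0 \<Longrightarrow> (\<integral>\<^sup>+x. ennreal (\<bar>g x\<bar> powr q) \<partial>lborel) \<le> ennreal (G powr q) \<Longrightarrow>
      \<bar>LINT x|lborel. (f x - poly P (x - x0)) * g x\<bar> \<le> K * h powr (\<alpha> + 1 / p) * G"
proof -
  have fm[measurable]: "f \<in> borel_measurable borel" using borel_measurable_integrable[OF f] by simp
  have [measurable]: "(\<lambda>w. \<tau> k x0 (fst w) (snd w)) \<in> borel_measurable lborel2" if "k < n" for k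
    using \<tau>_measurable[of k x0] that by simp
  define K1 where "K1 = C powr p + 2"
  have K1: "K1 \<ge> 0" by (simp add: K1_def)
  have blk: "(\<integral>\<^sup>+s\<in>{a / 4..a / 2}. cone f x0 s \<partial>lborel) \<le> ennreal (K1 * a powr (1 + \<alpha>))" if "0 < a" "a \<le> A" for a
    unfolding K1_def by (rule cone_block[OF p(1) fm that(1) C H[OF that]])
  have "\<forall>k\<in>{..<n}. \<exists>C\<ge>0. \<forall>h. 0 < h \<and> h \<le> A / 4 \<longrightarrow> (\<integral>\<^sup>+s\<in>{0<..<h}. (cone f x0 s * ennreal (s powr (- (real k + 1)))) \<partial>lborel) \<le> ennreal (C * h powr (\<alpha> - real k))"
    using cone_near[OF fm K1 k_less blk] by blast
  from bchoice[OF this] obtain Cn where Cn': "\<forall>k\<in>{..<n}. 0 \<le> Cn k \<and> (\<forall>h. 0 < h \<and> h \<le> A / 4 \<longrightarrow> (\<integral>\<^sup>+s\<in>{0<..<h}. (cone f x0 s * ennreal (s powr (- (real k + 1)))) \<partial>lborel) \<le> ennreal (Cn k * h powr (\<alpha> - real k)))" ..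
  have Cn: "\<And>k. k < n \<Longrightarrow> Cn k \<ge> 0"
    "\<And>k h. k < n \<Longrightarrow> 0 < h \<Longrightarrow> h \<le> A / 4 \<Longrightarrow> (\<integral>\<^sup>+s\<in>{0<..<h}. (cone f x0 s * ennreal (s powr (- (real k + 1)))) \<partial>lborel) \<le> ennreal (Cn k * h powr (\<alpha> - real k))"
    using Cn' by auto
  obtain C2 where C2: "C2 \<ge> 0" "\<And>h. 0 < h \<Longrightarrow> h \<le> A / 4 \<Longrightarrow> (\<integral>\<^sup>+s\<in>{h..A / 4}. (cone f x0 s * ennreal (s powr (- (real n + 1)))) \<partial>lborel) \<le> ennreal (C2 * h powr (\<alpha> - real n))"
    using cone_middle[OF fm K1 a blk] by blast
  have A4: "A / 4 > 0" using A by simp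
  have "\<forall>k. \<exists>C\<ge>0. (\<integral>\<^sup>+s\<in>{A / 4..}. (cone f x0 s * ennreal (s powr (- (real k + 1)))) \<partial>lborel) \<le> ennreal C"
    using cone_far[OF f A4] by blast
  from choice[OF this] obtain Cf where Cf': "\<forall>k. 0 \<le> Cf k \<and> (\<integral>\<^sup>+s\<in>{A / 4..}. (cone f x0 s * ennreal (s powr (- (real k + 1)))) \<partial>lborel) \<le> ennreal (Cf k)" ..
  have Cf: "\<And>k. Cf k \<ge> 0" "\<And>k. (\<integral>\<^sup>+s\<in>{A / 4..}. (cone f x0 s * ennreal (s powr (- (real k + 1)))) \<partial>lborel) \<le> ennreal (Cf k)"
    using Cf' by auto
  obtain Cq where Cq: "Cq \<ge> 0" and Lq: "\<And>f A. integrable lborel f \<Longrightarrow> (\<And>x. A < \<bar>x\<bar> \<Longrightarrow> f x = 0) \<Longrightarrow>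
    (\<integral>\<^sup>+x. ennreal (\<bar>f x\<bar> powr q) \<partial>lborel) < \<infinity> \<Longrightarrow>
    (\<integral>\<^sup>+t. ennpow (sqf \<eta> f {0<..} t) (q / 2) \<partial>lborel) \<le> ennreal Cq * (\<integral>\<^sup>+x. ennreal (\<bar>f x\<bar> powr q) \<partial>lborel)"
    using sqf_Lp[OF p(2)] by blast
  define T where "T k w = indicator {0<..} (fst w) * (cwt \<eta> f (fst w) (snd w) * \<tau> k x0 (fst w) (snd w)) / fst w" for k w
  have Tm[measurable]: "T k \<in> borel_measurable lborel2" if "k < n" for k
    using \<tau>_measurable[of k x0] that unfolding T_def by measurable
  have mass: "(\<integral>\<^sup>+w. ennreal (\<bar>cwt \<eta> f (fst w) (snd w) * \<tau> k x0 (fst w) (snd w)\<bar> / fst w) * indicator S (fst w) \<partial>lborel2)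
    \<le> ennreal BD * (\<integral>\<^sup>+s\<in>S. (cone f x0 s * ennreal (s powr (- (real k + 1)))) \<partial>lborel)"
    if "k < n" "S \<in> sets borel" "S \<subseteq> {0<..}" for k S
  proof (rule cone_mass)
    fix s t assume "s \<in> S"
    then have "s > 0" using that by auto
    then show "\<bar>\<tau> k x0 (fst (s, t)) (snd (s, t))\<bar> \<le> BD * (s powr (- (real k + 1)) * (if \<bar>t - x0\<bar> \<le> 2 * s then 1 else 0))"
      unfolding fst_conv snd_conv using that by (intro \<tau>_bound) auto
  qed (use that BD_nonneg in auto)
  have Ti: "integrable lborel2 (T k)" if k: "k < n" for k
  proof (rule integrableI_bounded)
    have "(\<integral>\<^sup>+w. ennreal (norm (T k w)) \<partial>lborel2) = (\<integral>\<^sup>+w. ennreal (\<bar>cwt \<eta> f (fst w) (snd w) * \<tau> k x0 (fst w) (snd w)\<bar> / fst w) * indicator {0<..} (fst w) \<partial>lborel2)"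
      by (intro nn_integral_cong) (auto simp: T_def split: split_indicator)
    also have "\<dots> \<le> ennreal BD * (\<integral>\<^sup>+s\<in>{0<..}. (cone f x0 s * ennreal (s powr (- (real k + 1)))) \<partial>lborel)"
      by (rule mass[OF k]) auto
    also have "\<dots> \<le> ennreal BD * ((\<integral>\<^sup>+s\<in>{0<..<A / 4}. (cone f x0 s * ennreal (s powr (- (real k + 1)))) \<partial>lborel) + (\<integral>\<^sup>+s\<in>{A / 4..}. (cone f x0 s * ennreal (s powr (- (real k + 1)))) \<partial>lborel))"
      by (intro mult_left_mono set_nn_integral_cover) auto
    also have "\<dots> \<le> ennreal BD * (ennreal (Cn k * (A / 4) powr (\<alpha> - real k)) + ennreal (Cf k))"
      using A4 by (intro mult_left_mono add_mono Cn(2)[OF k] Cf) auto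
    also have "\<dots> < \<infinity>" by (simp add: ennreal_mult_less_top)
    finally show "(\<integral>\<^sup>+w. ennreal (norm (T k w)) \<partial>lborel2) < \<infinity>" .
  qed (rule Tm[OF k])
  note cal = calderon_nonzero[OF nz]
  \<comment> \<open>Division by \<open>calderon\<close> undoes the constant in the reproducing
    formula.\<close>
  define c where "c k = (LINT w|lborel2. T k w) / calderon" for k
  define P where "P = (\<Sum>k<n. monom (c k) k)"
  have polyP: "poly P x = (\<Sum>k<n. c k * x ^ k)" for x by (simp add: P_def poly_sum poly_monom)
  have degP: "if n = 0 then P = 0 else degree P < n"
  proof (cases "n = 0")
    case False
    have "degree P < n"
      unfolding P_def by (rule degree_sum_less) (use False in \<open>auto intro: le_less_trans[OF degree_monom_le]\<close>)
    then show ?thesis using False by simp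
  qed (simp add: P_def)
  define \<beta> where "\<beta> = \<alpha> + 1 / p"
  define L where "L = 2 * 2 powr (1 / p)"
  define K where "K = (1 + Cq) * (C + 1) * 2 powr \<beta> + (\<Sum>k<n. L * BD * Cn k) + BD * (C2 + Cf n) * L"
  have L0: "L \<ge> 0" by (simp add: L_def)
  have K0: "K \<ge> 0"
    unfolding K_def using Cq C L0 BD_nonneg Cn(1) C2(1) Cf(1)[of n] by (intro add_nonneg_nonneg sum_nonneg mult_nonneg_nonneg) auto
  show ?thesis
  proof (rule that[of "K / \<bar>calderon\<bar>" P])
    show "K / \<bar>calderon\<bar> \<ge> 0" using K0 by simp
    show "if n = 0 then P = 0 else degree P < n" by (rule degP)
    fix h g G
    assume h: "0 < h" "h \<le> A / 4" and g: "test_fun g" and cg: "continuous_on UNIV g" and gs: "\<And>x. x \<notin> {x0 - h..x0 + h} \<Longrightarrow> g x = 0"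
      and G: "G > (0::real)" and Gq: "(\<integral>\<^sup>+x. ennreal (\<bar>g x\<bar> powr q) \<partial>lborel) \<le> ennreal (G powr q)"
    note gi = test_fun_integrable[OF g]
    have gm[measurable]: "g \<in> borel_measurable borel" using borel_measurable_integrable[OF gi] by simp
    define N where "N = (LINT y|lborel. \<bar>g y\<bar>)"
    have N0: "N \<ge> 0" by (simp add: N_def)
    have N: "N \<le> L * h powr (1 / p) * G" unfolding N_def L_def by (rule L1_le_Lq[OF p gi gs h(1) G Gq])
    define m where "m k = (LINT y|lborel. (y - x0) ^ k * g y)" for k
    have m: "\<bar>m k\<bar> \<le> h ^ k * N" for k unfolding m_def N_def using h by (intro moment_integrable(2)[OF gi gs]) auto
    define Hf where "Hf w = indicator {0<..} (fst w) * (cwt \<eta> f (fst w) (snd w) * cwt \<eta> g (fst w) (snd w)) / fst w" for w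
    \<comment> \<open>Below scale h the two parts are estimated separately (E1 and E2); from h on
      the difference is W_f times a Taylor remainder (E3).\<close>
    define D where "D w = Hf w - (\<Sum>k<n. m k * T k w)" for w
    have Hm[measurable]: "Hf \<in> borel_measurable lborel2" unfolding Hf_def by measurable
    have Dm[measurable]: "D \<in> borel_measurable lborel2"
      unfolding D_def by (intro borel_measurable_diff Hm borel_measurable_sum borel_measurable_times borel_measurable_const Tm) auto
    define E1 where "E1 w = ennreal (\<bar>cwt \<eta> f (fst w) (snd w) * cwt \<eta> g (fst w) (snd w)\<bar> / fst w) * indicator {0<..<h} (fst w)" for w
    define E2 where "E2 k w = ennreal (\<bar>cwt \<eta> f (fst w) (snd w) * \<tau> k x0 (fst w) (snd w)\<bar> / fst w) * indicator {0<..<h} (fst w)" for k w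
    define E3 where "E3 w = ennreal (\<bar>cwt \<eta> f (fst w) (snd w) * (cwt \<eta> g (fst w) (snd w) - (\<Sum>k<n. m k * \<tau> k x0 (fst w) (snd w)))\<bar> / fst w) * indicator {h..} (fst w)" for w
    have [measurable]: "E1 \<in> borel_measurable lborel2" unfolding E1_def by measurable
    have E2m[measurable]: "E2 k \<in> borel_measurable lborel2" if "k < n" for k
      using \<tau>_measurable[of k x0] that unfolding E2_def by measurable
    have E3m[measurable]: "E3 \<in> borel_measurable lborel2"
    proof -
      have [measurable]: "(\<lambda>w. \<Sum>k<n. m k * \<tau> k x0 (fst w) (snd w)) \<in> borel_measurable lborel2"
        by (intro borel_measurable_sum borel_measurable_times borel_measurable_const \<tau>_measurable) auto
      show ?thesis unfolding E3_def by measurable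
    qed
    have Dsplit: "D w = indicator {0<..} (fst w) * (cwt \<eta> f (fst w) (snd w) * (cwt \<eta> g (fst w) (snd w) - (\<Sum>k<n. m k * \<tau> k x0 (fst w) (snd w)))) / fst w" for w
      by (simp add: D_def Hf_def T_def right_diff_distrib diff_divide_distrib sum_distrib_left sum_divide_distrib ac_simps)
    have Dpt: "ennreal \<bar>D w\<bar> \<le> E1 w + (\<Sum>k<n. ennreal \<bar>m k\<bar> * E2 k w) + E3 w" for w
    proof -
      consider "fst w \<le> 0" | "0 < fst w" "fst w < h" | "h \<le> fst w" by linarith
      then show ?thesis
      proof cases
        case 1
        then show ?thesis by (simp add: Dsplit)
      next
        case 2
        have "\<bar>D w\<bar> \<le> \<bar>Hf w\<bar> + (\<Sum>k<n. \<bar>m k\<bar> * \<bar>T k w\<bar>)"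
          unfolding D_def abs_mult[symmetric] by (intro order_trans[OF abs_triangle_ineq4] add_left_mono sum_abs)
        then have "ennreal \<bar>D w\<bar> \<le> ennreal \<bar>Hf w\<bar> + ennreal (\<Sum>k<n. \<bar>m k\<bar> * \<bar>T k w\<bar>)"
          by (rule ennreal_le_add) (auto intro: sum_nonneg)
        also have "ennreal (\<Sum>k<n. \<bar>m k\<bar> * \<bar>T k w\<bar>) = (\<Sum>k<n. ennreal \<bar>m k\<bar> * ennreal \<bar>T k w\<bar>)"
          by (subst sum_ennreal[symmetric]) (auto simp: ennreal_mult)
        also have "\<dots> = (\<Sum>k<n. ennreal \<bar>m k\<bar> * E2 k w)"
          using 2 by (intro sum.cong) (auto simp: E2_def T_def)
        also have "ennreal \<bar>Hf w\<bar> = E1 w" using 2 by (simp add: E1_def Hf_def)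
        also have "E1 w + (\<Sum>k<n. ennreal \<bar>m k\<bar> * E2 k w) \<le> E1 w + (\<Sum>k<n. ennreal \<bar>m k\<bar> * E2 k w) + E3 w" by simp
        finally show ?thesis .
      next
        case 3
        then have "ennreal \<bar>D w\<bar> = E3 w" using h by (simp add: E3_def Dsplit)
        then show ?thesis by (simp add: add_increasing)
      qed
    qed
    have I1: "(\<integral>\<^sup>+w. E1 w \<partial>lborel2) \<le> ennreal ((1 + Cq) * (C + 1) * 2 powr \<beta> * h powr \<beta> * G)"
      unfolding E1_def \<beta>_def
    proof (rule small_scales[OF p fm gm h(1) C G gs _ _ Cq])
      show "(\<integral>\<^sup>+t\<in>{x0 - 2 * h..x0 + 2 * h}. ennpow (sqf \<eta> f {0<..<2 * h} t) (p / 2) \<partial>lborel) \<le> ennreal (2 * h * (C * (2 * h) powr \<alpha>) powr p)"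
        using H[of "2 * h"] h A by simp
      have "(\<integral>\<^sup>+t. ennpow (sqf \<eta> g {0<..} t) (q / 2) \<partial>lborel) \<le> ennreal Cq * (\<integral>\<^sup>+x. ennreal (\<bar>g x\<bar> powr q) \<partial>lborel)"
      proof (rule Lq[OF gi])
        show "g x = 0" if "\<bar>x0\<bar> + h < \<bar>x\<bar>" for x by (rule gs) (use that h in auto)
        show "(\<integral>\<^sup>+x. ennreal (\<bar>g x\<bar> powr q) \<partial>lborel) < \<infinity>" using Gq by (rule order_le_less_trans) simp
      qed
      also have "\<dots> \<le> ennreal Cq * ennreal (G powr q)" by (intro mult_left_mono Gq) simp
      also have "\<dots> = ennreal (Cq * G powr q)" using Cq by (intro ennreal_mult[symmetric]) auto
      finally show "(\<integral>\<^sup>+t. ennpow (sqf \<eta> g {0<..} t) (q / 2) \<partial>lborel) \<le> ennreal (Cq * G powr q)" .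
    qed
    have I2: "(\<integral>\<^sup>+w. (\<Sum>k<n. ennreal \<bar>m k\<bar> * E2 k w) \<partial>lborel2) \<le> ennreal ((\<Sum>k<n. L * BD * Cn k) * h powr \<beta> * G)"
    proof -
      have "(\<integral>\<^sup>+w. (\<Sum>k<n. ennreal \<bar>m k\<bar> * E2 k w) \<partial>lborel2) = (\<Sum>k<n. ennreal \<bar>m k\<bar> * (\<integral>\<^sup>+w. E2 k w \<partial>lborel2))"
        by (subst nn_integral_sum) (auto intro!: sum.cong nn_integral_cmult)
      also have "\<dots> \<le> (\<Sum>k<n. ennreal (L * BD * Cn k * h powr \<beta> * G))"
      proof (rule sum_mono)
        fix k assume "k \<in> {..<n}"
        then have k: "k < n" by simp
        have "(\<integral>\<^sup>+w. E2 k w \<partial>lborel2) \<le> ennreal BD * (\<integral>\<^sup>+s\<in>{0<..<h}. (cone f x0 s * ennreal (s powr (- (real k + 1)))) \<partial>lborel)"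
          unfolding E2_def by (rule mass[OF k]) auto
        also have "\<dots> \<le> ennreal BD * ennreal (Cn k * h powr (\<alpha> - real k))"
          by (intro mult_left_mono Cn(2) k h) simp
        finally have "ennreal \<bar>m k\<bar> * (\<integral>\<^sup>+w. E2 k w \<partial>lborel2) \<le> ennreal \<bar>m k\<bar> * (ennreal BD * ennreal (Cn k * h powr (\<alpha> - real k)))"
          by (rule mult_left_mono) simp
        also have "\<dots> = ennreal (\<bar>m k\<bar> * (BD * (Cn k * h powr (\<alpha> - real k))))"
          using BD_nonneg Cn(1)[OF k] by (simp add: ennreal_mult)
        also have "\<dots> \<le> ennreal (L * BD * Cn k * h powr \<beta> * G)"
        proof (rule ennreal_leI)
          have "\<bar>m k\<bar> \<le> h ^ k * (L * h powr (1 / p) * G)" using h by (intro order_trans[OF m] mult_left_mono N) auto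
          then have "\<bar>m k\<bar> * (BD * (Cn k * h powr (\<alpha> - real k))) \<le> h ^ k * (L * h powr (1 / p) * G) * (BD * (Cn k * h powr (\<alpha> - real k)))"
            using BD_nonneg Cn(1)[OF k] by (intro mult_right_mono) auto
          also have "\<dots> = L * BD * Cn k * (h ^ k * h powr (1 / p) * h powr (\<alpha> - real k)) * G" by (simp only: ac_simps)
          also have "h ^ k * h powr (1 / p) * h powr (\<alpha> - real k) = h powr \<beta>"
            using h by (simp add: powr_realpow[symmetric] powr_add[symmetric] \<beta>_def add.commute)
          finally show "\<bar>m k\<bar> * (BD * (Cn k * h powr (\<alpha> - real k))) \<le> L * BD * Cn k * h powr \<beta> * G" .
        qed
        finally show "ennreal \<bar>m k\<bar> * (\<integral>\<^sup>+w. E2 k w \<partial>lborel2) \<le> ennreal (L * BD * Cn k * h powr \<beta> * G)" .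
      qed
      also have "\<dots> = ennreal ((\<Sum>k<n. L * BD * Cn k) * h powr \<beta> * G)"
        using L0 BD_nonneg Cn(1) G by (subst sum_ennreal) (auto simp: sum_distrib_right)
      finally show ?thesis .
    qed
    have I3: "(\<integral>\<^sup>+w. E3 w \<partial>lborel2) \<le> ennreal (BD * (C2 + Cf n) * L * h powr \<beta> * G)"
    proof -
      have "(\<integral>\<^sup>+w. E3 w \<partial>lborel2) \<le> ennreal (BD * (C2 + Cf n) * (h powr \<alpha> * N))"
        unfolding E3_def m_def N_def
        by (rule taylor_integral_bound[OF f g gs h A(2) a C2(1) C2(2)[OF h] Cf])
      also have "\<dots> \<le> ennreal (BD * (C2 + Cf n) * L * h powr \<beta> * G)"
      proof (rule ennreal_leI)
        have "BD * (C2 + Cf n) * (h powr \<alpha> * N) \<le> BD * (C2 + Cf n) * (h powr \<alpha> * (L * h powr (1 / p) * G))"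
          using BD_nonneg C2(1) Cf(1)[of n] by (intro mult_left_mono N) auto
        also have "\<dots> = BD * (C2 + Cf n) * L * (h powr \<alpha> * h powr (1 / p)) * G" by (simp only: ac_simps)
        also have "h powr \<alpha> * h powr (1 / p) = h powr \<beta>" by (simp add: \<beta>_def powr_add)
        finally show "BD * (C2 + Cf n) * (h powr \<alpha> * N) \<le> BD * (C2 + Cf n) * L * h powr \<beta> * G" .
      qed
      finally show ?thesis .
    qed
    have Dnn: "(\<integral>\<^sup>+w. ennreal \<bar>D w\<bar> \<partial>lborel2) \<le> ennreal (K * h powr \<beta> * G)"
    proof -
      have S2: "(\<lambda>w. \<Sum>k<n. ennreal \<bar>m k\<bar> * E2 k w) \<in> borel_measurable lborel2"
        by (intro borel_measurable_sum borel_measurable_times borel_measurable_const E2m) auto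
      have "(\<integral>\<^sup>+w. ennreal \<bar>D w\<bar> \<partial>lborel2) \<le> (\<integral>\<^sup>+w. E1 w + (\<Sum>k<n. ennreal \<bar>m k\<bar> * E2 k w) + E3 w \<partial>lborel2)"
        by (intro nn_integral_mono Dpt)
      also have "\<dots> = (\<integral>\<^sup>+w. E1 w \<partial>lborel2) + (\<integral>\<^sup>+w. (\<Sum>k<n. ennreal \<bar>m k\<bar> * E2 k w) \<partial>lborel2) + (\<integral>\<^sup>+w. E3 w \<partial>lborel2)"
        using S2 by (subst nn_integral_add, simp, simp, subst nn_integral_add) auto
      also have "\<dots> \<le> ennreal ((1 + Cq) * (C + 1) * 2 powr \<beta> * h powr \<beta> * G) + ennreal ((\<Sum>k<n. L * BD * Cn k) * h powr \<beta> * G) + ennreal (BD * (C2 + Cf n) * L * h powr \<beta> * G)"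
        by (intro add_mono I1 I2 I3)
      also have "\<dots> = ennreal (K * h powr \<beta> * G)"
      proof -
        have "0 \<le> (1 + Cq) * (C + 1) * 2 powr \<beta> * h powr \<beta> * G" "0 \<le> (\<Sum>k<n. L * BD * Cn k) * h powr \<beta> * G" "0 \<le> BD * (C2 + Cf n) * L * h powr \<beta> * G"
          using Cq C L0 BD_nonneg Cn(1) C2(1) Cf(1)[of n] G by (auto intro!: sum_nonneg mult_nonneg_nonneg)
        then show ?thesis by (simp only: ennreal_plus[symmetric] add_nonneg_nonneg K_def distrib_right)
      qed
      finally show ?thesis .
    qed
    have Di: "integrable lborel2 D"
    proof (rule integrableI_bounded[OF Dm])
      show "(\<integral>\<^sup>+w. ennreal (norm (D w)) \<partial>lborel2) < \<infinity>"
        using Dnn by (simp only: real_norm_def) (rule order_le_less_trans, assumption, simp)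
    qed
    have Tsum: "integrable lborel2 (\<lambda>w. \<Sum>k<n. m k * T k w)"
      by (intro Bochner_Integration.integrable_sum integrable_mult_right Ti) simp
    \<comment> \<open>Only now is absolute convergence of the pairing known, as
      \<open>reproducing\<close> demands: the difference and the Taylor terms are both
      integrable.\<close>
    have Hi: "integrable lborel2 Hf"
      using Bochner_Integration.integrable_add[OF Di Tsum] by (simp add: D_def)
    have Hint: "(LINT w|lborel2. Hf w) = calderon * (LINT x|lborel. f x * g x)"
      using reproducing[OF f g cg] Hi unfolding Hf_def by blast
    have Dint: "(LINT w|lborel2. D w) = calderon * (LINT x|lborel. f x * g x) - (\<Sum>k<n. m k * (LINT w|lborel2. T k w))"
      unfolding D_def Bochner_Integration.integral_diff[OF Hi Tsum] Hint
      by (subst Bochner_Integration.integral_sum) (auto intro!: integrable_mult_right Ti)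
    obtain B where B: "\<And>x. \<bar>g x\<bar> \<le> B" using g by (auto simp: test_fun_def)
    have fg: "integrable lborel (\<lambda>x. f x * g x)"
    proof (rule Bochner_Integration.integrable_bound[OF integrable_mult_right[OF f, of B]])
      show "AE x in lborel. norm (f x * g x) \<le> norm (B * f x)"
        using B by (intro AE_I2) (auto simp: abs_mult mult.commute[of "\<bar>f _\<bar>"] intro!: mult_right_mono order_trans[OF B abs_ge_self])
    qed measurable
    have mi: "integrable lborel (\<lambda>y. (y - x0) ^ k * g y)" for k using h by (intro moment_integrable(1)[OF gi gs]) auto
    have Pg: "integrable lborel (\<lambda>x. \<Sum>k<n. c k * ((x - x0) ^ k * g x))"
      by (intro Bochner_Integration.integrable_sum integrable_mult_right mi)
    have "(LINT x|lborel. (f x - poly P (x - x0)) * g x) = (LINT x|lborel. f x * g x - (\<Sum>k<n. c k * ((x - x0) ^ k * g x)))"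
      by (intro Bochner_Integration.integral_cong refl) (simp add: polyP left_diff_distrib sum_distrib_right mult.assoc)
    also have "\<dots> = (LINT x|lborel. f x * g x) - (\<Sum>k<n. c k * m k)"
      unfolding Bochner_Integration.integral_diff[OF fg Pg] m_def
      by (subst Bochner_Integration.integral_sum) (auto intro!: integrable_mult_right mi)
    finally have "calderon * (LINT x|lborel. (f x - poly P (x - x0)) * g x) = (LINT w|lborel2. D w)"
      using cal by (simp add: Dint right_diff_distrib sum_distrib_left c_def mult.commute)
    moreover have "\<bar>LINT w|lborel2. D w\<bar> \<le> K * h powr \<beta> * G"
    proof -
      have "ennreal \<bar>LINT w|lborel2. D w\<bar> \<le> ennreal (K * h powr \<beta> * G)"
        using integral_norm_bound_ennreal[OF Di] Dnn by simp
      then show ?thesis using K0 G by (simp add: ennreal_le_iff)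
    qed
    ultimately have "\<bar>calderon\<bar> * \<bar>LINT x|lborel. (f x - poly P (x - x0)) * g x\<bar> \<le> K * h powr \<beta> * G"
      by (simp add: abs_mult[symmetric])
    then show "\<bar>LINT x|lborel. (f x - poly P (x - x0)) * g x\<bar> \<le> K / \<bar>calderon\<bar> * h powr (\<alpha> + 1 / p) * G"
      using cal by (simp add: \<beta>_def field_simps)
  qed
qed

end


subsection \<open>Duality and the converse\<close>

text \<open>The restriction to |U| <= N makes the integral Z finite, so that it can be cancelled.
  The interval is widened by d because the extremal function is approximated by continuous ones with
  slightly larger support.\<close>

lemma Lp_by_duality_bounded:
  fixes U :: "real \<Rightarrow> real"
  assumes p: "p > 1" "q > 1" "1 / p + 1 / q = 1" and U: "integrable lborel U" and d: "d > 0" and K: "K \<ge> 0"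
    and bound: "\<And>g G. test_fun g \<Longrightarrow> continuous_on UNIV g \<Longrightarrow> (\<And>x. x \<notin> {a - d..b + d} \<Longrightarrow> g x = 0) \<Longrightarrow> G > 0 \<Longrightarrow>
      (\<integral>\<^sup>+x. ennreal (\<bar>g x\<bar> powr q) \<partial>lborel) \<le> ennreal (G powr q) \<Longrightarrow> \<bar>LINT x|lborel. U x * g x\<bar> \<le> K * G"
  shows "(\<integral>\<^sup>+x. ennreal (\<bar>U x\<bar> powr p) * indicator {x \<in> {a..b}. \<bar>U x\<bar> \<le> real N} x \<partial>lborel) \<le> ennreal ((2 * K) powr p)"
proof -
  have [measurable]: "U \<in> borel_measurable borel" using borel_measurable_integrable[OF U] by simp
  define S where "S = {x \<in> {a..b}. \<bar>U x\<bar> \<le> real N}"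
  have [measurable]: "S \<in> sets borel" unfolding S_def by measurable
  \<comment> \<open>The extremal function of Hoelder's inequality: U g is |U|^p on S, and so is
    |g|^q since (p - 1) q = p.\<close>
  define g where "g x = indicator S x * (sgn (U x) * \<bar>U x\<bar> powr (p - 1))" for x
  have [measurable]: "g \<in> borel_measurable borel" unfolding g_def by measurable
  define B where "B = real N powr (p - 1)"
  have B: "B \<ge> 0" by (simp add: B_def)
  have gB: "\<bar>g x\<bar> \<le> B * indicator {a..b} x" for x
  proof (cases "x \<in> S")
    case True
    then have "\<bar>U x\<bar> powr (p - 1) \<le> B" unfolding B_def S_def using p by (intro powr_mono2) auto
    then show ?thesis using True by (auto simp: g_def S_def abs_mult abs_sgn_eq)
  qed (use B in \<open>auto simp: g_def split: split_indicator\<close>)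
  have tg: "test_fun (\<lambda>x. B * indicator {a - d..b + d} x)"
    by (rule test_funI[of _ B "\<bar>a\<bar> + \<bar>b\<bar> + d"]) (use B d in \<open>auto split: split_indicator\<close>)
  have pq: "(p - 1) * q = p" using p by (simp add: field_simps)
  have gq: "\<bar>g x\<bar> powr q = indicator S x * \<bar>U x\<bar> powr p" for x
    using p pq by (auto simp: g_def abs_mult abs_sgn_eq powr_powr split: split_indicator)
  have Ug: "U x * g x = indicator S x * \<bar>U x\<bar> powr p" for x
  proof -
    have "U x * sgn (U x) = \<bar>U x\<bar>" by (simp add: abs_sgn mult.commute)
    moreover have "\<bar>U x\<bar> * \<bar>U x\<bar> powr (p - 1) = \<bar>U x\<bar> powr p" by (simp add: powr_mult_base)
    ultimately have "U x * (sgn (U x) * \<bar>U x\<bar> powr (p - 1)) = \<bar>U x\<bar> powr p" by (simp add: mult.assoc[symmetric])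
    then show ?thesis by (simp add: g_def split: split_indicator)
  qed
  have bb: "integrable lborel (\<lambda>x. B * \<bar>U x\<bar>)" using U by simp
  have Zi: "integrable lborel (\<lambda>x. indicator S x * \<bar>U x\<bar> powr p)"
    unfolding Ug[symmetric]
  proof (rule Bochner_Integration.integrable_bound[OF bb])
    have "\<bar>U x\<bar> * \<bar>g x\<bar> \<le> \<bar>U x\<bar> * B" for x
      using gB[of x] B by (intro mult_left_mono) (auto split: split_indicator_asm)
    then show "AE x in lborel. norm (U x * g x) \<le> norm (B * \<bar>U x\<bar>)"
      using B by (intro AE_I2) (simp add: abs_mult mult.commute)
  qed measurable
  define Z where "Z = (LINT x|lborel. indicator S x * \<bar>U x\<bar> powr p)"
  have Z0: "Z \<ge> 0" by (simp add: Z_def)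
  have Znn: "(\<integral>\<^sup>+x. ennreal (indicator S x * \<bar>U x\<bar> powr p) \<partial>lborel) = ennreal Z"
    unfolding Z_def by (rule nn_integral_eq_integral[OF Zi]) simp
  have "Z \<le> (2 * K) powr p"
  proof (cases "Z = 0")
    case False
    then have Z: "Z > 0" using Z0 by simp
    \<comment> \<open>Strictly above the q-norm of g, so that the approximants eventually satisfy
      the constraint; this costs at most the factor 2.\<close>
    define G where "G = (2 * Z) powr (1 / q)"
    have G: "G > 0" "G powr q = 2 * Z" using Z p by (auto simp: G_def powr_powr)
    obtain h where h: "\<And>n::nat. continuous_on UNIV (h n)" "\<And>n x. \<bar>h n x\<bar> \<le> B * indicator {a - d..b + d} x"
      "AE x in lborel. (\<lambda>n. h n x) \<longlonglongrightarrow> g x"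
      using continuous_approximation[OF _ gB d B] by auto
    have hm[measurable]: "h n \<in> borel_measurable borel" for n using h(1) by (rule borel_measurable_continuous_onI)
    have th: "test_fun (h n)" for n
    proof (rule test_funI[of _ B "\<bar>a\<bar> + \<bar>b\<bar> + d"])
      show "\<bar>h n x\<bar> \<le> B" for x using h(2)[of n x] B by (auto split: split_indicator_asm)
      show "h n x = 0" if "\<bar>a\<bar> + \<bar>b\<bar> + d < \<bar>x\<bar>" for x using h(2)[of n x] that d by (auto split: split_indicator_asm)
    qed (rule hm)
    have "(\<lambda>n. \<integral>\<^sup>+x. ennreal (\<bar>h n x\<bar> powr q) \<partial>lborel) \<longlonglongrightarrow> (\<integral>\<^sup>+x. ennreal (\<bar>g x\<bar> powr q) \<partial>lborel)"
    proof (rule nn_integral_dominated_convergence[where w="\<lambda>x. ennreal (\<bar>B * indicator {a - d..b + d} x\<bar> powr q)"])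
      show "AE x in lborel. ennreal (\<bar>h n x\<bar> powr q) \<le> ennreal (\<bar>B * indicator {a - d..b + d} x\<bar> powr q)" for n
        using h(2)[of n] p by (intro AE_I2 ennreal_leI powr_mono2) (auto intro: order_trans[OF _ abs_ge_self])
      show "AE x in lborel. (\<lambda>n. ennreal (\<bar>h n x\<bar> powr q)) \<longlonglongrightarrow> ennreal (\<bar>g x\<bar> powr q)"
        using h(3) by eventually_elim (use p in \<open>intro tendsto_ennrealI tendsto_powr2 tendsto_rabs, auto\<close>)
      show "(\<integral>\<^sup>+x. ennreal (\<bar>B * indicator {a - d..b + d} x\<bar> powr q) \<partial>lborel) < \<infinity>"
        using test_fun_nn_powr_finite[OF tg] p by simp
    qed measurable
    also have "(\<integral>\<^sup>+x. ennreal (\<bar>g x\<bar> powr q) \<partial>lborel) = ennreal Z" unfolding gq by (rule Znn)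
    finally have "eventually (\<lambda>n. (\<integral>\<^sup>+x. ennreal (\<bar>h n x\<bar> powr q) \<partial>lborel) < ennreal (G powr q)) sequentially"
      by (rule order_tendstoD(2)) (use Z G in \<open>simp add: ennreal_less_iff\<close>)
    then have ev: "eventually (\<lambda>n. \<bar>LINT x|lborel. U x * h n x\<bar> \<le> K * G) sequentially"
    proof eventually_elim
      case (elim n)
      show ?case
      proof (rule bound[OF th h(1) _ G(1)])
        show "h n x = 0" if "x \<notin> {a - d..b + d}" for x using h(2)[of n x] that by simp
      qed (use elim in simp)
    qed
    have "(\<lambda>n. LINT x|lborel. U x * h n x) \<longlonglongrightarrow> (LINT x|lborel. U x * g x)"
    proof (rule integral_dominated_convergence[OF _ _ bb])
      show "AE x in lborel. (\<lambda>n. U x * h n x) \<longlonglongrightarrow> U x * g x"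
        using h(3) by eventually_elim (intro tendsto_intros)
      have "\<bar>U x\<bar> * \<bar>h n x\<bar> \<le> \<bar>U x\<bar> * B" for n x
        using h(2)[of n x] B by (intro mult_left_mono) (auto split: split_indicator_asm)
      then show "AE x in lborel. norm (U x * h n x) \<le> B * \<bar>U x\<bar>" for n
        by (intro AE_I2) (simp add: abs_mult mult.commute)
    qed measurable
    then have "(\<lambda>n. \<bar>LINT x|lborel. U x * h n x\<bar>) \<longlonglongrightarrow> \<bar>LINT x|lborel. U x * g x\<bar>" by (rule tendsto_rabs)
    then have "\<bar>LINT x|lborel. U x * g x\<bar> \<le> K * G" by (rule tendsto_upperbound[OF _ ev]) simp
    then have le: "Z \<le> K * G" using Z0 by (simp add: Ug Z_def)
    have "G \<le> 2 * Z powr (1 / q)"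
    proof -
      have "(2::real) powr (1 / q) \<le> 2 powr 1" using p by (intro powr_mono) auto
      then show ?thesis unfolding G_def using Z by (simp add: powr_mult)
    qed
    then have "Z \<le> K * (2 * Z powr (1 / q))" using K by (intro order_trans[OF le] mult_left_mono) auto
    moreover have "Z = Z powr (1 / p) * Z powr (1 / q)" using p Z by (simp add: powr_add[symmetric])
    ultimately have "Z powr (1 / p) * Z powr (1 / q) \<le> 2 * K * Z powr (1 / q)" by simp
    then have "Z powr (1 / p) \<le> 2 * K" using Z by simp
    then have "(Z powr (1 / p)) powr p \<le> (2 * K) powr p" using p by (intro powr_mono2) auto
    then show ?thesis using Z p by (simp add: powr_powr)
  qed simp
  then have "ennreal Z \<le> ennreal ((2 * K) powr p)" by (rule ennreal_leI)
  also have "ennreal Z = (\<integral>\<^sup>+x. ennreal (\<bar>U x\<bar> powr p) * indicator S x \<partial>lborel)"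
    unfolding Znn[symmetric] by (intro nn_integral_cong) (auto split: split_indicator)
  finally show ?thesis by (simp add: S_def)
qed

lemma Lp_by_duality:
  fixes U :: "real \<Rightarrow> real"
  assumes p: "p > 1" "q > 1" "1 / p + 1 / q = 1" and U: "integrable lborel U" and d: "d > 0" and K: "K \<ge> 0"
    and bound: "\<And>g G. test_fun g \<Longrightarrow> continuous_on UNIV g \<Longrightarrow> (\<And>x. x \<notin> {a - d..b + d} \<Longrightarrow> g x = 0) \<Longrightarrow> G > 0 \<Longrightarrow>
      (\<integral>\<^sup>+x. ennreal (\<bar>g x\<bar> powr q) \<partial>lborel) \<le> ennreal (G powr q) \<Longrightarrow> \<bar>LINT x|lborel. U x * g x\<bar> \<le> K * G"
  shows "(\<integral>\<^sup>+x\<in>{a..b}. ennreal (\<bar>U x\<bar> powr p) \<partial>lborel) \<le> ennreal ((2 * K) powr p)"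
proof -
  have [measurable]: "U \<in> borel_measurable borel" using borel_measurable_integrable[OF U] by simp
  define S where "S N = {x \<in> {a..b}. \<bar>U x\<bar> \<le> real N}" for N
  have S: "S N \<in> sets lborel" for N unfolding S_def by measurable
  have inc: "incseq S" unfolding S_def by (intro incseq_SucI) auto
  have un: "(\<Union>N. S N) = {a..b}" using real_arch_simple unfolding S_def by blast
  have "(\<integral>\<^sup>+x\<in>{a..b}. ennreal (\<bar>U x\<bar> powr p) \<partial>lborel) = (SUP N. \<integral>\<^sup>+x\<in>S N. ennreal (\<bar>U x\<bar> powr p) \<partial>lborel)"
    unfolding un[symmetric] by (rule nn_integral_incseq_sets[OF inc S]) measurable
  also have "\<dots> \<le> ennreal ((2 * K) powr p)"
    unfolding S_def by (intro SUP_least Lp_by_duality_bounded[OF p U d K bound])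
  finally show ?thesis .
qed

lemma (in taylor_wavelet) Tp_of_leaders:
  assumes p: "1 < p" and f: "Lp_loc p f" and a: "\<alpha> < real n" and k_less: "\<And>k. k < n \<Longrightarrow> real k < \<alpha>"
    and nz: "\<eta> z \<noteq> 0"
    and L: "C > 0" "a0 > 0" "\<And>a. 0 < a \<Longrightarrow> a < a0 \<Longrightarrow> pleader p \<eta> f a x0 \<le> ennreal (C * a powr \<alpha>)"
  shows "Tp p \<alpha> x0 f"
proof -
  define q where "q = p / (p - 1)"
  have q: "q > 1" "1 / p + 1 / q = 1" using p by (auto simp: q_def field_simps)
  \<comment> \<open>A <= 1 keeps all balls inside the window of \<open>f1\<close>; A < a0 is strict
    because the bound is needed for a = A as well.\<close>
  define A where "A = min 1 (a0 / 2)"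
  have A: "0 < A" "A \<le> 1" "A < a0" using L by (auto simp: A_def)
  define f1 where "f1 x = indicator {x0 - 2..x0 + 2} x * f x" for x
  have f1: "integrable lborel f1" unfolding f1_def by (rule Lp_loc_integrable(1)[OF p f])
  have [measurable]: "f \<in> borel_measurable borel" using f by (simp add: Lp_loc_def)
  have H: "(\<integral>\<^sup>+t\<in>{x0 - a..x0 + a}. ennpow (sqf \<eta> f1 {0<..<a} t) (p / 2) \<partial>lborel) \<le> ennreal (a * (C * a powr \<alpha>) powr p)"
    if a: "0 < a" "a \<le> A" for a
  proof -
    have "(\<integral>\<^sup>+t\<in>{x0 - a..x0 + a}. ennpow (sqf \<eta> f1 {0<..<a} t) (p / 2) \<partial>lborel) = (\<integral>\<^sup>+t\<in>{x0 - a..x0 + a}. ennpow (sqf \<eta> f {0<..<a} t) (p / 2) \<partial>lborel)"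
    proof (rule nn_integral_cong)
      fix t
      show "ennpow (sqf \<eta> f1 {0<..<a} t) (p / 2) * indicator {x0 - a..x0 + a} t = ennpow (sqf \<eta> f {0<..<a} t) (p / 2) * indicator {x0 - a..x0 + a} t"
      proof (cases "t \<in> {x0 - a..x0 + a}")
        case True
        have "sqf \<eta> f1 {0<..<a} t = sqf \<eta> f {0<..<a} t"
          unfolding sqf_def
        proof (rule nn_integral_cong)
          fix s
          show "ennreal ((cwt \<eta> f1 s t)\<^sup>2 / s) * indicator {0<..<a} s = ennreal ((cwt \<eta> f s t)\<^sup>2 / s) * indicator {0<..<a} s"
          proof (cases "s \<in> {0<..<a}")
            case s: True
            have "cwt \<eta> f1 s t = cwt \<eta> f s t"
            proof (rule cwt_cong)
              fix x assume "x \<in> {t - s..t + s}"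
              then have "x \<in> {x0 - 2..x0 + 2}" using s True a A by auto
              then show "f1 x = f x" by (simp add: f1_def)
            qed (use s in simp)
            then show ?thesis by simp
          qed simp
        qed
        then show ?thesis by simp
      qed simp
    qed
    also have "\<dots> \<le> ennreal (a * (C * a powr \<alpha>) powr p)"
    proof -
      have "a < a0" using a A by simp
      from L(3)[OF a(1) this] show ?thesis
        using a p L(1) by (subst (asm) pleader_le_iff) auto
    qed
    finally show ?thesis .
  qed
  obtain P K where K: "K \<ge> 0" and P: "if n = 0 then P = 0 else degree P < n"
    and est: "\<And>h g G. 0 < h \<Longrightarrow> h \<le> A / 4 \<Longrightarrow> test_fun g \<Longrightarrow> continuous_on UNIV g \<Longrightarrow> (\<And>x. x \<notin> {x0 - h..x0 + h} \<Longrightarrow> g x = 0) \<Longrightarrow>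
      G > 0 \<Longrightarrow> (\<integral>\<^sup>+x. ennreal (\<bar>g x\<bar> powr q) \<partial>lborel) \<le> ennreal (G powr q) \<Longrightarrow>
      \<bar>LINT x|lborel. (f1 x - poly P (x - x0)) * g x\<bar> \<le> K * h powr (\<alpha> + 1 / p) * G"
    by (rule key_estimate[OF p q f1 A(1,2) _ a k_less H nz]) (use L(1) in auto)
  \<comment> \<open>n = 0 is the case of a negative \<alpha>, where P must vanish; otherwise
    \<alpha> > 0 and degree P < n gives degree P < \<alpha>.\<close>
  have degP: "if \<alpha> \<le> 0 then P = 0 else real (degree P) < \<alpha>"
  proof (cases "n = 0")
    case True
    then show ?thesis using P a by simp
  next
    case False
    then have "0 < \<alpha>" using k_less[of 0] by simp
    moreover have "real (degree P) < \<alpha>" using P False k_less[of "degree P"] by simp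
    ultimately show ?thesis by simp
  qed
  define \<beta> where "\<beta> = \<alpha> + 1 / p"
  define M where "M = 2 * K * 2 powr \<beta>"
  have M: "M \<ge> 0" using K by (simp add: M_def)
  have fP: "Lp_loc p (\<lambda>x. f x - poly P (x - x0))" by (rule Lp_loc_minus_poly[OF p f])
  show ?thesis
    unfolding Tp_def
  proof (rule exI[of _ P], intro conjI degP, rule exI[of _ "M + 1"], intro conjI, use M in simp, rule exI[of _ "A / 8"], intro conjI allI impI)
    show "A / 8 > 0" using A by simp
    \<comment> \<open>Duality widens the ball from h to 2h, where the key estimate requires 2h <=
      A/4.\<close>
    fix h assume h: "0 < h \<and> h < A / 8"
    define U where "U x = indicator {x0 - 2 * h..x0 + 2 * h} x * (f x - poly P (x - x0))" for x
    have U: "integrable lborel U" unfolding U_def by (rule Lp_loc_integrable(1)[OF p fP])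
    have "(\<integral>\<^sup>+x\<in>{x0 - h..x0 + h}. ennreal (\<bar>U x\<bar> powr p) \<partial>lborel) \<le> ennreal ((2 * (K * (2 * h) powr \<beta>)) powr p)"
    proof (rule Lp_by_duality[OF p q U, where d=h])
      show "0 < h" using h by simp
      show "0 \<le> K * (2 * h) powr \<beta>" using K by simp
      fix g G
      assume g: "test_fun g" "continuous_on UNIV g" and gs: "\<And>x. x \<notin> {x0 - h - h..x0 + h + h} \<Longrightarrow> g x = 0" and G: "(0::real) < G"
        and Gq: "(\<integral>\<^sup>+x. ennreal (\<bar>g x\<bar> powr q) \<partial>lborel) \<le> ennreal (G powr q)"
      have gs': "g x = 0" if "x \<notin> {x0 - 2 * h..x0 + 2 * h}" for x using gs[of x] that by auto
      have "U x * g x = (f1 x - poly P (x - x0)) * g x" for x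
      proof (cases "x \<in> {x0 - 2 * h..x0 + 2 * h}")
        case True
        then have "x \<in> {x0 - 2..x0 + 2}" using h A by auto
        then show ?thesis using True by (simp add: U_def f1_def)
      qed (simp add: gs')
      then have "(LINT x|lborel. U x * g x) = (LINT x|lborel. (f1 x - poly P (x - x0)) * g x)"
        by (rule Bochner_Integration.integral_cong[OF refl])
      then show "\<bar>LINT x|lborel. U x * g x\<bar> \<le> K * (2 * h) powr \<beta> * G"
        using est[of "2 * h" g G] h g gs' G Gq by (simp add: \<beta>_def)
    qed
    moreover have "(\<integral>\<^sup>+x\<in>{x0 - h..x0 + h}. ennreal (\<bar>U x\<bar> powr p) \<partial>lborel)
      = (\<integral>\<^sup>+x. ennreal (indicator {x0 - h..x0 + h} x * (\<bar>f x - poly P (x - x0)\<bar> powr p)) \<partial>lborel)"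
      using h by (intro nn_integral_cong) (auto simp: U_def split: split_indicator)
    moreover have "\<dots> = ennreal (LINT x:{x0 - h..x0 + h}|lborel. \<bar>f x - poly P (x - x0)\<bar> powr p)"
      unfolding set_lebesgue_integral_def real_scaleR_def
      by (rule nn_integral_eq_integral[OF Lp_loc_integrable(2)[OF p fP]]) simp
    ultimately have I: "(LINT x:{x0 - h..x0 + h}|lborel. \<bar>f x - poly P (x - x0)\<bar> powr p) \<le> (2 * (K * (2 * h) powr \<beta>)) powr p"
      by (simp add: ennreal_le_iff)
    have e: "(2 * (K * (2 * h) powr \<beta>)) powr p = h * (M * h powr \<alpha>) powr p"
    proof -
      have "2 * (K * (2 * h) powr \<beta>) = M * h powr \<alpha> * h powr (1 / p)"
        using h by (simp add: M_def \<beta>_def powr_mult powr_add)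
      then have "(2 * (K * (2 * h) powr \<beta>)) powr p = (M * h powr \<alpha>) powr p * (h powr (1 / p)) powr p"
        using M h by (simp add: powr_mult)
      then show ?thesis using p h by (simp add: powr_powr)
    qed
    have "(1 / h) * (LINT x:{x0 - h..x0 + h}|lborel. \<bar>f x - poly P (x - x0)\<bar> powr p) \<le> (M * h powr \<alpha>) powr p"
      using I h unfolding e by (simp add: field_simps)
    moreover have "0 \<le> (1 / h) * (LINT x:{x0 - h..x0 + h}|lborel. \<bar>f x - poly P (x - x0)\<bar> powr p)"
      using h by (simp add: set_lebesgue_integral_def)
    ultimately have "((1 / h) * (LINT x:{x0 - h..x0 + h}|lborel. \<bar>f x - poly P (x - x0)\<bar> powr p)) powr (1 / p) \<le> ((M * h powr \<alpha>) powr p) powr (1 / p)"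
      using p by (intro powr_mono2) auto
    also have "\<dots> = M * h powr \<alpha>" using M p by (simp add: powr_powr)
    also have "\<dots> \<le> (M + 1) * h powr \<alpha>" by (intro mult_right_mono) auto
    finally show "((1 / h) * (LINT x:{x0 - h..x0 + h}|lborel. \<bar>f x - poly P (x - x0)\<bar> powr p)) powr (1 / p) \<le> (M + 1) * h powr \<alpha>" .
  qed
qed

subsection \<open>The main theorem\<close>

text \<open>The exterior of [-1, 1] is open, so each derivative there is that of a locally zero
  function.\<close>

lemma iterated_deriv_supp:
  assumes "\<And>x. 1 < \<bar>x\<bar> \<Longrightarrow> \<psi> x = (0::real)"
  shows "1 < \<bar>x\<bar> \<Longrightarrow> (deriv ^^ k) \<psi> x = 0"
proof (induction k arbitrary: x)
  case (Suc k)
  have "open {y::real. 1 < \<bar>y\<bar>}" by (intro open_Collect_less continuous_intros)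
  then have "eventually (\<lambda>y. y \<in> {y. 1 < \<bar>y\<bar>}) (nhds x)" using Suc.prems by (intro eventually_nhds_in_open) auto
  then have "eventually (\<lambda>y. (deriv ^^ k) \<psi> y = 0) (nhds x)" by eventually_elim (use Suc.IH in auto)
  then have "deriv ((deriv ^^ k) \<psi>) x = deriv (\<lambda>_. 0) x" by (rule deriv_cong_ev) simp
  then show ?case by simp
qed (use assms in simp)

text \<open>The derivative has mean zero by the fundamental theorem on [-2, 2], at whose end points
  \<psi> vanishes.\<close>

lemma smooth_wavelet_of_Cr:
  assumes C: "Cr r \<psi>" and r: "r \<ge> 1" and supp: "\<And>x. 1 < \<bar>x\<bar> \<Longrightarrow> \<psi> x = 0" and m: "(LINT x|lborel. \<psi> x) = 0"
  shows "smooth_wavelet \<psi> (deriv \<psi>)"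
proof -
  have Cc: "continuous_on UNIV ((deriv ^^ k) \<psi>)" if "k \<le> r" for k using C that by (simp add: Cr_def)
  have c0: "continuous_on UNIV \<psi>" and c1: "continuous_on UNIV (deriv \<psi>)" using Cc[where k=0] Cc[where k=1] r by simp_all
  have "\<forall>k<r. \<forall>x. ((deriv ^^ k) \<psi> has_real_derivative (deriv ^^ Suc k) \<psi> x) (at x)" using C by (simp add: Cr_def)
  from this[rule_format, of 0] have d: "(\<psi> has_real_derivative deriv \<psi> x) (at x)" for x using r by simp
  have s1: "deriv \<psi> x = 0" if "1 < \<bar>x\<bar>" for x using iterated_deriv_supp[where k=1, OF supp that] by simp
  interpret B: bump \<psi> using c0 supp by unfold_locales auto
  interpret B': bump "deriv \<psi>" using c1 s1 by unfold_locales auto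
  have "(LINT x|lborel. indicator {-2..2} x *\<^sub>R deriv \<psi> x) = \<psi> 2 - \<psi> (-2)"
    by (rule integral_FTC_atLeastAtMost)
       (auto simp: has_real_derivative_iff_has_vector_derivative[symmetric] intro: has_field_derivative_at_within d continuous_on_subset[OF B'.cont])
  also have "(\<lambda>x. indicator {-2..2} x *\<^sub>R deriv \<psi> x) = deriv \<psi>"
  proof
    fix x show "indicator {-2..2} x *\<^sub>R deriv \<psi> x = deriv \<psi> x"
      using s1[of x] by (cases "\<bar>x\<bar> \<le> 2") (auto simp: indicator_def abs_le_iff not_le)
  qed
  finally have "(LINT x|lborel. deriv \<psi> x) = 0" using supp[of 2] supp[of "-2"] by simp
  then show ?thesis using m d by unfold_locales auto
qed

theorem mainTheorem1:
  fixes p \<alpha> x0 :: real and f \<psi> :: "real \<Rightarrow> real" and r :: nat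
  assumes "1 < p"
    and "Lp_loc p f"
    and "\<alpha> > - 1 / p"
    and "real r \<ge> \<alpha>" and "r \<ge> 1"
    and "Cr r \<psi>"
    and "\<psi> \<noteq> (\<lambda>_. 0)"
    and "\<forall>x. \<psi> (- x) = \<psi> x"
    and "\<forall>x. \<bar>x\<bar> > 1 \<longrightarrow> \<psi> x = 0"
    and "\<forall>k\<le>r. (LINT x|lborel. x ^ k * \<psi> x) = 0"
  shows "(Tp p \<alpha> x0 f \<longrightarrow>
            (\<exists>C>0. \<exists>a0>0. \<forall>a. 0 < a \<and> a < a0 \<longrightarrow> pleader p \<psi> f a x0 \<le> ennreal (C * a powr \<alpha>)))
       \<and> ((\<alpha> \<notin> \<nat> \<and>
            (\<exists>C>0. \<exists>a0>0. \<forall>a. 0 < a \<and> a < a0 \<longrightarrow> pleader p \<psi> f a x0 \<le> ennreal (C * a powr \<alpha>)))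
           \<longrightarrow> Tp p \<alpha> x0 f)"
proof (intro conjI impI)
  have supp: "\<psi> x = 0" if "1 < \<bar>x\<bar>" for x using assms(9) that by blast
  have mom: "(LINT x|lborel. x ^ k * \<psi> x) = 0" if "k \<le> r" for k using assms(10) that by blast
  have sw: "smooth_wavelet \<psi> (deriv \<psi>)"
    using mom[of 0] by (intro smooth_wavelet_of_Cr[OF assms(6,5) supp]) auto
  then interpret S: smooth_wavelet \<psi> "deriv \<psi>" .
  have vm: "vanishing_moments \<psi> r" by unfold_locales (rule mom)
  {
    assume "Tp p \<alpha> x0 f"
    then show "\<exists>C>0. \<exists>a0>0. \<forall>a. 0 < a \<and> a < a0 \<longrightarrow> pleader p \<psi> f a x0 \<le> ennreal (C * a powr \<alpha>)"
      by (rule leaders_of_Tp[OF sw vm assms(1,2,4)])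
  next
    assume L: "\<alpha> \<notin> \<nat> \<and> (\<exists>C>0. \<exists>a0>0. \<forall>a. 0 < a \<and> a < a0 \<longrightarrow> pleader p \<psi> f a x0 \<le> ennreal (C * a powr \<alpha>))"
    then obtain C a0 where C: "C > 0" "a0 > 0" "\<And>a. 0 < a \<Longrightarrow> a < a0 \<Longrightarrow> pleader p \<psi> f a x0 \<le> ennreal (C * a powr \<alpha>)"
      by blast
    \<comment> \<open>The Taylor order: the least natural number not below \<alpha>, which is 0 for
      negative \<alpha> and at most r, so enough derivatives exist.\<close>
    define n where "n = nat \<lceil>\<alpha>\<rceil>"
    have "\<alpha> \<le> real n" unfolding n_def by linarith
    \<comment> \<open>Noninteger \<alpha> enters here: the strict inequality is what makes
      \<open>cone_middle\<close> converge.\<close>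
    moreover have "\<alpha> \<noteq> real n" using L by auto
    ultimately have n: "\<alpha> < real n" by simp
    have k: "real k < \<alpha>" if "k < n" for k using that unfolding n_def by linarith
    have nr: "n \<le> r" unfolding n_def using assms(4) by linarith
    interpret T: taylor_wavelet \<psi> "deriv \<psi>" "\<lambda>k. (deriv ^^ k) \<psi>" n
    proof unfold_locales
      show "continuous_on UNIV ((deriv ^^ k) \<psi>)" if "k \<le> n" for k
        using assms(6) that nr unfolding Cr_def by auto
      show "((deriv ^^ k) \<psi> has_real_derivative (deriv ^^ Suc k) \<psi> x) (at x)" if "k < n" for k x
        using assms(6) that nr unfolding Cr_def by auto
      show "(deriv ^^ k) \<psi> x = 0" if "k \<le> n" "1 < \<bar>x\<bar>" for k x
        by (rule iterated_deriv_supp[OF supp that(2)])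
    qed simp
    obtain z where z: "\<psi> z \<noteq> 0" using assms(7) by (auto simp: fun_eq_iff)
    show "Tp p \<alpha> x0 f" by (rule T.Tp_of_leaders[OF assms(1,2) n k z C])
  }
qed

end
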